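(* Let $(E,\langle\cdot,\cdot\rangle)$ be a pseudo-Euclidean vector bundle over a smooth manifold $M_0$, let $(M,\Omega)$ be the corresponding symplectic N-manifold of degree $2$, let $\mathcal{A}^{\cdot}$ be the sheaf (over $M_0$) of graded algebras of polynomial functions on $M$, and let $\mathbb{A}$ be the gauge Lie algebroid of $(E,\langle\cdot,\cdot\rangle)$. Then, as sheaves of graded algebras over $C^\infty(M_0)$, $$\mathcal{A}^{\cdot}\simeq(\wedge^{\cdot}E\otimes S^{\cdot}\mathbb{A})/I,$$ where $E$ is placed in degree $1$, $\mathbb{A}$ in degree $2$, and $I$ is the homogeneous ideal generated by the embedding of $\wedge^2E$ into $\mathbb{A}$, i.e. by the elements $\omega\otimes1-1\otimes\omega$, $\omega\in\wedge^2E$.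
   Context: Bundles are identified with their sheaves of sections, and tensor, exterior and symmetric products are over $C^\infty(M_0)$. A pseudo-Euclidean vector bundle is a vector bundle with a nondegenerate symmetric fibrewise bilinear form $\langle\cdot,\cdot\rangle$; $E$ is identified with $E^*$ via $\langle\cdot,\cdot\rangle$. The gauge Lie algebroid $\mathbb{A}$ of $(E,\langle\cdot,\cdot\rangle)$ is the vector bundle whose sections are the covariant differential operators preserving $\langle\cdot,\cdot\rangle$: operators $L:\Gamma(E)\to\Gamma(E)$ for which there is a vector field $v=a(L)$ on $M_0$ with $L(fX)=fL(X)+(v\cdot f)X$ and $v\cdot\langle X,Y\rangle=\langle LX,Y\rangle+\langle X,LY\rangle$. It fits in the Atiyah sequence $0\to\wedge^2E\to\mathbb{A}\xrightarrow{a}TM_0\to0$, in which $\wedge^2E\simeq\mathfrak{so}(E)$ via $e_1\wedge e_2\mapsto(X\mapsto e_1\langle e_2,X\rangle-\langle e_1,X\rangle e_2)$. The symplectic N-manifold $M$ corresponding to $(E,\langle\cdot,\cdot\rangle)$ is the supermanifold with coordinates graded by weight, covered by charts $(q^i,\xi^a,p_i)$ of weights $0,1,2$ ($\xi^a$ odd, $q^i,p_i$ even), one for each choice of local coordinates $x^i$ on $M_0$ and local frame $e_a$ of $E$ with $g_{ab}=\langle e_a,e_b\rangle$ constant, with $\Omega=dp_i\,dq^i+\frac12d\xi^ag_{ab}\,d\xi^b$; for a change $x^i=x^i(x')$, $e_{a'}=e_aT^a_{a'}$ with $T^a_{a'}g_{ab}T^b_{b'}=g_{a'b'}$ constant, the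 charts are glued by $q^i=q^i(q')$, $\xi^a=T^a_{a'}\xi^{a'}$, $p_i=\frac{\partial q^{i'}}{\partial q^i}p_{i'}+\frac12\xi^{a'}\frac{\partial T^a_{a'}}{\partial x^i}g_{ab}T^b_{b'}\xi^{b'}$. Equivalently, $M$ is the preimage, under the projection $T^*[2]E[1]\to(E\oplus E^* )[1]$, of the image of $E[1]$ under $X\mapsto(X,\frac12\langle X,\cdot\rangle)$, with the restricted canonical symplectic form; here $E[1]=\Pi E$ with fibre coordinates of weight $1$, and $T^*[2]E[1]=T^*\Pi E$ with each momentum of weight $2$ minus the weight of its conjugate coordinate. $\mathcal{A}^n$ consists of the functions, polynomial in $\xi,p$ with coefficients smooth in $q$, of total weight $n$. *)

theory Defs
  imports
    "HOL-Analysis.Analysis"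
    "HOL-Algebra.Module"
    "HOL-Algebra.QuotRing"
    "HOL-Algebra.Generated_Groups"
    "HOL-Library.Poly_Mapping"
    "HOL-Library.FSet"
begin

section \<open>Smooth manifolds\<close>

primrec Ck_on :: "nat \<Rightarrow> 'a::real_normed_vector set \<Rightarrow> ('a \<Rightarrow> 'b::real_normed_vector) \<Rightarrow> bool" where
  "Ck_on 0 S f = continuous_on S f"
| "Ck_on (Suc k) S f =
    ((\<forall>x\<in>S. f differentiable (at x)) \<and> (\<forall>v. Ck_on k S (\<lambda>x. frechet_derivative f (at x) v)))"

text \<open>This is only used for open sets.\<close>

definition smooth_on :: "'a::real_normed_vector set \<Rightarrow> ('a \<Rightarrow> 'b::real_normed_vector) \<Rightarrow> bool" where
  "smooth_on S f = (\<forall>k. Ck_on k S f)"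

text \<open>The underlying topological space of a manifold is a type.  The model space $R^n$ is the
  coordinate subspace spanned by a set \<open>axes\<close> of standard basis vectors of a Euclidean space, so
  that $n = 0$ is not excluded; a coordinate index $i$ is an element of \<open>axes\<close>.  A chart is a
  pair of its domain and a map that is only relevant on this domain.\<close>

record ('m, 'a) manifold =
  axes :: "'a set"
  atlas :: "('m set \<times> ('m \<Rightarrow> 'a)) set"

definition proj_axes :: "('m, 'a::euclidean_space, 'z) manifold_scheme \<Rightarrow> 'a \<Rightarrow> 'a" where
  "proj_axes M y = (\<Sum>b\<in>axes M. (y \<bullet> b) *\<^sub>R b)"

definition is_chart :: "('m::topological_space, 'a::euclidean_space, 'z) manifold_scheme
    \<Rightarrow> 'm set \<Rightarrow> ('m \<Rightarrow> 'a) \<Rightarrow> bool" where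
  "is_chart M V \<phi> \<longleftrightarrow> open V
     \<and> openin (top_of_set (span (axes M))) (\<phi> ` V)
     \<and> homeomorphism V (\<phi> ` V) \<phi> (inv_into V \<phi>)"

text \<open>A map on a relatively open subset of the model space is smooth iff its composition with
  the orthogonal projection onto the model space is smooth on the open preimage of the subset.
  The following is smoothness of \<open>f\<close> on the part of \<open>U\<close> in the domain of a chart, expressed in
  this chart.\<close>

definition smooth_in_chart :: "('m::topological_space, 'a::euclidean_space, 'z) manifold_scheme
    \<Rightarrow> 'm set \<Rightarrow> ('m \<Rightarrow> 'a) \<Rightarrow> 'm set \<Rightarrow> ('m \<Rightarrow> 'b::real_normed_vector) \<Rightarrow> bool" where
  "smooth_in_chart M V \<phi> U f \<longleftrightarrow>
     smooth_on {y. proj_axes M y \<in> \<phi> ` (U \<inter> V)} (\<lambda>y. f (inv_into V \<phi> (proj_axes M y)))"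

definition compatible_charts :: "('m::topological_space, 'a::euclidean_space, 'z) manifold_scheme
    \<Rightarrow> 'm set \<times> ('m \<Rightarrow> 'a) \<Rightarrow> 'm set \<times> ('m \<Rightarrow> 'a) \<Rightarrow> bool" where
  "compatible_charts M c d \<longleftrightarrow>
     smooth_in_chart M (fst c) (snd c) (fst d) (snd d)
   \<and> smooth_in_chart M (fst d) (snd d) (fst c) (snd c)"

text \<open>The atlas is maximal, hence it consists of all local coordinate systems.\<close>

definition smooth_manifold ::
  "('m::{t2_space, second_countable_topology}, 'a::euclidean_space, 'z) manifold_scheme \<Rightarrow> bool" where
  "smooth_manifold M \<longleftrightarrow>
     axes M \<subseteq> Basis
   \<and> (\<forall>(V, \<phi>) \<in> atlas M. is_chart M V \<phi>)
   \<and> (\<Union>(V, \<phi>) \<in> atlas M. V) = UNIV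
   \<and> (\<forall>c \<in> atlas M. \<forall>d \<in> atlas M. compatible_charts M c d)
   \<and> (\<forall>V \<phi>. is_chart M V \<phi> \<longrightarrow> (\<forall>d \<in> atlas M. compatible_charts M (V, \<phi>) d)
        \<longrightarrow> (V, \<phi>) \<in> atlas M)"

definition smooth_fun :: "('m::topological_space, 'a::euclidean_space, 'z) manifold_scheme
    \<Rightarrow> 'm set \<Rightarrow> ('m \<Rightarrow> real) \<Rightarrow> bool" where
  "smooth_fun M U f \<longleftrightarrow> (\<forall>(V, \<phi>) \<in> atlas M. smooth_in_chart M V \<phi> U f)"

text \<open>The partial derivative with respect to the coordinate \<open>b\<close> of the chart.\<close>

definition pderiv_chart :: "'m set \<Rightarrow> ('m \<Rightarrow> 'a::euclidean_space) \<Rightarrow> 'a \<Rightarrow> ('m \<Rightarrow> real) \<Rightarrow> 'm \<Rightarrow> real" where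
  "pderiv_chart V \<phi> b f x = deriv (\<lambda>t. f (inv_into V \<phi> (\<phi> x + t *\<^sub>R b))) 0"

text \<open>Elements of a sheaf over \<open>U\<close> that are functions on \<open>U\<close> are represented by functions
  vanishing outside \<open>U\<close>.\<close>

definition cut :: "'m set \<Rightarrow> ('m \<Rightarrow> 'b::zero) \<Rightarrow> 'm \<Rightarrow> 'b" where
  "cut U f = (\<lambda>x. if x \<in> U then f x else 0)"

definition Cinf :: "('m::topological_space, 'a::euclidean_space, 'z) manifold_scheme
    \<Rightarrow> 'm set \<Rightarrow> ('m \<Rightarrow> real) ring" where
  "Cinf M U = \<lparr>carrier = {f. smooth_fun M U f \<and> cut U f = f},
     mult = (\<lambda>f g x. f x * g x), one = cut U (\<lambda>x. 1),
     zero = (\<lambda>x. 0), add = (\<lambda>f g x. f x + g x)\<rparr>"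

text \<open>Vector fields on \<open>U\<close>, as operators on functions that have the form
  $\sum_i v^i \partial_i$ with smooth $v^i$ in all local coordinates.\<close>

definition vector_fields :: "('m::topological_space, 'a::euclidean_space, 'z) manifold_scheme
    \<Rightarrow> 'm set \<Rightarrow> (('m \<Rightarrow> real) \<Rightarrow> 'm \<Rightarrow> real) set" where
  "vector_fields M U = {v.
     (\<forall>f. f \<notin> carrier (Cinf M U) \<longrightarrow> v f = (\<lambda>x. 0))
   \<and> (\<forall>f \<in> carrier (Cinf M U). v f \<in> carrier (Cinf M U))
   \<and> (\<forall>(V, \<phi>) \<in> atlas M. \<exists>w. (\<forall>b \<in> axes M. smooth_fun M (U \<inter> V) (w b)) \<and>
        (\<forall>f \<in> carrier (Cinf M U). \<forall>x \<in> U \<inter> V.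
           v f x = (\<Sum>b\<in>axes M. w b x * pderiv_chart V \<phi> b f x)))}"

section \<open>Pseudo-Euclidean vector bundles\<close>

text \<open>The fibres are subspaces of one real vector space, for which no topology and no relation
  between different fibres is assumed (for an arbitrary bundle, take the direct sum of all its
  fibres).  The bundle structure is given by a set of local trivialisations, that is, of lists of
  local sections which are a frame on an open set.\<close>

record ('m, 'a, 'v) vbundle = "('m, 'a) manifold" +
  fibre :: "'m \<Rightarrow> 'v set"
  trivs :: "('m set \<times> ('m \<Rightarrow> 'v) list) set"

definition frame_at :: "('m, 'a, 'v::real_vector, 'z) vbundle_scheme \<Rightarrow> ('m \<Rightarrow> 'v) list \<Rightarrow> 'm \<Rightarrow> bool" where
  "frame_at E es x \<longleftrightarrow> distinct (map (\<lambda>e. e x) es)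
     \<and> independent (set (map (\<lambda>e. e x) es))
     \<and> span (set (map (\<lambda>e. e x) es)) = fibre E x"

definition frame_coeff :: "('m \<Rightarrow> 'v::real_vector) list \<Rightarrow> nat \<Rightarrow> ('m \<Rightarrow> 'v) \<Rightarrow> 'm \<Rightarrow> real" where
  "frame_coeff es a s x = representation (set (map (\<lambda>e. e x) es)) (s x) ((es ! a) x)"

definition vector_bundle :: "('m::{t2_space, second_countable_topology}, 'a::euclidean_space,
    'v::real_vector, 'z) vbundle_scheme \<Rightarrow> bool" where
  "vector_bundle E \<longleftrightarrow> smooth_manifold E
   \<and> (\<forall>(V, es) \<in> trivs E. open V \<and> (\<forall>x\<in>V. frame_at E es x))
   \<and> (\<Union>(V, es) \<in> trivs E. V) = UNIV
   \<and> (\<forall>(V, es) \<in> trivs E. \<forall>(V', es') \<in> trivs E. \<forall>a < length es. \<forall>a' < length es'.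
        smooth_fun E (V \<inter> V') (frame_coeff es a (es' ! a')))"

definition smooth_section :: "('m::topological_space, 'a::euclidean_space, 'v::real_vector, 'z) vbundle_scheme
    \<Rightarrow> 'm set \<Rightarrow> ('m \<Rightarrow> 'v) \<Rightarrow> bool" where
  "smooth_section E U s \<longleftrightarrow> (\<forall>x\<in>U. s x \<in> fibre E x)
   \<and> (\<forall>(V, es) \<in> trivs E. \<forall>a < length es. smooth_fun E (U \<inter> V) (frame_coeff es a s))"

text \<open>The ring operations are meaningless for this module and for the next one.\<close>

definition sections :: "('m::topological_space, 'a::euclidean_space, 'v::real_vector, 'z) vbundle_scheme
    \<Rightarrow> 'm set \<Rightarrow> ('m \<Rightarrow> real, 'm \<Rightarrow> 'v) module" where
  "sections E U = \<lparr>carrier = {s. smooth_section E U s \<and> cut U s = s},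
     mult = undefined, one = undefined,
     zero = (\<lambda>x. 0), add = (\<lambda>s t x. s x + t x), smult = (\<lambda>f s x. f x *\<^sub>R s x)\<rparr>"

record ('m, 'a, 'v) pe_bundle = "('m, 'a, 'v) vbundle" +
  form :: "'m \<Rightarrow> 'v \<Rightarrow> 'v \<Rightarrow> real"

definition pseudo_euclidean_bundle :: "('m::{t2_space, second_countable_topology}, 'a::euclidean_space,
    'v::real_vector, 'z) pe_bundle_scheme \<Rightarrow> bool" where
  "pseudo_euclidean_bundle E \<longleftrightarrow> vector_bundle E
   \<and> (\<forall>x. \<forall>u \<in> fibre E x. \<forall>v \<in> fibre E x. form E x u v = form E x v u
        \<and> (\<forall>w \<in> fibre E x. form E x (u + v) w = form E x u w + form E x v w)
        \<and> (\<forall>c. form E x (c *\<^sub>R u) v = c * form E x u v))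
   \<and> (\<forall>x. \<forall>u \<in> fibre E x. (\<forall>v \<in> fibre E x. form E x u v = 0) \<longrightarrow> u = 0)
   \<and> (\<forall>(V, es) \<in> trivs E. \<forall>a < length es. \<forall>b < length es.
        smooth_fun E V (\<lambda>x. form E x ((es ! a) x) ((es ! b) x)))"

definition pairing :: "('m, 'a, 'v::real_vector, 'z) pe_bundle_scheme
    \<Rightarrow> ('m \<Rightarrow> 'v) \<Rightarrow> ('m \<Rightarrow> 'v) \<Rightarrow> 'm \<Rightarrow> real" where
  "pairing E s t = (\<lambda>x. form E x (s x) (t x))"

section \<open>The gauge Lie algebroid\<close>

text \<open>A section of the gauge Lie algebroid is a pair of an operator $L$ and its vector field
  $v = a(L)$.  If the rank of $E$ is positive then $v$ is determined by $L$; for rank $0$, the pairs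
  are needed for the exactness of the Atiyah sequence.\<close>

type_synonym ('m, 'v) cdo = "(('m \<Rightarrow> 'v) \<Rightarrow> 'm \<Rightarrow> 'v) \<times> (('m \<Rightarrow> real) \<Rightarrow> 'm \<Rightarrow> real)"

definition is_cdo :: "('m::topological_space, 'a::euclidean_space, 'v::real_vector, 'z) pe_bundle_scheme
    \<Rightarrow> 'm set \<Rightarrow> (('m \<Rightarrow> 'v) \<Rightarrow> 'm \<Rightarrow> 'v) \<Rightarrow> (('m \<Rightarrow> real) \<Rightarrow> 'm \<Rightarrow> real) \<Rightarrow> bool" where
  "is_cdo E U L v \<longleftrightarrow>
     (\<forall>X. X \<notin> carrier (sections E U) \<longrightarrow> L X = (\<lambda>x. 0))
   \<and> (\<forall>X \<in> carrier (sections E U). L X \<in> carrier (sections E U))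
   \<and> (\<forall>X \<in> carrier (sections E U). \<forall>Y \<in> carrier (sections E U).
        L (\<lambda>x. X x + Y x) = (\<lambda>x. L X x + L Y x))
   \<and> (\<forall>c. \<forall>X \<in> carrier (sections E U). L (\<lambda>x. c *\<^sub>R X x) = (\<lambda>x. c *\<^sub>R L X x))
   \<and> v \<in> vector_fields E U
   \<and> (\<forall>f \<in> carrier (Cinf E U). \<forall>X \<in> carrier (sections E U).
        L (\<lambda>x. f x *\<^sub>R X x) = (\<lambda>x. f x *\<^sub>R L X x + v f x *\<^sub>R X x))
   \<and> (\<forall>X \<in> carrier (sections E U). \<forall>Y \<in> carrier (sections E U).
        v (cut U (pairing E X Y)) = cut U (\<lambda>x. pairing E (L X) Y x + pairing E X (L Y) x))"

definition gauge :: "('m::topological_space, 'a::euclidean_space, 'v::real_vector, 'z) pe_bundle_scheme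
    \<Rightarrow> 'm set \<Rightarrow> ('m \<Rightarrow> real, ('m, 'v) cdo) module" where
  "gauge E U = \<lparr>carrier = {(L, v). is_cdo E U L v},
     mult = undefined, one = undefined,
     zero = (\<lambda>X x. 0, \<lambda>f x. 0),
     add = (\<lambda>(L, v) (L', v'). (\<lambda>X x. L X x + L' X x, \<lambda>f x. v f x + v' f x)),
     smult = (\<lambda>h (L, v). (\<lambda>X x. h x *\<^sub>R L X x, \<lambda>f x. h x * v f x))\<rparr>"

text \<open>Covariant differential operators are local, so the following restriction is well-defined.\<close>

definition gauge_restr :: "('m::topological_space, 'a::euclidean_space, 'v::real_vector, 'z) pe_bundle_scheme
    \<Rightarrow> 'm set \<Rightarrow> 'm set \<Rightarrow> ('m, 'v) cdo \<Rightarrow> ('m, 'v) cdo" where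
  "gauge_restr E U V D = (THE D'. D' \<in> carrier (gauge E V)
     \<and> (\<forall>X \<in> carrier (sections E U). fst D' (cut V X) = cut V (fst D X))
     \<and> (\<forall>f \<in> carrier (Cinf E U). snd D' (cut V f) = cut V (snd D f)))"

definition wedge_cdo :: "('m::topological_space, 'a::euclidean_space, 'v::real_vector, 'z) pe_bundle_scheme
    \<Rightarrow> 'm set \<Rightarrow> ('m \<Rightarrow> 'v) \<Rightarrow> ('m \<Rightarrow> 'v) \<Rightarrow> ('m, 'v) cdo" where
  "wedge_cdo E U e1 e2 =
     (\<lambda>X. if X \<in> carrier (sections E U)
          then cut U (\<lambda>x. pairing E e2 X x *\<^sub>R e1 x - pairing E e1 X x *\<^sub>R e2 x) else (\<lambda>x. 0),
      \<lambda>f x. 0)"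

section \<open>Tensor, exterior and symmetric algebras over a commutative ring\<close>

text \<open>Algebras over a ring are represented by the records for modules, which have a ring
  multiplication.\<close>

definition monoid_alg :: "('r, 'y) ring_scheme \<Rightarrow> ('w, 'z) monoid_scheme \<Rightarrow> ('r, 'w \<Rightarrow> 'r) module" where
  "monoid_alg R W = \<lparr>
     carrier = {f. (\<forall>w. f w \<in> carrier R) \<and> (\<forall>w. w \<notin> carrier W \<longrightarrow> f w = \<zero>\<^bsub>R\<^esub>)
                 \<and> finite {w. f w \<noteq> \<zero>\<^bsub>R\<^esub>}},
     mult = (\<lambda>f g w. \<Oplus>\<^bsub>R\<^esub>p \<in> {(u, v). f u \<noteq> \<zero>\<^bsub>R\<^esub> \<and> g v \<noteq> \<zero>\<^bsub>R\<^esub> \<and> u \<otimes>\<^bsub>W\<^esub> v = w}.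
               f (fst p) \<otimes>\<^bsub>R\<^esub> g (snd p)),
     one = (\<lambda>w. if w = \<one>\<^bsub>W\<^esub> then \<one>\<^bsub>R\<^esub> else \<zero>\<^bsub>R\<^esub>),
     zero = (\<lambda>w. \<zero>\<^bsub>R\<^esub>),
     add = (\<lambda>f g w. f w \<oplus>\<^bsub>R\<^esub> g w),
     smult = (\<lambda>r f w. r \<otimes>\<^bsub>R\<^esub> f w)\<rparr>"

definition monom_alg :: "('r, 'y) ring_scheme \<Rightarrow> 'w \<Rightarrow> 'w \<Rightarrow> 'r" where
  "monom_alg R u = (\<lambda>w. if w = u then \<one>\<^bsub>R\<^esub> else \<zero>\<^bsub>R\<^esub>)"

definition monoid_alg_map :: "('r, 'y) ring_scheme \<Rightarrow> ('s, 'z) ring_scheme \<Rightarrow> ('r \<Rightarrow> 's) \<Rightarrow> ('w \<Rightarrow> 'u)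
    \<Rightarrow> ('w \<Rightarrow> 'r) \<Rightarrow> 'u \<Rightarrow> 's" where
  "monoid_alg_map R S h k f = (\<lambda>u. \<Oplus>\<^bsub>S\<^esub>w \<in> {w. f w \<noteq> \<zero>\<^bsub>R\<^esub> \<and> k w = u}. h (f w))"

definition quot_alg :: "('r, 'x) module \<Rightarrow> 'x set \<Rightarrow> ('r, 'x set) module" where
  "quot_alg A I = ring.extend (A Quot I)
     (module.fields (\<lambda>r C. \<Union>c\<in>C. I +>\<^bsub>A\<^esub> (r \<odot>\<^bsub>A\<^esub> c)))"

definition quot_map :: "('s, 'u) module \<Rightarrow> 'u set \<Rightarrow> ('x \<Rightarrow> 'u) \<Rightarrow> 'x set \<Rightarrow> 'u set" where
  "quot_map B J h C = (\<Union>c\<in>C. J +>\<^bsub>B\<^esub> h c)"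

definition word_monoid :: "'x set \<Rightarrow> 'x list monoid" where
  "word_monoid X = \<lparr>carrier = lists X, mult = (@), one = []\<rparr>"

definition word_alg :: "('r, 'y) ring_scheme \<Rightarrow> ('r, 'x) module \<Rightarrow> ('r, 'x list \<Rightarrow> 'r) module" where
  "word_alg R M = monoid_alg R (word_monoid (carrier M))"

definition tensor_alg_ideal :: "('r, 'y) ring_scheme \<Rightarrow> ('r, 'x) module \<Rightarrow> ('x list \<Rightarrow> 'r) set" where
  "tensor_alg_ideal R M = genideal (word_alg R M)
     ({monom_alg R [m \<oplus>\<^bsub>M\<^esub> n] \<ominus>\<^bsub>word_alg R M\<^esub> (monom_alg R [m] \<oplus>\<^bsub>word_alg R M\<^esub> monom_alg R [n])
        | m n. m \<in> carrier M \<and> n \<in> carrier M}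
    \<union> {monom_alg R [r \<odot>\<^bsub>M\<^esub> m] \<ominus>\<^bsub>word_alg R M\<^esub> (r \<odot>\<^bsub>word_alg R M\<^esub> monom_alg R [m])
        | r m. r \<in> carrier R \<and> m \<in> carrier M})"

definition tensor_alg :: "('r, 'y) ring_scheme \<Rightarrow> ('r, 'x) module \<Rightarrow> ('r, ('x list \<Rightarrow> 'r) set) module" where
  "tensor_alg R M = quot_alg (word_alg R M) (tensor_alg_ideal R M)"

definition tensor_incl :: "('r, 'y) ring_scheme \<Rightarrow> ('r, 'x) module \<Rightarrow> 'x \<Rightarrow> ('x list \<Rightarrow> 'r) set" where
  "tensor_incl R M m = tensor_alg_ideal R M +>\<^bsub>word_alg R M\<^esub> monom_alg R [m]"

definition tensor_alg_map :: "('r, 'y) ring_scheme \<Rightarrow> ('s, 'z) ring_scheme \<Rightarrow> ('s, 'u) module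
    \<Rightarrow> ('r \<Rightarrow> 's) \<Rightarrow> ('x \<Rightarrow> 'u) \<Rightarrow> ('x list \<Rightarrow> 'r) set \<Rightarrow> ('u list \<Rightarrow> 's) set" where
  "tensor_alg_map R S N h k =
     quot_map (word_alg S N) (tensor_alg_ideal S N) (monoid_alg_map R S h (map k))"

definition ext_ideal :: "('r, 'y) ring_scheme \<Rightarrow> ('r, 'x) module \<Rightarrow> ('x list \<Rightarrow> 'r) set set" where
  "ext_ideal R M = genideal (tensor_alg R M)
     {tensor_incl R M m \<otimes>\<^bsub>tensor_alg R M\<^esub> tensor_incl R M m | m. m \<in> carrier M}"

definition ext_alg :: "('r, 'y) ring_scheme \<Rightarrow> ('r, 'x) module \<Rightarrow> ('r, ('x list \<Rightarrow> 'r) set set) module" where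
  "ext_alg R M = quot_alg (tensor_alg R M) (ext_ideal R M)"

definition ext_incl :: "('r, 'y) ring_scheme \<Rightarrow> ('r, 'x) module \<Rightarrow> 'x \<Rightarrow> ('x list \<Rightarrow> 'r) set set" where
  "ext_incl R M m = ext_ideal R M +>\<^bsub>tensor_alg R M\<^esub> tensor_incl R M m"

definition ext_alg_map :: "('r, 'y) ring_scheme \<Rightarrow> ('s, 'z) ring_scheme \<Rightarrow> ('s, 'u) module
    \<Rightarrow> ('r \<Rightarrow> 's) \<Rightarrow> ('x \<Rightarrow> 'u) \<Rightarrow> ('x list \<Rightarrow> 'r) set set \<Rightarrow> ('u list \<Rightarrow> 's) set set" where
  "ext_alg_map R S N h k = quot_map (tensor_alg S N) (ext_ideal S N) (tensor_alg_map R S N h k)"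

definition sym_ideal :: "('r, 'y) ring_scheme \<Rightarrow> ('r, 'x) module \<Rightarrow> ('x list \<Rightarrow> 'r) set set" where
  "sym_ideal R M = genideal (tensor_alg R M)
     {(tensor_incl R M m \<otimes>\<^bsub>tensor_alg R M\<^esub> tensor_incl R M n) \<ominus>\<^bsub>tensor_alg R M\<^esub>
      (tensor_incl R M n \<otimes>\<^bsub>tensor_alg R M\<^esub> tensor_incl R M m) | m n. m \<in> carrier M \<and> n \<in> carrier M}"

definition sym_alg :: "('r, 'y) ring_scheme \<Rightarrow> ('r, 'x) module \<Rightarrow> ('r, ('x list \<Rightarrow> 'r) set set) module" where
  "sym_alg R M = quot_alg (tensor_alg R M) (sym_ideal R M)"

definition sym_incl :: "('r, 'y) ring_scheme \<Rightarrow> ('r, 'x) module \<Rightarrow> 'x \<Rightarrow> ('x list \<Rightarrow> 'r) set set" where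
  "sym_incl R M m = sym_ideal R M +>\<^bsub>tensor_alg R M\<^esub> tensor_incl R M m"

definition sym_alg_map :: "('r, 'y) ring_scheme \<Rightarrow> ('s, 'z) ring_scheme \<Rightarrow> ('s, 'u) module
    \<Rightarrow> ('r \<Rightarrow> 's) \<Rightarrow> ('x \<Rightarrow> 'u) \<Rightarrow> ('x list \<Rightarrow> 'r) set set \<Rightarrow> ('u list \<Rightarrow> 's) set set" where
  "sym_alg_map R S N h k = quot_map (tensor_alg S N) (sym_ideal S N) (tensor_alg_map R S N h k)"

text \<open>The tensor product of two algebras has the multiplication
  $(a \otimes b)(a' \otimes b') = aa' \otimes bb'$.  This is also the multiplication of the tensor product of
  graded algebras with the sign rule, if the second algebra is concentrated in even degrees.\<close>

definition pair_alg :: "('r, 'y) ring_scheme \<Rightarrow> ('r, 'x) module \<Rightarrow> ('r, 'u) module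
    \<Rightarrow> ('r, 'x \<times> 'u \<Rightarrow> 'r) module" where
  "pair_alg R A B = monoid_alg R (A \<times>\<times> B)"

definition tensor_prod_ideal :: "('r, 'y) ring_scheme \<Rightarrow> ('r, 'x) module \<Rightarrow> ('r, 'u) module
    \<Rightarrow> ('x \<times> 'u \<Rightarrow> 'r) set" where
  "tensor_prod_ideal R A B = genideal (pair_alg R A B)
     ({monom_alg R (a \<oplus>\<^bsub>A\<^esub> a', b) \<ominus>\<^bsub>pair_alg R A B\<^esub>
         (monom_alg R (a, b) \<oplus>\<^bsub>pair_alg R A B\<^esub> monom_alg R (a', b))
        | a a' b. a \<in> carrier A \<and> a' \<in> carrier A \<and> b \<in> carrier B}
    \<union> {monom_alg R (a, b \<oplus>\<^bsub>B\<^esub> b') \<ominus>\<^bsub>pair_alg R A B\<^esub>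
         (monom_alg R (a, b) \<oplus>\<^bsub>pair_alg R A B\<^esub> monom_alg R (a, b'))
        | a b b'. a \<in> carrier A \<and> b \<in> carrier B \<and> b' \<in> carrier B}
    \<union> {monom_alg R (r \<odot>\<^bsub>A\<^esub> a, b) \<ominus>\<^bsub>pair_alg R A B\<^esub> (r \<odot>\<^bsub>pair_alg R A B\<^esub> monom_alg R (a, b))
        | r a b. r \<in> carrier R \<and> a \<in> carrier A \<and> b \<in> carrier B}
    \<union> {monom_alg R (a, r \<odot>\<^bsub>B\<^esub> b) \<ominus>\<^bsub>pair_alg R A B\<^esub> (r \<odot>\<^bsub>pair_alg R A B\<^esub> monom_alg R (a, b))
        | r a b. r \<in> carrier R \<and> a \<in> carrier A \<and> b \<in> carrier B})"

definition tensor_prod :: "('r, 'y) ring_scheme \<Rightarrow> ('r, 'x) module \<Rightarrow> ('r, 'u) module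
    \<Rightarrow> ('r, ('x \<times> 'u \<Rightarrow> 'r) set) module" where
  "tensor_prod R A B = quot_alg (pair_alg R A B) (tensor_prod_ideal R A B)"

definition pure_tensor :: "('r, 'y) ring_scheme \<Rightarrow> ('r, 'x) module \<Rightarrow> ('r, 'u) module
    \<Rightarrow> 'x \<Rightarrow> 'u \<Rightarrow> ('x \<times> 'u \<Rightarrow> 'r) set" where
  "pure_tensor R A B a b = tensor_prod_ideal R A B +>\<^bsub>pair_alg R A B\<^esub> monom_alg R (a, b)"

definition tensor_prod_map :: "('r, 'y) ring_scheme \<Rightarrow> ('s, 'z) ring_scheme
    \<Rightarrow> ('s, 'x') module \<Rightarrow> ('s, 'u') module \<Rightarrow> ('r \<Rightarrow> 's) \<Rightarrow> ('x \<Rightarrow> 'x') \<Rightarrow> ('u \<Rightarrow> 'u')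
    \<Rightarrow> ('x \<times> 'u \<Rightarrow> 'r) set \<Rightarrow> ('x' \<times> 'u' \<Rightarrow> 's) set" where
  "tensor_prod_map R S A B h k l =
     quot_map (pair_alg S A B) (tensor_prod_ideal S A B) (monoid_alg_map R S h (map_prod k l))"

definition alg_prod_list :: "('r, 'x) module \<Rightarrow> 'x list \<Rightarrow> 'x" where
  "alg_prod_list A xs = foldr (mult A) xs \<one>\<^bsub>A\<^esub>"

section \<open>Sheaves of graded algebras over the sheaf of smooth functions\<close>

text \<open>Only the values at open sets are relevant.  For sheaves, the sum of the homogeneous parts is
  the direct sum of sheaves, so its sections are locally finite sums of homogeneous ones.\<close>

record ('m, 'x) galg_presheaf =
  alg :: "'m set \<Rightarrow> ('m \<Rightarrow> real, 'x) module"
  homog :: "'m set \<Rightarrow> nat \<Rightarrow> 'x set"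
  restr :: "'m set \<Rightarrow> 'm set \<Rightarrow> 'x \<Rightarrow> 'x"

text \<open>The germ at \<open>x\<close> of the section \<open>s\<close> over \<open>V\<close>, as a class of pairs of a neighbourhood of \<open>x\<close>
  and a section over it.\<close>

definition germ :: "('m::topological_space, 'x) galg_presheaf \<Rightarrow> 'm \<Rightarrow> 'm set \<Rightarrow> 'x \<Rightarrow> ('m set \<times> 'x) set" where
  "germ P x V s = {(W, t). open W \<and> x \<in> W \<and> t \<in> carrier (alg P W)
     \<and> (\<exists>N. open N \<and> x \<in> N \<and> N \<subseteq> V \<inter> W \<and> restr P V N s = restr P W N t)}"

definition germ_op :: "('m::topological_space, 'x) galg_presheaf \<Rightarrow> ('m set \<Rightarrow> 'x \<Rightarrow> 'x \<Rightarrow> 'x) \<Rightarrow> 'm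
    \<Rightarrow> ('m set \<times> 'x) set \<Rightarrow> ('m set \<times> 'x) set \<Rightarrow> ('m set \<times> 'x) set" where
  "germ_op P f x \<gamma> \<delta> = (\<Union>(V, s) \<in> \<gamma>. \<Union>(W, t) \<in> \<delta>.
     germ P x (V \<inter> W) (f (V \<inter> W) (restr P V (V \<inter> W) s) (restr P W (V \<inter> W) t)))"

text \<open>Families of germs over \<open>U\<close> that locally come from sections in \<open>F\<close>.\<close>

definition germ_sections :: "('m::topological_space, 'x) galg_presheaf \<Rightarrow> ('m set \<Rightarrow> 'x set)
    \<Rightarrow> 'm set \<Rightarrow> ('m \<Rightarrow> ('m set \<times> 'x) set) set" where
  "germ_sections P F U = {\<sigma>. (\<forall>x. x \<notin> U \<longrightarrow> \<sigma> x = {})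
     \<and> (\<forall>x\<in>U. \<exists>V. open V \<and> x \<in> V \<and> V \<subseteq> U \<and> (\<exists>s \<in> F V. \<forall>y\<in>V. \<sigma> y = germ P y V s))}"

definition sheafify :: "('m::topological_space, 'x) galg_presheaf
    \<Rightarrow> ('m, 'm \<Rightarrow> ('m set \<times> 'x) set) galg_presheaf" where
  "sheafify P = \<lparr>
     alg = (\<lambda>U. \<lparr>carrier = germ_sections P (\<lambda>V. carrier (alg P V)) U,
       mult = (\<lambda>\<sigma> \<tau> x. germ_op P (\<lambda>V. mult (alg P V)) x (\<sigma> x) (\<tau> x)),
       one = (\<lambda>x. if x \<in> U then germ P x U \<one>\<^bsub>alg P U\<^esub> else {}),
       zero = (\<lambda>x. if x \<in> U then germ P x U \<zero>\<^bsub>alg P U\<^esub> else {}),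
       add = (\<lambda>\<sigma> \<tau> x. germ_op P (\<lambda>V. add (alg P V)) x (\<sigma> x) (\<tau> x)),
       smult = (\<lambda>f \<sigma> x. \<Union>(V, s) \<in> \<sigma> x.
         germ P x (U \<inter> V) (cut (U \<inter> V) f \<odot>\<^bsub>alg P (U \<inter> V)\<^esub> restr P V (U \<inter> V) s))\<rparr>),
     homog = (\<lambda>U n. germ_sections P (\<lambda>V. homog P V n) U),
     restr = (\<lambda>U V \<sigma> x. if x \<in> V then \<sigma> x else {})\<rparr>"

definition isomorphic_galg_sheaves :: "('m::topological_space, 'a::euclidean_space, 'z) manifold_scheme
    \<Rightarrow> ('m, 'x) galg_presheaf \<Rightarrow> ('m, 'y) galg_presheaf \<Rightarrow> bool" where
  "isomorphic_galg_sheaves M P Q \<longleftrightarrow> (\<exists>\<Phi>. \<forall>U. open U \<longrightarrow>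
     bij_betw (\<Phi> U) (carrier (alg P U)) (carrier (alg Q U))
   \<and> (\<forall>n. \<Phi> U ` homog P U n = homog Q U n)
   \<and> \<Phi> U \<one>\<^bsub>alg P U\<^esub> = \<one>\<^bsub>alg Q U\<^esub>
   \<and> (\<forall>s \<in> carrier (alg P U). \<forall>t \<in> carrier (alg P U).
        \<Phi> U (s \<oplus>\<^bsub>alg P U\<^esub> t) = \<Phi> U s \<oplus>\<^bsub>alg Q U\<^esub> \<Phi> U t
      \<and> \<Phi> U (s \<otimes>\<^bsub>alg P U\<^esub> t) = \<Phi> U s \<otimes>\<^bsub>alg Q U\<^esub> \<Phi> U t)
   \<and> (\<forall>f \<in> carrier (Cinf M U). \<forall>s \<in> carrier (alg P U).
        \<Phi> U (f \<odot>\<^bsub>alg P U\<^esub> s) = f \<odot>\<^bsub>alg Q U\<^esub> \<Phi> U s)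
   \<and> (\<forall>V. open V \<and> V \<subseteq> U \<longrightarrow> (\<forall>s \<in> carrier (alg P U).
        \<Phi> V (restr P U V s) = restr Q U V (\<Phi> U s))))"

section \<open>The sheaf of polynomial functions on the symplectic N-manifold\<close>

text \<open>Polynomials in odd variables $\xi^a$ and even variables $p_i$ with real coefficients, as
  linear combinations of the monomials $\xi^{a_1} \cdots \xi^{a_k} p_{i_1} \cdots p_{i_l}$ with $a_1 < \dots < a_k$.\<close>

type_synonym 'a spoly = "(nat fset \<times> 'a multiset) \<Rightarrow>\<^sub>0 real"

definition spoly_scale :: "real \<Rightarrow> 'a spoly \<Rightarrow> 'a spoly" where
  "spoly_scale c F = Poly_Mapping.map ((*) c) F"

definition odd_sign :: "nat fset \<Rightarrow> nat fset \<Rightarrow> real" where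
  "odd_sign A B = (if fset A \<inter> fset B \<noteq> {} then 0
     else (- 1) ^ card {(a, b). a \<in> fset A \<and> b \<in> fset B \<and> b < a})"

definition spoly_mult :: "'a spoly \<Rightarrow> 'a spoly \<Rightarrow> 'a spoly" where
  "spoly_mult F G = (\<Sum>(A, m) \<in> Poly_Mapping.keys F. \<Sum>(B, n) \<in> Poly_Mapping.keys G.
     Poly_Mapping.single (A |\<union>| B, m + n)
       (odd_sign A B * Poly_Mapping.lookup F (A, m) * Poly_Mapping.lookup G (B, n)))"

definition spoly_one :: "'a spoly" where
  "spoly_one = Poly_Mapping.single ({||}, {#}) 1"

definition xi :: "nat \<Rightarrow> 'a spoly" where
  "xi a = Poly_Mapping.single ({|a|}, {#}) 1"

definition mom :: "'a \<Rightarrow> 'a spoly" where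
  "mom i = Poly_Mapping.single ({||}, {#i#}) 1"

text \<open>Substitution of \<open>\<theta> a\<close> for $\xi^a$ and of \<open>\<pi> i\<close> for $p_i$, where the \<open>\<pi> i\<close> are even, so that
  they commute.\<close>

definition spoly_subst :: "(nat \<Rightarrow> 'b spoly) \<Rightarrow> ('a \<Rightarrow> 'b spoly) \<Rightarrow> 'a spoly \<Rightarrow> 'b spoly" where
  "spoly_subst \<theta> \<pi> F = (\<Sum>(A, m) \<in> Poly_Mapping.keys F.
     spoly_scale (Poly_Mapping.lookup F (A, m))
       (spoly_mult (foldr (\<lambda>a. spoly_mult (\<theta> a)) (sorted_list_of_set (fset A)) spoly_one)
                   (fold_mset (\<lambda>i. spoly_mult (\<pi> i)) spoly_one m)))"

definition weight :: "nat fset \<times> 'a multiset \<Rightarrow> nat" where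
  "weight k = card (fset (fst k)) + 2 * size (snd k)"

text \<open>The charts of the N-manifold are given by a domain \<open>V\<close>, local coordinates \<open>\<phi>\<close> on \<open>V\<close> and a
  frame \<open>es\<close> on \<open>V\<close> with constant $g_{ab}$.\<close>

type_synonym ('m, 'a, 'v) nchart = "'m set \<times> ('m \<Rightarrow> 'a) \<times> ('m \<Rightarrow> 'v) list"

definition ncharts :: "('m::topological_space, 'a::euclidean_space, 'v::real_vector, 'z) pe_bundle_scheme
    \<Rightarrow> ('m, 'a, 'v) nchart set" where
  "ncharts E = {(V, \<phi>, es). (V, \<phi>) \<in> atlas E
     \<and> (\<forall>e \<in> set es. smooth_section E V e) \<and> (\<forall>x\<in>V. frame_at E es x)
     \<and> (\<forall>a < length es. \<forall>b < length es. \<exists>c. \<forall>x\<in>V. pairing E (es ! a) (es ! b) x = c)}"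

text \<open>The expressions at a point \<open>x\<close> for the coordinates of the chart \<open>(V, \<phi>, es)\<close> in those of the
  chart \<open>(V', \<phi>', es')\<close>, with $T^a_{a'}$ = \<open>frame_coeff es a (es' ! a')\<close>.  The
  coordinates $q^i$ do not appear as variables, since the coefficients of polynomial functions are
  represented by functions on open sets of the base manifold.\<close>

definition trans_xi :: "('m \<Rightarrow> 'v::real_vector) list \<Rightarrow> ('m \<Rightarrow> 'v) list \<Rightarrow> 'm \<Rightarrow> nat \<Rightarrow> 'a spoly" where
  "trans_xi es es' x a = (\<Sum>a' < length es'. spoly_scale (frame_coeff es a (es' ! a') x) (xi a'))"

definition trans_mom :: "('m, 'a::euclidean_space, 'v::real_vector, 'z) pe_bundle_scheme
    \<Rightarrow> ('m, 'a, 'v) nchart \<Rightarrow> ('m, 'a, 'v) nchart \<Rightarrow> 'm \<Rightarrow> 'a \<Rightarrow> 'a spoly" where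
  "trans_mom E = (\<lambda>(V, \<phi>, es) (V', \<phi>', es') x i.
     (\<Sum>i'\<in>axes E. spoly_scale (pderiv_chart V \<phi> i (\<lambda>y. \<phi>' y \<bullet> i') x) (mom i'))
   + (\<Sum>a' < length es'. \<Sum>b' < length es'. \<Sum>a < length es. \<Sum>b < length es.
        spoly_scale (1 / 2 * pderiv_chart V \<phi> i (frame_coeff es a (es' ! a')) x
            * pairing E (es ! a) (es ! b) x * frame_coeff es b (es' ! b') x)
          (spoly_mult (xi a') (xi b'))))"

text \<open>A polynomial function on the part of the N-manifold over \<open>U\<close> is a family of polynomial
  functions in all charts, which are transformed into each other by the transition maps.\<close>

definition nfuns :: "('m::topological_space, 'a::euclidean_space, 'v::real_vector, 'z) pe_bundle_scheme
    \<Rightarrow> 'm set \<Rightarrow> (('m, 'a, 'v) nchart \<Rightarrow> 'm \<Rightarrow> 'a spoly) set" where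
  "nfuns E U = {F.
     (\<forall>\<kappa> x. \<not> (\<kappa> \<in> ncharts E \<and> x \<in> U \<inter> fst \<kappa>) \<longrightarrow> F \<kappa> x = 0)
   \<and> (\<forall>(V, \<phi>, es) \<in> ncharts E.
        (\<forall>x \<in> U \<inter> V. Poly_Mapping.keys (F (V, \<phi>, es) x)
            \<subseteq> {(A, m). fset A \<subseteq> {..<length es} \<and> set_mset m \<subseteq> axes E})
      \<and> (\<forall>k. smooth_fun E (U \<inter> V) (\<lambda>x. Poly_Mapping.lookup (F (V, \<phi>, es) x) k))
      \<and> (\<forall>x \<in> U \<inter> V. \<exists>N d. open N \<and> x \<in> N \<and>
           (\<forall>y \<in> N \<inter> U \<inter> V. \<forall>k \<in> Poly_Mapping.keys (F (V, \<phi>, es) y). weight k \<le> d)))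
   \<and> (\<forall>(V, \<phi>, es) \<in> ncharts E. \<forall>(V', \<phi>', es') \<in> ncharts E. \<forall>x \<in> U \<inter> V \<inter> V'.
        F (V', \<phi>', es') x =
          spoly_subst (trans_xi es es' x) (trans_mom E (V, \<phi>, es) (V', \<phi>', es') x) (F (V, \<phi>, es) x))}"

definition polynomial_functions ::
  "('m::topological_space, 'a::euclidean_space, 'v::real_vector, 'z) pe_bundle_scheme
    \<Rightarrow> ('m, ('m, 'a, 'v) nchart \<Rightarrow> 'm \<Rightarrow> 'a spoly) galg_presheaf" where
  "polynomial_functions E = \<lparr>
     alg = (\<lambda>U. \<lparr>carrier = nfuns E U,
       mult = (\<lambda>F G \<kappa> x. spoly_mult (F \<kappa> x) (G \<kappa> x)),
       one = (\<lambda>\<kappa> x. if \<kappa> \<in> ncharts E \<and> x \<in> U \<inter> fst \<kappa> then spoly_one else 0),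
       zero = (\<lambda>\<kappa> x. 0),
       add = (\<lambda>F G \<kappa> x. F \<kappa> x + G \<kappa> x),
       smult = (\<lambda>f F \<kappa> x. spoly_scale (f x) (F \<kappa> x))\<rparr>),
     homog = (\<lambda>U n. {F \<in> nfuns E U. \<forall>\<kappa> x. \<forall>k \<in> Poly_Mapping.keys (F \<kappa> x). weight k = n}),
     restr = (\<lambda>U V F \<kappa>. cut V (F \<kappa>))\<rparr>"

section \<open>The sheaf generated by the bundle and its gauge algebroid\<close>

definition ext_E :: "('m::topological_space, 'a::euclidean_space, 'v::real_vector, 'z) pe_bundle_scheme
    \<Rightarrow> 'm set \<Rightarrow> ('m \<Rightarrow> real, (('m \<Rightarrow> 'v) list \<Rightarrow> 'm \<Rightarrow> real) set set) module" where
  "ext_E E U = ext_alg (Cinf E U) (sections E U)"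

definition sym_A :: "('m::topological_space, 'a::euclidean_space, 'v::real_vector, 'z) pe_bundle_scheme
    \<Rightarrow> 'm set \<Rightarrow> ('m \<Rightarrow> real, (('m, 'v) cdo list \<Rightarrow> 'm \<Rightarrow> real) set set) module" where
  "sym_A E U = sym_alg (Cinf E U) (gauge E U)"

type_synonym ('m, 'v) EA_tensor =
  "((('m \<Rightarrow> 'v) list \<Rightarrow> 'm \<Rightarrow> real) set set \<times> (('m, 'v) cdo list \<Rightarrow> 'm \<Rightarrow> real) set set
     \<Rightarrow> 'm \<Rightarrow> real) set"

definition ext_sym :: "('m::topological_space, 'a::euclidean_space, 'v::real_vector, 'z) pe_bundle_scheme
    \<Rightarrow> 'm set \<Rightarrow> ('m \<Rightarrow> real, ('m, 'v) EA_tensor) module" where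
  "ext_sym E U = tensor_prod (Cinf E U) (ext_E E U) (sym_A E U)"

text \<open>The graph of the embedding of $\wedge^2 E$ into the gauge algebroid.  Since
  $f(e_1 \wedge e_2) = (fe_1) \wedge e_2$, the additive group generated by the $e_1 \wedge e_2$ is all of
  $\wedge^2 E$.\<close>

definition wedge2_embedding ::
  "('m::topological_space, 'a::euclidean_space, 'v::real_vector, 'z) pe_bundle_scheme
    \<Rightarrow> 'm set \<Rightarrow> ((('m \<Rightarrow> 'v) list \<Rightarrow> 'm \<Rightarrow> real) set set \<times> ('m, 'v) cdo) set" where
  "wedge2_embedding E U = generate (add_monoid (ext_E E U) \<times>\<times> add_monoid (gauge E U))
     {(ext_incl (Cinf E U) (sections E U) e1 \<otimes>\<^bsub>ext_E E U\<^esub> ext_incl (Cinf E U) (sections E U) e2,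
       wedge_cdo E U e1 e2) | e1 e2. e1 \<in> carrier (sections E U) \<and> e2 \<in> carrier (sections E U)}"

definition EA_ideal :: "('m::topological_space, 'a::euclidean_space, 'v::real_vector, 'z) pe_bundle_scheme
    \<Rightarrow> 'm set \<Rightarrow> ('m, 'v) EA_tensor set" where
  "EA_ideal E U = genideal (ext_sym E U)
     {pure_tensor (Cinf E U) (ext_E E U) (sym_A E U) \<omega> \<one>\<^bsub>sym_A E U\<^esub> \<ominus>\<^bsub>ext_sym E U\<^esub>
      pure_tensor (Cinf E U) (ext_E E U) (sym_A E U) \<one>\<^bsub>ext_E E U\<^esub> (sym_incl (Cinf E U) (gauge E U) D)
      | \<omega> D. (\<omega>, D) \<in> wedge2_embedding E U}"

definition EA_alg :: "('m::topological_space, 'a::euclidean_space, 'v::real_vector, 'z) pe_bundle_scheme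
    \<Rightarrow> 'm set \<Rightarrow> ('m \<Rightarrow> real, ('m, 'v) EA_tensor set) module" where
  "EA_alg E U = quot_alg (ext_sym E U) (EA_ideal E U)"

text \<open>The class of $e_1 \wedge \dots \wedge e_j \otimes D_1 \cdots D_k$.\<close>

definition EA_monom :: "('m::topological_space, 'a::euclidean_space, 'v::real_vector, 'z) pe_bundle_scheme
    \<Rightarrow> 'm set \<Rightarrow> ('m \<Rightarrow> 'v) list \<Rightarrow> ('m, 'v) cdo list \<Rightarrow> ('m, 'v) EA_tensor set" where
  "EA_monom E U es Ds = EA_ideal E U +>\<^bsub>ext_sym E U\<^esub>
     pure_tensor (Cinf E U) (ext_E E U) (sym_A E U)
       (alg_prod_list (ext_E E U) (map (ext_incl (Cinf E U) (sections E U)) es))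
       (alg_prod_list (sym_A E U) (map (sym_incl (Cinf E U) (gauge E U)) Ds))"

definition EA_homog :: "('m::topological_space, 'a::euclidean_space, 'v::real_vector, 'z) pe_bundle_scheme
    \<Rightarrow> 'm set \<Rightarrow> nat \<Rightarrow> ('m, 'v) EA_tensor set set" where
  "EA_homog E U n = generate (add_monoid (EA_alg E U))
     {f \<odot>\<^bsub>EA_alg E U\<^esub> EA_monom E U es Ds | f es Ds. f \<in> carrier (Cinf E U)
        \<and> es \<in> lists (carrier (sections E U)) \<and> Ds \<in> lists (carrier (gauge E U))
        \<and> length es + 2 * length Ds = n}"

definition EA_restr :: "('m::topological_space, 'a::euclidean_space, 'v::real_vector, 'z) pe_bundle_scheme
    \<Rightarrow> 'm set \<Rightarrow> 'm set \<Rightarrow> ('m, 'v) EA_tensor set \<Rightarrow> ('m, 'v) EA_tensor set" where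
  "EA_restr E U V = quot_map (ext_sym E V) (EA_ideal E V)
     (tensor_prod_map (Cinf E U) (Cinf E V) (ext_E E V) (sym_A E V) (cut V)
       (ext_alg_map (Cinf E U) (Cinf E V) (sections E V) (cut V) (cut V))
       (sym_alg_map (Cinf E U) (Cinf E V) (gauge E V) (cut V) (gauge_restr E U V)))"

definition EA_presheaf :: "('m::topological_space, 'a::euclidean_space, 'v::real_vector, 'z) pe_bundle_scheme
    \<Rightarrow> ('m, ('m, 'v) EA_tensor set) galg_presheaf" where
  "EA_presheaf E = \<lparr>alg = EA_alg E, homog = EA_homog E, restr = EA_restr E\<rparr>"

text \<open>As always for tensor products and quotients of sheaves of modules, the sheaf is the one
  associated to the presheaf of the algebras over the open sets.\<close>

definition EA_sheaf :: "('m::topological_space, 'a::euclidean_space, 'v::real_vector, 'z) pe_bundle_scheme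
    \<Rightarrow> ('m, 'm \<Rightarrow> ('m set \<times> ('m, 'v) EA_tensor set) set) galg_presheaf" where
  "EA_sheaf E = sheafify (EA_presheaf E)"

end

theory Submission
 imports Defs
begin

text \<open>Over a chart with frame $e_a$, send a section $e$ to $\sum_a \langle e_a, e\rangle\, \xi^a$ and an operator
$D$ with symbol $v$ to $-\sum_i v^i p_i + \frac12 \sum_{a,b} \Gamma_{ab}\, \xi^a \xi^b$, where $\Gamma$ is the matrix of $D$ in the frame.
These assignments are compatible with the gluing of the charts, respect the relations, and are natural in the open set,
so they induce a homomorphism from the presheaf $(\wedge E \otimes S \mathbb{A})/I$ to the sheaf of polynomial functions.
Near every point there are charts with an orthonormal frame. There the quotient is spanned over the smooth functions by the ordered
monomials in the dual frame and in the operators $s^a e_a \mapsto -(\partial_i s^a) e_a$, because $I$ expresses the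
$\wedge^2 E$ part of every operator through the frame. These monomials go to the monomials
$\xi^A p^m$, which are linearly independent: the homomorphism is bijective over small open sets,
hence an isomorphism of the associated sheaves.\<close>

text \<open>The sign and the factor in the image of an operator are forced. Under a change of frame
  the Leibniz rule adds to the matrix of D a term in T and v(T), and the gluing formula adds to p_i
  a quadratic term with the differentiated factor on the other side. As the xi^a anticommute,
  exchanging the two costs a sign, so the terms match when p enters with -1. The factor 1/2 comes
  from the relations: the matrix of a wedge is antisymmetrised, so each product is counted twice.
  The homomorphism is built at one point of one chart at a time, with values in polynomials over the
  reals and semilinear along evaluation at the point. The universal property then applies directly;
  smoothness and gluing follow by induction over generators. Two obstacles come from the bundle.
  Null vectors interrupt Gram-Schmidt for an indefinite form, and operators over U act only on
  sections over all of U, so frame vectors and coordinates must first be extended by bump functions.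
  The isomorphism is written from functions to families of germs: a germ is the set of its
  representatives, and those inducing F can be collected without a choice.\<close>

abbreviation "supp == Poly_Mapping.keys"
abbreviation "coef == Poly_Mapping.lookup"
abbreviation "sgl == Poly_Mapping.single"
abbreviation "pmul == spoly_mult"
abbreviation "pscl == spoly_scale"
abbreviation "secs E U == carrier (sections E U)"
abbreviation "gaug E U == carrier (gauge E U)"
abbreviation "smf == smooth_fun"
abbreviation "sms == smooth_section"
abbreviation "fco == frame_coeff"
abbreviation "pdc == pderiv_chart"
abbreviation "tens == tensor_alg"
abbreviation "tinc == tensor_incl"
notation scaleR (infixr "*r" 75)
abbreviation near :: "'a::topological_space => ('a => 'b) => ('a => 'b) => bool" where
 "near x f g == \<forall>\<^sub>F y in nhds x. f y = g y"

section \<open>Monoid algebras\<close>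

text \<open>Terms with arbitrary coefficients: every element of the monoid algebra is a plain sum of
  them, so inductions need no separate case for scalars.\<close>

definition mterm :: "('r, 'y) ring_scheme => 'r => 'w => 'w => 'r" where
 "mterm R r u = (%w. if w = u then r else \<zero>\<^bsub>R\<^esub>)"

locale monoid_algebra = R: cring R + W: Group.monoid W for R :: "('r, 'y) ring_scheme" (structure) and W :: "('w, 'z) monoid_scheme"
begin

abbreviation "A == monoid_alg R W"

lemma carrier_iff: "f : carrier A \<longleftrightarrow> (ALL w. f w : carrier R)
  & (ALL w. w ~: carrier W --> f w = \<zero>) & finite {w. f w ~= \<zero>}" by (simp add: monoid_alg_def)

lemma add_eq: "f \<oplus>\<^bsub>A\<^esub> g = (%w. f w \<oplus> g w)" and zero_eq: "\<zero>\<^bsub>A\<^esub> = (%w. \<zero>)"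
 and one_eq: "\<one>\<^bsub>A\<^esub> = mterm R \<one> \<one>\<^bsub>W\<^esub>" and smult_eq: "r \<odot>\<^bsub>A\<^esub> f = (%w. r \<otimes> f w)"
 and monom_eq: "monom_alg R u = mterm R \<one> u" by (simp_all add: monoid_alg_def mterm_def monom_alg_def)

lemma mterm_closed: "r : carrier R ==> u : carrier W ==> mterm R r u : carrier A"
 by (auto simp: carrier_iff mterm_def)

lemma smult_mterm: "r : carrier R ==> s : carrier R ==> r \<odot>\<^bsub>A\<^esub> mterm R s u = mterm R (r \<otimes> s) u"
 by (auto simp: smult_eq mterm_def)

lemma add_closed: "f : carrier A ==> g : carrier A ==> f \<oplus>\<^bsub>A\<^esub> g : carrier A"
 unfolding carrier_iff add_eq by (auto intro: finite_subset[of _ "{w. f w ~= \<zero>} Un {w. g w ~= \<zero>}"])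

lemma zero_closed: "\<zero>\<^bsub>A\<^esub> : carrier A" by (simp add: carrier_iff zero_eq)

text \<open>One point is peeled off the finite support at a time. With the distributive laws this
  reduces associativity, the unit laws and multiplicativity of \<open>ev\<close> to single
  terms.\<close>

lemma induct [consumes 1, case_names zero mterm add]:
 assumes f: "f : carrier A" and z: "P \<zero>\<^bsub>A\<^esub>"
  and m: "!!r u. r : carrier R ==> u : carrier W ==> P (mterm R r u)"
  and a: "!!f g. f : carrier A ==> g : carrier A ==> P f ==> P g ==> P (f \<oplus>\<^bsub>A\<^esub> g)"
 shows "P f"
proof -
 have "P f" if "finite F" "f : carrier A" "{w. f w ~= \<zero>} = F" for F f using that
 proof (induction F arbitrary: f rule: finite_induct)
  case empty
  hence "f = \<zero>\<^bsub>A\<^esub>" by (auto simp: zero_eq)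
  thus ?case using z by simp
 next
  case (insert x F)
  let ?g = "%w. if w = x then \<zero> else f w"
  have gs: "{w. ?g w ~= \<zero>} = F" using insert by auto
  have g: "?g : carrier A" using insert.prems(1) gs insert.hyps(1) by (auto simp: carrier_iff)
  have x: "x : carrier W" "f x : carrier R" using insert.prems by (auto simp: carrier_iff)
  have "f = mterm R (f x) x \<oplus>\<^bsub>A\<^esub> ?g" using insert.prems(1) by (auto simp: add_eq mterm_def carrier_iff)
  thus ?case using a[OF mterm_closed[OF x(2,1)] g m[OF x(2,1)] insert.IH[OF g gs]] by simp
 qed
 thus ?thesis using f by (auto simp: carrier_iff)
qed

text \<open>The product sums over the exact supports, which change under addition. Larger finite
  sets \<open>F\<close> and \<open>G\<close> may replace them because the extra summands vanish, so
  both sides of a distributive law get one common index set.\<close>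

lemma mult_eq:
 assumes f: "f : carrier A" and g: "g : carrier A" and F: "finite F" "{w. f w ~= \<zero>} <= F"
  and G: "finite G" "{w. g w ~= \<zero>} <= G"
 shows "(f \<otimes>\<^bsub>A\<^esub> g) w = (\<Oplus>p\<in>{p : F \<times> G. fst p \<otimes>\<^bsub>W\<^esub> snd p = w}. f (fst p) \<otimes> g (snd p))"
proof -
 have c: "f u : carrier R" "g u : carrier R" for u using f g by (auto simp: carrier_iff)
 have "(f \<otimes>\<^bsub>A\<^esub> g) w = (\<Oplus>p\<in>{(u, v). f u ~= \<zero> & g v ~= \<zero> & u \<otimes>\<^bsub>W\<^esub> v = w}. f (fst p) \<otimes> g (snd p))"
  by (simp add: monoid_alg_def)
 also have "... = (\<Oplus>p\<in>{p : F \<times> G. fst p \<otimes>\<^bsub>W\<^esub> snd p = w}. f (fst p) \<otimes> g (snd p))"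
  by (rule R.add.finprod_mono_neutral_cong_left) (use F G c in auto)
 finally show ?thesis .
qed

lemma mult_closed:
 assumes f: "f : carrier A" and g: "g : carrier A" shows "f \<otimes>\<^bsub>A\<^esub> g : carrier A"
proof -
 let ?F = "{w. f w ~= \<zero>}" and ?G = "{w. g w ~= \<zero>}"
 have c: "f u : carrier R" "g u : carrier R" for u using f g by (auto simp: carrier_iff)
 have fin: "finite ?F" "finite ?G" and W: "?F <= carrier W" "?G <= carrier W" using f g by (auto simp: carrier_iff)
 note e = mult_eq[OF f g fin(1) order_refl fin(2) order_refl]
 have z: "(f \<otimes>\<^bsub>A\<^esub> g) w = \<zero>" if "w ~: (%(u, v). u \<otimes>\<^bsub>W\<^esub> v) ` (?F \<times> ?G)" for w
 proof -
  have "{p : ?F \<times> ?G. fst p \<otimes>\<^bsub>W\<^esub> snd p = w} = {}" using that by force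
  thus ?thesis unfolding e by (simp only: R.finsum_empty)
 qed
 have "{w. (f \<otimes>\<^bsub>A\<^esub> g) w ~= \<zero>} <= (%(u, v). u \<otimes>\<^bsub>W\<^esub> v) ` (?F \<times> ?G)"
  using z by blast
 hence "finite {w. (f \<otimes>\<^bsub>A\<^esub> g) w ~= \<zero>}" using fin finite_subset by blast
 moreover have "(f \<otimes>\<^bsub>A\<^esub> g) w : carrier R" for w unfolding e using c by (intro R.finsum_closed) auto
 moreover have "(f \<otimes>\<^bsub>A\<^esub> g) w = \<zero>" if "w ~: carrier W" for w using that W by (intro z) (auto dest!: subsetD)
 ultimately show ?thesis by (auto simp: carrier_iff)
qed

lemma distr:
 assumes f: "f : carrier A" and g: "g : carrier A" and h: "h : carrier A"
 shows "(f \<oplus>\<^bsub>A\<^esub> g) \<otimes>\<^bsub>A\<^esub> h = f \<otimes>\<^bsub>A\<^esub> h \<oplus>\<^bsub>A\<^esub> g \<otimes>\<^bsub>A\<^esub> h"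
  and "h \<otimes>\<^bsub>A\<^esub> (f \<oplus>\<^bsub>A\<^esub> g) = h \<otimes>\<^bsub>A\<^esub> f \<oplus>\<^bsub>A\<^esub> h \<otimes>\<^bsub>A\<^esub> g"
proof -
 let ?F = "{w. f w ~= \<zero>} Un {w. g w ~= \<zero>}" and ?H = "{w. h w ~= \<zero>}"
 have c: "f u : carrier R" "g u : carrier R" "h u : carrier R" for u using f g h by (auto simp: carrier_iff)
 have fin: "finite ?F" "finite ?H" using f g h by (auto simp: carrier_iff)
 have sub: "{w. (f \<oplus>\<^bsub>A\<^esub> g) w ~= \<zero>} <= ?F" by (auto simp: add_eq)
 note fg = add_closed[OF f g]
 have 1: "((f \<oplus>\<^bsub>A\<^esub> g) \<otimes>\<^bsub>A\<^esub> h) w = (f \<otimes>\<^bsub>A\<^esub> h \<oplus>\<^bsub>A\<^esub> g \<otimes>\<^bsub>A\<^esub> h) w" for w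
  unfolding mult_eq[OF fg h fin(1) sub fin(2) order_refl] add_eq[of "f \<otimes>\<^bsub>A\<^esub> h"]
   mult_eq[OF f h fin(1) Un_upper1 fin(2) order_refl] mult_eq[OF g h fin(1) Un_upper2 fin(2) order_refl]
  by (subst R.finsum_addf[symmetric]) (auto simp: c add_eq R.l_distr intro!: R.finsum_cong')
 have 2: "(h \<otimes>\<^bsub>A\<^esub> (f \<oplus>\<^bsub>A\<^esub> g)) w = (h \<otimes>\<^bsub>A\<^esub> f \<oplus>\<^bsub>A\<^esub> h \<otimes>\<^bsub>A\<^esub> g) w" for w
  unfolding mult_eq[OF h fg fin(2) order_refl fin(1) sub] add_eq[of "h \<otimes>\<^bsub>A\<^esub> f"]
   mult_eq[OF h f fin(2) order_refl fin(1) Un_upper1] mult_eq[OF h g fin(2) order_refl fin(1) Un_upper2]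
  by (subst R.finsum_addf[symmetric]) (auto simp: c add_eq R.r_distr intro!: R.finsum_cong')
 show "(f \<oplus>\<^bsub>A\<^esub> g) \<otimes>\<^bsub>A\<^esub> h = f \<otimes>\<^bsub>A\<^esub> h \<oplus>\<^bsub>A\<^esub> g \<otimes>\<^bsub>A\<^esub> h"
  and "h \<otimes>\<^bsub>A\<^esub> (f \<oplus>\<^bsub>A\<^esub> g) = h \<otimes>\<^bsub>A\<^esub> f \<oplus>\<^bsub>A\<^esub> h \<otimes>\<^bsub>A\<^esub> g"
  using 1 2 by auto
qed

lemma mult_zero:
 assumes "f : carrier A"
 shows "\<zero>\<^bsub>A\<^esub> \<otimes>\<^bsub>A\<^esub> f = \<zero>\<^bsub>A\<^esub>" "f \<otimes>\<^bsub>A\<^esub> \<zero>\<^bsub>A\<^esub> = \<zero>\<^bsub>A\<^esub>"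
 by (simp_all add: monoid_alg_def)

lemma mult_mterm:
 assumes r: "r : carrier R" "u : carrier W" and s: "s : carrier R" "v : carrier W"
 shows "mterm R r u \<otimes>\<^bsub>A\<^esub> mterm R s v = mterm R (r \<otimes> s) (u \<otimes>\<^bsub>W\<^esub> v)"
proof
 fix w
 have "(mterm R r u \<otimes>\<^bsub>A\<^esub> mterm R s v) w = (\<Oplus>p\<in>{p : {u} \<times> {v}. fst p \<otimes>\<^bsub>W\<^esub> snd p = w}.
   mterm R r u (fst p) \<otimes> mterm R s v (snd p))" using r s by (intro mult_eq mterm_closed) (auto simp: mterm_def)
 also have "{p : {u} \<times> {v}. fst p \<otimes>\<^bsub>W\<^esub> snd p = w} = (if u \<otimes>\<^bsub>W\<^esub> v = w then {(u, v)} else {})" by auto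
 also have "(\<Oplus>p\<in>.... mterm R r u (fst p) \<otimes> mterm R s v (snd p)) = mterm R (r \<otimes> s) (u \<otimes>\<^bsub>W\<^esub> v) w"
  using r s by (auto simp: mterm_def R.add.finprod_insert)
 finally show "(mterm R r u \<otimes>\<^bsub>A\<^esub> mterm R s v) w = mterm R (r \<otimes> s) (u \<otimes>\<^bsub>W\<^esub> v) w" .
qed

lemma ring: "ring A"
proof (rule ringI)
 show "abelian_group A"
 proof (rule abelian_groupI)
  fix f assume f: "f : carrier A"
  have "(%w. \<ominus> f w) : carrier A" using f by (auto simp: carrier_iff intro: finite_subset[of _ "{w. f w ~= \<zero>}"])
  thus "EX g:carrier A. g \<oplus>\<^bsub>A\<^esub> f = \<zero>\<^bsub>A\<^esub>" using f
   by (intro bexI[of _ "%w. \<ominus> f w"]) (auto simp: add_eq zero_eq carrier_iff R.l_neg)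
 qed (auto simp: add_closed zero_closed, auto simp: add_eq zero_eq carrier_iff R.a_ac)
 \<comment> \<open>Both sides are additive in each of the three arguments, so three nested
   inductions leave only terms, where the claim is associativity in \<open>R\<close> and in
   \<open>W\<close>.\<close>
 have assoc: "(x \<otimes>\<^bsub>A\<^esub> y) \<otimes>\<^bsub>A\<^esub> z = x \<otimes>\<^bsub>A\<^esub> (y \<otimes>\<^bsub>A\<^esub> z)"
  if x: "x : carrier A" and y: "y : carrier A" and z: "z : carrier A" for x y z using x
 proof (induction x rule: induct)
  case (mterm r u) note x = mterm
  from y show ?case
  proof (induction y rule: induct)
   case (mterm s v) note y = mterm
   from z show ?case
   proof (induction z rule: induct)
    case (mterm t w)
    thus ?case using x y by (simp add: mult_mterm R.m_assoc W.m_assoc)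
   qed (use x y in \<open>auto simp: distr mult_zero mult_closed mterm_closed\<close>)
  qed (use x z in \<open>auto simp: distr mult_zero mult_closed mterm_closed\<close>)
 qed (use y z in \<open>auto simp: distr mult_zero mult_closed mterm_closed\<close>)
 have one: "\<one>\<^bsub>A\<^esub> \<otimes>\<^bsub>A\<^esub> x = x" "x \<otimes>\<^bsub>A\<^esub> \<one>\<^bsub>A\<^esub> = x" if x: "x : carrier A" for x
  using x by (induction x rule: induct)
   (auto simp: one_eq distr mult_zero mult_closed mterm_closed mult_mterm)
 show "Group.monoid A" by (rule Group.monoidI) (simp_all add: one[unfolded one_eq] assoc mult_closed one_eq mterm_closed)
qed (auto simp: distr)

end

section \<open>Algebras over a commutative ring\<close>

text \<open>An algebra is encoded by its structure map r -> r 1, a ring homomorphism with central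
  image; the module axioms then follow from the ring axioms (\<open>assoc_algD\<close>).\<close>

definition assoc_alg :: "('r, 'y) ring_scheme => ('r, 'x) module => bool" where
 "assoc_alg R A \<longleftrightarrow> cring R & ring A & (%r. r \<odot>\<^bsub>A\<^esub> \<one>\<^bsub>A\<^esub>) : ring_hom R A
  & (ALL r:carrier R. ALL a:carrier A. r \<odot>\<^bsub>A\<^esub> a = (r \<odot>\<^bsub>A\<^esub> \<one>\<^bsub>A\<^esub>) \<otimes>\<^bsub>A\<^esub> a
     & a \<otimes>\<^bsub>A\<^esub> (r \<odot>\<^bsub>A\<^esub> \<one>\<^bsub>A\<^esub>) = (r \<odot>\<^bsub>A\<^esub> \<one>\<^bsub>A\<^esub>) \<otimes>\<^bsub>A\<^esub> a)"

text \<open>Semilinear along \<open>h\<close>, so that one notion covers projections and lifts over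
  a fixed ring (\<open>id\<close>), restriction maps (\<open>cut V\<close>) and values at a point
  (evaluation to the reals).\<close>

definition alg_hom :: "('r => 's) => ('r, 'y) ring_scheme => ('r, 'x) module => ('s, 'u) module
  => ('x => 'u) => bool" where
 "alg_hom h R A B T \<longleftrightarrow> T : ring_hom A B
  & (ALL r:carrier R. T (r \<odot>\<^bsub>A\<^esub> \<one>\<^bsub>A\<^esub>) = h r \<odot>\<^bsub>B\<^esub> \<one>\<^bsub>B\<^esub>)"

lemma assoc_algD: fixes A (structure)
 assumes "assoc_alg R A" shows "cring R" "ring A"
  and "r : carrier R ==> a : carrier A ==> r \<odot> a : carrier A"
  and "r : carrier R ==> a : carrier A ==> (r \<odot> \<one>) \<otimes> a = r \<odot> a"
  and "r : carrier R ==> a : carrier A ==> b : carrier A ==> (r \<odot> a) \<otimes> b = r \<odot> (a \<otimes> b)"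
  and "r : carrier R ==> a : carrier A ==> b : carrier A ==> a \<otimes> (r \<odot> b) = r \<odot> (a \<otimes> b)"
  and "r : carrier R ==> a : carrier A ==> b : carrier A ==> r \<odot> (a \<oplus> b) = r \<odot> a \<oplus> r \<odot> b"
  and "r : carrier R ==> s : carrier R ==> a : carrier A ==>
   (r \<oplus>\<^bsub>R\<^esub> s) \<odot> a = r \<odot> a \<oplus> s \<odot> a"
  and "r : carrier R ==> s : carrier R ==> a : carrier A ==>
   (r \<otimes>\<^bsub>R\<^esub> s) \<odot> a = r \<odot> (s \<odot> a)"
  and "a : carrier A ==> \<one>\<^bsub>R\<^esub> \<odot> a = a"
  and "a : carrier A ==> \<zero>\<^bsub>R\<^esub> \<odot> a = \<zero>"
  and "r : carrier R ==> r \<odot> \<zero> = \<zero>"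
proof -
 interpret R: cring R using assms by (simp add: assoc_alg_def)
 interpret A: ring A using assms by (simp add: assoc_alg_def)
 let ?c = "%r. r \<odot> \<one>"
 have h: "?c : ring_hom R A" and e: "!!r a. r : carrier R ==> a : carrier A ==> r \<odot> a = ?c r \<otimes> a"
  and m: "!!r a. r : carrier R ==> a : carrier A ==> a \<otimes> ?c r = ?c r \<otimes> a"
  using assms unfolding assoc_alg_def by blast+
 have c: "r : carrier R ==> ?c r : carrier A" for r using h by (auto dest: ring_hom_closed)
 show "cring R" by (rule R.is_cring)
 show "ring A" by (rule A.ring_axioms)
 show cl: "r \<odot> a : carrier A" if "r : carrier R" "a : carrier A" for r a unfolding e[OF that] using c that by auto
 show "(r \<odot> \<one>) \<otimes> a = r \<odot> a" if "r : carrier R" "a : carrier A" using e[OF that] by (rule sym)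
 show "(r \<odot> a) \<otimes> b = r \<odot> (a \<otimes> b)" if "r : carrier R" "a : carrier A" "b : carrier A"
  using that c by (simp add: e[of _ a] e[of _ "a \<otimes> b"] A.m_assoc)
 show "a \<otimes> (r \<odot> b) = r \<odot> (a \<otimes> b)" if "r : carrier R" "a : carrier A" "b : carrier A"
 proof -
  have "a \<otimes> (r \<odot> b) = (a \<otimes> ?c r) \<otimes> b" using that c by (simp add: e[of _ b] A.m_assoc)
  also have "... = r \<odot> (a \<otimes> b)" using that c by (simp add: m e[of _ "a \<otimes> b"] A.m_assoc)
  finally show ?thesis .
 qed
 show "r \<odot> (a \<oplus> b) = r \<odot> a \<oplus> r \<odot> b" if "r : carrier R" "a : carrier A" "b : carrier A"
  using that c by (simp add: e[of _ a] e[of _ b] e[of _ "a \<oplus> b"] A.r_distr)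
 show "(r \<oplus>\<^bsub>R\<^esub> s) \<odot> a = r \<odot> a \<oplus> s \<odot> a" if "r : carrier R" "s : carrier R" "a : carrier A"
  using that c ring_hom_add[OF h] by (simp add: e[of _ a] A.l_distr)
 show "(r \<otimes>\<^bsub>R\<^esub> s) \<odot> a = r \<odot> (s \<odot> a)" if "r : carrier R" "s : carrier R" "a : carrier A"
  using that c cl ring_hom_mult[OF h] by (simp add: e[of _ a] e[of _ "?c s \<otimes> a"] A.m_assoc)
 show "\<one>\<^bsub>R\<^esub> \<odot> a = a" if "a : carrier A" using that ring_hom_one[OF h] by (simp add: e[of _ a])
 show "\<zero>\<^bsub>R\<^esub> \<odot> a = \<zero>" if "a : carrier A"
  using that ring_hom_zero[OF h R.ring_axioms A.ring_axioms] by (simp add: e[of _ a])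
 show "r \<odot> \<zero> = \<zero>" if "r : carrier R" using that c by (simp add: e[of _ "\<zero>"])
qed

lemma alg_homD: fixes A (structure)
 assumes T: "alg_hom h R A B T" and A: "assoc_alg R A" and B: "assoc_alg S B" and h: "h : ring_hom R S"
 shows "a : carrier A ==> T a : carrier B"
  and "a : carrier A ==> b : carrier A ==> T (a \<oplus> b) = T a \<oplus>\<^bsub>B\<^esub> T b"
  and "a : carrier A ==> b : carrier A ==> T (a \<otimes> b) = T a \<otimes>\<^bsub>B\<^esub> T b"
  and "a : carrier A ==> b : carrier A ==> T (a \<ominus> b) = T a \<ominus>\<^bsub>B\<^esub> T b"
  and "r : carrier R ==> a : carrier A ==> T (r \<odot> a) = h r \<odot>\<^bsub>B\<^esub> T a"
  and "T \<one> = \<one>\<^bsub>B\<^esub>" and "T \<zero> = \<zero>\<^bsub>B\<^esub>"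
proof -
 interpret A: ring A using assoc_algD[OF A] by simp
 interpret B: ring B using assoc_algD[OF B] by simp
 interpret T: ring_hom_ring A B T using T by unfold_locales (simp add: alg_hom_def)
 show "a : carrier A ==> T a : carrier B"
  "a : carrier A ==> b : carrier A ==> T (a \<oplus> b) = T a \<oplus>\<^bsub>B\<^esub> T b"
  "a : carrier A ==> b : carrier A ==> T (a \<otimes> b) = T a \<otimes>\<^bsub>B\<^esub> T b"
  "a : carrier A ==> b : carrier A ==> T (a \<ominus> b) = T a \<ominus>\<^bsub>B\<^esub> T b"
  "T \<one> = \<one>\<^bsub>B\<^esub>" "T \<zero> = \<zero>\<^bsub>B\<^esub>" by (auto simp: A.minus_eq B.minus_eq)
 show "T (r \<odot> a) = h r \<odot>\<^bsub>B\<^esub> T a" if "r : carrier R" "a : carrier A"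
 proof -
  have "T (r \<odot> a) = T ((r \<odot> \<one>) \<otimes> a)" using that assoc_algD(4)[OF A] by simp
  also have "... = (h r \<odot>\<^bsub>B\<^esub> \<one>\<^bsub>B\<^esub>) \<otimes>\<^bsub>B\<^esub> T a"
   using that assoc_algD(3)[OF A] T by (simp add: alg_hom_def)
  also have "... = h r \<odot>\<^bsub>B\<^esub> T a" using that assoc_algD(4)[OF B] h by (simp add: ring_hom_closed)
  finally show ?thesis .
 qed
qed

lemma alg_hom_comp:
 assumes "alg_hom h R A B T" "alg_hom h' S B C T'" "assoc_alg R A" "assoc_alg S B" "assoc_alg S' C"
  "h : ring_hom R S" "h' : ring_hom S S'" shows "alg_hom (h' \<circ> h) R A C (T' \<circ> T)"
proof -
 have "T' \<circ> T : ring_hom A C" using assms by (auto simp: alg_hom_def intro: ring_hom_trans)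
 thus ?thesis using assms by (auto simp: alg_hom_def ring_hom_closed)
qed

text \<open>Generators multiply from the left only. This reaches every word, and an induction meets
  a single new factor at each stage.\<close>

inductive_set alg_span :: "('r, 'y) ring_scheme => ('r, 'x) module => 'x set => 'x set" for R A G where
 one: "\<one>\<^bsub>A\<^esub> : alg_span R A G"
| add: "a : alg_span R A G ==> b : alg_span R A G ==> a \<oplus>\<^bsub>A\<^esub> b : alg_span R A G"
| smult: "r : carrier R ==> a : alg_span R A G ==> r \<odot>\<^bsub>A\<^esub> a : alg_span R A G"
| mult: "g : G ==> a : alg_span R A G ==> g \<otimes>\<^bsub>A\<^esub> a : alg_span R A G"

lemma alg_span_closed:
 assumes A: "assoc_alg R A" and G: "G <= carrier A" and a: "a : alg_span R A G" shows "a : carrier A"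
proof -
 interpret A: ring A using assoc_algD[OF A] by simp
 show ?thesis using a by induction (use G assoc_algD(3)[OF A] in auto)
qed

lemma alg_span_image:
 assumes T: "alg_hom h R A B T" and A: "assoc_alg R A" and B: "assoc_alg S B"
  and h: "h : ring_hom R S" and G: "G <= carrier A" and a: "a : alg_span R A G" shows "T a : alg_span S B (T ` G)"
proof -
 note D = alg_homD[OF T A B h] and cl = alg_span_closed[OF A G]
 show ?thesis using a by induction (use G h in \<open>auto simp: D cl subset_iff ring_hom_closed intro: alg_span.intros\<close>)
qed

lemma alg_hom_unique:
 assumes T: "alg_hom h R A B T" and T': "alg_hom h R A B T'" and A: "assoc_alg R A" and B: "assoc_alg S B"
  and h: "h : ring_hom R S" and G: "G <= carrier A" and a: "a : alg_span R A G"
  and eq: "!!g. g : G ==> T g = T' g" shows "T a = T' a"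
proof -
 note D = alg_homD[OF T A B h] alg_homD[OF T' A B h] and cl = alg_span_closed[OF A G]
 show ?thesis using a by induction (use G h in \<open>auto simp: D cl subset_iff eq\<close>)
qed

lemma (in monoid_algebra) assoc_alg: "assoc_alg R A"
proof -
 interpret A: ring A by (rule ring)
 have c: "r \<odot>\<^bsub>A\<^esub> \<one>\<^bsub>A\<^esub> = mterm R r \<one>\<^bsub>W\<^esub>" if "r : carrier R" for r
  using that by (simp add: one_eq smult_mterm)
 have 1: "r \<odot>\<^bsub>A\<^esub> f = mterm R r \<one>\<^bsub>W\<^esub> \<otimes>\<^bsub>A\<^esub> f & f \<otimes>\<^bsub>A\<^esub> mterm R r \<one>\<^bsub>W\<^esub> = r \<odot>\<^bsub>A\<^esub> f"
  if r: "r : carrier R" and f: "f : carrier A" for r f using f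
 proof (induction f rule: induct)
  case zero
  thus ?case using r by (simp add: mult_zero mterm_closed) (simp add: smult_eq zero_eq)
 next
  case (mterm s u)
  thus ?case using r by (simp add: smult_mterm mult_mterm R.m_comm)
 next
  case (add f g)
  have "r \<odot>\<^bsub>A\<^esub> (f \<oplus>\<^bsub>A\<^esub> g) = r \<odot>\<^bsub>A\<^esub> f \<oplus>\<^bsub>A\<^esub> r \<odot>\<^bsub>A\<^esub> g"
   using add(1,2) r by (auto simp: smult_eq add_eq carrier_iff R.r_distr)
  thus ?case using add r by (simp only: mterm_closed distr R.one_closed W.one_closed)
 qed
 have "(%r. r \<odot>\<^bsub>A\<^esub> \<one>\<^bsub>A\<^esub>) : ring_hom R A"
 proof (rule ring_hom_memI, goal_cases)
  case (3 r s)
  hence "r \<oplus> s : carrier R" by simp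
  with 3 show ?case by (simp only: c) (auto simp: mterm_def add_eq)
 next
  case 4
  show ?case unfolding c[OF R.one_closed] by (simp only: one_eq)
 qed (simp_all add: c mterm_closed mult_mterm del: one_eq)
 thus ?thesis unfolding assoc_alg_def using 1 c ring R.is_cring by auto
qed

section \<open>Quotients by generated ideals\<close>

text \<open>\<open>quot_alg\<close> extends the quotient ring to a module record, so its type
  differs from that of \<open>A Quot I\<close>; the ring axioms are transported field by
  field.\<close>

lemma ring_cong:
 assumes "ring S" "carrier T = carrier S" "add T = add S" "mult T = mult S" "one T = one S" "zero T = zero S" shows "ring T"
proof -
 interpret S: ring S by fact
 show ?thesis
 proof (rule ringI)
  show "abelian_group T"
  proof (rule abelian_groupI)
   fix x assume "x : carrier T"
   thus "EX y:carrier T. y \<oplus>\<^bsub>T\<^esub> x = \<zero>\<^bsub>T\<^esub>"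
    by (intro bexI[of _ "\<ominus>\<^bsub>S\<^esub> x"]) (simp_all add: assms(2-) S.l_neg)
  qed (simp_all add: assms(2-) S.a_ac)
  show "Group.monoid T" by (rule Group.monoidI) (simp_all add: assms(2-) S.m_assoc)
 qed (simp_all add: assms(2-) S.l_distr S.r_distr)
qed

lemma quot_alg_simps: fixes A (structure) shows
 "carrier (quot_alg A I) = a_rcosets I" "add (quot_alg A I) = set_add A"
 "mult (quot_alg A I) = rcoset_mult A I" "\<one>\<^bsub>quot_alg A I\<^esub> = I +> \<one>" "\<zero>\<^bsub>quot_alg A I\<^esub> = I"
 "r \<odot>\<^bsub>quot_alg A I\<^esub> C = (\<Union>c\<in>C. I +> (r \<odot> c))" by (simp_all add: quot_alg_def ring.defs module.defs FactRing_def)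

lemma quot_alg_ops: fixes A (structure)
 assumes A: "assoc_alg R A" and I: "ideal I A" shows "carrier (quot_alg A I) = (+>) I ` carrier A"
  and "a : carrier A ==> b : carrier A ==>
   (I +> a) \<oplus>\<^bsub>quot_alg A I\<^esub> (I +> b) = I +> (a \<oplus> b)"
  and "a : carrier A ==> b : carrier A ==>
   (I +> a) \<otimes>\<^bsub>quot_alg A I\<^esub> (I +> b) = I +> (a \<otimes> b)"
  and "r : carrier R ==> a : carrier A ==>
   r \<odot>\<^bsub>quot_alg A I\<^esub> (I +> a) = I +> (r \<odot> a)"
proof -
 interpret I: ideal I A by fact
 show "carrier (quot_alg A I) = (+>) I ` carrier A" by (auto simp: quot_alg_simps A_RCOSETS_def RCOSETS_def a_r_coset_def)
 show "a : carrier A ==> b : carrier A ==>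
   (I +> a) \<oplus>\<^bsub>quot_alg A I\<^esub> (I +> b) = I +> (a \<oplus> b)" by (simp add: quot_alg_simps I.a_rcos_sum)
 show m: "a : carrier A ==> b : carrier A ==>
   (I +> a) \<otimes>\<^bsub>quot_alg A I\<^esub> (I +> b) = I +> (a \<otimes> b)" for a b by (simp add: quot_alg_simps I.rcoset_mult_add)
 show "r \<odot>\<^bsub>quot_alg A I\<^esub> (I +> a) = I +> (r \<odot> a)" if r: "r : carrier R" and a: "a : carrier A"
 proof -
  have "I +> (r \<odot> c) = I +> (r \<odot> a)" if c: "c : I +> a" for c
  proof -
   have ca: "c : carrier A" using I.a_elemrcos_carrier[OF a c] .
   have eq: "I +> c = I +> a" using I.a_repr_independence'[OF c a] by simp
   have r1: "r \<odot> \<one> : carrier A" using assoc_algD(3)[OF A r] by simp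
   have "I +> ((r \<odot> \<one>) \<otimes> c) = I +> ((r \<odot> \<one>) \<otimes> a)"
    unfolding m[OF r1 ca, symmetric] m[OF r1 a, symmetric] eq ..
   thus ?thesis using assoc_algD(4)[OF A r] a ca by simp
  qed
  moreover have "a : I +> a" using a by (rule I.a_rcos_self)
  ultimately show ?thesis unfolding quot_alg_simps by blast
 qed
qed

lemma quot_assoc_alg: fixes A (structure)
 assumes A: "assoc_alg R A" and I: "ideal I A" shows "assoc_alg R (quot_alg A I)" and "alg_hom id R A (quot_alg A I) ((+>) I)"
proof -
 interpret I: ideal I A by fact
 interpret R: cring R using assoc_algD[OF A] by simp
 note o = quot_alg_ops[OF A I] and D = assoc_algD[OF A]
 have one: "\<one>\<^bsub>quot_alg A I\<^esub> = I +> \<one>" by (simp add: quot_alg_simps)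
 have r: "ring (quot_alg A I)" by (rule ring_cong[OF I.quotient_is_ring]) (simp_all add: quot_alg_simps FactRing_def)
 have h: "(%r. r \<odot>\<^bsub>quot_alg A I\<^esub> \<one>\<^bsub>quot_alg A I\<^esub>) : ring_hom R (quot_alg A I)"
  by (rule ring_hom_memI) (auto simp: one o D(3-5,7-10))
 show "assoc_alg R (quot_alg A I)" unfolding assoc_alg_def using r h R.is_cring by (auto simp: one o D(3-6))
 show "alg_hom id R A (quot_alg A I) ((+>) I)" unfolding alg_hom_def using D(3) by (auto simp: one o intro!: ring_hom_memI)
qed

text \<open>\<open>T\<close> is constant on cosets as soon as its kernel contains the ideal; the
  common value is then the only element of the image.\<close>

definition quot_lift :: "('x => 'u) => 'x set => 'u" where
 "quot_lift T C = the_elem (T ` C)"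

text \<open>The kernel is an ideal, so it contains the ideal generated by \<open>S\<close> once it
  contains \<open>S\<close>.\<close>

lemma quot_lift_eq: fixes A (structure)
 assumes T: "alg_hom h R A B T" and A: "assoc_alg R A" and B: "assoc_alg R' B" and h: "h : ring_hom R R'"
  and S: "S <= carrier A" and z: "!!s. s : S ==> T s = \<zero>\<^bsub>B\<^esub>" and a: "a : carrier A"
 shows "T ` (genideal A S +> a) = {T a}" and "quot_lift T (genideal A S +> a) = T a"
proof -
 interpret A: ring A using assoc_algD[OF A] by simp
 interpret B: ring B using assoc_algD[OF B] by simp
 have T': "T : ring_hom A B" using T by (simp add: alg_hom_def)
 have hr: "ring_hom_ring A B T" by (rule ring_hom_ringI2[OF A.ring_axioms B.ring_axioms T'])
 interpret I: ideal "genideal A S" A using S by (rule A.genideal_ideal)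
 have Sk: "S <= a_kernel A B T" using S by (auto simp: a_kernel_def' z)
 have "genideal A S <= a_kernel A B T" by (rule A.genideal_minimal[OF ring_hom_ring.kernel_is_ideal[OF hr] Sk])
 hence k: "T i = \<zero>\<^bsub>B\<^esub>" if "i : genideal A S" for i using that by (auto simp: a_kernel_def')
 have "T c = T a" if "c : genideal A S +> a" for c
  using that a k I.a_Hcarr ring_hom_closed[OF T'] by (auto simp: a_r_coset_def' ring_hom_add[OF T'])
 moreover have "a : genideal A S +> a" using a by (rule I.a_rcos_self)
 ultimately show 1: "T ` (genideal A S +> a) = {T a}" by blast
 show "quot_lift T (genideal A S +> a) = T a" unfolding quot_lift_def 1 by simp
qed

lemma quot_lift_hom:
 assumes T: "alg_hom h R A B T" and A: "assoc_alg R A" and B: "assoc_alg R' B" and h: "h : ring_hom R R'"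
  and S: "S <= carrier A" and z: "!!s. s : S ==> T s = \<zero>\<^bsub>B\<^esub>"
 shows "alg_hom h R (quot_alg A (genideal A S)) B (quot_lift T)"
proof -
 interpret A: ring A using assoc_algD[OF A] by simp
 have I: "ideal (genideal A S) A" using S by (rule A.genideal_ideal)
 note e = quot_lift_eq(2)[OF T A B h S z] and o = quot_alg_ops[OF A I] and D = alg_homD[OF T A B h]
 have one: "\<one>\<^bsub>quot_alg A (genideal A S)\<^esub> = genideal A S +>\<^bsub>A\<^esub> \<one>\<^bsub>A\<^esub>" by (simp add: quot_alg_simps)
 show ?thesis unfolding alg_hom_def by (auto simp: one o e D assoc_algD(3)[OF A] intro!: ring_hom_memI)
qed

section \<open>Universal properties\<close>

lemma alg_hom_cong:
 assumes T: "alg_hom h R A B T" and A: "assoc_alg R A" and e: "!!a. a : carrier A ==> T' a = T a" shows "alg_hom h R A B T'"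
proof -
 interpret A: ring A using assoc_algD[OF A] by simp
 show ?thesis using T assoc_algD(3)[OF A] by (auto simp: alg_hom_def e ring_hom_def Pi_iff)
qed

text \<open>Only carriers, addition and scalars occur, because \<open>sections\<close> and
  \<open>gauge\<close> carry no meaningful ring multiplication.\<close>

definition lin_map :: "('r => 's) => ('r, 'y) ring_scheme => ('r, 'x) module => ('s, 'u) module
  => ('x => 'u) => bool" where
 "lin_map h R M B k \<longleftrightarrow> (ALL m:carrier M. k m : carrier B)
  & (ALL m:carrier M. ALL n:carrier M. k (m \<oplus>\<^bsub>M\<^esub> n) = k m \<oplus>\<^bsub>B\<^esub> k n)
  & (ALL r:carrier R. ALL m:carrier M. k (r \<odot>\<^bsub>M\<^esub> m) = h r \<odot>\<^bsub>B\<^esub> k m)"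

lemma lin_map_comp:
 assumes "lin_map h R M A k" "alg_hom h' S A B T" "assoc_alg S A" "assoc_alg S' B"
  "h : ring_hom R S" "h' : ring_hom S S'" shows "lin_map (h' \<circ> h) R M B (T \<circ> k)"
 using assms(1) alg_homD[OF assms(2-4,6)] assms(5) by (auto simp: lin_map_def ring_hom_closed)

context monoid_algebra
begin

text \<open>Evaluation of a formal combination along a monoid map \<open>ph\<close>. This is the
  universal property of the monoid algebra, from which those of the tensor algebra and of the tensor
  product are derived.\<close>

definition ev :: "('r => 's) => ('s, 'u) module => ('w => 'u) => ('w => 'r) => 'u" where
 "ev h B ph f = (\<Oplus>\<^bsub>B\<^esub>w\<in>{w. f w ~= \<zero>}. h (f w) \<odot>\<^bsub>B\<^esub> ph w)"

lemma ev_superset: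
 assumes B: "assoc_alg S B" and h: "h : ring_hom R S" and p: "!!w. w : carrier W ==> ph w : carrier B"
  and f: "f : carrier A" and F: "finite F" "{w. f w ~= \<zero>} <= F" "F <= carrier W"
 shows "ev h B ph f = (\<Oplus>\<^bsub>B\<^esub>w\<in>F. h (f w) \<odot>\<^bsub>B\<^esub> ph w)"
proof -
 note D = assoc_algD[OF B]
 interpret S: cring S using D by simp
 interpret B: ring B using D by simp
 have "h \<zero> = \<zero>\<^bsub>S\<^esub>" by (rule ring_hom_zero[OF h R.ring_axioms S.ring_axioms])
 moreover have "f w : carrier R" for w using f by (simp add: carrier_iff)
 ultimately show ?thesis unfolding ev_def
  by (intro B.add.finprod_mono_neutral_cong_left) (use F p h in \<open>auto simp: D ring_hom_closed subset_iff\<close>)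
qed

lemma ev_mterm:
 assumes B: "assoc_alg S B" and h: "h : ring_hom R S" and p: "!!w. w : carrier W ==> ph w : carrier B"
  and r: "r : carrier R" and u: "u : carrier W" shows "ev h B ph (mterm R r u) = h r \<odot>\<^bsub>B\<^esub> ph u"
proof -
 note D = assoc_algD[OF B]
 interpret B: ring B using D by simp
 have "ev h B ph (mterm R r u) = (\<Oplus>\<^bsub>B\<^esub>w\<in>{u}. h (mterm R r u w) \<odot>\<^bsub>B\<^esub> ph w)"
  by (rule ev_superset[OF B h p mterm_closed[OF r u]]) (auto simp: mterm_def u)
 thus ?thesis using r u p h by (simp add: mterm_def D ring_hom_closed)
qed

lemma ev_hom:
 assumes B: "assoc_alg S B" and h: "h : ring_hom R S" and p: "!!w. w : carrier W ==> ph w : carrier B"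
  and p1: "ph \<one>\<^bsub>W\<^esub> = \<one>\<^bsub>B\<^esub>"
  and pm: "!!u v. u : carrier W ==> v : carrier W ==> ph (u \<otimes>\<^bsub>W\<^esub> v) = ph u \<otimes>\<^bsub>B\<^esub> ph v"
 shows "alg_hom h R A B (ev h B ph)"
proof -
 note D = assoc_algD[OF B]
 interpret S: cring S using D by simp
 interpret B: ring B using D by simp
 have sup: "!!f F. f : carrier A ==> finite F ==> {w. f w ~= \<zero>} <= F ==> F <= carrier W ==>
   ev h B ph f = (\<Oplus>\<^bsub>B\<^esub>w\<in>F. h (f w) \<odot>\<^bsub>B\<^esub> ph w)" by (rule ev_superset[OF B h p])
 have ter: "!!r u. r : carrier R ==> u : carrier W ==> ev h B ph (mterm R r u) = h r \<odot>\<^bsub>B\<^esub> ph u"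
  by (rule ev_mterm[OF B h p])
 note hc = ring_hom_closed[OF h] and hm = ring_hom_mult[OF h]
 have z: "ev h B ph \<zero>\<^bsub>A\<^esub> = \<zero>\<^bsub>B\<^esub>" by (simp add: ev_def zero_eq)
 have cl: "ev h B ph f : carrier B" if "f : carrier A" for f
  unfolding ev_def using that by (intro B.finsum_closed) (auto simp: carrier_iff intro!: D(3) p hc)
 have ad: "ev h B ph (f \<oplus>\<^bsub>A\<^esub> g) = ev h B ph f \<oplus>\<^bsub>B\<^esub> ev h B ph g" if f: "f : carrier A" and g: "g : carrier A" for f g
 proof -
  let ?F = "{w. f w ~= \<zero>} Un {w. g w ~= \<zero>}"
  have F: "finite ?F" "?F <= carrier W" and c: "!!w. f w : carrier R" "!!w. g w : carrier R"
   using f g by (auto simp: carrier_iff)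
  have s: "{w. (f \<oplus>\<^bsub>A\<^esub> g) w ~= \<zero>} <= ?F" by (auto simp: add_eq)
  show ?thesis unfolding sup[OF add_closed[OF f g] F(1) s F(2)] sup[OF f F(1) Un_upper1 F(2)] sup[OF g F(1) Un_upper2 F(2)]
  proof -
   have c': "w : ?F ==> h (f w) \<odot>\<^bsub>B\<^esub> ph w : carrier B" "w : ?F ==> h (g w) \<odot>\<^bsub>B\<^esub> ph w : carrier B" for w
    using F(2) c p hc by (auto intro!: D(3))
   have "(\<Oplus>\<^bsub>B\<^esub>w\<in>?F. h ((f \<oplus>\<^bsub>A\<^esub> g) w) \<odot>\<^bsub>B\<^esub> ph w) = (\<Oplus>\<^bsub>B\<^esub>w\<in>?F. h (f w) \<odot>\<^bsub>B\<^esub> ph w \<oplus>\<^bsub>B\<^esub> h (g w) \<odot>\<^bsub>B\<^esub> ph w)"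
   proof (rule B.finsum_cong'[OF refl])
    fix w assume w: "w : ?F"
    hence "w : carrier W" using F(2) by auto
    thus "h ((f \<oplus>\<^bsub>A\<^esub> g) w) \<odot>\<^bsub>B\<^esub> ph w = h (f w) \<odot>\<^bsub>B\<^esub> ph w \<oplus>\<^bsub>B\<^esub> h (g w) \<odot>\<^bsub>B\<^esub> ph w"
     using c p hc by (simp add: add_eq ring_hom_add[OF h] D(8))
   qed (use c' in auto)
   also have "... = (\<Oplus>\<^bsub>B\<^esub>w\<in>?F. h (f w) \<odot>\<^bsub>B\<^esub> ph w) \<oplus>\<^bsub>B\<^esub> (\<Oplus>\<^bsub>B\<^esub>w\<in>?F. h (g w) \<odot>\<^bsub>B\<^esub> ph w)"
    by (rule B.finsum_addf) (use c' in auto)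
   finally show "(\<Oplus>\<^bsub>B\<^esub>w\<in>?F. h ((f \<oplus>\<^bsub>A\<^esub> g) w) \<odot>\<^bsub>B\<^esub> ph w) = (\<Oplus>\<^bsub>B\<^esub>w\<in>?F. h (f w) \<odot>\<^bsub>B\<^esub> ph w) \<oplus>\<^bsub>B\<^esub> (\<Oplus>\<^bsub>B\<^esub>w\<in>?F. h (g w) \<odot>\<^bsub>B\<^esub> ph w)" .
  qed
 qed
 have mu: "ev h B ph (f \<otimes>\<^bsub>A\<^esub> g) = ev h B ph f \<otimes>\<^bsub>B\<^esub> ev h B ph g" if f: "f : carrier A" and g: "g : carrier A" for f g
  using f
 proof (induction f rule: induct)
  case (mterm r u) note x = mterm
  from g show ?case
  proof (induction g rule: induct)
   case (mterm s v)
   have "h r \<odot>\<^bsub>B\<^esub> ph u \<otimes>\<^bsub>B\<^esub> (h s \<odot>\<^bsub>B\<^esub> ph v) = (h r \<otimes>\<^bsub>S\<^esub> h s) \<odot>\<^bsub>B\<^esub> (ph u \<otimes>\<^bsub>B\<^esub> ph v)"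
    using mterm x hc p by (subst S.m_comm) (simp_all add: D(3,5,6,9))
   thus ?case using mterm x by (simp add: mult_mterm ter hm pm)
  qed (use x in \<open>simp_all add: mult_zero distr z ad cl B.r_distr mterm_closed mult_closed\<close>)
 qed (use g in \<open>simp_all add: mult_zero distr z ad cl B.l_distr mult_closed\<close>)
 have o: "ev h B ph \<one>\<^bsub>A\<^esub> = \<one>\<^bsub>B\<^esub>" unfolding one_eq using p1 p by (simp add: ter ring_hom_one[OF h] D)
 have sm: "ev h B ph (r \<odot>\<^bsub>A\<^esub> \<one>\<^bsub>A\<^esub>) = h r \<odot>\<^bsub>B\<^esub> \<one>\<^bsub>B\<^esub>" if "r : carrier R" for r
  unfolding one_eq using that p1 p by (simp add: smult_mterm ter)
 show ?thesis unfolding alg_hom_def using cl ad mu o sm by (auto intro!: ring_hom_memI)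
qed

lemma finsum_apply:
 assumes "finite F" and "!!i. i : F ==> g i : carrier A"
 shows "(\<Oplus>\<^bsub>A\<^esub>i\<in>F. g i) u = (\<Oplus>i\<in>F. g i u)"
proof -
 interpret A: ring A by (rule ring)
 have c: "f : carrier A ==> f u : carrier R" for f by (simp add: carrier_iff)
 show ?thesis using assms
 proof (induction F rule: finite_induct)
  case empty
  thus ?case by (simp add: zero_eq)
 next
  case (insert x F)
  hence "(\<Oplus>\<^bsub>A\<^esub>i\<in>insert x F. g i) = g x \<oplus>\<^bsub>A\<^esub> (\<Oplus>\<^bsub>A\<^esub>i\<in>F. g i)"
   by (intro A.finsum_insert) auto
  moreover have "(\<Oplus>i\<in>insert x F. g i u) = g x u \<oplus> (\<Oplus>i\<in>F. g i u)" using insert c by (intro R.finsum_insert) auto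
  ultimately show ?case using insert by (simp add: add_eq)
 qed
qed

end

text \<open>\<open>monoid_alg_map\<close> adds up coefficients along the fibres of \<open>k\<close>.
  It therefore agrees with the evaluation that sends \<open>w\<close> to the monomial of
  \<open>k w\<close>, for which the homomorphism property is \<open>ev_hom\<close>.\<close>

lemma monoid_alg_map_hom:
 fixes R :: "('r, 'y) ring_scheme" and S :: "('s, 'z) ring_scheme" and W :: "('w, 'a) monoid_scheme" and W' :: "('w', 'b) monoid_scheme"
 assumes "monoid_algebra R W" "monoid_algebra S W'"
  and h: "h : ring_hom R S" and k: "!!w. w : carrier W ==> k w : carrier W'"
  and k1: "k \<one>\<^bsub>W\<^esub> = \<one>\<^bsub>W'\<^esub>"
  and km: "!!u v. u : carrier W ==> v : carrier W ==> k (u \<otimes>\<^bsub>W\<^esub> v) = k u \<otimes>\<^bsub>W'\<^esub> k v"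
 shows "alg_hom h R (monoid_alg R W) (monoid_alg S W') (monoid_alg_map R S h k)"
  and "u : carrier W ==> monoid_alg_map R S h k (monom_alg R u) = monom_alg S (k u)"
proof -
 interpret A: monoid_algebra R W by fact
 interpret B: monoid_algebra S W' by fact
 interpret BR: ring "monoid_alg S W'" by (rule B.ring)
 let ?p = "%w. mterm S \<one>\<^bsub>S\<^esub> (k w)"
 note hc = ring_hom_closed[OF h]
 have h0: "h \<zero>\<^bsub>R\<^esub> = \<zero>\<^bsub>S\<^esub>" by (rule ring_hom_zero[OF h A.R.ring_axioms B.R.ring_axioms])
 have p: "?p w : carrier (monoid_alg S W')" if "w : carrier W" for w using k[OF that] by (simp add: B.mterm_closed)
 have ev: "alg_hom h R (monoid_alg R W) (monoid_alg S W') (A.ev h (monoid_alg S W') ?p)"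
  by (rule A.ev_hom[OF B.assoc_alg h p]) (simp_all add: k1 B.one_eq B.mult_mterm k km)
 have e: "monoid_alg_map R S h k f = A.ev h (monoid_alg S W') ?p f" if f: "f : carrier (monoid_alg R W)" for f
 proof
  fix u
  let ?F = "{w. f w ~= \<zero>\<^bsub>R\<^esub>}"
  have F: "finite ?F" "?F <= carrier W" and c: "!!w. f w : carrier R" using f by (auto simp: A.carrier_iff)
  have "A.ev h (monoid_alg S W') ?p f u = (\<Oplus>\<^bsub>S\<^esub>w\<in>?F. (h (f w) \<odot>\<^bsub>monoid_alg S W'\<^esub> ?p w) u)"
   unfolding A.ev_def using F p hc c assoc_algD(3)[OF B.assoc_alg] by (intro B.finsum_apply) (auto simp: subset_iff)
  also have "... = (\<Oplus>\<^bsub>S\<^esub>w\<in>{w. f w ~= \<zero>\<^bsub>R\<^esub> & k w = u}. h (f w))"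
   using F c hc by (intro B.R.add.finprod_mono_neutral_cong_right) (auto simp: B.smult_mterm, auto simp: mterm_def)
  finally show "monoid_alg_map R S h k f u = A.ev h (monoid_alg S W') ?p f u" by (simp add: monoid_alg_map_def)
 qed
 show "alg_hom h R (monoid_alg R W) (monoid_alg S W') (monoid_alg_map R S h k)" by (rule alg_hom_cong[OF ev A.assoc_alg e])
 show "monoid_alg_map R S h k (monom_alg R u) = monom_alg S (k u)" if u: "u : carrier W"
  unfolding A.monom_eq B.monom_eq e[OF A.mterm_closed[OF A.R.one_closed u]] by (subst A.ev_mterm[OF B.assoc_alg h p A.R.one_closed u])
   (simp_all add: ring_hom_one[OF h] B.smult_mterm)
qed

section \<open>Generators of quotients, commuting subalgebras, and maps between quotients\<close>

lemma quot_generated: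
 assumes A: "assoc_alg R A" and I: "ideal I A" and G: "G <= carrier A" "!!a. a : carrier A ==> a : alg_span R A G"
  and C: "C : carrier (quot_alg A I)" shows "C : alg_span R (quot_alg A I) ((+>\<^bsub>A\<^esub>) I ` G)"
proof -
 have id: "id : ring_hom R R" by (rule ring_hom_memI) auto
 note Q = quot_assoc_alg[OF A I]
 obtain a where "a : carrier A" "C = I +>\<^bsub>A\<^esub> a" using C quot_alg_ops(1)[OF A I] by auto
 thus ?thesis using alg_span_image[OF Q(2) A Q(1) id G(1) G(2)] by simp
qed

text \<open>Commutation passes from generators to the subalgebras they span. This provides the
  hypothesis of \<open>tp_lift\<close> on the images of the two factors.\<close>

lemma alg_span_commute: fixes A (structure)
 assumes A: "assoc_alg R A" and G: "G <= carrier A" and H: "H <= carrier A"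
  and c: "!!g k. g : G ==> k : H ==> g \<otimes> k = k \<otimes> g"
  and a: "a : alg_span R A G" and b: "b : alg_span R A H" shows "a \<otimes> b = b \<otimes> a"
proof -
 note D = assoc_algD[OF A]
 interpret A: ring A using D by simp
 note clG = alg_span_closed[OF A G] and clH = alg_span_closed[OF A H]
 have 1: "g \<otimes> b = b \<otimes> g" if g: "g : G" for g using b
 proof induction
  case (mult k b)
  have "g : carrier A" "k : carrier A" "b : carrier A" using g mult H G clH by auto
  thus ?case using mult.IH c[OF g mult.hyps(1)] by (metis A.m_assoc)
 qed (use g G clH in \<open>auto simp: A.l_distr A.r_distr D(5,6) subset_iff\<close>)
 note bc = clH[OF b]
 show ?thesis using a
 proof induction
  case (mult k a)
  have "k : carrier A" "a : carrier A" using mult H G clG by auto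
  thus ?case using mult.IH 1[OF mult.hyps(1)] bc by (metis A.m_assoc)
 qed (use bc clG in \<open>auto simp: A.l_distr A.r_distr D(5,6) subset_iff\<close>)
qed

lemma coset_eqI:
 assumes "ring A" "ideal I A" "a : carrier A" "b : carrier A" "a \<ominus>\<^bsub>A\<^esub> b : I"
 shows "I +>\<^bsub>A\<^esub> a = I +>\<^bsub>A\<^esub> b" using ring.quotient_eq_iff_same_a_r_cos[OF assms(1,2,3,4)] assms(5) by simp

lemma id_hom: "id : ring_hom R R" by (rule ring_hom_memI) auto

lemma lin_map_trans: "h : ring_hom R S ==> lin_map h R M N k ==> lin_map id S N B j ==> lin_map h R M B (%m. j (k m))"
 by (auto simp: lin_map_def ring_hom_closed)

text \<open>\<open>quot_map\<close> is a union of cosets, whose well-definedness would require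
  mapping one ideal into the other. Instead it is compared with a homomorphism \<open>L\<close>
  known from a universal property: \<open>J + T a\<close> and \<open>L (I + a)\<close> are two
  homomorphisms in \<open>a\<close>, so they agree once they agree on generators.\<close>

lemma quot_map_eq: fixes A (structure)
 assumes T: "alg_hom h R A B T" and A: "assoc_alg R A" and B: "assoc_alg R' B" and h: "h : ring_hom R R'"
  and I: "ideal I A" and J: "ideal J B" and G: "G <= carrier A" "!!a. a : carrier A ==> a : alg_span R A G"
  and L: "alg_hom h R (quot_alg A I) (quot_alg B J) L" and e: "!!g. g : G ==> L (I +> g) = J +>\<^bsub>B\<^esub> T g"
  and C: "C : carrier (quot_alg A I)" shows "quot_map B J T C = L C"
proof -
 interpret I: ideal I A by (rule I)
 note QA = quot_assoc_alg[OF A I] and QB = quot_assoc_alg[OF B J]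
 have 1: "alg_hom h R A (quot_alg B J) ((+>\<^bsub>B\<^esub>) J \<circ> T)" using alg_hom_comp[OF T QB(2) A B QB(1) h id_hom] by simp
 have 2: "alg_hom h R A (quot_alg B J) (L \<circ> (+>) I)" using alg_hom_comp[OF QA(2) L A QA(1) QB(1) id_hom h] by simp
 have eq: "J +>\<^bsub>B\<^esub> T a = L (I +> a)" if "a : carrier A" for a using alg_hom_unique[OF 1 2 A QB(1) h G(1) G(2)[OF that]] e by simp
 obtain a where a: "a : carrier A" "C = I +> a" using C quot_alg_ops(1)[OF A I] by auto
 have "J +>\<^bsub>B\<^esub> T c = L C" if c: "c : C" for c
  using eq[OF I.a_elemrcos_carrier[OF a(1)]] I.a_repr_independence'[OF _ a(1), of c] c a(2) by simp
 moreover have "a : C" using I.a_rcos_self[OF a(1)] a(2) by simp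
 ultimately show ?thesis unfolding quot_map_def by blast
qed

text \<open>The relations of the tensor algebra are written with the two operations of
  \<open>M\<close>, so \<open>M\<close> has to be closed under them; linearity is imposed by the
  quotient.\<close>

locale gen_module = R: cring R for R :: "('r, 'y) ring_scheme" (structure) and M :: "('r, 'x) module" +
 assumes add_closed: "m : carrier M ==> n : carrier M ==> m \<oplus>\<^bsub>M\<^esub> n : carrier M"
  and smult_closed: "r : carrier R ==> m : carrier M ==> r \<odot>\<^bsub>M\<^esub> m : carrier M"
begin

lemma word_monoid: "Group.monoid (word_monoid (carrier M))" by (rule Group.monoidI) (auto simp: word_monoid_def)

sublocale wd: monoid_algebra R "word_monoid (carrier M)" by (rule monoid_algebra.intro[OF R.is_cring word_monoid])

lemma word_alg_eq: "monoid_alg R (word_monoid (carrier M)) = word_alg R M" by (simp add: word_alg_def)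

lemmas word_assoc = wd.assoc_alg[unfolded word_alg_eq]

lemma monom_closed: "w : lists (carrier M) ==> monom_alg R w : carrier (word_alg R M)"
 unfolding wd.monom_eq word_alg_eq[symmetric] by (rule wd.mterm_closed) (auto simp: word_monoid_def)

definition "tensor_gens = {monom_alg R [m \<oplus>\<^bsub>M\<^esub> n] \<ominus>\<^bsub>word_alg R M\<^esub> (monom_alg R [m] \<oplus>\<^bsub>word_alg R M\<^esub> monom_alg R [n])
    | m n. m : carrier M & n : carrier M}
  Un {monom_alg R [r \<odot>\<^bsub>M\<^esub> m] \<ominus>\<^bsub>word_alg R M\<^esub> (r \<odot>\<^bsub>word_alg R M\<^esub> monom_alg R [m])
    | r m. r : carrier R & m : carrier M}"

lemma tensor_alg_eq: "tens R M = quot_alg (word_alg R M) (genideal (word_alg R M) tensor_gens)"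
 and tensor_incl_eq: "tinc R M m = genideal (word_alg R M) tensor_gens +>\<^bsub>word_alg R M\<^esub> monom_alg R [m]"
 by (simp_all add: tensor_alg_def tensor_alg_ideal_def tensor_gens_def tensor_incl_def)

lemma tensor_gens: "tensor_gens <= carrier (word_alg R M)"
proof -
 interpret A: ring "word_alg R M" using assoc_algD[OF word_assoc] by simp
 show ?thesis by (auto simp: tensor_gens_def
   intro!: A.minus_closed A.a_closed monom_closed add_closed smult_closed assoc_algD(3)[OF word_assoc])
qed

lemma tensor_ideal: "ideal (genideal (word_alg R M) tensor_gens) (word_alg R M)"
 using assoc_algD[OF word_assoc] tensor_gens by (simp add: ring.genideal_ideal)

lemma tensor_assoc: "assoc_alg R (tens R M)" unfolding tensor_alg_eq by (rule quot_assoc_alg[OF word_assoc tensor_ideal])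

lemma tensor_incl_lin: "lin_map id R M (tens R M) (tinc R M)"
proof -
 note D = assoc_algD[OF word_assoc]
 interpret A: ring "word_alg R M" using D by simp
 note o = quot_alg_ops[OF word_assoc tensor_ideal] and eq = coset_eqI[OF A.ring_axioms tensor_ideal]
 have G: "g : tensor_gens ==> g : genideal (word_alg R M) tensor_gens" for g using A.genideal_self[OF tensor_gens] by auto
 show ?thesis unfolding lin_map_def tensor_alg_eq tensor_incl_eq
 proof (intro conjI ballI)
  fix m n assume m: "m : carrier M" and n: "n : carrier M"
  show "genideal (word_alg R M) tensor_gens +>\<^bsub>word_alg R M\<^esub> monom_alg R [m \<oplus>\<^bsub>M\<^esub> n] =
   (genideal (word_alg R M) tensor_gens +>\<^bsub>word_alg R M\<^esub> monom_alg R [m])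
   \<oplus>\<^bsub>quot_alg (word_alg R M) (genideal (word_alg R M) tensor_gens)\<^esub>
   (genideal (word_alg R M) tensor_gens +>\<^bsub>word_alg R M\<^esub> monom_alg R [n])"
  proof -
   have "monom_alg R [m \<oplus>\<^bsub>M\<^esub> n] \<ominus>\<^bsub>word_alg R M\<^esub> (monom_alg R [m] \<oplus>\<^bsub>word_alg R M\<^esub> monom_alg R [n]) : tensor_gens"
    unfolding tensor_gens_def using m n by blast
   from eq[OF _ _ G[OF this]] show ?thesis using m n add_closed by (simp add: o monom_closed)
  qed
 next
  fix r m assume m: "r : carrier R" "m : carrier M"
  show "genideal (word_alg R M) tensor_gens +>\<^bsub>word_alg R M\<^esub> monom_alg R [r \<odot>\<^bsub>M\<^esub> m] =
   id r \<odot>\<^bsub>quot_alg (word_alg R M) (genideal (word_alg R M) tensor_gens)\<^esub>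
   (genideal (word_alg R M) tensor_gens +>\<^bsub>word_alg R M\<^esub> monom_alg R [m])"
  proof -
   have "monom_alg R [r \<odot>\<^bsub>M\<^esub> m] \<ominus>\<^bsub>word_alg R M\<^esub> (r \<odot>\<^bsub>word_alg R M\<^esub> monom_alg R [m]) : tensor_gens"
    unfolding tensor_gens_def using m by blast
   from eq[OF _ _ G[OF this]] show ?thesis using m smult_closed by (simp add: o monom_closed D(3))
  qed
 qed (auto simp: o monom_closed)
qed

lemma word_generated:
 assumes "f : carrier (word_alg R M)" shows "f : alg_span R (word_alg R M) ((%m. monom_alg R [m]) ` carrier M)"
 using assms[unfolded word_alg_eq[symmetric]]
proof (induction f rule: wd.induct)
 note D = assoc_algD[OF word_assoc]
 interpret A: ring "word_alg R M" using D by simp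
 case zero
 have "\<zero> \<odot>\<^bsub>word_alg R M\<^esub> \<one>\<^bsub>word_alg R M\<^esub> : alg_span R (word_alg R M) ((%m. monom_alg R [m]) ` carrier M)"
  by (intro alg_span.intros) auto
 thus ?case unfolding word_alg_eq D(11)[OF A.one_closed] .
next
 case (mterm r w)
 have "w : lists (carrier M)" using mterm by (simp add: word_monoid_def)
 thus ?case
 proof (induction w)
  case Nil
  have "r \<odot>\<^bsub>word_alg R M\<^esub> \<one>\<^bsub>word_alg R M\<^esub> : alg_span R (word_alg R M) ((%m. monom_alg R [m]) ` carrier M)"
   using mterm by (intro alg_span.intros) auto
  moreover have "r \<odot>\<^bsub>word_alg R M\<^esub> \<one>\<^bsub>word_alg R M\<^esub> = mterm R r []"
   unfolding word_alg_eq[symmetric] wd.one_eq using mterm by (simp add: wd.smult_mterm) (simp add: word_monoid_def)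
  ultimately show ?case by simp
 next
  case (Cons m w)
  have "mterm R r (m # w) = monom_alg R [m] \<otimes>\<^bsub>word_alg R M\<^esub> mterm R r w"
   unfolding word_alg_eq[symmetric] wd.monom_eq using mterm Cons by (subst wd.mult_mterm) (auto simp: word_monoid_def)
  thus ?case using Cons by (auto intro: alg_span.intros)
 qed
next
 case (add f g)
 thus ?case unfolding word_alg_eq by (intro alg_span.add)
qed

lemma tensor_generated:
 assumes "a : carrier (tens R M)" shows "a : alg_span R (tens R M) (tinc R M ` carrier M)"
proof -
 have "a : alg_span R (quot_alg (word_alg R M) (genideal (word_alg R M) tensor_gens))
  ((+>\<^bsub>word_alg R M\<^esub>) (genideal (word_alg R M) tensor_gens) ` (%m. monom_alg R [m]) ` carrier M)"
  using assms[unfolded tensor_alg_eq] word_generated by (intro quot_generated[OF word_assoc tensor_ideal]) (auto intro!: monom_closed)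
 thus ?thesis unfolding tensor_alg_eq tensor_incl_eq by (simp add: image_image)
qed

text \<open>A word goes to the product of the images of its letters; linearity of \<open>k\<close>
  says exactly that the two families of relations are killed.\<close>

lemma tensor_lift:
 assumes B: "assoc_alg S B" and h: "h : ring_hom R S" and k: "lin_map h R M B k"
 obtains T where "alg_hom h R (tens R M) B T" "!!m. m : carrier M ==> T (tinc R M m) = k m"
proof -
 note D = assoc_algD[OF B]
 interpret B: ring B using D by simp
 let ?p = "%w. foldr (%m. (\<otimes>\<^bsub>B\<^esub>) (k m)) w \<one>\<^bsub>B\<^esub>"
 have kc: "m : carrier M ==> k m : carrier B" for m using k by (simp add: lin_map_def)
 have p: "w : lists (carrier M) ==> ?p w : carrier B" for w by (induction w) (auto simp: kc)
 have pm: "u : lists (carrier M) ==> v : lists (carrier M) ==> ?p (u @ v) = ?p u \<otimes>\<^bsub>B\<^esub> ?p v" for u v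
 proof (induction u)
  case Nil
  thus ?case using p[of v] by simp
 next
  case (Cons a u)
  thus ?case using p[of v] p[of u] kc by (simp add: B.m_assoc)
 qed
 have p': "w : carrier (word_monoid (carrier M)) ==> ?p w : carrier B" for w using p by (simp add: word_monoid_def)
 let ?T = "wd.ev h B ?p"
 have T: "alg_hom h R (word_alg R M) B ?T" unfolding word_alg_eq[symmetric]
  by (rule wd.ev_hom[OF B h p']) (use pm in \<open>auto simp: word_monoid_def\<close>)
 have Tm: "?T (monom_alg R [m]) = k m" if "m : carrier M" for m unfolding wd.monom_eq using that kc
  by (subst wd.ev_mterm[OF B h p']) (auto simp: word_monoid_def ring_hom_one[OF h] D)
 note H = alg_homD[OF T word_assoc B h]
 note mc = monom_closed[of "[m]" for m]
 interpret A: ring "word_alg R M" using assoc_algD[OF word_assoc] by simp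
 have z: "?T s = \<zero>\<^bsub>B\<^esub>" if "s : tensor_gens" for s
  using that k add_closed smult_closed mc assoc_algD(3)[OF word_assoc] ring_hom_closed[OF h] kc D(3)
  unfolding tensor_gens_def lin_map_def by (auto simp: H Tm B.minus_eq B.r_neg)
 show thesis
 proof (rule that[of "quot_lift ?T"])
  show "alg_hom h R (tens R M) B (quot_lift ?T)" unfolding tensor_alg_eq by (rule quot_lift_hom[OF T word_assoc B h tensor_gens z])
  show "quot_lift ?T (tinc R M m) = k m" if "m : carrier M" for m
   unfolding tensor_incl_eq using quot_lift_eq(2)[OF T word_assoc B h tensor_gens z mc] Tm that by simp
 qed
qed

end

lemma tensor_map:
 fixes R :: "('r, 'y) ring_scheme" and S :: "('s, 'z) ring_scheme"
 assumes "gen_module R M" "gen_module S N" and h: "h : ring_hom R S" and k: "lin_map h R M N k"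
 shows "alg_hom h R (tens R M) (tens S N) (tensor_alg_map R S N h k)"
  and "m : carrier M ==> tensor_alg_map R S N h k (tinc R M m) = tinc S N (k m)"
proof -
 interpret M: gen_module R M by fact
 interpret N: gen_module S N by fact
 let ?T = "monoid_alg_map R S h (map k)"
 have l: "w : carrier (word_monoid (carrier M)) ==> map k w : carrier (word_monoid (carrier N))" for w
  using k by (auto simp: word_monoid_def lin_map_def)
 note TT = monoid_alg_map_hom[OF M.wd.monoid_algebra_axioms N.wd.monoid_algebra_axioms h l]
 have T: "alg_hom h R (word_alg R M) (word_alg S N) ?T"
  unfolding M.word_alg_eq[symmetric] N.word_alg_eq[symmetric] by (rule TT(1)) (auto simp: word_monoid_def)
 have Tm: "?T (monom_alg R [m]) = monom_alg S [k m]" if "m : carrier M" for m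
  by (rule trans[OF TT(2)]) (use that in \<open>auto simp: word_monoid_def\<close>)
 obtain L where L: "alg_hom h R (tens R M) (tens S N) L"
  "!!m. m : carrier M ==> L (tinc R M m) = tinc S N (k m)"
  by (rule M.tensor_lift[OF N.tensor_assoc h lin_map_trans[OF h k N.tensor_incl_lin]]) blast
 have eq: "tensor_alg_map R S N h k = quot_map (word_alg S N) (genideal (word_alg S N) N.tensor_gens) ?T"
  by (simp add: tensor_alg_map_def tensor_alg_ideal_def N.tensor_gens_def)
 have e: "tensor_alg_map R S N h k C = L C" if C: "C : carrier (tens R M)" for C
  unfolding eq by (rule quot_map_eq[OF T M.word_assoc N.word_assoc h M.tensor_ideal N.tensor_ideal _ M.word_generated
    L(1)[unfolded M.tensor_alg_eq N.tensor_alg_eq] _ C[unfolded M.tensor_alg_eq]])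
   (use M.monom_closed L(2) Tm in \<open>auto simp: M.tensor_incl_eq N.tensor_incl_eq\<close>)
 show "alg_hom h R (tens R M) (tens S N) (tensor_alg_map R S N h k)" by (rule alg_hom_cong[OF L(1) M.tensor_assoc e])
 show "m : carrier M ==> tensor_alg_map R S N h k (tinc R M m) = tinc S N (k m)"
  using e[of "tinc R M m"] L(2) M.tensor_incl_lin by (simp add: lin_map_def)
qed

section \<open>Exterior and symmetric algebras\<close>

context gen_module
begin

lemma tensor_incl_closed: "m : carrier M ==> tinc R M m : carrier (tens R M)"
 using tensor_incl_lin by (simp add: lin_map_def)

lemma tensor_ring: "ring (tens R M)" using assoc_algD[OF tensor_assoc] by simp

text \<open>Exterior and symmetric algebras differ only in the relations divided out of the tensor
  algebra, so both are treated together with a set \<open>K\<close> of relations.\<close>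

context
 fixes K :: "('x list => 'r) set set"
 assumes K: "K <= carrier (tens R M)"
begin

abbreviation "J == genideal (tens R M) K"
abbreviation "Q == quot_alg (tens R M) J"
abbreviation "inc m == J +>\<^bsub>tens R M\<^esub> tinc R M m"

lemma tensor_quot_ideal: "ideal J (tens R M)" using tensor_ring K by (simp add: ring.genideal_ideal)

lemma tensor_quot_assoc: "assoc_alg R Q" by (rule quot_assoc_alg[OF tensor_assoc tensor_quot_ideal])

lemma tensor_quot_lin: "lin_map id R M Q inc" using lin_map_comp[OF tensor_incl_lin quot_assoc_alg(2)[OF tensor_assoc tensor_quot_ideal]
  tensor_assoc tensor_quot_assoc id_hom id_hom] by (simp add: o_def id_def)

lemma tensor_quot_generated: "a : carrier Q ==> a : alg_span R Q (inc ` carrier M)"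
 using quot_generated[OF tensor_assoc tensor_quot_ideal _ tensor_generated] tensor_incl_closed by (simp add: image_image image_subset_iff)

lemma tensor_quot_eqI:
 assumes "a : carrier (tens R M)" "b : carrier (tens R M)" "a \<ominus>\<^bsub>tens R M\<^esub> b : K"
 shows "J +>\<^bsub>tens R M\<^esub> a = J +>\<^bsub>tens R M\<^esub> b"
 using coset_eqI[OF tensor_ring tensor_quot_ideal assms(1,2)] ring.genideal_self[OF tensor_ring K] assms(3) by blast

text \<open>The lift to the tensor algebra is only known to exist, so condition \<open>z\<close>
  speaks of every \<open>T\<close> that extends \<open>k\<close>.\<close>

lemma tensor_quot_lift:
 assumes B: "assoc_alg S B" and h: "h : ring_hom R S" and k: "lin_map h R M B k"
  and z: "!!T s. alg_hom h R (tens R M) B T ==> (!!m. m : carrier M ==> T (tinc R M m) = k m)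
   ==> s : K ==> T s = \<zero>\<^bsub>B\<^esub>"
 obtains T where "alg_hom h R Q B T" "!!m. m : carrier M ==> T (inc m) = k m"
proof -
 obtain T where T: "alg_hom h R (tens R M) B T" "!!m. m : carrier M ==> T (tinc R M m) = k m"
  using tensor_lift[OF B h k] by blast
 note z' = z[OF T]
 show thesis using that[of "quot_lift T"] quot_lift_hom[OF T(1) tensor_assoc B h K z']
   quot_lift_eq(2)[OF T(1) tensor_assoc B h K z' tensor_incl_closed] T(2) by auto
qed

end

lemma ext_gens: "{tinc R M m \<otimes>\<^bsub>tens R M\<^esub> tinc R M m | m. m : carrier M} <= carrier (tens R M)"
 and sym_gens: "{(tinc R M m \<otimes>\<^bsub>tens R M\<^esub> tinc R M n) \<ominus>\<^bsub>tens R M\<^esub>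
   (tinc R M n \<otimes>\<^bsub>tens R M\<^esub> tinc R M m) | m n. m : carrier M & n : carrier M}
  <= carrier (tens R M)"
proof -
 interpret T: ring "tens R M" by (rule tensor_ring)
 show "{tinc R M m \<otimes>\<^bsub>tens R M\<^esub> tinc R M m | m. m : carrier M} <= carrier (tens R M)"
  "{(tinc R M m \<otimes>\<^bsub>tens R M\<^esub> tinc R M n) \<ominus>\<^bsub>tens R M\<^esub>
   (tinc R M n \<otimes>\<^bsub>tens R M\<^esub> tinc R M m) | m n. m : carrier M & n : carrier M}
  <= carrier (tens R M)" by (auto intro!: T.minus_closed T.m_closed tensor_incl_closed)
qed

lemmas ext_assoc = tensor_quot_assoc[OF ext_gens, folded ext_ideal_def ext_alg_def]
 and ext_lin = tensor_quot_lin[OF ext_gens, folded ext_ideal_def ext_alg_def ext_incl_def]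
 and ext_generated = tensor_quot_generated[OF ext_gens, folded ext_ideal_def ext_alg_def ext_incl_def]
 and ext_lift0 = tensor_quot_lift[OF ext_gens, folded ext_ideal_def ext_alg_def ext_incl_def]
 and ext_ideal = tensor_quot_ideal[OF ext_gens, folded ext_ideal_def]
 and sym_assoc = tensor_quot_assoc[OF sym_gens, folded sym_ideal_def sym_alg_def]
 and sym_lin = tensor_quot_lin[OF sym_gens, folded sym_ideal_def sym_alg_def sym_incl_def]
 and sym_generated = tensor_quot_generated[OF sym_gens, folded sym_ideal_def sym_alg_def sym_incl_def]
 and sym_lift0 = tensor_quot_lift[OF sym_gens, folded sym_ideal_def sym_alg_def sym_incl_def]
 and sym_ideal = tensor_quot_ideal[OF sym_gens, folded sym_ideal_def]

lemma ext_incl_closed: "m : carrier M ==> ext_incl R M m : carrier (ext_alg R M)" using ext_lin by (simp add: lin_map_def)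

lemma sym_incl_closed: "m : carrier M ==> sym_incl R M m : carrier (sym_alg R M)" using sym_lin by (simp add: lin_map_def)

lemma ext_square:
 assumes m: "m : carrier M" shows "ext_incl R M m \<otimes>\<^bsub>ext_alg R M\<^esub> ext_incl R M m = \<zero>\<^bsub>ext_alg R M\<^esub>"
proof -
 interpret T: ring "tens R M" by (rule tensor_ring)
 interpret I: ideal "ext_ideal R M" "tens R M" by (rule ext_ideal)
 have "tinc R M m \<otimes>\<^bsub>tens R M\<^esub> tinc R M m : ext_ideal R M"
  unfolding ext_ideal_def using T.genideal_self[OF ext_gens] m by blast
 thus ?thesis unfolding ext_alg_def ext_incl_def using quot_alg_ops(3)[OF tensor_assoc ext_ideal] tensor_incl_closed[OF m]
  by (simp add: I.a_rcos_const quot_alg_simps(5))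
qed

lemma sym_commute:
 assumes "m : carrier M" "n : carrier M"
 shows "sym_incl R M m \<otimes>\<^bsub>sym_alg R M\<^esub> sym_incl R M n = sym_incl R M n \<otimes>\<^bsub>sym_alg R M\<^esub> sym_incl R M m"
proof -
 interpret T: ring "tens R M" by (rule tensor_ring)
 have "sym_ideal R M +>\<^bsub>tens R M\<^esub> (tinc R M m \<otimes>\<^bsub>tens R M\<^esub> tinc R M n) =
  sym_ideal R M +>\<^bsub>tens R M\<^esub> (tinc R M n \<otimes>\<^bsub>tens R M\<^esub> tinc R M m)"
  unfolding sym_ideal_def by (rule tensor_quot_eqI[OF sym_gens]) (use assms tensor_incl_closed in auto)
 thus ?thesis unfolding sym_alg_def sym_incl_def using quot_alg_ops(3)[OF tensor_assoc sym_ideal] tensor_incl_closed assms by simp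
qed

lemma ext_lift:
 assumes B: "assoc_alg S B" and h: "h : ring_hom R S" and k: "lin_map h R M B k"
  and z: "!!m. m : carrier M ==> k m \<otimes>\<^bsub>B\<^esub> k m = \<zero>\<^bsub>B\<^esub>"
 obtains T where "alg_hom h R (ext_alg R M) B T" "!!m. m : carrier M ==> T (ext_incl R M m) = k m"
proof (rule ext_lift0[OF B h k _ that])
 fix T s
 assume T: "alg_hom h R (tens R M) B T" "!!m. m : carrier M ==> T (tinc R M m) = k m"
  and s: "s : {tinc R M m \<otimes>\<^bsub>tens R M\<^esub> tinc R M m | m. m : carrier M}"
 thus "T s = \<zero>\<^bsub>B\<^esub>" using z by (auto simp: alg_homD[OF T(1) tensor_assoc B h] tensor_incl_closed)
qed auto

lemma sym_lift:
 assumes B: "assoc_alg S B" and h: "h : ring_hom R S" and k: "lin_map h R M B k"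
  and z: "!!m n. m : carrier M ==> n : carrier M ==> k m \<otimes>\<^bsub>B\<^esub> k n = k n \<otimes>\<^bsub>B\<^esub> k m"
 obtains T where "alg_hom h R (sym_alg R M) B T" "!!m. m : carrier M ==> T (sym_incl R M m) = k m"
proof (rule sym_lift0[OF B h k _ that])
 interpret T: ring "tens R M" by (rule tensor_ring)
 interpret B: ring B using assoc_algD[OF B] by simp
 fix T s
 assume T: "alg_hom h R (tens R M) B T" "!!m. m : carrier M ==> T (tinc R M m) = k m"
  and s: "s : {(tinc R M m \<otimes>\<^bsub>tens R M\<^esub> tinc R M n) \<ominus>\<^bsub>tens R M\<^esub>
   (tinc R M n \<otimes>\<^bsub>tens R M\<^esub> tinc R M m) | m n. m : carrier M & n : carrier M}"
 obtain m n where mn: "m : carrier M" "n : carrier M"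
  "s = (tinc R M m \<otimes>\<^bsub>tens R M\<^esub> tinc R M n) \<ominus>\<^bsub>tens R M\<^esub>
   (tinc R M n \<otimes>\<^bsub>tens R M\<^esub> tinc R M m)" using s by blast
 have "k m : carrier B" "k n : carrier B" using k mn by (auto simp: lin_map_def)
 thus "T s = \<zero>\<^bsub>B\<^esub>" using z[OF mn(1,2)] mn(1,2) unfolding mn(3)
  by (simp add: alg_homD[OF T(1) tensor_assoc B h] T(2) tensor_incl_closed B.minus_eq B.r_neg)
qed auto

end

lemma ext_map:
 fixes R :: "('r, 'y) ring_scheme" and S :: "('s, 'z) ring_scheme"
 assumes "gen_module R M" "gen_module S N" and h: "h : ring_hom R S" and k: "lin_map h R M N k"
 shows "alg_hom h R (ext_alg R M) (ext_alg S N) (ext_alg_map R S N h k)"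
  and "m : carrier M ==> ext_alg_map R S N h k (ext_incl R M m) = ext_incl S N (k m)"
proof -
 interpret M: gen_module R M by fact
 interpret N: gen_module S N by fact
 note T = tensor_map[OF assms]
 have kc: "m : carrier M ==> k m : carrier N" for m using k by (simp add: lin_map_def)
 obtain L where L: "alg_hom h R (ext_alg R M) (ext_alg S N) L" "!!m. m : carrier M ==> L (ext_incl R M m) = ext_incl S N (k m)"
  by (rule M.ext_lift[OF N.ext_assoc h lin_map_trans[OF h k N.ext_lin] N.ext_square[OF kc]]) blast+
 have e: "ext_alg_map R S N h k C = L C" if C: "C : carrier (ext_alg R M)" for C unfolding ext_alg_map_def
  by (rule quot_map_eq[OF T(1) M.tensor_assoc N.tensor_assoc h M.ext_ideal N.ext_ideal _ M.tensor_generated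
    L(1)[unfolded ext_alg_def] _ C[unfolded ext_alg_def]])
   (use M.tensor_incl_closed L(2) T(2) in \<open>auto simp: ext_incl_def\<close>)
 show "alg_hom h R (ext_alg R M) (ext_alg S N) (ext_alg_map R S N h k)" by (rule alg_hom_cong[OF L(1) M.ext_assoc e])
 show "m : carrier M ==> ext_alg_map R S N h k (ext_incl R M m) = ext_incl S N (k m)" using e[OF M.ext_incl_closed] L(2) by simp
qed

lemma sym_map:
 fixes R :: "('r, 'y) ring_scheme" and S :: "('s, 'z) ring_scheme"
 assumes "gen_module R M" "gen_module S N" and h: "h : ring_hom R S" and k: "lin_map h R M N k"
 shows "alg_hom h R (sym_alg R M) (sym_alg S N) (sym_alg_map R S N h k)"
  and "m : carrier M ==> sym_alg_map R S N h k (sym_incl R M m) = sym_incl S N (k m)"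
proof -
 interpret M: gen_module R M by fact
 interpret N: gen_module S N by fact
 note T = tensor_map[OF assms]
 have kc: "m : carrier M ==> k m : carrier N" for m using k by (simp add: lin_map_def)
 obtain L where L: "alg_hom h R (sym_alg R M) (sym_alg S N) L" "!!m. m : carrier M ==> L (sym_incl R M m) = sym_incl S N (k m)"
  by (rule M.sym_lift[OF N.sym_assoc h lin_map_trans[OF h k N.sym_lin] N.sym_commute[OF kc kc]]) blast+
 have e: "sym_alg_map R S N h k C = L C" if C: "C : carrier (sym_alg R M)" for C unfolding sym_alg_map_def
  by (rule quot_map_eq[OF T(1) M.tensor_assoc N.tensor_assoc h M.sym_ideal N.sym_ideal _ M.tensor_generated
    L(1)[unfolded sym_alg_def] _ C[unfolded sym_alg_def]])
   (use M.tensor_incl_closed L(2) T(2) in \<open>auto simp: sym_incl_def\<close>)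
 show "alg_hom h R (sym_alg R M) (sym_alg S N) (sym_alg_map R S N h k)" by (rule alg_hom_cong[OF L(1) M.sym_assoc e])
 show "m : carrier M ==> sym_alg_map R S N h k (sym_incl R M m) = sym_incl S N (k m)" using e[OF M.sym_incl_closed] L(2) by simp
qed

section \<open>Tensor products of algebras\<close>

locale alg_pair =
 fixes R :: "('r, 'y) ring_scheme" and A :: "('r, 'x) module" and B :: "('r, 'u) module"
 assumes A: "assoc_alg R A" and B: "assoc_alg R B"
begin

sublocale RA: ring A using assoc_algD[OF A] by simp
sublocale RB: ring B using assoc_algD[OF B] by simp

sublocale pr: monoid_algebra R "A \<times>\<times> B"
 using assoc_algD[OF A] DirProd_monoid[OF RA.monoid_axioms RB.monoid_axioms] by (simp add: monoid_algebra_def)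

lemma pair_monoid_algebra: "monoid_algebra R (A \<times>\<times> B)" by (rule pr.monoid_algebra_axioms)

lemma pair_alg_eq: "monoid_alg R (A \<times>\<times> B) = pair_alg R A B" by (simp add: pair_alg_def)

lemmas pair_assoc = pr.assoc_alg[unfolded pair_alg_eq]

definition "pair_gens =
  {monom_alg R (a \<oplus>\<^bsub>A\<^esub> a', b) \<ominus>\<^bsub>pair_alg R A B\<^esub>
    (monom_alg R (a, b) \<oplus>\<^bsub>pair_alg R A B\<^esub> monom_alg R (a', b))
    | a a' b. a : carrier A & a' : carrier A & b : carrier B}
  Un {monom_alg R (a, b \<oplus>\<^bsub>B\<^esub> b') \<ominus>\<^bsub>pair_alg R A B\<^esub>
    (monom_alg R (a, b) \<oplus>\<^bsub>pair_alg R A B\<^esub> monom_alg R (a, b'))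
    | a b b'. a : carrier A & b : carrier B & b' : carrier B}
  Un {monom_alg R (r \<odot>\<^bsub>A\<^esub> a, b) \<ominus>\<^bsub>pair_alg R A B\<^esub> (r \<odot>\<^bsub>pair_alg R A B\<^esub> monom_alg R (a, b))
    | r a b. r : carrier R & a : carrier A & b : carrier B}
  Un {monom_alg R (a, r \<odot>\<^bsub>B\<^esub> b) \<ominus>\<^bsub>pair_alg R A B\<^esub> (r \<odot>\<^bsub>pair_alg R A B\<^esub> monom_alg R (a, b))
    | r a b. r : carrier R & a : carrier A & b : carrier B}"

lemma tensor_prod_ideal_eq: "tensor_prod_ideal R A B = genideal (pair_alg R A B) pair_gens" by (simp add: tensor_prod_ideal_def pair_gens_def)

lemma pair_ring: "ring (pair_alg R A B)" using assoc_algD[OF pair_assoc] by simp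

lemma pair_monom_closed: "a : carrier A ==> b : carrier B ==> monom_alg R (a, b) : carrier (pair_alg R A B)"
 unfolding pr.monom_eq pair_alg_eq[symmetric] by (rule pr.mterm_closed) auto

lemma pair_gens: "pair_gens <= carrier (pair_alg R A B)"
proof -
 interpret P: ring "pair_alg R A B" by (rule pair_ring)
 show ?thesis unfolding pair_gens_def by (auto intro!: P.minus_closed P.a_closed pair_monom_closed assoc_algD(3)[OF pair_assoc]
    assoc_algD(3)[OF A] assoc_algD(3)[OF B])
qed

lemma tp_ideal: "ideal (tensor_prod_ideal R A B) (pair_alg R A B)"
 unfolding tensor_prod_ideal_eq using pair_ring pair_gens by (simp add: ring.genideal_ideal)

lemma tp_assoc: "assoc_alg R (tensor_prod R A B)" unfolding tensor_prod_def by (rule quot_assoc_alg[OF pair_assoc tp_ideal])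

lemma pure_closed: "a : carrier A ==> b : carrier B ==> pure_tensor R A B a b : carrier (tensor_prod R A B)"
 unfolding pure_tensor_def tensor_prod_def quot_alg_ops(1)[OF pair_assoc tp_ideal] by (simp add: pair_monom_closed)

lemma pure_mult:
 assumes "a : carrier A" "b : carrier B" "a' : carrier A" "b' : carrier B"
 shows "pure_tensor R A B a b \<otimes>\<^bsub>tensor_prod R A B\<^esub> pure_tensor R A B a' b' =
  pure_tensor R A B (a \<otimes>\<^bsub>A\<^esub> a') (b \<otimes>\<^bsub>B\<^esub> b')"
proof -
 have "monom_alg R (a, b) \<otimes>\<^bsub>pair_alg R A B\<^esub> monom_alg R (a', b') = monom_alg R (a \<otimes>\<^bsub>A\<^esub> a', b \<otimes>\<^bsub>B\<^esub> b')"
  unfolding pr.monom_eq pair_alg_eq[symmetric] using assms by (subst pr.mult_mterm) auto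
 thus ?thesis unfolding pure_tensor_def tensor_prod_def using quot_alg_ops(3)[OF pair_assoc tp_ideal] pair_monom_closed assms by simp
qed

lemma pure_one: "\<one>\<^bsub>tensor_prod R A B\<^esub> = pure_tensor R A B \<one>\<^bsub>A\<^esub> \<one>\<^bsub>B\<^esub>"
proof -
 have "\<one>\<^bsub>pair_alg R A B\<^esub> = monom_alg R (\<one>\<^bsub>A\<^esub>, \<one>\<^bsub>B\<^esub>)"
  unfolding pr.monom_eq pair_alg_eq[symmetric] pr.one_eq by simp
 thus ?thesis by (simp add: pure_tensor_def tensor_prod_def quot_alg_simps)
qed

lemma pure_lin: shows "b : carrier B ==> lin_map id R A (tensor_prod R A B) (%a. pure_tensor R A B a b)"
  and "a : carrier A ==> lin_map id R B (tensor_prod R A B) (%b. pure_tensor R A B a b)"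
proof -
 note o = quot_alg_ops[OF pair_assoc tp_ideal]
 interpret P: ring "pair_alg R A B" by (rule pair_ring)
 note cl = pair_monom_closed assoc_algD(3)[OF pair_assoc] assoc_algD(3)[OF A] assoc_algD(3)[OF B]
 have e: "tensor_prod_ideal R A B +>\<^bsub>pair_alg R A B\<^esub> x = tensor_prod_ideal R A B +>\<^bsub>pair_alg R A B\<^esub> y"
  if "x : carrier (pair_alg R A B)" "y : carrier (pair_alg R A B)" "x \<ominus>\<^bsub>pair_alg R A B\<^esub> y : pair_gens" for x y
  using coset_eqI[OF pair_ring tp_ideal that(1,2)] that(3) P.genideal_self[OF pair_gens] unfolding tensor_prod_ideal_eq by blast
 show "lin_map id R A (tensor_prod R A B) (%a. pure_tensor R A B a b)" if b: "b : carrier B" unfolding lin_map_def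
 proof (intro conjI ballI)
  fix m n assume m: "m : carrier A" and n: "n : carrier A"
  have "monom_alg R (m \<oplus>\<^bsub>A\<^esub> n, b) \<ominus>\<^bsub>pair_alg R A B\<^esub>
    (monom_alg R (m, b) \<oplus>\<^bsub>pair_alg R A B\<^esub> monom_alg R (n, b)) : pair_gens" unfolding pair_gens_def using m n b by blast
  from e[OF _ _ this] show "pure_tensor R A B (m \<oplus>\<^bsub>A\<^esub> n) b = pure_tensor R A B m b \<oplus>\<^bsub>tensor_prod R A B\<^esub> pure_tensor R A B n b"
   using m n b cl by (simp add: pure_tensor_def tensor_prod_def o)
 next
  fix r m assume r: "r : carrier R" and m: "m : carrier A"
  have "monom_alg R (r \<odot>\<^bsub>A\<^esub> m, b) \<ominus>\<^bsub>pair_alg R A B\<^esub> (r \<odot>\<^bsub>pair_alg R A B\<^esub> monom_alg R (m, b)) : pair_gens"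
   unfolding pair_gens_def using m r b by blast
  from e[OF _ _ this] show "pure_tensor R A B (r \<odot>\<^bsub>A\<^esub> m) b = id r \<odot>\<^bsub>tensor_prod R A B\<^esub> pure_tensor R A B m b"
   using m r b cl by (simp add: pure_tensor_def tensor_prod_def o)
 qed (simp add: pure_closed b)
 show "lin_map id R B (tensor_prod R A B) (%b. pure_tensor R A B a b)" if a: "a : carrier A" unfolding lin_map_def
 proof (intro conjI ballI)
  fix m n assume m: "m : carrier B" and n: "n : carrier B"
  have "monom_alg R (a, m \<oplus>\<^bsub>B\<^esub> n) \<ominus>\<^bsub>pair_alg R A B\<^esub>
    (monom_alg R (a, m) \<oplus>\<^bsub>pair_alg R A B\<^esub> monom_alg R (a, n)) : pair_gens" unfolding pair_gens_def using m n a by blast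
  from e[OF _ _ this] show "pure_tensor R A B a (m \<oplus>\<^bsub>B\<^esub> n) = pure_tensor R A B a m \<oplus>\<^bsub>tensor_prod R A B\<^esub> pure_tensor R A B a n"
   using m n a cl by (simp add: pure_tensor_def tensor_prod_def o)
 next
  fix r m assume r: "r : carrier R" and m: "m : carrier B"
  have "monom_alg R (a, r \<odot>\<^bsub>B\<^esub> m) \<ominus>\<^bsub>pair_alg R A B\<^esub> (r \<odot>\<^bsub>pair_alg R A B\<^esub> monom_alg R (a, m)) : pair_gens"
   unfolding pair_gens_def using m r a by blast
  from e[OF _ _ this] show "pure_tensor R A B a (r \<odot>\<^bsub>B\<^esub> m) = id r \<odot>\<^bsub>tensor_prod R A B\<^esub> pure_tensor R A B a m"
   using m r a cl by (simp add: pure_tensor_def tensor_prod_def o)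
 qed (simp add: pure_closed a)
qed

text \<open>Generators of the left factor are peeled off first, by (g a) (x) b = (g (x) 1)(a (x) b),
  and then those of the right factor in 1 (x) b.\<close>

lemma tp_generated:
 assumes G: "G <= carrier A" "!!a. a : carrier A ==> a : alg_span R A G"
  and H: "H <= carrier B" "!!b. b : carrier B ==> b : alg_span R B H"
  and C: "C : carrier (tensor_prod R A B)" shows "C : alg_span R (tensor_prod R A B)
  ((%g. pure_tensor R A B g \<one>\<^bsub>B\<^esub>) ` G Un (%g. pure_tensor R A B \<one>\<^bsub>A\<^esub> g) ` H)" (is "_ : ?S")
proof -
 note D = assoc_algD[OF tp_assoc] and DP = assoc_algD[OF pair_assoc]
 interpret P: ring "pair_alg R A B" by (rule pair_ring)
 interpret TP: ring "tensor_prod R A B" using D by simp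
 have 1: "pure_tensor R A B \<one>\<^bsub>A\<^esub> b : ?S" if "b : alg_span R B H" for b using that
 proof induction
  case one
  thus ?case using pure_one alg_span.one by metis
 next
  case (add a b)
  thus ?case using alg_span_closed[OF B H(1)] pure_lin(2)[OF RA.one_closed] by (auto simp: lin_map_def intro: alg_span.intros)
 next
  case (smult r a)
  thus ?case using alg_span_closed[OF B H(1)] pure_lin(2)[OF RA.one_closed] by (auto simp: lin_map_def intro: alg_span.intros)
 next
  case (mult g b)
  have "g : carrier B" "b : carrier B" using mult H(1) alg_span_closed[OF B H(1)] by auto
  hence "pure_tensor R A B \<one>\<^bsub>A\<^esub> (g \<otimes>\<^bsub>B\<^esub> b) =
   pure_tensor R A B \<one>\<^bsub>A\<^esub> g \<otimes>\<^bsub>tensor_prod R A B\<^esub> pure_tensor R A B \<one>\<^bsub>A\<^esub> b"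
   by (simp add: pure_mult)
  thus ?case using mult by (auto intro!: alg_span.mult)
 qed
 have 2: "pure_tensor R A B a b : ?S" if "a : alg_span R A G" "b : carrier B" for a b using that(1)
 proof induction
  case one
  thus ?case using 1 H(2) that(2) by blast
 next
  case (add a a')
  thus ?case using alg_span_closed[OF A G(1)] pure_lin(1)[OF that(2)] by (auto simp: lin_map_def intro: alg_span.intros)
 next
  case (smult r a)
  thus ?case using alg_span_closed[OF A G(1)] pure_lin(1)[OF that(2)] by (auto simp: lin_map_def intro: alg_span.intros)
 next
  case (mult g a)
  have "g : carrier A" "a : carrier A" using mult G(1) alg_span_closed[OF A G(1)] by auto
  hence "pure_tensor R A B (g \<otimes>\<^bsub>A\<^esub> a) b =
   pure_tensor R A B g \<one>\<^bsub>B\<^esub> \<otimes>\<^bsub>tensor_prod R A B\<^esub> pure_tensor R A B a b"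
   using that(2) by (simp add: pure_mult)
  thus ?case using mult by (auto intro!: alg_span.mult)
 qed
 note o = quot_alg_ops[OF pair_assoc tp_ideal, folded tensor_prod_def]
 obtain f where f: "f : carrier (pair_alg R A B)" "C = tensor_prod_ideal R A B +>\<^bsub>pair_alg R A B\<^esub> f" using C o(1) by auto
 have "tensor_prod_ideal R A B +>\<^bsub>pair_alg R A B\<^esub> f : ?S" using f(1)[folded pair_alg_eq]
 proof (induction f rule: pr.induct)
  case zero
  have "\<zero>\<^bsub>R\<^esub> \<odot>\<^bsub>tensor_prod R A B\<^esub> \<one>\<^bsub>tensor_prod R A B\<^esub> : ?S"
   by (intro alg_span.intros) auto
  moreover have "tensor_prod_ideal R A B +>\<^bsub>pair_alg R A B\<^esub> \<zero>\<^bsub>pair_alg R A B\<^esub> = \<zero>\<^bsub>tensor_prod R A B\<^esub>"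
   unfolding tensor_prod_def quot_alg_simps using P.a_coset_add_zero ideal.axioms(1)[OF tp_ideal]
    additive_subgroup.a_subset by blast
  ultimately show ?case unfolding pair_alg_eq by (simp add: D(11))
 next
  case (mterm r w)
  obtain a b where w: "w = (a, b)" "a : carrier A" "b : carrier B" using mterm by (cases w) auto
  have "mterm R r w = r \<odot>\<^bsub>pair_alg R A B\<^esub> monom_alg R (a, b)"
   unfolding pr.monom_eq pair_alg_eq[symmetric] using mterm w by (simp add: pr.smult_mterm)
  hence "tensor_prod_ideal R A B +>\<^bsub>pair_alg R A B\<^esub> mterm R r w = r \<odot>\<^bsub>tensor_prod R A B\<^esub> pure_tensor R A B a b"
   using o(4) mterm w pair_monom_closed by (simp add: pure_tensor_def)
  thus ?case using 2[OF G(2)] w mterm(1) by (auto intro: alg_span.intros)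
 next
  case (add f g)
  thus ?case using o(2)[of f g] unfolding pair_alg_eq by (metis alg_span.add)
 qed
 thus ?thesis using f(2) by simp
qed

lemma tp_lift:
 assumes C: "assoc_alg S C" and h: "h : ring_hom R S" and TA: "alg_hom h R A C TA" and TB: "alg_hom h R B C TB"
  and c: "!!a b. a : carrier A ==> b : carrier B ==> TA a \<otimes>\<^bsub>C\<^esub> TB b = TB b \<otimes>\<^bsub>C\<^esub> TA a"
 obtains T where "alg_hom h R (tensor_prod R A B) C T"
  "!!a b. a : carrier A ==> b : carrier B ==> T (pure_tensor R A B a b) = TA a \<otimes>\<^bsub>C\<^esub> TB b"
proof -
 note D = assoc_algD[OF C] and HA = alg_homD[OF TA A C h] and HB = alg_homD[OF TB B C h]
 interpret C: ring C using D by simp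
 let ?p = "%(a, b). TA a \<otimes>\<^bsub>C\<^esub> TB b"
 have p: "w : carrier (A \<times>\<times> B) ==> ?p w : carrier C" for w by (cases w) (simp add: HA(1) HB(1))
 let ?T = "pr.ev h C ?p"
 have T: "alg_hom h R (pair_alg R A B) C ?T" unfolding pair_alg_eq[symmetric]
 proof (rule pr.ev_hom[OF C h p])
  fix u v assume "u : carrier (A \<times>\<times> B)" "v : carrier (A \<times>\<times> B)"
  then obtain a b a' b' where w: "u = (a, b)" "v = (a', b')" "a : carrier A" "b : carrier B"
   "a' : carrier A" "b' : carrier B" by (cases u, cases v) auto
  \<comment> \<open>Moving \<open>TA a'\<close> past \<open>TB b\<close> is the point where the two
    images have to commute.\<close>
  have "TA a \<otimes>\<^bsub>C\<^esub> TA a' \<otimes>\<^bsub>C\<^esub> (TB b \<otimes>\<^bsub>C\<^esub> TB b') = TA a \<otimes>\<^bsub>C\<^esub> (TA a' \<otimes>\<^bsub>C\<^esub> TB b) \<otimes>\<^bsub>C\<^esub> TB b'"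
   using w by (simp add: HA(1) HB(1) C.m_assoc)
  also have "... = (TA a \<otimes>\<^bsub>C\<^esub> TB b) \<otimes>\<^bsub>C\<^esub> (TA a' \<otimes>\<^bsub>C\<^esub> TB b')"
   unfolding c[OF w(5,4)] using w by (simp add: HA(1) HB(1) C.m_assoc)
  finally show "?p (u \<otimes>\<^bsub>A \<times>\<times> B\<^esub> v) = ?p u \<otimes>\<^bsub>C\<^esub> ?p v" using w by (simp add: HA(1,3) HB(1,3))
 qed (simp_all add: HA(1,6) HB(1,6))
 have Tm: "?T (monom_alg R (a, b)) = TA a \<otimes>\<^bsub>C\<^esub> TB b" if "a : carrier A" "b : carrier B" for a b
  unfolding pr.monom_eq using that by (subst pr.ev_mterm[OF C h p]) (simp_all add: ring_hom_one[OF h] D(3,10) HA(1) HB(1))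
 note H = alg_homD[OF T pair_assoc C h]
 interpret P: ring "pair_alg R A B" by (rule pair_ring)
 note cl = pair_monom_closed assoc_algD(3)[OF pair_assoc] assoc_algD(3)[OF A] assoc_algD(3)[OF B] ring_hom_closed[OF h]
 have z: "?T s = \<zero>\<^bsub>C\<^esub>" if "s : pair_gens" for s using that cl D(3) unfolding pair_gens_def Un_iff mem_Collect_eq
  by (elim disjE exE conjE) (simp_all add: H(1-5) Tm HA(1-3,5) HB(1-3,5) C.l_distr C.r_distr D(5,6) C.minus_eq C.r_neg)
 show thesis
 proof (rule that[of "quot_lift ?T"])
  show "alg_hom h R (tensor_prod R A B) C (quot_lift ?T)" unfolding tensor_prod_def tensor_prod_ideal_eq
   by (rule quot_lift_hom[OF T pair_assoc C h pair_gens z])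
  show "quot_lift ?T (pure_tensor R A B a b) = TA a \<otimes>\<^bsub>C\<^esub> TB b" if "a : carrier A" "b : carrier B" for a b
   unfolding pure_tensor_def tensor_prod_ideal_eq
   using quot_lift_eq(2)[OF T pair_assoc C h pair_gens z pair_monom_closed[OF that]] Tm[OF that] by simp
 qed
qed

lemma pair_generated:
 assumes "f : carrier (pair_alg R A B)"
 shows "f : alg_span R (pair_alg R A B) {monom_alg R (a, b) | a b. a : carrier A & b : carrier B}" (is "_ : ?S")
proof -
 note D = assoc_algD[OF pair_assoc]
 interpret P: ring "pair_alg R A B" by (rule pair_ring)
 show ?thesis using assms[folded pair_alg_eq]
 proof (induction f rule: pr.induct)
  case zero
  have "\<zero>\<^bsub>R\<^esub> \<odot>\<^bsub>pair_alg R A B\<^esub> \<one>\<^bsub>pair_alg R A B\<^esub> : ?S" by (intro alg_span.intros) auto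
  thus ?case unfolding pair_alg_eq by (simp add: D(11))
 next
  case (mterm r w)
  obtain a b where w: "w = (a, b)" "a : carrier A" "b : carrier B" using mterm by (cases w) auto
  have "mterm R r w = r \<odot>\<^bsub>pair_alg R A B\<^esub> (monom_alg R (a, b) \<otimes>\<^bsub>pair_alg R A B\<^esub> \<one>\<^bsub>pair_alg R A B\<^esub>)"
   unfolding P.r_one[OF pair_monom_closed[OF w(2,3)]] unfolding pr.monom_eq pair_alg_eq[symmetric] using mterm w by (simp add: pr.smult_mterm)
  moreover have "... : ?S" by (intro alg_span.smult alg_span.mult alg_span.one) (use mterm w in auto)
  ultimately show ?case by simp
 next
  case (add f g) thus ?case unfolding pair_alg_eq by (intro alg_span.add)
 qed
qed

lemma pure_hom: shows "alg_hom id R A (tensor_prod R A B) (%a. pure_tensor R A B a \<one>\<^bsub>B\<^esub>)"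
  and "alg_hom id R B (tensor_prod R A B) (%b. pure_tensor R A B \<one>\<^bsub>A\<^esub> b)"
 using pure_lin(1)[OF RB.one_closed] pure_lin(2)[OF RA.one_closed] by (auto simp: alg_hom_def lin_map_def pure_one pure_mult intro!: ring_hom_memI)

end

lemma tensor_prod_map:
 fixes R :: "('r, 'y) ring_scheme" and S :: "('s, 'z) ring_scheme"
  and A :: "('r, 'x) module" and B :: "('r, 'u) module" and A' :: "('s, 'x2) module" and B' :: "('s, 'u2) module"
 assumes 1: "alg_pair R A B" and 2: "alg_pair S A' B'" and h: "h : ring_hom R S" and k: "alg_hom h R A A' k" and l: "alg_hom h R B B' l"
 shows "alg_hom h R (tensor_prod R A B) (tensor_prod S A' B') (tensor_prod_map R S A' B' h k l)"
  and "a : carrier A ==> b : carrier B ==>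
   tensor_prod_map R S A' B' h k l (pure_tensor R A B a b) = pure_tensor S A' B' (k a) (l b)"
proof -
 note A = alg_pair.A[OF 1] and B = alg_pair.B[OF 1] and A' = alg_pair.A[OF 2] and B' = alg_pair.B[OF 2]
 note TP = alg_pair.tp_assoc[OF 1] and TP' = alg_pair.tp_assoc[OF 2]
 note HA = alg_homD[OF k A A' h] and HB = alg_homD[OF l B B' h]
 interpret RA: ring A by (rule assoc_algD(2)[OF A])
 interpret RB: ring B by (rule assoc_algD(2)[OF B])
 interpret RA': ring A' by (rule assoc_algD(2)[OF A'])
 interpret RB': ring B' by (rule assoc_algD(2)[OF B'])
 let ?T = "monoid_alg_map R S h (map_prod k l)"
 have p: "w : carrier (A \<times>\<times> B) ==> map_prod k l w : carrier (A' \<times>\<times> B')" for w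
  by (cases w) (simp add: HA(1) HB(1))
 note TT = monoid_alg_map_hom[OF alg_pair.pair_monoid_algebra[OF 1] alg_pair.pair_monoid_algebra[OF 2] h p]
 have T: "alg_hom h R (pair_alg R A B) (pair_alg S A' B') ?T" unfolding alg_pair.pair_alg_eq[OF 1, symmetric] alg_pair.pair_alg_eq[OF 2, symmetric]
  by (rule TT(1)) (auto simp: HA(1,3,6) HB(1,3,6))
 have Tm: "?T (monom_alg R (a, b)) = monom_alg S (k a, l b)" if "a : carrier A" "b : carrier B" for a b
  by (rule trans[OF TT(2)]) (use that in \<open>auto simp: HA(1,3,6) HB(1,3,6)\<close>)
 have TA: "alg_hom h R A (tensor_prod S A' B') (%a. pure_tensor S A' B' (k a) \<one>\<^bsub>B'\<^esub>)"
  using alg_hom_comp[OF k alg_pair.pure_hom(1)[OF 2] A A' TP' h id_hom] by (simp add: o_def)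
 have TB: "alg_hom h R B (tensor_prod S A' B') (%b. pure_tensor S A' B' \<one>\<^bsub>A'\<^esub> (l b))"
  using alg_hom_comp[OF l alg_pair.pure_hom(2)[OF 2] B B' TP' h id_hom] by (simp add: o_def)
 obtain L where L: "alg_hom h R (tensor_prod R A B) (tensor_prod S A' B') L"
  "!!a b. a : carrier A ==> b : carrier B ==> L (pure_tensor R A B a b) = pure_tensor S A' B' (k a) (l b)"
  by (rule alg_pair.tp_lift[OF 1 TP' h TA TB]) (simp_all add: alg_pair.pure_mult[OF 2] HA(1) HB(1))
 have e: "tensor_prod_map R S A' B' h k l C = L C" if C: "C : carrier (tensor_prod R A B)" for C unfolding tensor_prod_map_def
  by (rule quot_map_eq[OF T alg_pair.pair_assoc[OF 1] alg_pair.pair_assoc[OF 2] h alg_pair.tp_ideal[OF 1] alg_pair.tp_ideal[OF 2] _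
    alg_pair.pair_generated[OF 1] L(1)[unfolded tensor_prod_def] _ C[unfolded tensor_prod_def]])
   (use L(2) Tm alg_pair.pair_monom_closed[OF 1] in \<open>auto simp: pure_tensor_def\<close>)
 show "alg_hom h R (tensor_prod R A B) (tensor_prod S A' B') (tensor_prod_map R S A' B' h k l)" by (rule alg_hom_cong[OF L(1) TP e])
 show "a : carrier A ==> b : carrier B ==>
   tensor_prod_map R S A' B' h k l (pure_tensor R A B a b) = pure_tensor S A' B' (k a) (l b)" using e[OF alg_pair.pure_closed[OF 1]] L(2) by simp
qed

section \<open>The algebra generated by the bundle and its gauge algebroid\<close>

definition EA_E :: "('m::topological_space, 'a::euclidean_space, 'v::real_vector, 'z) pe_bundle_scheme
  => 'm set => ('m => 'v) => ('m, 'v) EA_tensor set" where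
 "EA_E E U X = EA_ideal E U +>\<^bsub>ext_sym E U\<^esub>
  pure_tensor (Cinf E U) (ext_E E U) (sym_A E U) (ext_incl (Cinf E U) (sections E U) X) \<one>\<^bsub>sym_A E U\<^esub>"

definition EA_A :: "('m::topological_space, 'a::euclidean_space, 'v::real_vector, 'z) pe_bundle_scheme
  => 'm set => ('m, 'v) cdo => ('m, 'v) EA_tensor set" where
 "EA_A E U D = EA_ideal E U +>\<^bsub>ext_sym E U\<^esub>
  pure_tensor (Cinf E U) (ext_E E U) (sym_A E U) \<one>\<^bsub>ext_E E U\<^esub> (sym_incl (Cinf E U) (gauge E U) D)"

definition EA_gens :: "('m::topological_space, 'a::euclidean_space, 'v::real_vector, 'z) pe_bundle_scheme
  => 'm set => ('m, 'v) EA_tensor set" where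
 "EA_gens E U = {pure_tensor (Cinf E U) (ext_E E U) (sym_A E U) \<omega> \<one>\<^bsub>sym_A E U\<^esub> \<ominus>\<^bsub>ext_sym E U\<^esub>
   pure_tensor (Cinf E U) (ext_E E U) (sym_A E U) \<one>\<^bsub>ext_E E U\<^esub> (sym_incl (Cinf E U) (gauge E U) D)
   | \<omega> D. (\<omega>, D) : wedge2_embedding E U}"

locale EA =
 fixes E :: "('m::topological_space, 'a::euclidean_space, 'v::real_vector, 'z) pe_bundle_scheme" and U :: "'m set"
 assumes sec: "gen_module (Cinf E U) (sections E U)" and gau: "gen_module (Cinf E U) (gauge E U)" and gab: "abelian_group (gauge E U)"
  and wedge: "e1 : secs E U ==> e2 : secs E U ==>
   wedge_cdo E U e1 e2 : gaug E U"
begin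

abbreviation "C == Cinf E U"
abbreviation "ei == ext_incl (Cinf E U) (sections E U)"
abbreviation "sj == sym_incl (Cinf E U) (gauge E U)"
abbreviation "pt == pure_tensor (Cinf E U) (ext_E E U) (sym_A E U)"

lemmas ext_assoc = gen_module.ext_assoc[OF sec, folded ext_E_def] and ext_lin = gen_module.ext_lin[OF sec, folded ext_E_def]
 and ext_closed = gen_module.ext_incl_closed[OF sec, folded ext_E_def] and ext_square = gen_module.ext_square[OF sec, folded ext_E_def]
 and ext_generated = gen_module.ext_generated[OF sec, folded ext_E_def] and sym_assoc = gen_module.sym_assoc[OF gau, folded sym_A_def]
 and sym_lin = gen_module.sym_lin[OF gau, folded sym_A_def] and sym_closed = gen_module.sym_incl_closed[OF gau, folded sym_A_def]
 and sym_commute = gen_module.sym_commute[OF gau, folded sym_A_def] and sym_generated = gen_module.sym_generated[OF gau, folded sym_A_def]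

lemma pair: "alg_pair C (ext_E E U) (sym_A E U)" by (rule alg_pair.intro[OF ext_assoc sym_assoc])

lemmas ts_assoc = alg_pair.tp_assoc[OF pair, folded ext_sym_def] and pt_closed = alg_pair.pure_closed[OF pair, folded ext_sym_def]
 and pt_mult = alg_pair.pure_mult[OF pair, folded ext_sym_def] and pt_one = alg_pair.pure_one[OF pair, folded ext_sym_def]
 and pt_lin = alg_pair.pure_lin[OF pair, folded ext_sym_def] and ts_generated = alg_pair.tp_generated[OF pair, folded ext_sym_def]

lemma ext_ring: "ring (ext_E E U)" and sym_ring: "ring (sym_A E U)" and ts_ring: "ring (ext_sym E U)"
 using assoc_algD(2)[OF ext_assoc] assoc_algD(2)[OF sym_assoc] assoc_algD(2)[OF ts_assoc] by auto

lemma ext_one_closed: "\<one>\<^bsub>ext_E E U\<^esub> : carrier (ext_E E U)"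
 and sym_one_closed: "\<one>\<^bsub>sym_A E U\<^esub> : carrier (sym_A E U)" using ext_ring sym_ring by (auto simp: ring.ring_simprules)

text \<open>The embedding is given as a subgroup of pairs, so statements about it are proved by
  induction over \<open>generate\<close>. Membership of both components is carried along because the
  cases for inverses and sums are only available inside the carriers.\<close>

lemma wedge2_induct:
 assumes w: "(\<omega>, D) : wedge2_embedding E U" and z: "P \<zero>\<^bsub>ext_E E U\<^esub> \<zero>\<^bsub>gauge E U\<^esub>"
  and g: "!!e1 e2. e1 : secs E U ==> e2 : secs E U ==>
   P (ei e1 \<otimes>\<^bsub>ext_E E U\<^esub> ei e2) (wedge_cdo E U e1 e2)"
  and n: "!!\<omega> D. \<omega> : carrier (ext_E E U) ==> D : gaug E U ==> P \<omega> D ==> P (\<ominus>\<^bsub>ext_E E U\<^esub> \<omega>) (\<ominus>\<^bsub>gauge E U\<^esub> D)"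
  and a: "!!\<omega> D \<omega>' D'. \<omega> : carrier (ext_E E U) ==> D : gaug E U ==> P \<omega> D ==>
   \<omega>' : carrier (ext_E E U) ==> D' : gaug E U ==> P \<omega>' D' ==>
   P (\<omega> \<oplus>\<^bsub>ext_E E U\<^esub> \<omega>') (D \<oplus>\<^bsub>gauge E U\<^esub> D')"
 shows "\<omega> : carrier (ext_E E U) & D : gaug E U & P \<omega> D"
proof -
 interpret X: ring "ext_E E U" by (rule ext_ring)
 interpret G: abelian_group "gauge E U" by (rule gab)
 have base: "ei e1 \<otimes>\<^bsub>ext_E E U\<^esub> ei e2 : carrier (ext_E E U)" if "e1 : secs E U" "e2 : secs E U" for e1 e2
  using ext_closed that by simp
 have "case p of (\<omega>, D) => \<omega> : carrier (ext_E E U) & D : gaug E U & P \<omega> D"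
  if "p : wedge2_embedding E U" for p using that unfolding wedge2_embedding_def
 proof (induction p rule: generate.induct)
  case one
  thus ?case using z by simp
 next
  case (incl h)
  thus ?case using g base wedge by auto
 next
  case (inv h)
  then obtain e1 e2 where e: "e1 : secs E U" "e2 : secs E U"
   "h = (ei e1 \<otimes>\<^bsub>ext_E E U\<^esub> ei e2, wedge_cdo E U e1 e2)" by blast
  have "inv\<^bsub>add_monoid (ext_E E U) \<times>\<times> add_monoid (gauge E U)\<^esub> h =
   (\<ominus>\<^bsub>ext_E E U\<^esub> (ei e1 \<otimes>\<^bsub>ext_E E U\<^esub> ei e2), \<ominus>\<^bsub>gauge E U\<^esub> wedge_cdo E U e1 e2)"
   using base[OF e(1,2)] wedge[OF e(1,2)] unfolding e(3) a_inv_def by (intro inv_DirProd) (auto simp: X.a_group G.a_group)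
  thus ?case using n g e base wedge by auto
 next
  case (eng h1 h2)
  obtain w1 D1 w2 D2 where h: "h1 = (w1, D1)" "h2 = (w2, D2)" by (metis surj_pair)
  show ?case using eng.IH a[of w1 D1 w2 D2] unfolding h by (simp add: X.a_closed G.a_closed)
 qed
 from this[OF w] show ?thesis by simp
qed

lemma wedge2_closed:
 assumes "(\<omega>, D) : wedge2_embedding E U" shows "\<omega> : carrier (ext_E E U)" "D : gaug E U"
 using wedge2_induct[OF assms, of "%_ _. True"] by auto

text \<open>Both maps are additive, so agreement on the products of two sections extends to the
  whole generated graph. The ideal thus reduces to the relations e1 e2 =
  \<open>wedge_cdo E U e1 e2\<close>.\<close>

lemma wedge2_agree:
 assumes w: "(\<omega>, D) : wedge2_embedding E U" and B: "assoc_alg S B" and h: "h : ring_hom C S"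
  and T: "alg_hom h C (ext_E E U) B T" and k: "lin_map h C (gauge E U) B k"
  and e: "!!e1 e2. e1 : secs E U ==> e2 : secs E U ==>
   T (ei e1) \<otimes>\<^bsub>B\<^esub> T (ei e2) = k (wedge_cdo E U e1 e2)" shows "T \<omega> = k D"
proof -
 interpret X: ring "ext_E E U" by (rule ext_ring)
 interpret G: abelian_group "gauge E U" by (rule gab)
 interpret B: ring B using assoc_algD(2)[OF B] .
 note H = alg_homD[OF T ext_assoc B h]
 have kc: "D : gaug E U ==> k D : carrier B" for D using k by (simp add: lin_map_def)
 have ka: "D : gaug E U ==> D' : gaug E U ==> k (D \<oplus>\<^bsub>gauge E U\<^esub> D') = k D \<oplus>\<^bsub>B\<^esub> k D'" for D D'
  using k by (simp add: lin_map_def)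
 have kz: "k \<zero>\<^bsub>gauge E U\<^esub> = \<zero>\<^bsub>B\<^esub>"
  using ka[of "\<zero>\<^bsub>gauge E U\<^esub>" "\<zero>\<^bsub>gauge E U\<^esub>"] kc[of "\<zero>\<^bsub>gauge E U\<^esub>"] by (simp add: B.add.l_cancel_one)
 have "\<omega> : carrier (ext_E E U) & D : gaug E U & T \<omega> = k D"
 proof (rule wedge2_induct[OF w])
  fix \<omega> D assume a: "\<omega> : carrier (ext_E E U)" "D : gaug E U" "T \<omega> = k D"
  have "T (\<ominus>\<^bsub>ext_E E U\<^esub> \<omega>) \<oplus>\<^bsub>B\<^esub> T \<omega> = \<zero>\<^bsub>B\<^esub>"
   using a H(2)[of "\<ominus>\<^bsub>ext_E E U\<^esub> \<omega>" \<omega>] H(7) by (simp add: X.l_neg)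
  moreover have "k (\<ominus>\<^bsub>gauge E U\<^esub> D) \<oplus>\<^bsub>B\<^esub> k D = \<zero>\<^bsub>B\<^esub>"
   using a ka[of "\<ominus>\<^bsub>gauge E U\<^esub> D" D] kz by (simp add: G.l_neg)
  ultimately show "T (\<ominus>\<^bsub>ext_E E U\<^esub> \<omega>) = k (\<ominus>\<^bsub>gauge E U\<^esub> D)"
   using a H(1)[of \<omega>] H(1)[of "\<ominus>\<^bsub>ext_E E U\<^esub> \<omega>"] kc[of "\<ominus>\<^bsub>gauge E U\<^esub> D"]
    B.minus_equality[of "T (\<ominus>\<^bsub>ext_E E U\<^esub> \<omega>)" "T \<omega>"] B.minus_equality[of "k (\<ominus>\<^bsub>gauge E U\<^esub> D)" "T \<omega>"]
   by (simp add: X.a_inv_closed G.a_inv_closed)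
 qed (use H(2,3,7) kz ka e ext_closed in auto)
 thus ?thesis by simp
qed

lemma EA_gens_closed: "EA_gens E U <= carrier (ext_sym E U)"
proof -
 interpret T: ring "ext_sym E U" by (rule ts_ring)
 show ?thesis unfolding EA_gens_def using wedge2_closed ext_one_closed sym_one_closed sym_closed by (auto intro!: T.minus_closed pt_closed)
qed

lemma EA_ideal_eq: "EA_ideal E U = genideal (ext_sym E U) (EA_gens E U)" by (simp add: EA_ideal_def EA_gens_def)

lemma EA_ideal: "ideal (EA_ideal E U) (ext_sym E U)" unfolding EA_ideal_eq using ts_ring EA_gens_closed by (simp add: ring.genideal_ideal)

lemma EA_assoc: "assoc_alg C (EA_alg E U)" unfolding EA_alg_def by (rule quot_assoc_alg[OF ts_assoc EA_ideal])

lemmas EA_proj = quot_assoc_alg(2)[OF ts_assoc EA_ideal, folded EA_alg_def]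
lemmas EA_projD = alg_homD[OF EA_proj ts_assoc EA_assoc id_hom]

lemma EA_E_lin: "lin_map id C (sections E U) (EA_alg E U) (EA_E E U)"
proof -
 have "lin_map id C (sections E U) (ext_sym E U) (%X. pt (ei X) \<one>\<^bsub>sym_A E U\<^esub>)"
  using ext_lin pt_lin(1)[OF sym_one_closed] by (auto simp: lin_map_def)
 from lin_map_comp[OF this EA_proj ts_assoc EA_assoc id_hom id_hom] show ?thesis by (simp add: o_def EA_E_def[abs_def] id_def)
qed

lemma EA_A_lin: "lin_map id C (gauge E U) (EA_alg E U) (EA_A E U)"
proof -
 have "lin_map id C (gauge E U) (ext_sym E U) (%X. pt \<one>\<^bsub>ext_E E U\<^esub> (sj X))"
  using sym_lin pt_lin(2)[OF ext_one_closed] by (auto simp: lin_map_def)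
 from lin_map_comp[OF this EA_proj ts_assoc EA_assoc id_hom id_hom] show ?thesis by (simp add: o_def EA_A_def[abs_def] id_def)
qed

lemma EA_E_closed: "X : secs E U ==> EA_E E U X : carrier (EA_alg E U)"
 and EA_A_closed: "D : gaug E U ==> EA_A E U D : carrier (EA_alg E U)" using EA_E_lin EA_A_lin by (auto simp: lin_map_def)

lemma EA_mult:
 assumes "a : carrier (ext_E E U)" "b : carrier (sym_A E U)" "a' : carrier (ext_E E U)" "b' : carrier (sym_A E U)"
 shows "(EA_ideal E U +>\<^bsub>ext_sym E U\<^esub> pt a b) \<otimes>\<^bsub>EA_alg E U\<^esub> (EA_ideal E U +>\<^bsub>ext_sym E U\<^esub> pt a' b') =
  EA_ideal E U +>\<^bsub>ext_sym E U\<^esub> pt (a \<otimes>\<^bsub>ext_E E U\<^esub> a') (b \<otimes>\<^bsub>sym_A E U\<^esub> b')"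
 using EA_projD(3)[OF pt_closed[OF assms(1,2)] pt_closed[OF assms(3,4)]] pt_mult[OF assms] by simp

lemma EA_E_square:
 assumes X: "X : secs E U" shows "EA_E E U X \<otimes>\<^bsub>EA_alg E U\<^esub> EA_E E U X = \<zero>\<^bsub>EA_alg E U\<^esub>"
proof -
 interpret S: ring "sym_A E U" by (rule sym_ring)
 interpret T: ring "ext_sym E U" by (rule ts_ring)
 note l = pt_lin(1)[OF sym_one_closed]
 interpret XX: ring "ext_E E U" by (rule ext_ring)
 have "pt \<zero>\<^bsub>ext_E E U\<^esub> \<one>\<^bsub>sym_A E U\<^esub> \<oplus>\<^bsub>ext_sym E U\<^esub> pt \<zero>\<^bsub>ext_E E U\<^esub> \<one>\<^bsub>sym_A E U\<^esub> = pt \<zero>\<^bsub>ext_E E U\<^esub> \<one>\<^bsub>sym_A E U\<^esub>"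
  using l unfolding lin_map_def by (metis XX.r_zero XX.zero_closed)
 hence "pt \<zero>\<^bsub>ext_E E U\<^esub> \<one>\<^bsub>sym_A E U\<^esub> = \<zero>\<^bsub>ext_sym E U\<^esub>"
  using pt_closed[OF XX.zero_closed sym_one_closed] by (simp add: T.add.l_cancel_one)
 thus ?thesis unfolding EA_E_def using EA_mult[OF ext_closed[OF X] sym_one_closed ext_closed[OF X] sym_one_closed] ext_square[OF X] EA_projD(7)
  by simp
qed

lemma EA_A_central:
 assumes D: "D : gaug E U"
 shows "X : secs E U ==> EA_A E U D \<otimes>\<^bsub>EA_alg E U\<^esub> EA_E E U X = EA_E E U X \<otimes>\<^bsub>EA_alg E U\<^esub> EA_A E U D"
  and "D' : gaug E U ==> EA_A E U D \<otimes>\<^bsub>EA_alg E U\<^esub> EA_A E U D' = EA_A E U D' \<otimes>\<^bsub>EA_alg E U\<^esub> EA_A E U D"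
proof -
 interpret S: ring "sym_A E U" by (rule sym_ring)
 interpret XX: ring "ext_E E U" by (rule ext_ring)
 show "X : secs E U ==> EA_A E U D \<otimes>\<^bsub>EA_alg E U\<^esub> EA_E E U X = EA_E E U X \<otimes>\<^bsub>EA_alg E U\<^esub> EA_A E U D"
  unfolding EA_A_def EA_E_def using EA_mult ext_closed sym_closed[OF D] ext_one_closed sym_one_closed by simp
 show "D' : gaug E U ==> EA_A E U D \<otimes>\<^bsub>EA_alg E U\<^esub> EA_A E U D' = EA_A E U D' \<otimes>\<^bsub>EA_alg E U\<^esub> EA_A E U D"
  unfolding EA_A_def using EA_mult sym_closed D ext_one_closed sym_one_closed sym_commute by simp
qed

lemma EA_wedge:
 assumes e: "e1 : secs E U" "e2 : secs E U"
 shows "EA_E E U e1 \<otimes>\<^bsub>EA_alg E U\<^esub> EA_E E U e2 = EA_A E U (wedge_cdo E U e1 e2)"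
proof -
 interpret S: ring "sym_A E U" by (rule sym_ring)
 interpret XX: ring "ext_E E U" by (rule ext_ring)
 interpret T: ring "ext_sym E U" by (rule ts_ring)
 note c = ext_closed[OF e(1)] ext_closed[OF e(2)]
 have "(ei e1 \<otimes>\<^bsub>ext_E E U\<^esub> ei e2, wedge_cdo E U e1 e2) : wedge2_embedding E U"
  unfolding wedge2_embedding_def by (rule generate.incl) (use e in blast)
 hence "pt (ei e1 \<otimes>\<^bsub>ext_E E U\<^esub> ei e2) \<one>\<^bsub>sym_A E U\<^esub> \<ominus>\<^bsub>ext_sym E U\<^esub> pt \<one>\<^bsub>ext_E E U\<^esub> (sj (wedge_cdo E U e1 e2))
   : EA_gens E U" unfolding EA_gens_def by blast
 hence "pt (ei e1 \<otimes>\<^bsub>ext_E E U\<^esub> ei e2) \<one>\<^bsub>sym_A E U\<^esub> \<ominus>\<^bsub>ext_sym E U\<^esub> pt \<one>\<^bsub>ext_E E U\<^esub> (sj (wedge_cdo E U e1 e2))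
   : EA_ideal E U" unfolding EA_ideal_eq using T.genideal_self[OF EA_gens_closed] by blast
 from coset_eqI[OF ts_ring EA_ideal _ _ this] show ?thesis unfolding EA_A_def EA_E_def
  using EA_mult[OF c(1) sym_one_closed c(2) sym_one_closed] c ext_one_closed sym_one_closed sym_closed[OF wedge[OF e]] by (simp add: pt_closed)
qed

lemma EA_gen_closed: "EA_E E U ` secs E U Un EA_A E U ` gaug E U <= carrier (EA_alg E U)" using EA_E_closed EA_A_closed by auto

abbreviation "ts_gens == (%g. pt g \<one>\<^bsub>sym_A E U\<^esub>) ` ei ` secs E U Un (%g. pt \<one>\<^bsub>ext_E E U\<^esub> g) ` sj ` gaug E U"

lemma ts_gens: "ts_gens <= carrier (ext_sym E U)" "b : carrier (ext_sym E U) ==> b : alg_span C (ext_sym E U) ts_gens"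
proof -
 show "ts_gens <= carrier (ext_sym E U)" using pt_closed ext_closed sym_closed ext_one_closed sym_one_closed by auto
 show "b : carrier (ext_sym E U) ==> b : alg_span C (ext_sym E U) ts_gens"
  by (rule ts_generated) (use ext_closed sym_closed ext_generated sym_generated in auto)
qed

lemma EA_generated:
 "a : carrier (EA_alg E U) ==>
  a : alg_span C (EA_alg E U) (EA_E E U ` secs E U Un EA_A E U ` gaug E U)"
 using quot_generated[OF ts_assoc EA_ideal ts_gens, folded EA_alg_def] by (simp add: image_Un image_image EA_E_def EA_A_def)

text \<open>Universal property in terms of the two kinds of generators: sections square to zero,
  operators commute with all generators, and a product of two sections is the image of their wedge.
  Restriction maps and the passage to polynomials are both obtained from it.\<close>

lemma EA_lift:
 assumes B: "assoc_alg S B" and h: "h : ring_hom C S" and k: "lin_map h C (sections E U) B k" and l: "lin_map h C (gauge E U) B l"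
  and sq: "!!X. X : secs E U ==> k X \<otimes>\<^bsub>B\<^esub> k X = \<zero>\<^bsub>B\<^esub>"
  and kl: "!!X D. X : secs E U ==> D : gaug E U ==> k X \<otimes>\<^bsub>B\<^esub> l D = l D \<otimes>\<^bsub>B\<^esub> k X"
  and ll: "!!D D'. D : gaug E U ==> D' : gaug E U ==> l D \<otimes>\<^bsub>B\<^esub> l D' = l D' \<otimes>\<^bsub>B\<^esub> l D"
  and w: "!!e1 e2. e1 : secs E U ==> e2 : secs E U ==>
   k e1 \<otimes>\<^bsub>B\<^esub> k e2 = l (wedge_cdo E U e1 e2)"
 obtains T where "alg_hom h C (EA_alg E U) B T"
  "!!X. X : secs E U ==> T (EA_E E U X) = k X"
  "!!D. D : gaug E U ==> T (EA_A E U D) = l D"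
proof -
 interpret B: ring B using assoc_algD(2)[OF B] .
 obtain TA where TA: "alg_hom h C (ext_E E U) B TA" "!!X. X : secs E U ==> TA (ei X) = k X"
  using gen_module.ext_lift[OF sec B h k sq] unfolding ext_E_def by blast
 obtain TB where TB: "alg_hom h C (sym_A E U) B TB" "!!D. D : gaug E U ==> TB (sj D) = l D"
  using gen_module.sym_lift[OF gau B h l ll] unfolding sym_A_def by blast
 note HA = alg_homD[OF TA(1) ext_assoc B h] and HB = alg_homD[OF TB(1) sym_assoc B h]
 have kc: "k ` secs E U <= carrier B" "l ` gaug E U <= carrier B" using k l by (auto simp: lin_map_def)
 have comm: "TA a \<otimes>\<^bsub>B\<^esub> TB b = TB b \<otimes>\<^bsub>B\<^esub> TA a" if a: "a : carrier (ext_E E U)" and b: "b : carrier (sym_A E U)" for a b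
 proof (rule alg_span_commute[OF B kc])
  have "TA ` ei ` secs E U = k ` secs E U" using TA(2) by (force simp: image_image)
  thus "TA a : alg_span S B (k ` secs E U)" using alg_span_image[OF TA(1) ext_assoc B h _ ext_generated[OF a]] ext_closed by auto
  have "TB ` sj ` gaug E U = l ` gaug E U" using TB(2) by (force simp: image_image)
  thus "TB b : alg_span S B (l ` gaug E U)" using alg_span_image[OF TB(1) sym_assoc B h _ sym_generated[OF b]] sym_closed
   by (simp add: image_subset_iff)
 qed (use kl in auto)
 obtain T where T: "alg_hom h C (ext_sym E U) B T"
  "!!a b. a : carrier (ext_E E U) ==> b : carrier (sym_A E U) ==> T (pt a b) = TA a \<otimes>\<^bsub>B\<^esub> TB b"
  using alg_pair.tp_lift[OF pair B h TA(1) TB(1) comm] unfolding ext_sym_def by blast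
 note H = alg_homD[OF T(1) ts_assoc B h]
 have z: "T s = \<zero>\<^bsub>B\<^esub>" if s: "s : EA_gens E U" for s
 proof -
  obtain \<omega> D where o: "(\<omega>, D) : wedge2_embedding E U"
   "s = pt \<omega> \<one>\<^bsub>sym_A E U\<^esub> \<ominus>\<^bsub>ext_sym E U\<^esub> pt \<one>\<^bsub>ext_E E U\<^esub> (sj D)" using s unfolding EA_gens_def by blast
  note c = wedge2_closed[OF o(1)]
  have "TA \<omega> = l D" by (rule wedge2_agree[OF o(1) B h TA(1) l]) (use TA(2) w in simp)
  moreover have "l D : carrier B" using kc(2) c(2) by blast
  ultimately show ?thesis unfolding o(2) using c ext_one_closed sym_one_closed sym_closed HA(1)
   by (simp add: H(4) pt_closed T(2) HA(6) HB(1,6) TB(2) B.minus_eq B.r_neg)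
 qed
 show thesis
 proof (rule that[of "quot_lift T"])
  show "alg_hom h C (EA_alg E U) B (quot_lift T)" unfolding EA_alg_def EA_ideal_eq by (rule quot_lift_hom[OF T(1) ts_assoc B h EA_gens_closed z])
  note q = quot_lift_eq(2)[OF T(1) ts_assoc B h EA_gens_closed z, folded EA_ideal_eq]
  show "quot_lift T (EA_E E U X) = k X" if "X : secs E U" for X unfolding EA_E_def using q[OF _ pt_closed] ext_closed sym_one_closed that kc
   by (simp add: T(2) TA(2) HB(6) image_subset_iff)
  show "quot_lift T (EA_A E U D) = l D" if "D : gaug E U" for D unfolding EA_A_def using q[OF _ pt_closed] sym_closed ext_one_closed that kc
   by (simp add: T(2) TB(2) HA(6) image_subset_iff)
 qed
qed

text \<open>Rewrites the monomials that define the grading as products of generators, so that a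
  homomorphism can be evaluated on them factor by factor.\<close>

lemma EA_monom_eq:
 assumes es: "es : lists (secs E U)" and Ds: "Ds : lists (gaug E U)" shows "EA_monom E U es Ds =
  foldr (%X. (\<otimes>\<^bsub>EA_alg E U\<^esub>) (EA_E E U X)) es \<one>\<^bsub>EA_alg E U\<^esub> \<otimes>\<^bsub>EA_alg E U\<^esub>
  foldr (%D. (\<otimes>\<^bsub>EA_alg E U\<^esub>) (EA_A E U D)) Ds \<one>\<^bsub>EA_alg E U\<^esub>"
proof -
 interpret S: ring "sym_A E U" by (rule sym_ring)
 interpret XX: ring "ext_E E U" by (rule ext_ring)
 let ?p = "%x. EA_ideal E U +>\<^bsub>ext_sym E U\<^esub> x"
 have one: "\<one>\<^bsub>EA_alg E U\<^esub> = ?p (pt \<one>\<^bsub>ext_E E U\<^esub> \<one>\<^bsub>sym_A E U\<^esub>)"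
  using EA_projD(6) pt_one by simp
 have 1: "alg_prod_list (ext_E E U) (map ei es) : carrier (ext_E E U)
  & ?p (pt (alg_prod_list (ext_E E U) (map ei es)) \<one>\<^bsub>sym_A E U\<^esub>) =
   foldr (%X. (\<otimes>\<^bsub>EA_alg E U\<^esub>) (EA_E E U X)) es \<one>\<^bsub>EA_alg E U\<^esub>" using es
 proof (induction es)
  case (Cons X es)
  thus ?case using EA_mult[OF ext_closed[of X] sym_one_closed, of "alg_prod_list (ext_E E U) (map ei es)" "\<one>\<^bsub>sym_A E U\<^esub>"] sym_one_closed
   by (simp add: alg_prod_list_def EA_E_def ext_closed)
 qed (simp add: alg_prod_list_def one)
 have 2: "alg_prod_list (sym_A E U) (map sj Ds) : carrier (sym_A E U)
  & ?p (pt \<one>\<^bsub>ext_E E U\<^esub> (alg_prod_list (sym_A E U) (map sj Ds))) =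
   foldr (%D. (\<otimes>\<^bsub>EA_alg E U\<^esub>) (EA_A E U D)) Ds \<one>\<^bsub>EA_alg E U\<^esub>" using Ds
 proof (induction Ds)
  case (Cons D Ds)
  thus ?case using EA_mult[OF ext_one_closed sym_closed[of D] ext_one_closed, of "alg_prod_list (sym_A E U) (map sj Ds)"]
   by (simp add: alg_prod_list_def EA_A_def sym_closed)
 qed (simp add: alg_prod_list_def one)
 show ?thesis unfolding EA_monom_def conjunct2[OF 1, symmetric] conjunct2[OF 2, symmetric]
  using EA_mult[of "alg_prod_list (ext_E E U) (map ei es)" "\<one>\<^bsub>sym_A E U\<^esub>" "\<one>\<^bsub>ext_E E U\<^esub>" "alg_prod_list (sym_A E U) (map sj Ds)"]
   1 2 ext_one_closed sym_one_closed by simp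
qed

end

text \<open>The restriction is assembled through several layers of quotients. Each layer is
  identified on generators, and the outermost one with the homomorphism supplied by
  \<open>EA_lift\<close>.\<close>

lemma EA_restr_hom:
 fixes E :: "('m::topological_space, 'a::euclidean_space, 'v::real_vector, 'z) pe_bundle_scheme"
 assumes U: "EA E U" and V: "EA E V" and h: "cut V : ring_hom (Cinf E U) (Cinf E V)"
  and k: "lin_map (cut V) (Cinf E U) (sections E U) (sections E V) (cut V)"
  and l: "lin_map (cut V) (Cinf E U) (gauge E U) (gauge E V) (gauge_restr E U V)"
  and w: "!!e1 e2. e1 : secs E U ==> e2 : secs E U ==>
   gauge_restr E U V (wedge_cdo E U e1 e2) = wedge_cdo E V (cut V e1) (cut V e2)"
 shows "alg_hom (cut V) (Cinf E U) (EA_alg E U) (EA_alg E V) (EA_restr E U V)"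
  and "X : secs E U ==> EA_restr E U V (EA_E E U X) = EA_E E V (cut V X)"
  and "D : gaug E U ==> EA_restr E U V (EA_A E U D) = EA_A E V (gauge_restr E U V D)"
proof -
 let ?k = "ext_alg_map (Cinf E U) (Cinf E V) (sections E V) (cut V) (cut V)"
 let ?l = "sym_alg_map (Cinf E U) (Cinf E V) (gauge E V) (cut V) (gauge_restr E U V)"
 note k' = ext_map[OF EA.sec[OF U] EA.sec[OF V] h k, folded ext_E_def]
 note l' = sym_map[OF EA.gau[OF U] EA.gau[OF V] h l, folded sym_A_def]
 note T = tensor_prod_map[OF EA.pair[OF U] EA.pair[OF V] h k'(1) l'(1), folded ext_sym_def]
 note HA = alg_homD(6)[OF k'(1) EA.ext_assoc[OF U] EA.ext_assoc[OF V] h]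
 note HB = alg_homD(6)[OF l'(1) EA.sym_assoc[OF U] EA.sym_assoc[OF V] h]
 note c = EA.ext_one_closed[OF U] EA.sym_one_closed[OF U] EA.ext_closed[OF U] EA.sym_closed[OF U]
 have sc: "X : secs E U ==> cut V X : carrier (sections E V)"
  and gc: "D : gaug E U ==> gauge_restr E U V D : carrier (gauge E V)" for X D using k l by (simp_all add: lin_map_def)
 obtain L where L: "alg_hom (cut V) (Cinf E U) (EA_alg E U) (EA_alg E V) L"
  "!!X. X : secs E U ==> L (EA_E E U X) = EA_E E V (cut V X)"
  "!!D. D : gaug E U ==> L (EA_A E U D) = EA_A E V (gauge_restr E U V D)"
  by (rule EA.EA_lift[OF U EA.EA_assoc[OF V] h lin_map_trans[OF h k EA.EA_E_lin[OF V]] lin_map_trans[OF h l EA.EA_A_lin[OF V]]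
    EA.EA_E_square[OF V sc] EA.EA_A_central(1)[OF V gc sc, symmetric] EA.EA_A_central(2)[OF V gc gc]])
   (simp_all only: w EA.EA_wedge[OF V sc sc])
 have e: "EA_restr E U V S = L S" if S: "S : carrier (EA_alg E U)" for S unfolding EA_restr_def
 proof (rule quot_map_eq[OF T(1) EA.ts_assoc[OF U] EA.ts_assoc[OF V] h EA.EA_ideal[OF U] EA.EA_ideal[OF V]
    EA.ts_gens[OF U] L(1)[unfolded EA_alg_def] _ S[unfolded EA_alg_def]])
  fix g assume "g : EA.ts_gens E U"
  then consider X where "X : secs E U"
    "g = pure_tensor (Cinf E U) (ext_E E U) (sym_A E U) (ext_incl (Cinf E U) (sections E U) X) \<one>\<^bsub>sym_A E U\<^esub>"
   | D where "D : gaug E U"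
    "g = pure_tensor (Cinf E U) (ext_E E U) (sym_A E U) \<one>\<^bsub>ext_E E U\<^esub> (sym_incl (Cinf E U) (gauge E U) D)" by blast
  thus "L (EA_ideal E U +>\<^bsub>ext_sym E U\<^esub> g) = EA_ideal E V +>\<^bsub>ext_sym E V\<^esub>
    tensor_prod_map (Cinf E U) (Cinf E V) (ext_E E V) (sym_A E V) (cut V) ?k ?l g"
  proof cases
   case 1 thus ?thesis using L(2)[OF 1(1)] c by (simp add: EA_E_def T(2) k'(2) HB)
  next
   case 2 thus ?thesis using L(3)[OF 2(1)] c by (simp add: EA_A_def T(2) l'(2) HA)
  qed
 qed
 show "alg_hom (cut V) (Cinf E U) (EA_alg E U) (EA_alg E V) (EA_restr E U V)" by (rule alg_hom_cong[OF L(1) EA.EA_assoc[OF U] e])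
 show "X : secs E U ==> EA_restr E U V (EA_E E U X) = EA_E E V (cut V X)" using e[OF EA.EA_E_closed[OF U]] L(2) by simp
 show "D : gaug E U ==> EA_restr E U V (EA_A E U D) = EA_A E V (gauge_restr E U V D)"
  using e[OF EA.EA_A_closed[OF U]] L(3) by simp
qed

section \<open>Polynomials in odd and even variables\<close>

lemma lookup_spoly_scale: "coef (pscl c F) k = c * coef F k"
 unfolding spoly_scale_def by transfer (simp add: when_def)

lemma spoly_scale_add: "pscl c (F + G) = pscl c F + pscl c G"
 and spoly_scale_add_left: "pscl (c + d) F = pscl c F + pscl d F"
 and spoly_scale_scale: "pscl c (pscl d F) = pscl (c * d) F" and spoly_scale_one: "pscl 1 F = F"
 and spoly_scale_zero: "pscl 0 F = 0" "pscl c 0 = 0"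
 and spoly_scale_single: "pscl c (sgl k d) = sgl k (c * d)"
 and spoly_scale_minus: "pscl (- c) F = - pscl c F" "pscl c (- F) = - pscl c F"
 by (rule poly_mapping_eqI; simp add: lookup_spoly_scale lookup_add lookup_single when_def algebra_simps)+

lemma spoly_scale_sum: "pscl c (SUM i:I. F i) = (SUM i:I. pscl c (F i))"
 by (induction I rule: infinite_finite_induct) (simp_all add: spoly_scale_zero spoly_scale_add)

lemma spoly_sum_scale: "pscl (SUM i:I. c i) F = (SUM i:I. pscl (c i) F)"
 by (induction I rule: infinite_finite_induct) (simp_all add: spoly_scale_zero spoly_scale_add_left)

lemma keys_spoly_scale: "supp (pscl c F) <= supp F" by (auto simp: in_keys_iff lookup_spoly_scale)

lemma spoly_sum_keys:
 "finite K ==> supp F <= K ==> F = (SUM k:K. sgl k (coef F k))"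
 by (rule poly_mapping_eqI)
  (auto simp: lookup_sum lookup_single when_def in_keys_iff sum.delta subset_iff)

lemma spoly_induct [case_names zero single add]:
 fixes F :: "'b \<Rightarrow>\<^sub>0 real"
 assumes "P 0" "!!k c. P (sgl k c)" "!!F G. P F ==> P G ==> P (F + G)" shows "P F"
proof -
 have "P (SUM k:K. sgl k (coef F k))" if "finite K" for K using that by (induction K) (auto intro: assms)
 from this[OF finite_keys[of F]] show ?thesis using spoly_sum_keys[OF finite_keys order_refl, of F] by simp
qed

subsection \<open>The sign of a product of odd monomials\<close>

text \<open>For disjoint sets, the number of adjacent transpositions that sort the increasing list
  of \<open>A\<close> followed by that of \<open>B\<close>.\<close>

definition inv_pairs :: "nat set => nat set => nat" where
 "inv_pairs A B = card {(a, b). a : A & b : B & b < a}"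

definition set_sign :: "nat set => nat set => real" where
 "set_sign A B = (if A Int B ~= {} then 0 else (- 1) ^ inv_pairs A B)"

lemma odd_sign_eq: "odd_sign A B = set_sign (fset A) (fset B)" by (simp add: odd_sign_def set_sign_def inv_pairs_def)

lemma finite_inv_pairs: "finite A ==> finite B ==> finite {(a, b). a : A & b : B & (b::nat) < a}"
 by (rule finite_subset[of _ "A \<times> B"]) auto

lemma inv_pairs_Un_left:
 assumes "finite A" "finite B" "finite C" "A Int B = {}" shows "inv_pairs (A Un B) C = inv_pairs A C + inv_pairs B C"
proof -
 have e: "{(a, b). a : A Un B & b : C & b < a} = {(a, b). a : A & b : C & b < a} Un {(a, b). a : B & b : C & b < a}"
  by auto
 show ?thesis unfolding inv_pairs_def e by (rule card_Un_disjoint) (use assms finite_inv_pairs in auto)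
qed

lemma inv_pairs_Un_right:
 assumes "finite A" "finite B" "finite C" "B Int C = {}" shows "inv_pairs A (B Un C) = inv_pairs A B + inv_pairs A C"
proof -
 have e: "{(a, b). a : A & b : B Un C & b < a} = {(a, b). a : A & b : B & b < a} Un {(a, b). a : A & b : C & b < a}"
  by auto
 show ?thesis unfolding inv_pairs_def e by (rule card_Un_disjoint) (use assms finite_inv_pairs in auto)
qed

text \<open>Inversion numbers are additive over disjoint unions, so both sides count the inversions
  between all three sets; if two of them meet, both sides vanish. This cocycle identity is
  associativity of \<open>spoly_mult\<close> on monomials.\<close>

lemma set_sign_cocycle:
 assumes "finite A" "finite B" "finite C" shows "set_sign A B * set_sign (A Un B) C = set_sign B C * set_sign A (B Un C)"
proof (cases "A Int B = {} & A Int C = {} & B Int C = {}")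
 case True
 hence "A Int B = {}" "A Int C = {}" "B Int C = {}" "(A Un B) Int C = {}" "A Int (B Un C) = {}" by auto
 thus ?thesis using assms by (simp add: set_sign_def inv_pairs_Un_left inv_pairs_Un_right power_add)
next
 case False
 thus ?thesis by (auto simp: set_sign_def)
qed

text \<open>For disjoint sets each pair in \<open>A \<times> B\<close> is an inversion in exactly
  one of the two orders, so the two inversion numbers add up to card A * card B, which is
  even.\<close>

lemma set_sign_swap:
 assumes "finite A" "finite B" "even (card A)" shows "set_sign A B = set_sign B A"
proof (cases "A Int B = {}")
 case True
 have "card (prod.swap ` {(a, b). a : B & b : A & b < a}) = inv_pairs B A"
  unfolding inv_pairs_def by (rule card_image) (rule inj_on_subset[OF inj_swap subset_UNIV])
 moreover have "prod.swap ` {(a, b). a : B & b : A & b < a} = {(a, b). a : A & b : B & a < b}"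
  by (auto simp: image_iff)
 moreover have "A \<times> B = {(a, b). a : A & b : B & b < a} Un {(a, b). a : A & b : B & a < b}"
  using True by auto
 moreover have "finite {(a, b). a : A & b : B & a < b}" by (rule finite_subset[of _ "A \<times> B"]) (use assms in auto)
 moreover have "card ({(a, b). a : A & b : B & b < a} Un {(a, b). a : A & b : B & a < b}) =
   card {(a, b). a : A & b : B & b < a} + card {(a, b). a : A & b : B & a < b}"
  by (rule card_Un_disjoint) (use finite_inv_pairs[OF assms(1,2)] calculation(4) in auto)
 ultimately have "card (A \<times> B) = inv_pairs A B + inv_pairs B A" by (simp only: inv_pairs_def)
 hence "even (inv_pairs A B + inv_pairs B A)" using assms(3) by (metis card_cartesian_product even_mult_iff)
 hence "(- 1 :: real) ^ inv_pairs A B = (- 1) ^ inv_pairs B A" by (simp add: minus_one_power_iff)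
 thus ?thesis using True by (auto simp: set_sign_def)
qed (auto simp: set_sign_def)

lemma set_sign_empty: "set_sign {} A = 1" "set_sign A {} = 1" by (simp_all add: set_sign_def inv_pairs_def)

lemma set_sign_less: "ALL a:A. b < a ==> set_sign {b} A = 1"
proof -
 assume "ALL a:A. b < a"
 hence "b ~: A" "{(a, c). a : {b} & c : A & c < a} = {}" by force+
 thus ?thesis unfolding set_sign_def inv_pairs_def by (simp only:) simp
qed

subsection \<open>The algebra structure\<close>

definition sterm :: "'a spoly => 'a spoly => nat fset \<times> 'a multiset => nat fset \<times> 'a multiset => 'a spoly" where
 "sterm F G k l = sgl (fst k |\<union>| fst l, snd k + snd l)
  (odd_sign (fst k) (fst l) * coef F k * coef G l)"

lemma spoly_mult_superset:
 assumes "finite K" "supp F <= K" "finite L" "supp G <= L"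
 shows "pmul F G = (SUM k:K. SUM l:L. sterm F G k l)"
proof -
 have "pmul F G = (SUM k:supp F. SUM l:supp G. sterm F G k l)"
  unfolding spoly_mult_def sterm_def by (simp add: case_prod_beta)
 also have "... = (SUM k:supp F. SUM l:L. sterm F G k l)"
  using assms by (intro sum.cong refl sum.mono_neutral_left) (auto simp: sterm_def in_keys_iff)
 also have "... = (SUM k:K. SUM l:L. sterm F G k l)" using assms by (intro sum.mono_neutral_left) (auto simp: sterm_def in_keys_iff)
 finally show ?thesis .
qed

lemma spoly_mult_add:
 "pmul (F + G) H = pmul F H + pmul G H"
 "pmul H (F + G) = pmul H F + pmul H G"
proof -
 let ?K = "supp F Un supp G"
 have K: "finite ?K" "supp (F + G) <= ?K" "supp F <= ?K" "supp G <= ?K"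
  using keys_add[of F G] by auto
 note FG = spoly_mult_superset[OF K(1,2)] spoly_mult_superset[OF finite_keys order_refl K(1,2)]
  and F = spoly_mult_superset[OF K(1,3)] spoly_mult_superset[OF finite_keys order_refl K(1,3)]
  and G = spoly_mult_superset[OF K(1,4)] spoly_mult_superset[OF finite_keys order_refl K(1,4)]
 have t: "sterm (F + G) H k = (%l. sterm F H k l + sterm G H k l)" "sterm H (F + G) k = (%l. sterm H F k l + sterm H G k l)" for k
  by (simp_all add: fun_eq_iff sterm_def lookup_add single_add[symmetric] algebra_simps)
 show "pmul (F + G) H = pmul F H + pmul G H"
  unfolding FG(1)[OF finite_keys order_refl] F(1)[OF finite_keys order_refl] G(1)[OF finite_keys order_refl] by (simp only: t sum.distrib)
 show "pmul H (F + G) = pmul H F + pmul H G" unfolding FG(2) F(2) G(2) by (simp only: t sum.distrib)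
qed

lemma spoly_mult_zero: "pmul 0 F = 0" "pmul F 0 = 0" by (simp_all add: spoly_mult_def case_prod_beta)

lemma spoly_mult_single:
 "pmul (sgl (A, m) c) (sgl (B, n) d) =
  sgl (A |\<union>| B, m + n) (odd_sign A B * c * d)"
 by (subst spoly_mult_superset[where K = "{(A, m)}" and L = "{(B, n)}"]) (auto simp: sterm_def)

lemma spoly_mult_scale:
 "pmul (pscl c F) G = pscl c (pmul F G)"
 "pmul F (pscl c G) = pscl c (pmul F G)"
proof -
 note F = spoly_mult_superset[OF finite_keys order_refl finite_keys order_refl, of F G]
 have t: "sterm (pscl c F) G k = (%l. pscl c (sterm F G k l))"
  "sterm F (pscl c G) k = (%l. pscl c (sterm F G k l))" for k
  by (simp_all add: fun_eq_iff sterm_def spoly_scale_single lookup_spoly_scale mult_ac)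
 show "pmul (pscl c F) G = pscl c (pmul F G)"
  unfolding F spoly_mult_superset[OF finite_keys keys_spoly_scale finite_keys order_refl, of c F G] by (simp only: t spoly_scale_sum)
 show "pmul F (pscl c G) = pscl c (pmul F G)"
  unfolding F spoly_mult_superset[OF finite_keys order_refl finite_keys keys_spoly_scale, of F c G] by (simp only: t spoly_scale_sum)
qed

lemma spoly_mult_minus: "pmul (- F) G = - pmul F G" "pmul F (- G) = - pmul F G"
 using spoly_mult_scale(1)[of "- 1" F G] spoly_mult_scale(2)[of F "- 1" G] by (simp_all add: spoly_scale_minus spoly_scale_one)

lemma spoly_mult_sum:
 "pmul (SUM i:I. F i) G = (SUM i:I. pmul (F i) G)"
 "pmul G (SUM i:I. F i) = (SUM i:I. pmul G (F i))"
 by (induction I rule: infinite_finite_induct) (simp_all add: spoly_mult_zero spoly_mult_add)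

lemma spoly_mult_assoc: "pmul (pmul F G) H = pmul F (pmul G H)"
proof (induction F rule: spoly_induct)
 case (single k c)
 show ?case
 proof (induction G rule: spoly_induct)
  case (single l d)
  show ?case
  proof (induction H rule: spoly_induct)
   case (single j e)
   obtain A m B n C r where kl: "k = (A, m)" "l = (B, n)" "j = (C, r)" by (metis surj_pair)
   have "odd_sign A B * odd_sign (A |\<union>| B) C = odd_sign B C * odd_sign A (B |\<union>| C)"
    unfolding odd_sign_eq by (simp add: set_sign_cocycle)
   hence "(odd_sign A B * odd_sign (A |\<union>| B) C) * (c * d * e) = (odd_sign B C * odd_sign A (B |\<union>| C)) * (c * d * e)"
    by (rule arg_cong)
   hence e: "odd_sign (A |\<union>| B) C * (odd_sign A B * c * d) * e = odd_sign A (B |\<union>| C) * c * (odd_sign B C * d * e)"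
    by (simp only: mult_ac)
   show ?case unfolding kl spoly_mult_single e funion_assoc add.assoc ..
  qed (simp_all add: spoly_mult_zero spoly_mult_add)
 qed (simp_all add: spoly_mult_zero spoly_mult_add)
qed (simp_all add: spoly_mult_zero spoly_mult_add)

lemma spoly_mult_one: "pmul spoly_one F = F" "pmul F spoly_one = F"
proof -
 have "pmul spoly_one F = F & pmul F spoly_one = F"
 proof (induction F rule: spoly_induct)
  case (single k c)
  obtain A m where "k = (A, m)" by (metis surj_pair)
  thus ?case by (simp add: spoly_one_def spoly_mult_single odd_sign_eq set_sign_empty)
 qed (simp_all add: spoly_mult_zero spoly_mult_add)
 thus "pmul spoly_one F = F" "pmul F spoly_one = F" by auto
qed

lemma spoly_mult_even:
 assumes "!!k. k : supp F ==> even (card (fset (fst k)))" shows "pmul F G = pmul G F"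
proof -
 have "sterm F G k l = sterm G F l k" if "k : supp F" for k l using set_sign_swap[OF _ _ assms[OF that], of "fset (fst l)"]
  by (simp add: sterm_def odd_sign_eq sup.commute add.commute mult_ac)
 thus ?thesis using sum.swap[of "sterm G F" "supp F" "supp G"]
  by (simp add: spoly_mult_superset[OF finite_keys order_refl finite_keys order_refl])
qed

lemma keys_spoly_mult:
 assumes "k : supp (pmul F G)"
 obtains A m B n where "(A, m) : supp F" "(B, n) : supp G"
  "fset A Int fset B = {}" "k = (A |\<union>| B, m + n)"
proof -
 have "supp (pmul F G) <=
   (\<Union>k\<in>supp F. \<Union>l\<in>supp G. supp (sterm F G k l))"
  unfolding spoly_mult_superset[OF finite_keys order_refl finite_keys order_refl]
  by (rule order_trans[OF keys_sum]) (intro UN_mono order_refl keys_sum)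
 then obtain i l where il: "i : supp F" "l : supp G" "k : supp (sterm F G i l)"
  using assms by blast
 hence "odd_sign (fst i) (fst l) ~= 0" "k = (fst i |\<union>| fst l, snd i + snd l)" by (auto simp: sterm_def split: if_splits)
 thus thesis using that[of "fst i" "snd i" "fst l" "snd l"] il by (auto simp: odd_sign_def split: if_splits)
qed

lemma weight_Un: "fset A Int fset B = {} ==> weight (A |\<union>| B, m + n) = weight (A, m) + weight (B, n)"
 by (simp add: weight_def card_Un_disjoint)

text \<open>The reals as a ring record: the base ring of \<open>spoly_alg\<close> and the target of
  evaluation at a point.\<close>

definition real_ring :: "real ring" where
 "real_ring = \<lparr>carrier = UNIV, mult = (*), one = 1, zero = 0, add = (+)\<rparr>"

definition spoly_alg :: "(real, 'a spoly) module" where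
 "spoly_alg = \<lparr>carrier = UNIV, mult = pmul, one = spoly_one, zero = 0, add = (+), smult = pscl\<rparr>"

lemma real_ring: "cring real_ring" by (rule cringI; (rule abelian_groupI | rule comm_monoidI)?)
  (auto simp: real_ring_def algebra_simps intro: exI[of _ "- x" for x])

lemma spoly_assoc_alg: "assoc_alg real_ring (spoly_alg :: (real, 'a spoly) module)"
proof -
 have "ring (spoly_alg :: (real, 'a spoly) module)"
 proof (rule ringI)
  show "abelian_group (spoly_alg :: (real, 'a spoly) module)"
   by (rule abelian_groupI) (auto simp: spoly_alg_def add_ac intro: exI[of _ "- x" for x])
  show "Group.monoid (spoly_alg :: (real, 'a spoly) module)" by (rule Group.monoidI) (auto simp: spoly_alg_def spoly_mult_assoc spoly_mult_one)
 qed (auto simp: spoly_alg_def spoly_mult_add)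
 thus ?thesis unfolding assoc_alg_def by (auto simp: real_ring ring_hom_def)
   (auto simp: spoly_alg_def real_ring_def spoly_mult_scale spoly_mult_one spoly_scale_add_left spoly_scale_scale spoly_scale_one mult.commute)
qed

subsection \<open>Substitution\<close>

text \<open>What a substitution needs in order to respect products: anticommuting images of the xi^a
  and central images of the p_i. Transition maps have this property
  (\<open>trans_hom\<close>).\<close>

locale spoly_hom =
 fixes \<theta> :: "nat => 'b spoly" and \<pi> :: "'a => 'b spoly"
 assumes odd: "pmul (\<theta> a) (\<theta> b) = - pmul (\<theta> b) (\<theta> a)"
  and even: "pmul (\<pi> i) F = pmul F (\<pi> i)"
begin

definition xs :: "nat set => 'b spoly" where
 "xs A = foldr (%a. pmul (\<theta> a)) (sorted_list_of_set A) spoly_one"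

definition ps :: "'a multiset => 'b spoly" where
 "ps m = fold_mset (%i. pmul (\<pi> i)) spoly_one m"

text \<open>Anticommutation with itself gives twice the square equal to zero, and the scalars
  contain 1/2.\<close>

lemma square: "pmul (\<theta> a) (\<theta> a) = 0"
proof -
 have "pmul (\<theta> a) (\<theta> a) + pmul (\<theta> a) (\<theta> a) = 0" using odd[of a a] by (simp add: eq_neg_iff_add_eq_0)
 hence "pscl 2 (pmul (\<theta> a) (\<theta> a)) = 0"
  using spoly_scale_add_left[of 1 1 "pmul (\<theta> a) (\<theta> a)"] by (simp add: spoly_scale_one)
 hence "pscl (1 / 2) (pscl 2 (pmul (\<theta> a) (\<theta> a))) = 0" by (simp add: spoly_scale_zero)
 thus ?thesis by (simp add: spoly_scale_scale spoly_scale_one)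
qed

lemma xs_insert_min:
 assumes "finite A" "ALL a:A. b < a" shows "xs (insert b A) = pmul (\<theta> b) (xs A)"
proof -
 have "b ~: A" using assms by auto
 hence "sorted_list_of_set (insert b A) = insort b (sorted_list_of_set A)" using assms by (simp add: sorted_list_of_set_insert_remove)
 also have "... = b # sorted_list_of_set A" using assms by (intro insort_is_Cons) auto
 finally show ?thesis by (simp add: xs_def)
qed

text \<open>The set grows by a new minimum \<open>b\<close>, the first factor of the ordered
  product. Then either \<open>c = b\<close> and the square vanishes, or \<open>c < b\<close> is
  already in place, or \<open>c\<close> passes \<open>b\<close> at the cost of one sign.\<close>

lemma xs_mult_single: "finite A ==> pmul (\<theta> c) (xs A) = pscl (set_sign {c} A) (xs (insert c A))"
proof (induction A rule: finite_linorder_min_induct)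
 case empty
 thus ?case using xs_insert_min[of "{}" c] by (simp add: set_sign_empty spoly_scale_one)
next
 case (insert b A)
 note b = xs_insert_min[OF insert(1,2)]
 consider "c = b" | "c < b" | "b < c" by linarith
 thus ?case
 proof cases
  case 1
  thus ?thesis unfolding b by (simp add: spoly_mult_assoc[symmetric] square spoly_mult_zero set_sign_def spoly_scale_zero)
 next
  case 2
  hence "ALL a:insert b A. c < a" using insert(2) by auto
  thus ?thesis using xs_insert_min[of "insert b A" c] insert(1) by (simp add: set_sign_less spoly_scale_one)
 next
  case 3
  have s: "set_sign {c} (insert b A) = - set_sign {c} A"
  proof -
   have "inv_pairs {c} ({b} Un A) = inv_pairs {c} {b} + inv_pairs {c} A" using insert(1,2) by (intro inv_pairs_Un_right) auto
   moreover have "{(a, d). a : {c} & d : {b} & d < a} = {(c, b)}" using 3 by auto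
   ultimately show ?thesis using 3 by (simp add: set_sign_def inv_pairs_def)
  qed
  have "pmul (\<theta> c) (xs (insert b A)) = - pmul (\<theta> b) (pmul (\<theta> c) (xs A))"
   unfolding b by (simp add: spoly_mult_assoc[symmetric] odd[of c b] spoly_mult_minus)
  also have "... = - pscl (set_sign {c} A) (pmul (\<theta> b) (xs (insert c A)))" by (simp add: insert.IH spoly_mult_scale)
  also have "pmul (\<theta> b) (xs (insert c A)) = xs (insert b (insert c A))"
   using insert(1,2) 3 by (subst xs_insert_min[of "insert c A" b]) auto
  finally show ?thesis by (simp add: s spoly_scale_minus insert_commute)
 qed
qed

lemma xs_mult: "finite A ==> finite B ==> pmul (xs A) (xs B) = pscl (set_sign A B) (xs (A Un B))"
proof (induction A rule: finite_linorder_min_induct)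
 case empty
 thus ?case by (simp add: xs_def set_sign_empty spoly_scale_one spoly_mult_one)
next
 case (insert b A)
 have "pmul (xs (insert b A)) (xs B) = pscl (set_sign A B) (pmul (\<theta> b) (xs (A Un B)))"
  using insert by (simp add: xs_insert_min spoly_mult_assoc spoly_mult_scale)
 also have "... = pscl (set_sign A B * set_sign {b} (A Un B)) (xs (insert b A Un B))"
  using insert by (simp add: xs_mult_single spoly_scale_scale)
 \<comment> \<open>The cocycle identity for \<open>{b}\<close>, \<open>A\<close>, \<open>B\<close>;
   the sign of \<open>{b}\<close> with \<open>A\<close> is 1 because \<open>b\<close> lies below all
   of \<open>A\<close>.\<close>
 also have "set_sign A B * set_sign {b} (A Un B) = set_sign {b} A * set_sign ({b} Un A) B"
  using insert by (intro set_sign_cocycle[symmetric]) auto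
 finally show ?case using insert(2) by (simp add: set_sign_less)
qed

lemma ps_central: "pmul (ps m) F = pmul F (ps m)" and ps_add: "ps (m + n) = pmul (ps m) (ps n)"
proof -
 interpret comp_fun_commute "%i. pmul (\<pi> i)"
 proof
  fix i j
  have "pmul (\<pi> j) (pmul (\<pi> i) F) = pmul (\<pi> i) (pmul (\<pi> j) F)" for F
   unfolding spoly_mult_assoc[symmetric] even[of j "\<pi> i"] ..
  thus "pmul (\<pi> j) \<circ> pmul (\<pi> i) = pmul (\<pi> i) \<circ> pmul (\<pi> j)" by auto
 qed
 have psadd: "ps (add_mset i m) = pmul (\<pi> i) (ps m)" for i m by (simp add: ps_def)
 have empty: "ps {#} = spoly_one" by (simp add: ps_def)
 show c: "pmul (ps m) F = pmul F (ps m)"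
 proof (induction m)
  case (add i m)
  have "pmul (ps (add_mset i m)) F = pmul (\<pi> i) (pmul F (ps m))" unfolding psadd spoly_mult_assoc add  ..
  also have "... = pmul F (ps (add_mset i m))" by (simp only: psadd spoly_mult_assoc[symmetric] even[of i F])
  finally show ?case .
 qed (simp add: empty spoly_mult_one)
 show "ps (m + n) = pmul (ps m) (ps n)" by (induction m) (simp_all add: empty psadd spoly_mult_one spoly_mult_assoc)
qed

lemma subst_eq:
 assumes "finite K" "supp F <= K"
 shows "spoly_subst \<theta> \<pi> F = (SUM k:K. pscl (coef F k) (pmul (xs (fset (fst k))) (ps (snd k))))"
proof -
 have "spoly_subst \<theta> \<pi> F = (SUM k:supp F. pscl (coef F k) (pmul (xs (fset (fst k))) (ps (snd k))))"
  unfolding spoly_subst_def xs_def ps_def by (simp add: case_prod_beta)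
 also have "... = (SUM k:K. pscl (coef F k) (pmul (xs (fset (fst k))) (ps (snd k))))"
  using assms by (intro sum.mono_neutral_left) (auto simp: in_keys_iff spoly_scale_zero)
 finally show ?thesis .
qed

lemma subst_add: "spoly_subst \<theta> \<pi> (F + G) = spoly_subst \<theta> \<pi> F + spoly_subst \<theta> \<pi> G"
proof -
 let ?K = "supp F Un supp G"
 have K: "finite ?K" "supp (F + G) <= ?K" "supp F <= ?K" "supp G <= ?K"
  using keys_add[of F G] by auto
 show ?thesis unfolding subst_eq[OF K(1,2)] subst_eq[OF K(1,3)] subst_eq[OF K(1,4)] by (simp add: lookup_add spoly_scale_add_left sum.distrib)
qed

lemma subst_zero: "spoly_subst \<theta> \<pi> 0 = 0" by (simp add: spoly_subst_def)

lemma subst_single: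
 "spoly_subst \<theta> \<pi> (sgl (A, m) c) = pscl c (pmul (xs (fset A)) (ps m))"
 by (subst subst_eq[where K = "{(A, m)}"]) auto

lemma subst_scale: "spoly_subst \<theta> \<pi> (pscl c F) = pscl c (spoly_subst \<theta> \<pi> F)"
 unfolding subst_eq[OF finite_keys keys_spoly_scale] subst_eq[OF finite_keys order_refl, of F]
 by (simp add: spoly_scale_sum lookup_spoly_scale spoly_scale_scale)

lemma subst_sum: "spoly_subst \<theta> \<pi> (SUM i:I. F i) = (SUM i:I. spoly_subst \<theta> \<pi> (F i))"
 by (induction I rule: infinite_finite_induct) (simp_all add: subst_zero subst_add)

text \<open>On monomials the central factor \<open>ps m\<close> moves past
  \<open>xs (fset B)\<close>, and \<open>xs_mult\<close> produces the same sign as the product of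
  the monomials before substitution.\<close>

lemma subst_mult: "spoly_subst \<theta> \<pi> (pmul F G) = pmul (spoly_subst \<theta> \<pi> F) (spoly_subst \<theta> \<pi> G)"
proof (induction F rule: spoly_induct)
 case (single k c)
 show ?case
 proof (induction G rule: spoly_induct)
  case (single l d)
  obtain A m B n where kl: "k = (A, m)" "l = (B, n)" by (metis surj_pair)
  have "pmul (pmul (xs (fset A)) (ps m)) (pmul (xs (fset B)) (ps n)) =
   pmul (xs (fset A)) (pmul (pmul (ps m) (xs (fset B))) (ps n))" by (simp add: spoly_mult_assoc)
  also have "... = pmul (pmul (xs (fset A)) (xs (fset B))) (pmul (ps m) (ps n))"
   unfolding ps_central[of m "xs (fset B)"] by (simp only: spoly_mult_assoc)
  also have "... = pscl (odd_sign A B) (pmul (xs (fset (A |\<union>| B))) (ps (m + n)))"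
   by (simp add: xs_mult ps_add odd_sign_eq spoly_mult_scale)
  finally show ?case unfolding kl by (simp add: spoly_mult_single subst_single spoly_mult_scale spoly_scale_scale mult_ac)
 qed (simp_all add: spoly_mult_zero spoly_mult_add subst_zero subst_add)
qed (simp_all add: spoly_mult_zero spoly_mult_add subst_zero subst_add)

lemma subst_one: "spoly_subst \<theta> \<pi> spoly_one = spoly_one"
 unfolding spoly_one_def subst_single by (simp add: xs_def ps_def spoly_mult_one spoly_scale_one spoly_one_def[symmetric])

lemma subst_xi: "spoly_subst \<theta> \<pi> (xi a) = \<theta> a"
 unfolding xi_def subst_single by (simp add: xs_def ps_def spoly_mult_one spoly_scale_one)

lemma subst_mom: "spoly_subst \<theta> \<pi> (mom i) = \<pi> i"
 unfolding mom_def subst_single by (simp add: xs_def ps_def spoly_mult_one spoly_scale_one)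

end

lemma xi_anticommute: "pmul (xi a) (xi b) = - pmul (xi b) (xi a)"
proof -
 have e: "pmul (xi a) (xi b) = sgl ({|a|} |\<union>| {|b|}, {#}) (set_sign {a} {b})" for a b
  by (simp add: xi_def spoly_mult_single odd_sign_eq)
 have l: "set_sign {b} {a} = - set_sign {a} {b}" if "a < b" for a b :: nat
 proof -
  have "{(c, d). c : {b} & d : {a} & d < c} = {(b, a)}" using that by auto
  hence "inv_pairs {b} {a} = 1" unfolding inv_pairs_def by simp
  thus ?thesis using that set_sign_less[of "{b}" a] by (simp add: set_sign_def)
 qed
 have "set_sign {a} {b} = - set_sign {b} {a}"
 proof (cases a b rule: linorder_cases)
  case equal
  thus ?thesis by (simp add: set_sign_def)
 qed (use l[of a b] l[of b a] in auto)
 thus ?thesis unfolding e sup.commute[of "{|b|}"] by (simp only: single_uminus)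
qed

lemma keys_xi: "supp (xi a) = {({|a|}, {#})}" and keys_mom: "supp (mom i) = {({||}, {#i#})}"
 by (simp_all add: xi_def mom_def)

lemma mom_central: "pmul (mom i) F = pmul F (mom i)" by (rule spoly_mult_even) (simp add: keys_mom)

text \<open>In increasing order every sign is 1, so ordered products of the xi^a are basis monomials
  with coefficient 1.\<close>

lemma foldr_xi: "sorted_wrt (<) as ==> foldr (%a. pmul (xi a)) as spoly_one =
  sgl (fset_of_list as, {#}) 1"
proof (induction as)
 case (Cons a as)
 hence "set_sign {a} (set as) = 1" by (intro set_sign_less) auto
 thus ?case using Cons by (simp add: xi_def spoly_mult_single odd_sign_eq fset_of_list.rep_eq)
qed (simp add: spoly_one_def)

lemma foldr_mom: "foldr (%i. pmul (mom i)) is spoly_one = sgl ({||}, mset is) 1"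
 by (induction "is") (simp_all add: mom_def spoly_mult_single odd_sign_eq set_sign_empty spoly_one_def)

section \<open>Calculus of $C^k$ maps\<close>

lemma Ck_on_cong:
 assumes "open S" "!!x. x : S ==> f x = g x" "Ck_on k S f" shows "Ck_on k S g" using assms
proof (induction k arbitrary: f g)
 case 0
 thus ?case using continuous_on_cong[of S S f g] by simp
next
 case (Suc k)
 have d: "(g has_derivative D) (at x) \<longleftrightarrow> (f has_derivative D) (at x)" if x: "x : S" for x D
  using has_derivative_transform_within_open[OF _ Suc.prems(1) x, of f D UNIV g]
   has_derivative_transform_within_open[OF _ Suc.prems(1) x, of g D UNIV f] Suc.prems(2) by auto
 have fd: "frechet_derivative f (at x) = frechet_derivative g (at x)" if "x : S" for x unfolding frechet_derivative_def d[OF that] ..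
 have "Ck_on k S (%x. frechet_derivative g (at x) v)" for v
  by (rule Suc.IH[of "%x. frechet_derivative f (at x) v"]) (use Suc.prems fd in auto)
 moreover have "g differentiable (at x)" if "x : S" for x
 proof -
  have "f differentiable (at x)" using Suc.prems(3) that by simp
  thus ?thesis unfolding differentiable_def using d[OF that] by blast
 qed
 ultimately show ?case by simp
qed

lemma Ck_on_subset: "Ck_on k S f ==> T <= S ==> Ck_on k T f"
 by (induction k arbitrary: f) (auto intro: continuous_on_subset)

lemma Ck_on_local:
 assumes "!!x. x : S ==> EX T. open T & x : T & Ck_on k (T Int S) f" and "open S" shows "Ck_on k S f"
 using assms(1)
proof (induction k arbitrary: f)
 case 0
 have "continuous (at x) f" if "x : S" for x
 proof -
  obtain T where "open T" "x : T" "continuous_on (T Int S) f" using 0 \<open>x : S\<close> by auto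
  thus ?thesis using assms(2) that by (simp add: continuous_on_eq_continuous_at open_Int)
 qed
 thus ?case by (simp add: continuous_at_imp_continuous_on)
next
 case (Suc k)
 have "Ck_on k S (%x. frechet_derivative f (at x) v)" for v by (rule Suc.IH) (use Suc.prems in fastforce)
 moreover have "f differentiable (at x)" if "x : S" for x using Suc.prems[OF that] that by auto
 ultimately show ?case by simp
qed

lemma Ck_on_SucI:
 assumes "open S" "!!x. x : S ==> (f has_derivative F x) (at x)" "!!v. Ck_on k S (%x. F x v)"
 shows "Ck_on (Suc k) S f"
proof -
 have "frechet_derivative f (at x) = F x" if "x : S" for x using frechet_derivative_at[OF assms(2)[OF that]] by simp
 hence "Ck_on k S (%x. frechet_derivative f (at x) v)" for v using Ck_on_cong[OF assms(1) _ assms(3)[of v]] by simp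
 thus ?thesis using assms(2) by (auto simp: differentiable_def)
qed

lemma Ck_on_SucD:
 assumes "Ck_on (Suc k) S f" "x : S" shows "(f has_derivative frechet_derivative f (at x)) (at x)" using assms frechet_derivative_works by auto

lemma Ck_on_continuous: "open S ==> Ck_on k S f ==> continuous_on S f"
 by (cases k) (auto intro!: differentiable_imp_continuous_on simp: differentiable_on_eq_differentiable_at)

lemma Ck_on_Suc_imp: "open S ==> Ck_on (Suc k) S f ==> Ck_on k S f"
proof (induction k arbitrary: f)
 case 0
 thus ?case using Ck_on_continuous[OF 0(1) 0(2)] by simp
next
 case (Suc k)
 have 1: "ALL x:S. f differentiable (at x)" "!!v. Ck_on (Suc k) S (%x. frechet_derivative f (at x) v)"
  using Suc.prems(2) unfolding Ck_on.simps(2)[of "Suc k"] by blast+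
 have "Ck_on k S (%x. frechet_derivative f (at x) v)" for v by (rule Suc.IH[OF Suc.prems(1) 1(2)])
 with 1(1) show ?case by simp
qed

lemma Ck_on_const: "open S ==> Ck_on k S (%x. c)"
 by (induction k arbitrary: c) (auto intro: Ck_on_SucI[where F = "%x v. 0"])

lemma Ck_on_linear: "open S ==> bounded_linear f ==> Ck_on k S f"
proof (cases k)
 case (Suc k)
 thus "open S ==> bounded_linear f ==> Ck_on k S f" for k S
  by (cases k) (auto intro!: Ck_on_SucI[where F = "%x. f"] Ck_on_const linear_continuous_on
   bounded_linear_imp_has_derivative simp del: Ck_on.simps(2))
qed (auto intro: linear_continuous_on)

lemma Ck_on_linear_comp:
 assumes "open S" "bounded_linear A" "Ck_on k S f" shows "Ck_on k S (%x. A (f x))" using assms(3)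
proof (induction k arbitrary: f)
 case 0
 thus ?case using bounded_linear.continuous_on[OF assms(2)] by auto
next
 case (Suc k)
 show ?case by (rule Ck_on_SucI[OF assms(1) bounded_linear.has_derivative[OF assms(2) Ck_on_SucD[OF Suc.prems]]])
   (use Suc in auto)
qed

lemma Ck_on_add:
 assumes "open S" "Ck_on k S f" "Ck_on k S g" shows "Ck_on k S (%x. f x + g x)" using assms(2,3)
proof (induction k arbitrary: f g)
 case 0
 thus ?case by (auto intro: continuous_on_add)
next
 case (Suc k)
 show ?case by (rule Ck_on_SucI[OF assms(1) has_derivative_add[OF Ck_on_SucD[OF Suc.prems(1)] Ck_on_SucD[OF Suc.prems(2)]]])
   (use Suc in auto)
qed

lemma Ck_on_sum:
 assumes "open S" "!!i. i : I ==> Ck_on k S (f i)" shows "Ck_on k S (%x. SUM i:I. f i x)"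
 using assms by (induction I rule: infinite_finite_induct) (auto intro: Ck_on_const Ck_on_add)

lemma Ck_on_scaleR:
 assumes "open S" "Ck_on k S (f :: _ => real)" "Ck_on k S g" shows "Ck_on k S (%x. f x *r g x)" using assms(2,3)
proof (induction k arbitrary: f g)
 case 0
 thus ?case by (auto intro: continuous_on_scaleR)
next
 case (Suc k)
 have fg: "Ck_on k S f" "Ck_on k S g" using Suc.prems by (auto intro: Ck_on_Suc_imp[OF assms(1)])
 have d: "Ck_on k S (%x. frechet_derivative f (at x) v)" "Ck_on k S (%x. frechet_derivative g (at x) v)" for v
  using Suc.prems by auto
 show ?case by (rule Ck_on_SucI[OF assms(1) has_derivative_scaleR[OF Ck_on_SucD[OF Suc.prems(1)] Ck_on_SucD[OF Suc.prems(2)]]])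
   (assumption+, intro Ck_on_add[OF assms(1)] Suc.IH fg d)
qed

lemma Ck_on_mult:
 assumes "open S" "Ck_on k S (f :: _ => real)" "Ck_on k S g" shows "Ck_on k S (%x. f x * g x)"
 using Ck_on_scaleR[OF assms] by simp

text \<open>\<open>Ck_on\<close> controls derivatives in fixed directions, while the chain rule
  differentiates \<open>g\<close> in a direction that varies with the point. Expanding that
  direction in \<open>Basis\<close> leaves fixed directions with C^k coefficients, which is why the
  middle space is Euclidean.\<close>

lemma Ck_on_compose:
 fixes f :: "'a::real_normed_vector => 'b::euclidean_space" and g :: "'b => 'c::real_normed_vector"
 assumes "open S" "open T" "Ck_on k S f" "Ck_on k T g" "!!x. x : S ==> f x : T" shows "Ck_on k S (%x. g (f x))"
 using assms(3-5)
proof (induction k arbitrary: f g)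
 case 0
 have "continuous_on S (%x. g (f x))" by (rule continuous_on_compose2[of T g S f]) (use 0 in auto)
 thus ?case by simp
next
 case (Suc k)
 let ?D = "%x v. SUM b:Basis. (frechet_derivative f (at x) v \<bullet> b) *r frechet_derivative g (at (f x)) b"
 have d: "((%x. g (f x)) has_derivative ?D x) (at x)" if x: "x : S" for x
 proof -
  have f: "(f has_derivative frechet_derivative f (at x)) (at x)" by (rule Ck_on_SucD[OF Suc.prems(1) x])
  have g: "(g has_derivative frechet_derivative g (at (f x))) (at (f x))" by (rule Ck_on_SucD[OF Suc.prems(2) Suc.prems(3)[OF x]])
  have l: "linear (frechet_derivative g (at (f x)))" using g has_derivative_linear by blast
  have ex: "frechet_derivative g (at (f x)) w = (SUM b:Basis. (w \<bullet> b) *r frechet_derivative g (at (f x)) b)" for w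
  proof -
   have "frechet_derivative g (at (f x)) w = frechet_derivative g (at (f x)) (SUM b:Basis. (w \<bullet> b) *r b)"
    unfolding euclidean_representation ..
   also have "... = (SUM b:Basis. (w \<bullet> b) *r frechet_derivative g (at (f x)) b)"
    by (simp only: linear_sum[OF l] linear_scale[OF l])
   finally show ?thesis .
  qed
  have "frechet_derivative g (at (f x)) \<circ> frechet_derivative f (at x) = ?D x" unfolding o_def by (rule ext) (rule ex)
  with diff_chain_at[OF f g] show ?thesis unfolding o_def by simp
 qed
 have fk: "Ck_on k S f" by (rule Ck_on_Suc_imp[OF assms(1) Suc.prems(1)])
 have "Ck_on k S (%x. (frechet_derivative f (at x) v \<bullet> b) *r frechet_derivative g (at (f x)) b)" for v b
 proof (rule Ck_on_scaleR[OF assms(1)])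
  show "Ck_on k S (%x. frechet_derivative f (at x) v \<bullet> b)"
   using Suc.prems(1) by (intro Ck_on_linear_comp[OF assms(1) bounded_linear_inner_left]) simp
  show "Ck_on k S (%x. frechet_derivative g (at (f x)) b)" by (rule Suc.IH[OF fk _ Suc.prems(3)]) (use Suc.prems(2) in auto)
 qed
 thus ?case by (intro Ck_on_SucI[OF assms(1) d] Ck_on_sum[OF assms(1)]) auto
qed

lemma smooth_on_has_derivative: "smooth_on S f ==> x : S ==> (f has_derivative frechet_derivative f (at x)) (at x)"
 using Ck_on_SucD[of 0] unfolding smooth_on_def by blast

lemma smooth_on_directional: "smooth_on S f ==> smooth_on S (%x. frechet_derivative f (at x) v)"
 unfolding smooth_on_def using Ck_on.simps(2) by blast

text \<open>Exponent -1 serves for the quotient in the bump functions and -1/2 for normalising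
  sections. The derivative stays in the family up to a constant factor, so the induction is over all
  exponents at once.\<close>

lemma smooth_on_powr: "smooth_on {0<..} (%t::real. t powr a)"
proof -
 have "Ck_on k {0<..} (%t::real. t powr a)" for k
 proof (induction k arbitrary: a)
  case 0
  thus ?case by (auto intro!: continuous_intros)
 next
  case (Suc k)
  have "((%t. t powr a) has_derivative (%v. v * (a * x powr (a - 1)))) (at x)" if "x : {0<..}" for x :: real
   using that has_real_derivative_powr[of x a] by (simp add: has_field_derivative_def mult.commute[of _ "a * x powr (a - 1)"])
  thus ?case by (rule Ck_on_SucI[rotated]) (auto intro!: Ck_on_mult Ck_on_const Suc)
 qed
 thus ?thesis by (simp add: smooth_on_def)
qed

text \<open>The functions $t^{-k} e^{-1/t}$ for $t > 0$, extended by $0$: this family is closed under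
 differentiation up to linear combinations.\<close>

definition flat_fun :: "nat => real => real" where
 "flat_fun k t = (if t > 0 then exp (- inverse t) / t ^ k else 0)"

lemma flat_fun_tendsto: "((%t. flat_fun k t) \<longlongrightarrow> 0) (at 0)"
proof -
 have "((%t::real. exp (- inverse t) / t ^ k) \<longlongrightarrow> 0) (at_right 0)"
 proof -
  have "((%u::real. u ^ k / exp u) \<longlongrightarrow> 0) at_top" by (rule tendsto_power_div_exp_0)
  hence "((%t::real. inverse t ^ k / exp (inverse t)) \<longlongrightarrow> 0) (at_right 0)"
   by (rule filterlim_compose[OF _ filterlim_inverse_at_top_right])
  thus ?thesis by (simp add: exp_minus field_simps power_inverse)
 qed
 hence "((%t. flat_fun k t) \<longlongrightarrow> 0) (at_right 0)"
  by (rule Lim_transform_eventually) (auto simp: flat_fun_def eventually_at_right_less eventually_at intro!: exI[of _ 1])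
 moreover have "((%t. flat_fun k t) \<longlongrightarrow> 0) (at_left 0)"
  by (rule tendsto_eventually) (auto simp: flat_fun_def eventually_at intro!: exI[of _ 1])
 ultimately show ?thesis by (simp add: filterlim_split_at)
qed

lemma flat_fun_deriv:
 "(flat_fun k has_real_derivative (flat_fun (k + 2) x - k * flat_fun (Suc k) x)) (at x)"
proof (cases x "0::real" rule: linorder_cases)
 case greater
 have "((%t. exp (- inverse t) / t ^ k) has_real_derivative
   (flat_fun (k + 2) x - k * flat_fun (Suc k) x)) (at x)" using greater
  by (auto intro!: derivative_eq_intros simp: flat_fun_def) (cases k; simp add: field_simps power2_eq_square)
 thus ?thesis by (rule has_field_derivative_transform_within_open[where S = "{0<..}"]) (use greater in \<open>auto simp: flat_fun_def\<close>)
next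
 case less
 have "((%t. 0) has_real_derivative (flat_fun (k + 2) x - k * flat_fun (Suc k) x)) (at x)" using less by (simp add: flat_fun_def)
 thus ?thesis by (rule has_field_derivative_transform_within_open[where S = "{..<0}"]) (use less in \<open>auto simp: flat_fun_def\<close>)
next
 case equal
 \<comment> \<open>At 0 the difference quotient of \<open>flat_fun k\<close> is
   \<open>flat_fun (Suc k)\<close>, which tends to 0, the value of the claimed derivative
   there.\<close>
 have "((%t. (flat_fun k t - flat_fun k 0) / (t - 0)) \<longlongrightarrow> 0) (at 0)" using flat_fun_tendsto[of "Suc k"]
  by (rule Lim_transform_eventually) (auto simp: flat_fun_def eventually_at intro!: exI[of _ 1])
 thus ?thesis using equal by (simp add: has_field_derivative_iff) (simp add: flat_fun_def)
qed

lemma smooth_on_flat_fun: "smooth_on UNIV (flat_fun j)"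
proof -
 have "Ck_on k UNIV (flat_fun j)" for k
 proof (induction k arbitrary: j)
  case 0
  thus ?case using flat_fun_deriv by (auto intro!: continuous_at_imp_continuous_on DERIV_isCont)
 next
  case (Suc k)
  have "(flat_fun j has_derivative (%v. (flat_fun (j + 2) x + (- real j) * flat_fun (Suc j) x) * v)) (at x)" for x
   using flat_fun_deriv[of j x] by (simp add: has_field_derivative_def)
  thus ?case by (rule Ck_on_SucI[OF open_UNIV]) (assumption | intro Ck_on_mult Ck_on_add Ck_on_const Suc open_UNIV)+
 qed
 thus ?thesis by (simp add: smooth_on_def)
qed

section \<open>Smooth functions on manifolds\<close>

lemma smooth_on_cong: "open S ==> (!!x. x : S ==> f x = g x) ==> smooth_on S f ==> smooth_on S g"
 unfolding smooth_on_def using Ck_on_cong by blast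

lemma smooth_on_subset: "smooth_on S f ==> T <= S ==> smooth_on T f"
 unfolding smooth_on_def using Ck_on_subset by blast

lemma smooth_on_compose:
 fixes f :: "'a::real_normed_vector => 'b::euclidean_space" and g :: "'b => 'c::real_normed_vector"
 assumes "open S" "open T" "smooth_on S f" "smooth_on T g" "!!x. x : S ==> f x : T"
 shows "smooth_on S (%x. g (f x))" using assms Ck_on_compose unfolding smooth_on_def by blast

lemma smooth_on_local:
 assumes "!!x. x : S ==> EX T. open T & x : T & smooth_on (T Int S) f" and "open S"
 shows "smooth_on S f" using assms Ck_on_local[of S _ f] unfolding smooth_on_def by meson

locale smooth_mfd =
 fixes M :: "('m::{t2_space, second_countable_topology}, 'a::euclidean_space, 'z) manifold_scheme"
 assumes mfd: "smooth_manifold M"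
begin

lemma axes_Basis: "axes M <= Basis" and finite_axes: "finite (axes M)"
 using mfd finite_subset[OF _ finite_Basis] unfolding smooth_manifold_def by auto

lemma chart: "(V, ph) : atlas M ==> is_chart M V ph" using mfd unfolding smooth_manifold_def by blast

lemma chart_open: "(V, ph) : atlas M ==> open V" using chart unfolding is_chart_def by blast

lemma chart_exists: obtains V ph where "(V, ph) : atlas M" "x : V"
proof -
 have "x : (\<Union>(V, ph) \<in> atlas M. V)" using mfd unfolding smooth_manifold_def by auto
 thus thesis using that by auto
qed

lemma charts_compatible:
 "(V, ph) : atlas M ==> (V', ph') : atlas M ==> smooth_in_chart M V' ph' V ph"
 using mfd unfolding smooth_manifold_def compatible_charts_def by fastforce

lemma proj_linear: "linear (proj_axes M)" unfolding proj_axes_def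
 by (intro linear_compose_sum ballI) (simp add: linear_iff inner_add_left scaleR_add_left)

lemma proj_bounded: "bounded_linear (proj_axes M)" using proj_linear linear_conv_bounded_linear by blast

lemma proj_continuous: "continuous_on S (proj_axes M)" using proj_bounded by (rule linear_continuous_on)

lemma proj_span: "proj_axes M y : span (axes M)" unfolding proj_axes_def by (intro span_sum span_scale span_base)

lemma proj_inner: "b : axes M ==> proj_axes M y \<bullet> b = y \<bullet> b"
proof -
 assume b: "b : axes M"
 have "proj_axes M y \<bullet> b = (SUM c:axes M. (y \<bullet> c) * (c \<bullet> b))" by (simp add: proj_axes_def inner_sum_left)
 also have "... = (SUM c:axes M. if c = b then y \<bullet> b else 0)"
  by (rule sum.cong) (use b axes_Basis in \<open>auto simp: inner_Basis subset_iff\<close>)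
 finally show ?thesis using b finite_axes by simp
qed

lemma proj_id: "y : span (axes M) ==> proj_axes M y = y"
proof (induction y rule: span_induct_alt)
 case base
 thus ?case by (simp add: linear_0[OF proj_linear])
next
 case (step c x y)
 have "proj_axes M x = (SUM b:axes M. if b = x then x else 0)" unfolding proj_axes_def
  by (rule sum.cong) (use step(1) axes_Basis in \<open>auto simp: inner_Basis subset_iff\<close>)
 hence "proj_axes M x = x" using step(1) finite_axes by simp
 thus ?case using step by (simp add: linear_add[OF proj_linear] linear_scale[OF proj_linear])
qed

context
 fixes V ph assumes c: "(V, ph) : atlas M"
begin

lemma chart_inj: "inj_on ph V"
proof -
 have "homeomorphism V (ph ` V) ph (inv_into V ph)" using chart[OF c] unfolding is_chart_def by blast
 thus ?thesis unfolding homeomorphism_def by (metis inj_on_inverseI)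
qed

lemma chart_inv: "x : V ==> inv_into V ph (ph x) = x" by (rule inv_into_f_f[OF chart_inj])

lemma chart_continuous: "continuous_on V ph" "continuous_on (ph ` V) (inv_into V ph)"
 using chart[OF c] unfolding is_chart_def homeomorphism_def by blast+

lemma chart_openin: "openin (top_of_set (span (axes M))) (ph ` V)" using chart[OF c] unfolding is_chart_def by blast

lemma chart_span: "x : V ==> ph x : span (axes M)" using openin_imp_subset[OF chart_openin] by auto

lemma chart_proj: "x : V ==> proj_axes M (ph x) = ph x" by (rule proj_id[OF chart_span])

text \<open>\<open>Ck_on\<close> is meant for open sets of the ambient space; the preimage under the
  projection turns the relatively open image of a chart domain into one.\<close>

lemma chart_dom_open:
 assumes "open U" shows "open {y. proj_axes M y : ph ` (U Int V)}"
proof -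
 have "openin (top_of_set (ph ` V)) (ph ` (U Int V))"
 proof (rule homeomorphism_imp_open_map)
  show "homeomorphism V (ph ` V) ph (inv_into V ph)" using chart[OF c] unfolding is_chart_def by blast
  show "openin (top_of_set V) (U Int V)" using assms by (metis Int_commute openin_open_Int)
 qed
 hence "openin (top_of_set (span (axes M))) (ph ` (U Int V))" using chart_openin openin_trans by blast
 then obtain O' where O': "open O'" "ph ` (U Int V) = span (axes M) Int O'" unfolding openin_open by blast
 have "{y. proj_axes M y : ph ` (U Int V)} = proj_axes M -` O'" unfolding O'(2) using proj_span by auto
 thus ?thesis using open_vimage[OF O'(1) proj_continuous] by simp
qed

lemma chart_coordinate_open:
 assumes "open S" shows "open {x : V. ph x : S}"
proof -
 have "openin (top_of_set V) (V Int ph -` S)" using chart_continuous(1) assms by (rule continuous_openin_preimage_gen)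
 hence "open (V Int ph -` S)" using chart_open[OF c] by (metis openin_open_trans)
 thus ?thesis by (simp add: vimage_def Int_def)
qed

end

lemma smooth_fun_iff: "smf M U f \<longleftrightarrow> (ALL V ph. (V, ph) : atlas M -->
  smooth_on {y. proj_axes M y : ph ` (U Int V)} (%y. f (inv_into V ph (proj_axes M y))))"
 unfolding smooth_fun_def smooth_in_chart_def by auto

lemma smooth_fun_cong:
 assumes "open U" "!!x. x : U ==> f x = g x" "smf M U f" shows "smf M U g" unfolding smooth_fun_iff
proof (intro allI impI)
 fix V ph assume c: "(V, ph) : atlas M"
 show "smooth_on {y. proj_axes M y : ph ` (U Int V)} (%y. g (inv_into V ph (proj_axes M y)))"
  by (rule smooth_on_cong[OF chart_dom_open[OF c assms(1)] _ assms(3)[unfolded smooth_fun_iff, rule_format, OF c]])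
   (auto simp: chart_inv[OF c] assms(2))
qed

lemma smooth_fun_subset: "smf M U f ==> W <= U ==> smf M W f" unfolding smooth_fun_iff
proof (intro allI impI)
 fix V ph assume f: "ALL V ph. (V, ph) : atlas M -->
   smooth_on {y. proj_axes M y : ph ` (U Int V)} (%y. f (inv_into V ph (proj_axes M y)))"
  and W: "W <= U" and c: "(V, ph) : atlas M"
 show "smooth_on {y. proj_axes M y : ph ` (W Int V)} (%y. f (inv_into V ph (proj_axes M y)))"
  by (rule smooth_on_subset[OF f[rule_format, OF c]]) (use W in auto)
qed

lemma smooth_fun_local:
 assumes "open U" "!!x. x : U ==> EX W. open W & x : W & smf M (W Int U) f"
 shows "smf M U f" unfolding smooth_fun_iff
proof (intro allI impI)
 fix V ph assume c: "(V, ph) : atlas M"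
 let ?S = "%U. {y. proj_axes M y : ph ` (U Int V)}"
 show "smooth_on (?S U) (%y. f (inv_into V ph (proj_axes M y)))"
 proof (rule smooth_on_local[OF _ chart_dom_open[OF c assms(1)]])
  fix y assume "y : ?S U"
  then obtain x where x: "x : U" "x : V" "proj_axes M y = ph x" by auto
  obtain W where W: "open W" "x : W" "smf M (W Int U) f" using assms(2)[OF x(1)] by blast
  have "smooth_on (?S (W Int U)) (%y. f (inv_into V ph (proj_axes M y)))" using W(3) c unfolding smooth_fun_iff by blast
  moreover have "?S (W Int U) Int ?S U = ?S (W Int U)" by auto
  moreover have "y : ?S (W Int U)" using x W by auto
  ultimately show "EX T. open T & y : T & smooth_on (T Int ?S U) (%y. f (inv_into V ph (proj_axes M y)))"
   using chart_dom_open[OF c open_Int[OF W(1) assms(1)]] by metis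
 qed
qed

text \<open>One chart suffices: any other expression of \<open>f\<close> is the given one composed
  with a transition map, which is smooth by compatibility.\<close>

lemma smooth_fun_from_chart:
 assumes c: "(V, ph) : atlas M" and W: "open W" "W <= V"
  and f: "smooth_on {y. proj_axes M y : ph ` W} (%y. f (inv_into V ph (proj_axes M y)))" shows "smf M W f"
 unfolding smooth_fun_iff
proof (intro allI impI)
 fix V' ph' assume c': "(V', ph') : atlas M"
 let ?S = "{y. proj_axes M y : ph' ` (W Int V')}"
 have g: "smooth_on ?S (%y. ph (inv_into V' ph' (proj_axes M y)))" using charts_compatible[OF c c'] unfolding smooth_in_chart_def
  by (rule smooth_on_subset) (use W(2) in auto)
 have Wo: "open {y. proj_axes M y : ph ` W}" using chart_dom_open[OF c W(1)] W(2) by (simp add: Int_absorb2)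
 note So = chart_dom_open[OF c' W(1)]
 have "smooth_on ?S (%y. f (inv_into V ph (proj_axes M (ph (inv_into V' ph' (proj_axes M y))))))"
  by (rule smooth_on_compose[OF So Wo g f])
   (use W(2) in \<open>auto simp: chart_inv[OF c'] chart_proj[OF c] subset_iff\<close>)
 thus "smooth_on ?S (%y. f (inv_into V' ph' (proj_axes M y)))" by (rule smooth_on_cong[OF So, rotated])
   (use W(2) in \<open>auto simp: chart_inv[OF c'] chart_inv[OF c] chart_proj[OF c] subset_iff\<close>)
qed

lemma smooth_fun_const: "open U ==> smf M U (%x. c)"
 unfolding smooth_fun_iff smooth_on_def using chart_dom_open Ck_on_const by blast

lemma smooth_fun_add: "open U ==> smf M U f ==> smf M U g ==> smf M U (%x. f x + g x)"
 unfolding smooth_fun_iff smooth_on_def using chart_dom_open Ck_on_add by blast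

lemma smooth_fun_mult: "open U ==> smf M U f ==> smf M U g ==> smf M U (%x. f x * g x)"
 unfolding smooth_fun_iff smooth_on_def using chart_dom_open Ck_on_mult by blast

lemma smooth_fun_minus: "open U ==> smf M U f ==> smf M U (%x. - f x)"
 using smooth_fun_mult[OF _ smooth_fun_const[of U "- 1"], of f] by simp

lemma smooth_fun_diff: "open U ==> smf M U f ==> smf M U g ==> smf M U (%x. f x - g x)"
 using smooth_fun_add[OF _ _ smooth_fun_minus, of U f g] by simp

lemma smooth_fun_sum: "open U ==> (!!i. i : I ==> smf M U (f i)) ==> smf M U (%x. SUM i:I. f i x)"
 by (induction I rule: infinite_finite_induct) (auto intro: smooth_fun_const smooth_fun_add)

lemma smooth_fun_compose:
 fixes g :: "real => real"
 assumes "open U" "smf M U f" "open T" "smooth_on T g" "!!x. x : U ==> f x : T"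
 shows "smf M U (%x. g (f x))" unfolding smooth_fun_iff
proof (intro allI impI)
 fix V ph assume c: "(V, ph) : atlas M"
 show "smooth_on {y. proj_axes M y : ph ` (U Int V)} (%y. g (f (inv_into V ph (proj_axes M y))))"
  by (rule smooth_on_compose[OF chart_dom_open[OF c assms(1)] assms(3)
    assms(2)[unfolded smooth_fun_iff, rule_format, OF c] assms(4)])
   (auto simp: chart_inv[OF c] assms(5))
qed

lemma smooth_fun_coordinate:
 assumes c: "(V, ph) : atlas M" shows "smf M V (%x. ph x \<bullet> b)"
proof (rule smooth_fun_from_chart[OF c chart_open[OF c] order_refl])
 have o: "open {y. proj_axes M y : ph ` V}" using chart_dom_open[OF c chart_open[OF c]] by simp
 have "bounded_linear (%y. proj_axes M y \<bullet> b)" by (rule bounded_linear_compose[OF bounded_linear_inner_left proj_bounded])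
 hence "smooth_on {y. proj_axes M y : ph ` V} (%y. proj_axes M y \<bullet> b)"
  unfolding smooth_on_def using Ck_on_linear[OF o] by blast
 thus "smooth_on {y. proj_axes M y : ph ` V} (%y. ph (inv_into V ph (proj_axes M y)) \<bullet> b)"
  by (rule smooth_on_cong[OF o, rotated]) (auto simp: chart_inv[OF c])
qed

subsection \<open>Partial derivatives\<close>

text \<open>A line in the direction of an axis stays in the model space, where
  \<open>proj_axes\<close> is the identity. The partial derivative is thus a directional derivative
  of the ambient expression.\<close>

lemma pderiv_frechet:
 assumes c: "(V, ph) : atlas M" and U: "open U" and f: "smf M U f" and x: "x : U" "x : V" and b: "b : axes M"
 shows "((%t. f (inv_into V ph (ph x + t *r b))) has_real_derivative
   frechet_derivative (%y. f (inv_into V ph (proj_axes M y))) (at (ph x)) b) (at 0)"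
proof -
 let ?F = "%y. f (inv_into V ph (proj_axes M y))"
 have "ph x : {y. proj_axes M y : ph ` (U Int V)}" using x chart_proj[OF c] by auto
 hence F: "(?F has_derivative frechet_derivative ?F (at (ph x))) (at (ph x))"
  using f c smooth_on_has_derivative unfolding smooth_fun_iff by blast
 have l: "linear (frechet_derivative ?F (at (ph x)))" using F has_derivative_linear by blast
 have p: "proj_axes M (ph x + t *r b) = ph x + t *r b" for t
  using chart_span[OF c x(2)] b by (intro proj_id span_add span_scale) (auto intro: span_base)
 have "((%t. ph x + t *r b) has_derivative (%t. t *r b)) (at 0)" by (auto intro!: derivative_eq_intros)
 moreover have "(?F has_derivative frechet_derivative ?F (at (ph x))) (at (ph x + 0 *r b))" using F by simp
 ultimately have "(?F \<circ> (%t. ph x + t *r b) has_derivative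
   frechet_derivative ?F (at (ph x)) \<circ> (%t. t *r b)) (at 0)"
  using diff_chain_at[of "%t. ph x + t *r b" "%t. t *r b" 0 ?F] by simp
 thus ?thesis by (simp add: o_def p has_field_derivative_def linear_scale[OF l] mult.commute[of _ "frechet_derivative ?F (at (ph x)) b"])
qed

lemma pderiv_deriv:
 assumes "(V, ph) : atlas M" "open U" "smf M U f" "x : U" "x : V" "b : axes M"
 shows "((%t. f (inv_into V ph (ph x + t *r b))) has_real_derivative pdc V ph b f x) (at 0)"
  and "pdc V ph b f x = frechet_derivative (%y. f (inv_into V ph (proj_axes M y))) (at (ph x)) b"
 using pderiv_frechet[OF assms] DERIV_imp_deriv[OF pderiv_frechet[OF assms]] by (simp_all add: pderiv_chart_def)

lemma pderiv_unique:
 assumes "((%t. f (inv_into V ph (ph x + t *r b))) has_real_derivative d) (at 0)" shows "pdc V ph b f x = d"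
 unfolding pderiv_chart_def using assms by (rule DERIV_imp_deriv)

lemma pderiv_add:
 assumes c: "(V, ph) : atlas M" and x: "open U" "x : U" "x : V" "b : axes M" and f: "smf M U f" "smf M U g"
 shows "pdc V ph b (%y. f y + g y) x = pdc V ph b f x + pdc V ph b g x"
 by (rule pderiv_unique DERIV_add pderiv_deriv[OF c] x f)+

lemma pderiv_mult:
 assumes c: "(V, ph) : atlas M" and x: "open U" "x : U" "x : V" "b : axes M" and f: "smf M U f" "smf M U g"
 shows "pdc V ph b (%y. f y * g y) x = pdc V ph b f x * g x + f x * pdc V ph b g x"
proof (rule pderiv_unique)
 have x0: "inv_into V ph (ph x + 0 *r b) = x" using chart_inv[OF c x(3)] by simp
 show "((%t. f (inv_into V ph (ph x + t *r b)) * g (inv_into V ph (ph x + t *r b))) has_real_derivative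
  pdc V ph b f x * g x + f x * pdc V ph b g x) (at 0)"
  using DERIV_mult[OF pderiv_deriv(1)[OF c x(1) f(1) x(2-4)] pderiv_deriv(1)[OF c x(1) f(2) x(2-4)]] unfolding x0 by (simp add: mult.commute)
qed

lemma pderiv_const: "pdc V ph b (%y. c) x = 0" by (rule pderiv_unique) simp

lemma pderiv_sum:
 assumes c: "(V, ph) : atlas M" and x: "open U" "x : U" "x : V" "b : axes M" and f: "!!i. i : I ==> smf M U (f i)"
 shows "pdc V ph b (%y. SUM i:I. f i y) x = (SUM i:I. pdc V ph b (f i) x)" using f
proof (induction I rule: infinite_finite_induct)
 case (insert i I)
 thus ?case using pderiv_add[OF c x, of "f i" "%y. SUM i:I. f i y"] smooth_fun_sum[OF x(1), of I f] by simp
qed (simp_all add: pderiv_const)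

lemma pderiv_cong:
 assumes c: "(V, ph) : atlas M" and W: "open W" "x : W" "x : V" and b: "b : axes M" and e: "!!y. y : W Int V ==> f y = g y"
 shows "pdc V ph b f x = pdc V ph b g x"
proof -
 let ?S = "{t. proj_axes M (ph x + t *r b) : ph ` (W Int V)}"
 have p: "proj_axes M (ph x + t *r b) = ph x + t *r b" for t
  using chart_span[OF c W(3)] b by (intro proj_id span_add span_scale) (auto intro: span_base)
 have "open ((%t. ph x + t *r b) -` {y. proj_axes M y : ph ` (W Int V)})"
  by (rule open_vimage[OF chart_dom_open[OF c W(1)]]) (intro continuous_intros)
 hence S: "open ?S" by (simp add: vimage_def)
 have "0 : ?S" using W p[of 0] by simp
 hence "\<forall>\<^sub>F t in nhds 0. f (inv_into V ph (ph x + t *r b)) = g (inv_into V ph (ph x + t *r b))"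
  unfolding eventually_nhds using S by (intro exI[of _ ?S]) (auto simp: p chart_inv[OF c] e)
 thus ?thesis unfolding pderiv_chart_def by (rule deriv_cong_ev) simp
qed

lemma pderiv_coordinate:
 assumes c: "(V, ph) : atlas M" and x: "x : V" and b: "b : axes M" "b' : axes M"
 shows "pdc V ph b (%y. ph y \<bullet> b') x = (if b = b' then 1 else 0)"
proof -
 let ?F = "%y. ph (inv_into V ph (proj_axes M y)) \<bullet> b'"
 note s = smooth_fun_coordinate[OF c, of b']
 have "((%y. proj_axes M y \<bullet> b') has_derivative (%y. proj_axes M y \<bullet> b')) (at (ph x))"
  by (rule bounded_linear_imp_has_derivative[OF bounded_linear_compose[OF bounded_linear_inner_left proj_bounded]])
 moreover have "open {y. proj_axes M y : ph ` (V Int V)}" by (rule chart_dom_open[OF c chart_open[OF c]])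
 ultimately have "(?F has_derivative (%y. proj_axes M y \<bullet> b')) (at (ph x))"
  by (rule has_derivative_transform_within_open) (use x in \<open>auto simp: chart_proj[OF c] chart_inv[OF c]\<close>)
 hence "frechet_derivative ?F (at (ph x)) = (%y. proj_axes M y \<bullet> b')" using frechet_derivative_at by metis
 thus ?thesis using pderiv_deriv(2)[OF c chart_open[OF c] s x x b(1)] proj_inner[OF b(2), of b] b axes_Basis
  by (auto simp: inner_Basis subset_iff)
qed

lemma smooth_fun_pderiv:
 assumes c: "(V, ph) : atlas M" and U: "open U" and f: "smf M U f" and b: "b : axes M"
 shows "smf M (U Int V) (pdc V ph b f)"
proof (rule smooth_fun_from_chart[OF c])
 let ?S = "{y. proj_axes M y : ph ` (U Int V)}"
 let ?F = "%y. f (inv_into V ph (proj_axes M y))"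
 show UV: "open (U Int V)" using U chart_open[OF c] by auto
 have S: "open ?S" by (rule chart_dom_open[OF c U])
 have F: "smooth_on ?S ?F" using f c unfolding smooth_fun_iff by blast
 have pr: "smooth_on ?S (proj_axes M)" unfolding smooth_on_def using Ck_on_linear[OF S proj_bounded] by blast
 have "smooth_on ?S (%y. frechet_derivative ?F (at (proj_axes M y)) b)"
  by (rule smooth_on_compose[OF S S pr smooth_on_directional[OF F]]) (auto simp: proj_id[OF proj_span])
 thus "smooth_on ?S (%y. pdc V ph b f (inv_into V ph (proj_axes M y)))" by (rule smooth_on_cong[OF S, rotated])
   (auto simp: chart_inv[OF c] pderiv_deriv(2)[OF c U f _ _ b])
qed simp

lemma pderiv_chain:
 assumes c: "(V, ph) : atlas M" and c': "(V', ph') : atlas M" and U: "open U" and f: "smf M U f"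
  and x: "x : U" "x : V" "x : V'" and b: "b : axes M"
 shows "pdc V ph b f x = (SUM b':axes M. pdc V ph b (%y. ph' y \<bullet> b') x * pdc V' ph' b' f x)"
proof -
 let ?F = "%y. f (inv_into V ph (proj_axes M y))" and ?F' = "%y. f (inv_into V' ph' (proj_axes M y))"
 let ?G = "%y. ph' (inv_into V ph (proj_axes M y))"
 let ?S = "{y. proj_axes M y : ph ` (V' Int V)}"
 have xS: "ph x : ?S" using x chart_proj[OF c] by auto
 have S: "open ?S" by (rule chart_dom_open[OF c chart_open[OF c']])
 have Gs: "smooth_on ?S ?G" using charts_compatible[OF c' c] unfolding smooth_in_chart_def .
 have G: "(?G has_derivative frechet_derivative ?G (at (ph x))) (at (ph x))" by (rule smooth_on_has_derivative[OF Gs xS])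
 have Gx: "?G (ph x) = ph' x" using x by (simp add: chart_proj[OF c] chart_inv[OF c])
 have "ph' x : {y. proj_axes M y : ph' ` (U Int V')}" using x chart_proj[OF c'] by auto
 hence F': "(?F' has_derivative frechet_derivative ?F' (at (ph' x))) (at (?G (ph x)))"
  using f c' smooth_on_has_derivative unfolding smooth_fun_iff Gx by blast
 have l: "linear (frechet_derivative ?F' (at (ph' x)))" using F' has_derivative_linear by blast
 define w where "w = frechet_derivative ?G (at (ph x)) b"
 have "(?F' \<circ> ?G has_derivative frechet_derivative ?F' (at (ph' x)) \<circ> frechet_derivative ?G (at (ph x))) (at (ph x))"
  by (rule diff_chain_at[OF G F'])
 hence "(?F has_derivative frechet_derivative ?F' (at (ph' x)) \<circ> frechet_derivative ?G (at (ph x))) (at (ph x))"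
  by (rule has_derivative_transform_within_open[OF _ S xS])
   (auto simp: chart_inv[OF c] chart_inv[OF c'] chart_proj[OF c'])
 hence 1: "pdc V ph b f x = frechet_derivative ?F' (at (ph' x)) w"
  using frechet_derivative_at pderiv_deriv(2)[OF c U f x(1,2) b] by (metis comp_apply w_def)
 have wc: "w \<bullet> d = frechet_derivative (%y. ?G y \<bullet> d) (at (ph x)) b" for d
  using frechet_derivative_at[OF bounded_linear.has_derivative[OF bounded_linear_inner_left G, of d]] w_def by metis
 \<comment> \<open>The transition map takes values in the model space, hence so does its derivative
   \<open>w\<close>; therefore \<open>w\<close> expands in the axes alone and not in all of
   \<open>Basis\<close>.\<close>
 have "(proj_axes M \<circ> ?G has_derivative proj_axes M \<circ> frechet_derivative ?G (at (ph x))) (at (ph x))"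
  by (rule diff_chain_at[OF G bounded_linear_imp_has_derivative[OF proj_bounded]])
 hence "(?G has_derivative proj_axes M \<circ> frechet_derivative ?G (at (ph x))) (at (ph x))"
  by (rule has_derivative_transform_within_open[OF _ S xS]) (auto simp: chart_inv[OF c] chart_proj[OF c'])
 hence "w = proj_axes M w" using frechet_derivative_at[of ?G] unfolding w_def by (metis comp_apply)
 hence w: "w = (SUM b':axes M. (w \<bullet> b') *r b')" by (simp add: proj_axes_def)
 have 2: "w \<bullet> b' = pdc V ph b (%y. ph' y \<bullet> b') x" for b'
  using wc pderiv_deriv(2)[OF c chart_open[OF c'] smooth_fun_coordinate[OF c'] x(3,2) b, of b'] by simp
 have "frechet_derivative ?F' (at (ph' x)) w = (SUM b':axes M. (w \<bullet> b') * frechet_derivative ?F' (at (ph' x)) b')"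
  by (subst w) (simp add: linear_sum[OF l] linear_scale[OF l])
 also have "... = (SUM b':axes M. pdc V ph b (%y. ph' y \<bullet> b') x * pdc V' ph' b' f x)"
  by (rule sum.cong) (auto simp: 2 pderiv_deriv(2)[OF c' U f x(1,3)])
 finally show ?thesis using 1 by simp
qed

subsection \<open>Bump functions\<close>

text \<open>The bump is built in a chart and extended by zero. The extension is smooth because the
  bump vanishes off \<open>C\<close>, the image of a compact set of coordinates, which is closed in
  the whole Hausdorff manifold and not merely in the chart domain.\<close>

lemma bump_function:
 assumes U: "open U" and x: "x : U"
 obtains \<beta> N C where "smf M UNIV \<beta>" "open N" "x : N" "N <= U" "!!y. y : N ==> \<beta> y = 1"
  "closed C" "C <= U" "!!y. y ~: C ==> \<beta> y = 0"
proof -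
 obtain V ph where c: "(V, ph) : atlas M" "x : V" by (rule chart_exists)
 have xS: "ph x : {y. proj_axes M y : ph ` (U Int V)}" using x c chart_proj[OF c(1)] by auto
 obtain r where r: "r > 0" "cball (ph x) r <= {y. proj_axes M y : ph ` (U Int V)}"
  using open_contains_cball_eq[OF chart_dom_open[OF c(1) U]] xS by blast
 define K where "K = cball (ph x) r Int span (axes M)"
 have Kc: "compact K" unfolding K_def by (intro compact_Int_closed compact_cball closed_span)
 have K: "K <= ph ` (U Int V)" using r(2) proj_id unfolding K_def by fastforce
 define C where "C = inv_into V ph ` K"
 have "compact C" unfolding C_def using continuous_on_subset[OF chart_continuous(2)[OF c(1)]] K Kc by (intro compact_continuous_image) auto
 hence Cc: "closed C" by (rule compact_imp_closed)
 have CU: "C <= U Int V" unfolding C_def using K chart_inv[OF c(1)] by fastforce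
 have Cmem: "y : C" if "y : V" "dist (ph x) (ph y) <= r" for y
  unfolding C_def using that chart_inv[OF c(1) that(1)] chart_span[OF c(1) that(1)] by (intro image_eqI[of _ _ "ph y"]) (auto simp: K_def)
 define s where "s y = (ph y - ph x) \<bullet> (ph y - ph x)" for y
 have ss: "smf M V s"
 proof -
  have "smf M V (%y. SUM b:Basis. (ph y \<bullet> b - ph x \<bullet> b) * (ph y \<bullet> b - ph x \<bullet> b))"
   using chart_open[OF c(1)] smooth_fun_coordinate[OF c(1)] by (intro smooth_fun_sum smooth_fun_mult smooth_fun_diff smooth_fun_const)
  moreover have e: "s y = (SUM b:Basis. (ph y \<bullet> b - ph x \<bullet> b) * (ph y \<bullet> b - ph x \<bullet> b))" for y
   unfolding s_def by (subst euclidean_inner) (simp only: inner_diff_left)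
  ultimately show ?thesis by (intro smooth_fun_cong[OF chart_open[OF c(1)] e[symmetric]])
 qed
 have sd: "s y = (dist (ph x) (ph y))\<^sup>2" for y by (simp add: s_def dist_norm norm_minus_commute[of "ph x"] power2_norm_eq_inner)
 let ?e = "flat_fun 0"
 have epos: "?e t > 0" if "t > 0" for t using that by (simp add: flat_fun_def)
 have enn: "?e t \<ge> 0" for t by (simp add: flat_fun_def)
 have dpos: "?e (r\<^sup>2 - s y) + ?e (s y - r\<^sup>2 / 4) > 0" for y
 proof (cases "s y < r\<^sup>2")
  case True
  thus ?thesis using epos[of "r\<^sup>2 - s y"] enn[of "s y - r\<^sup>2 / 4"] by linarith
 next
  case False
  moreover have "r\<^sup>2 > 0" using r(1) by simp
  ultimately have "s y - r\<^sup>2 / 4 > 0" by linarith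
  thus ?thesis using epos[of "s y - r\<^sup>2 / 4"] enn[of "r\<^sup>2 - s y"] by linarith
 qed
 \<comment> \<open>The quotient e(r^2 - s) / (e(r^2 - s) + e(s - r^2/4)), with s the squared
   coordinate distance: it is 0 for s >= r^2 and 1 for s <= r^2/4. The denominator is positive
   because the two arguments are never both nonpositive.\<close>
 define wt where "wt y = ?e (r\<^sup>2 - s y) * (?e (r\<^sup>2 - s y) + ?e (s y - r\<^sup>2 / 4)) powr (- 1)" for y
 note Vo = chart_open[OF c(1)]
 have cs: "smf M V wt"
 proof -
  have 1: "smf M V (%y. ?e (r\<^sup>2 - s y))" "smf M V (%y. ?e (s y - r\<^sup>2 / 4))"
   using ss Vo by (auto intro!: smooth_fun_compose[OF _ _ open_UNIV smooth_on_flat_fun] smooth_fun_diff smooth_fun_const)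
  have "smf M V (%y. (?e (r\<^sup>2 - s y) + ?e (s y - r\<^sup>2 / 4)) powr (- 1))"
   by (rule smooth_fun_compose[OF Vo smooth_fun_add[OF Vo 1] open_greaterThan smooth_on_powr]) (use dpos in simp)
  thus ?thesis unfolding wt_def using 1 Vo by (intro smooth_fun_mult)
 qed
 define \<beta> where "\<beta> = cut V wt"
 have b0: "\<beta> y = 0" if "y ~: C" for y
 proof (cases "y : V")
  case True
  hence "r < dist (ph x) (ph y)" using Cmem[OF True] that by force
  hence "r\<^sup>2 < s y" unfolding sd using r(1) by (intro power_strict_mono) auto
  thus ?thesis by (simp add: \<beta>_def wt_def cut_def flat_fun_def)
 qed (simp add: \<beta>_def cut_def)
 have sb: "smf M UNIV \<beta>"
 proof (rule smooth_fun_local[OF open_UNIV])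
  fix y :: 'm
  show "EX W. open W & y : W & smf M (W Int UNIV) \<beta>"
  proof (cases "y : V")
   case True
   have "smf M V \<beta>" by (rule smooth_fun_cong[OF Vo _ cs]) (simp add: \<beta>_def cut_def)
   thus ?thesis using True Vo by auto
  next
   case False
   have o: "open (- C)" using Cc by (simp add: open_Compl)
   have "smf M (- C) \<beta>" by (rule smooth_fun_cong[OF o _ smooth_fun_const[OF o, of 0]]) (simp add: b0)
   thus ?thesis using False CU o by (intro exI[of _ "- C"]) auto
  qed
 qed
 define N where "N = {y : V. ph y : ball (ph x) (r / 2)}"
 have b1: "\<beta> y = 1" if "y : N" for y
 proof -
  have "dist (ph x) (ph y) < r / 2" "y : V" using that by (auto simp: N_def)
  hence "s y < (r / 2)\<^sup>2" unfolding sd by (intro power_strict_mono) auto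
  hence sy: "s y < r\<^sup>2 / 4" by (simp add: power_divide)
  moreover have "r\<^sup>2 > 0" using r(1) by simp
  ultimately have e: "?e (s y - r\<^sup>2 / 4) = 0" "s y < r\<^sup>2" by (simp add: flat_fun_def, linarith)
  have "?e (r\<^sup>2 - s y) > 0" using e(2) by (intro epos) simp
  thus ?thesis using \<open>y : V\<close> e(1) by (simp add: \<beta>_def wt_def cut_def powr_minus)
 qed
 have "N <= C" using Cmem r(1) by (auto simp: N_def)
 moreover have "open N" unfolding N_def by (rule chart_coordinate_open[OF c(1) open_ball])
 moreover have "x : N" using c(2) r(1) by (simp add: N_def)
 ultimately show thesis using that[OF sb _ _ _ b1 Cc _ b0] CU by blast
qed

end

section \<open>Pseudo-Euclidean vector bundles\<close>

subsection \<open>Frames\<close>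

lemma frame_bij:
 assumes "frame_at E es x" shows "bij_betw (%a. (es ! a) x) {..<length es} (set (map (%e. e x) es))"
proof -
 have "bij_betw ((!) (map (%e. e x) es)) {..<length es} (set (map (%e. e x) es))"
  using assms by (intro bij_betw_nth) (auto simp: frame_at_def)
 thus ?thesis by (rule bij_betw_cong[THEN iffD1, rotated]) simp
qed

lemma frame_sum:
 assumes f: "frame_at E es x" and v: "s x : fibre E x" shows "(SUM a<length es. fco es a s x *r (es ! a) x) = s x"
proof -
 let ?B = "set (map (%e. e x) es)"
 have "(SUM b:?B. representation ?B (s x) b *r b) = s x"
  using f v by (intro real_vector.sum_representation_eq) (auto simp: frame_at_def)
 thus ?thesis using sum.reindex_bij_betw[OF frame_bij[OF f], of "%b. representation ?B (s x) b *r b"]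
  by (simp add: frame_coeff_def)
qed

lemma frame_unique:
 assumes f: "frame_at E es x" and s: "s x = (SUM a<length es. c a *r (es ! a) x)" and a: "a < length es" shows "fco es a s x = c a"
proof -
 let ?B = "set (map (%e. e x) es)"
 have B: "independent ?B" using f by (simp add: frame_at_def)
 have m: "(es ! i) x : ?B" if "i < length es" for i using that by auto
 have "representation ?B (s x) = (%b. SUM i<length es. representation ?B (c i *r (es ! i) x) b)"
  unfolding s using m by (intro real_vector.representation_sum[OF B] real_vector.span_scale real_vector.span_base) auto
 moreover have "representation ?B (c i *r (es ! i) x) ((es ! a) x) = (if i = a then c a else 0)" if i: "i < length es" for i
 proof -
  have "(es ! i) x = (es ! a) x \<longleftrightarrow> i = a" using frame_bij[OF f] i a unfolding bij_betw_def inj_on_def by auto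
  thus ?thesis using real_vector.representation_scale[OF B real_vector.span_base[OF m[OF i]]] real_vector.representation_basis[OF B m[OF i]]
   by auto
 qed
 ultimately show ?thesis using a by (simp add: frame_coeff_def)
qed

lemma frame_coeff_cong: "s x = t x ==> fco es a s x = fco es a t x" by (simp add: frame_coeff_def)

locale pe_mfd = smooth_mfd E for E :: "('m::{t2_space, second_countable_topology}, 'a::euclidean_space, 'v::real_vector, 'z) pe_bundle_scheme" +
 assumes pe: "pseudo_euclidean_bundle E"
begin

lemma trivs_all:
 "ALL (V, es) : trivs E. open V & (ALL x:V. frame_at E es x)"
 "(\<Union>(V, es) \<in> trivs E. V) = UNIV"
 "ALL (V, es) : trivs E. ALL (V', es') : trivs E. ALL a < length es. ALL a' < length es'.
    smf E (V Int V') (fco es a (es' ! a'))"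
 "ALL (V, es) : trivs E. ALL a < length es. ALL b < length es.
    smf E V (%x. form E x ((es ! a) x) ((es ! b) x))"
proof -
 note p = pe[unfolded pseudo_euclidean_bundle_def vector_bundle_def]
 show "ALL (V, es) : trivs E. open V & (ALL x:V. frame_at E es x)"
  by (rule p[THEN conjunct1, THEN conjunct2, THEN conjunct1])
 show "(\<Union>(V, es) \<in> trivs E. V) = UNIV" by (rule p[THEN conjunct1, THEN conjunct2, THEN conjunct2, THEN conjunct1])
 show "ALL (V, es) : trivs E. ALL (V', es') : trivs E. ALL a < length es. ALL a' < length es'.
    smf E (V Int V') (fco es a (es' ! a'))" by (rule p[THEN conjunct1, THEN conjunct2, THEN conjunct2, THEN conjunct2])
 show "ALL (V, es) : trivs E. ALL a < length es. ALL b < length es.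
    smf E V (%x. form E x ((es ! a) x) ((es ! b) x))" by (rule p[THEN conjunct2, THEN conjunct2, THEN conjunct2])
qed

lemma triv:
 assumes "(V, es) : trivs E" shows "open V" "x : V ==> frame_at E es x" using bspec[OF trivs_all(1) assms] by simp_all

lemma triv_exists: obtains V es where "(V, es) : trivs E" "x : V"
proof -
 have "x : (\<Union>(V, es) \<in> trivs E. V)" unfolding trivs_all(2) by simp
 thus thesis using that by auto
qed

lemma triv_smooth:
 assumes "(V, es) : trivs E" "(V', es') : trivs E" "a < length es" "a' < length es'"
 shows "smf E (V Int V') (fco es a (es' ! a'))"
 using bspec[OF bspec[OF trivs_all(3) assms(1), unfolded prod.case] assms(2)] assms(3,4) by simp

lemma triv_form_smooth:
 assumes "(V, es) : trivs E" "a < length es" "b < length es" shows "smf E V (%x. form E x ((es ! a) x) ((es ! b) x))"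
 using bspec[OF trivs_all(4) assms(1)] assms(2,3) by simp

lemma fibre_subspace: "subspace (fibre E x)"
proof -
 obtain V es where "(V, es) : trivs E" "x : V" by (rule triv_exists)
 hence "span (set (map (%e. e x) es)) = fibre E x" using triv(2) unfolding frame_at_def by blast
 thus ?thesis using real_vector.subspace_span[of "set (map (%e. e x) es)"] by simp
qed

lemma fibre_zero: "0 : fibre E x" by (rule real_vector.subspace_0[OF fibre_subspace])

lemma fibre_add: "u : fibre E x ==> v : fibre E x ==> u + v : fibre E x"
 by (rule real_vector.subspace_add[OF fibre_subspace])

lemma fibre_diff: "u : fibre E x ==> v : fibre E x ==> u - v : fibre E x"
 by (rule real_vector.subspace_diff[OF fibre_subspace])

lemma fibre_scale: "u : fibre E x ==> c *r u : fibre E x" by (rule real_vector.subspace_scale[OF fibre_subspace])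

lemma fibre_sum: "(!!i. i : I ==> f i : fibre E x) ==> (SUM i:I. f i) : fibre E x"
 by (rule real_vector.subspace_sum[OF fibre_subspace])

lemma fibre_comb: "(!!i. i : I ==> u i : fibre E x) ==> (SUM i:I. c i *r u i) : fibre E x"
 by (rule fibre_sum) (rule fibre_scale)

lemma frame_fibre: "frame_at E es x ==> a < length es ==> (es ! a) x : fibre E x"
 unfolding frame_at_def using real_vector.span_base[of "(es ! a) x" "set (map (%e. e x) es)"] by auto

lemma form_sym: "u : fibre E x ==> v : fibre E x ==> form E x u v = form E x v u"
 and form_add: "u : fibre E x ==> v : fibre E x ==> w : fibre E x ==> form E x (u + v) w = form E x u w + form E x v w"
 and form_scale: "u : fibre E x ==> v : fibre E x ==> form E x (c *r u) v = c * form E x u v"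
 and form_nondeg: "u : fibre E x ==> (!!v. v : fibre E x ==> form E x u v = 0) ==> u = 0"
proof -
 note p = pe[unfolded pseudo_euclidean_bundle_def]
 note q = p[THEN conjunct2, THEN conjunct1]
 show "u : fibre E x ==> v : fibre E x ==> form E x u v = form E x v u"
  "u : fibre E x ==> v : fibre E x ==> w : fibre E x ==> form E x (u + v) w = form E x u w + form E x v w"
  "u : fibre E x ==> v : fibre E x ==> form E x (c *r u) v = c * form E x u v" using q by blast+
 show "u : fibre E x ==> (!!v. v : fibre E x ==> form E x u v = 0) ==> u = 0"
  using p[THEN conjunct2, THEN conjunct2, THEN conjunct1] by blast
qed

lemma form_add_right: "u : fibre E x ==> v : fibre E x ==> w : fibre E x ==> form E x w (u + v) = form E x w u + form E x w v"
 using form_add[of u x v w] form_sym fibre_add by simp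

lemma form_scale_right: "u : fibre E x ==> v : fibre E x ==> form E x u (c *r v) = c * form E x u v"
 using form_scale[of v x u c] form_sym fibre_scale by simp

lemma form_zero: "u : fibre E x ==> form E x 0 u = 0" "u : fibre E x ==> form E x u 0 = 0"
 using form_scale[of u x u 0] form_scale_right[of u x u 0] by auto

lemma form_diff: "u : fibre E x ==> v : fibre E x ==> w : fibre E x ==> form E x (u - v) w = form E x u w - form E x v w"
 using form_add[of u x "- 1 *r v" w] form_scale[of v x w "- 1"] fibre_scale[of v x "- 1"] by simp

lemma form_diff_right: "u : fibre E x ==> v : fibre E x ==> w : fibre E x ==> form E x w (u - v) = form E x w u - form E x w v"
 using form_diff[of u x v w] form_sym fibre_diff by simp

lemma form_comb: "(!!i. i : I ==> u i : fibre E x) ==> v : fibre E x ==>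
  form E x (SUM i:I. c i *r u i) v = (SUM i:I. c i * form E x (u i) v)"
proof (induction I rule: infinite_finite_induct)
 case (insert i I)
 have "(SUM i:I. c i *r u i) : fibre E x" using insert(4) by (intro fibre_comb) simp
 thus ?case using insert by (simp add: form_add[OF fibre_scale] form_scale)
qed (simp_all add: form_zero)

lemma form_comb_right: "(!!i. i : I ==> u i : fibre E x) ==> v : fibre E x ==>
  form E x v (SUM i:I. c i *r u i) = (SUM i:I. c i * form E x v (u i))"
 using form_comb[of I u x v c] form_sym[of v x] fibre_comb[of I u x c] by simp

lemma frame_coeff_add:
 assumes f: "frame_at E es x" and s: "s x : fibre E x" "t x : fibre E x" and a: "a < length es"
 shows "fco es a (%y. s y + t y) x = fco es a s x + fco es a t x"
 by (rule frame_unique[OF f _ a]) (simp add: scaleR_add_left sum.distrib frame_sum[where s = s, OF f s(1)] frame_sum[where s = t, OF f s(2)])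

lemma frame_coeff_scale:
 assumes f: "frame_at E es x" and s: "s x : fibre E x" and a: "a < length es"
 shows "fco es a (%y. h y *r s y) x = h x * fco es a s x"
proof (rule frame_unique[OF f _ a])
 have "h x *r s x = h x *r (SUM a<length es. fco es a s x *r (es ! a) x)" using frame_sum[where s = s, OF f s] by simp
 thus "h x *r s x = (SUM a<length es. (h x * fco es a s x) *r (es ! a) x)" by (simp add: scaleR_sum_right)
qed

lemma form_frame:
 assumes f: "frame_at E es x" and u: "s x : fibre E x" "t x : fibre E x" shows "form E x (s x) (t x) = (SUM a<length es. SUM b<length es.
  fco es a s x * fco es b t x * form E x ((es ! a) x) ((es ! b) x))"
proof -
 note fr = frame_fibre[OF f]
 have "form E x (s x) (t x) = form E x (SUM a<length es. fco es a s x *r (es ! a) x)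
   (SUM b<length es. fco es b t x *r (es ! b) x)"
  by (simp add: frame_sum[where s = s, OF f u(1)] frame_sum[where s = t, OF f u(2)])
 also have "... = (SUM a<length es. SUM b<length es. fco es a s x * (fco es b t x * form E x ((es ! a) x) ((es ! b) x)))"
 proof -
  have "(SUM b<length es. fco es b t x *r (es ! b) x) : fibre E x" by (rule fibre_comb) (simp add: fr)
  hence "form E x (SUM a<length es. fco es a s x *r (es ! a) x) (SUM b<length es. fco es b t x *r (es ! b) x)
    = (SUM a<length es. fco es a s x * form E x ((es ! a) x) (SUM b<length es. fco es b t x *r (es ! b) x))"
   by (intro form_comb) (auto simp: fr)
  also have "... = (SUM a<length es. fco es a s x * (SUM b<length es. fco es b t x * form E x ((es ! a) x) ((es ! b) x)))"
   by (intro sum.cong refl arg_cong2[where f = "(*)"] form_comb_right) (auto simp: fr)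
  finally show ?thesis by (simp add: sum_distrib_left)
 qed
 finally show ?thesis by (simp add: mult.assoc)
qed

subsection \<open>Smooth sections\<close>

lemma section_fibre: "sms E U s ==> x : U ==> s x : fibre E x" by (simp add: smooth_section_def)

lemma section_coeff: "sms E U s ==> (V, es) : trivs E ==> a < length es ==> smf E (U Int V) (fco es a s)"
 unfolding smooth_section_def by auto

lemma section_subset: "sms E U s ==> W <= U ==> sms E W s"
proof -
 assume s: "sms E U s" and W: "W <= U"
 show ?thesis unfolding smooth_section_def
 proof (intro conjI ballI, goal_cases)
  case (1 x) thus ?case using s W section_fibre by blast
 next
  case (2 p)
  show ?case
  proof (cases p, clarify)
   fix V es a assume "p = (V, es)" and a: "a < length es"
   hence V: "(V, es) : trivs E" using 2 by simp
   show "smf E (W Int V) (fco es a s)" by (rule smooth_fun_subset[OF section_coeff[OF s V a]]) (use W in auto)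
  qed
 qed
qed

lemma section_cong:
 assumes "open U" "!!x. x : U ==> s x = t x" "sms E U s" shows "sms E U t" unfolding smooth_section_def
proof (intro conjI ballI, goal_cases)
 case (1 x) thus ?case using assms section_fibre by fastforce
next
 case (2 p)
 show ?case
 proof (cases p, clarify)
  fix V es a assume "p = (V, es)" "a < length es"
  hence V: "(V, es) : trivs E" using 2 by simp
  show "smf E (U Int V) (fco es a t)"
   by (rule smooth_fun_cong[OF open_Int[OF assms(1) triv(1)[OF V]] _ section_coeff[OF assms(3) V \<open>a < length es\<close>]])
    (rule frame_coeff_cong, simp add: assms(2))
 qed
qed

lemma section_local:
 assumes "open U" "!!x. x : U ==> EX W. open W & x : W & sms E (W Int U) s"
 shows "sms E U s" unfolding smooth_section_def
proof (intro conjI ballI, goal_cases)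
 case (1 x) thus ?case using assms(2)[of x] section_fibre by blast
next
 case (2 p)
 show ?case
 proof (cases p, clarify)
  fix V es a assume "p = (V, es)" and a: "a < length es"
  hence V: "(V, es) : trivs E" using 2 by simp
  show "smf E (U Int V) (fco es a s)"
  proof (rule smooth_fun_local)
   show "open (U Int V)" using assms(1) triv(1)[OF V] by auto
   fix x assume x: "x : U Int V"
   then obtain W where W: "open W" "x : W" "sms E (W Int U) s" using assms(2) by blast
   have "W Int (U Int V) = W Int U Int V" by auto
   thus "EX W. open W & x : W & smf E (W Int (U Int V)) (fco es a s)"
    using W section_coeff[OF W(3) V a] by metis
  qed
 qed
qed

lemma section_add:
 assumes U: "open U" and s: "sms E U s" and t: "sms E U t" shows "sms E U (%x. s x + t x)"
 unfolding smooth_section_def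
proof (intro conjI ballI, goal_cases)
 case (1 x) thus ?case using s t section_fibre fibre_add by blast
next
 case (2 p)
 show ?case
 proof (cases p, clarify)
  fix V es a assume "p = (V, es)" and a: "a < length es"
  hence V: "(V, es) : trivs E" using 2 by simp
  have o: "open (U Int V)" using U triv(1)[OF V] by auto
  show "smf E (U Int V) (fco es a (%x. s x + t x))"
   by (rule smooth_fun_cong[OF o _ smooth_fun_add[OF o section_coeff[OF s V a] section_coeff[OF t V a]]])
    (use a s t triv(2)[OF V] section_fibre in \<open>auto intro!: frame_coeff_add[symmetric]\<close>)
 qed
qed

lemma section_scale:
 assumes U: "open U" and f: "smf E U f" and s: "sms E U s" shows "sms E U (%x. f x *r s x)"
 unfolding smooth_section_def
proof (intro conjI ballI, goal_cases)
 case (1 x) thus ?case using s section_fibre fibre_scale by blast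
next
 case (2 p)
 show ?case
 proof (cases p, clarify)
  fix V es a assume "p = (V, es)" and a: "a < length es"
  hence V: "(V, es) : trivs E" using 2 by simp
  have o: "open (U Int V)" using U triv(1)[OF V] by auto
  show "smf E (U Int V) (fco es a (%x. f x *r s x))"
   by (rule smooth_fun_cong[OF o _ smooth_fun_mult[OF o smooth_fun_subset[OF f] section_coeff[OF s V a]]])
    (use a s triv(2)[OF V] section_fibre in \<open>auto intro!: frame_coeff_scale[symmetric]\<close>)
 qed
qed

lemma section_zero: "open U ==> sms E U (%x. 0)"
proof -
 assume U: "open U"
 show ?thesis unfolding smooth_section_def
 proof (intro conjI ballI, goal_cases)
  case (2 p)
  show ?case
  proof (cases p, clarify)
   fix V es a assume "p = (V, es)" and a: "a < length es"
   hence V: "(V, es) : trivs E" using 2 by simp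
   have o: "open (U Int V)" using U triv(1)[OF V] by auto
   show "smf E (U Int V) (fco es a (%x. 0))" by (rule smooth_fun_cong[OF o _ smooth_fun_const[OF o, of 0]])
     (rule frame_unique[where c = "%_. 0", symmetric]; use a triv(2)[OF V] in auto)
  qed
 qed (simp add: fibre_zero)
qed

lemma section_sum: "open U ==> (!!i. i : I ==> sms E U (s i)) ==> sms E U (%x. SUM i:I. s i x)"
 by (induction I rule: infinite_finite_induct) (auto intro: section_zero section_add)

lemma section_diff:
 assumes "open U" "sms E U s" "sms E U t" shows "sms E U (%x. s x - t x)"
 using section_add[OF assms(1,2) section_scale[OF assms(1) smooth_fun_const[OF assms(1), of "- 1"] assms(3)]] by simp

lemma triv_section: "(V, es) : trivs E ==> a < length es ==> sms E V (es ! a)"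
 unfolding smooth_section_def
proof (intro conjI ballI, goal_cases)
 case (1 x) thus ?case using triv(2) frame_fibre by blast
next
 case (2 p)
 thus ?case using triv_smooth[of "fst p" "snd p" V es _ a] by (auto simp: Int_commute)
qed

lemma pairing_smooth:
 assumes U: "open U" and s: "sms E U s" and t: "sms E U t" shows "smf E U (pairing E s t)"
proof (rule smooth_fun_local[OF U])
 fix x assume x: "x : U"
 obtain V es where V: "(V, es) : trivs E" "x : V" by (rule triv_exists)
 have o: "open (V Int U)" using U triv(1)[OF V(1)] by auto
 have c: "smf E (V Int U) (fco es a s)" "smf E (V Int U) (fco es a t)" if "a < length es" for a
  using section_coeff[OF s V(1) that] section_coeff[OF t V(1) that] by (simp_all add: Int_commute)
 have "smf E (V Int U) (%x. SUM a<length es. SUM b<length es.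
  fco es a s x * fco es b t x * form E x ((es ! a) x) ((es ! b) x))"
  using c smooth_fun_subset[OF triv_form_smooth[OF V(1)] Int_lower1] by (intro smooth_fun_sum smooth_fun_mult o) auto
 hence "smf E (V Int U) (pairing E s t)" by (rule smooth_fun_cong[OF o, rotated])
   (use triv(2)[OF V(1)] s t section_fibre in \<open>auto simp: pairing_def intro!: form_frame[symmetric]\<close>)
 thus "EX W. open W & x : W & smf E (W Int U) (pairing E s t)" using V triv(1) by blast
qed

subsection \<open>Orthonormal frames\<close>

lemma smooth_fun_continuous:
 assumes "open U" "smf E U f" shows "continuous_on U f"
proof -
 have "isCont f x" if x: "x : U" for x
 proof -
  obtain V ph where c: "(V, ph) : atlas E" "x : V" by (rule chart_exists)
  let ?S = "{y. proj_axes E y : ph ` (U Int V)}"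
  let ?F = "%y. f (inv_into V ph (proj_axes E y))"
  have "smooth_on ?S ?F" using assms(2) c unfolding smooth_fun_iff by blast
  hence "continuous_on ?S ?F" unfolding smooth_on_def using Ck_on.simps(1) by blast
  moreover have "ph ` (U Int V) <= ?S" using chart_proj[OF c(1)] by auto
  ultimately have "continuous_on (ph ` (U Int V)) ?F" by (rule continuous_on_subset)
  hence "continuous_on (U Int V) (?F \<circ> ph)"
   using continuous_on_subset[OF chart_continuous(1)[OF c(1)]] by (intro continuous_on_compose) auto
  hence "continuous_on (U Int V) f" by (rule continuous_on_eq) (auto simp: chart_proj[OF c(1)] chart_inv[OF c(1)])
  thus ?thesis using x c assms(1) chart_open[OF c(1)] by (simp add: continuous_on_eq_continuous_at open_Int)
 qed
 thus ?thesis by (simp add: continuous_at_imp_continuous_on)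
qed

text \<open>The signs \<open>\<epsilon>\<close> are the same at all points of \<open>W\<close>, so
  the Gram matrix is constant, as the charts of the N-manifold demand. Spanning is not part of the
  notion, in order to admit the partial systems of Gram-Schmidt.\<close>

definition onb :: "'m set => ('m => 'v) list => bool" where
 "onb W us \<longleftrightarrow> open W & (ALL u:set us. sms E W u)
  & (EX \<epsilon>::nat => real. (ALL i. \<epsilon> i * \<epsilon> i = 1) & (ALL i<length us. ALL j<length us. ALL y:W.
     form E y ((us ! i) y) ((us ! j) y) = (if i = j then \<epsilon> i else 0)))"

lemma span_bound:
 assumes "frame_at E es x" "independent S" "S <= fibre E x" shows "finite S & card S <= length es"
proof -
 have "finite S & card S <= card (set (map (%e. e x) es))"
  using assms by (intro real_vector.independent_span_bound) (auto simp: frame_at_def)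
 thus ?thesis using card_length[of "map (%e. e x) es"] by simp
qed

text \<open>Pairing a vanishing combination with a member of the system isolates its coefficient,
  which gives independence; the number of members then gives spanning.\<close>

lemma onb_frame:
 assumes o: "onb W us" and y: "y : W" and f: "frame_at E es y" and l: "length us = length es" shows "frame_at E us y"
proof -
 obtain \<epsilon> :: "nat => real" where e: "!!i. \<epsilon> i * \<epsilon> i = 1" "!!i j. i < length us ==> j < length us ==>
   form E y ((us ! i) y) ((us ! j) y) = (if i = j then \<epsilon> i else 0)" using o y unfolding onb_def by blast
 have e0: "\<epsilon> i ~= 0" for i using e(1)[of i] by auto
 have fb: "(us ! i) y : fibre E y" if "i < length us" for i using o y nth_mem[OF that] section_fibre unfolding onb_def by blast
 have inj: "inj_on (%i. (us ! i) y) {..<length us}"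
 proof (rule inj_onI)
  fix i j assume "i : {..<length us}" "j : {..<length us}" "(us ! i) y = (us ! j) y"
  thus "i = j" using e(2)[of i j] e(2)[of i i] e0[of i] by (auto split: if_splits)
 qed
 have d: "distinct (map (%u. u y) us)" using inj by (auto simp: distinct_conv_nth inj_on_def)
 let ?B = "set (map (%u. u y) us)"
 have B: "?B = (%i. (us ! i) y) ` {..<length us}" unfolding set_map by (auto simp: set_conv_nth)
 have ind: "independent ?B"
 proof (rule real_vector.independent_if_scalars_zero)
  fix c v assume z: "(SUM v:?B. c v *r v) = 0" and v: "v : ?B"
  obtain j where j: "j < length us" "v = (us ! j) y" using v unfolding B by auto
  have "0 = form E y (SUM i<length us. c ((us ! i) y) *r (us ! i) y) ((us ! j) y)"
   using z fb[OF j(1)] unfolding B by (simp add: sum.reindex[OF inj] form_zero)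
  also have "... = (SUM i<length us. c ((us ! i) y) * form E y ((us ! i) y) ((us ! j) y))" by (rule form_comb) (use fb j in auto)
  also have "... = (SUM i<length us. if i = j then c v * \<epsilon> j else 0)" by (rule sum.cong) (use e(2) j in auto)
  also have "... = c v * \<epsilon> j" using j(1) by simp
  finally show "c v = 0" using e0[of j] by simp
 qed simp
 have sub: "?B <= fibre E y" using fb unfolding B by auto
 have "span ?B = fibre E y"
 proof (rule ccontr)
  assume n: "span ?B ~= fibre E y"
  have "span ?B <= fibre E y" using sub fibre_subspace by (rule real_vector.span_minimal)
  then obtain b where b: "b : fibre E y" "b ~: span ?B" using n by blast
  have "independent (insert b ?B)" using ind b(2) by (simp add: real_vector.independent_insert)
  hence "card (insert b ?B) <= length es" using span_bound[OF f] sub b(1) by simp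
  moreover have "card (insert b ?B) = Suc (length us)"
   using b(2) distinct_card[OF d] real_vector.span_base[of b ?B] by (simp add: card_insert_if) metis
  ultimately show False using l by simp
 qed
 thus ?thesis using d ind by (simp add: frame_at_def)
qed

text \<open>One step of Gram-Schmidt for an indefinite form. A nonzero vector orthogonal to
  \<open>us\<close> may be null, so nondegeneracy is used to find a second orthogonal vector not
  orthogonal to the first; one of the two or their sum is not null. This vector is continued to a
  neighbourhood, made orthogonal again and normalised where its square keeps its sign.\<close>

lemma onb_extend:
 assumes o: "onb W us" and x: "x : W" and V: "(V, es) : trivs E" "x : V" and l: "length us < length es"
 obtains W' u where "x : W'" "W' <= W Int V" "onb W' (us @ [u])"
proof -
 let ?k = "length us"
 obtain \<epsilon> :: "nat => real" where e: "!!i. \<epsilon> i * \<epsilon> i = 1" "!!i j y. y : W ==> i < ?k ==> j < ?k ==>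
   form E y ((us ! i) y) ((us ! j) y) = (if i = j then \<epsilon> i else 0)" using o unfolding onb_def by blast
 have Wo: "open W" and us: "!!i. i < ?k ==> sms E W (us ! i)" using o unfolding onb_def by auto
 have fb: "(us ! i) y : fibre E y" if "i < ?k" "y : W" for i y using section_fibre[OF us[OF that(1)] that(2)] .
 \<comment> \<open>Subtracts the components along \<open>us\<close>; \<open>\<epsilon> i\<close>
   appears in the coefficient because it is its own inverse.\<close>
 define P where "P y s = s - (SUM i<?k. (\<epsilon> i * form E y s ((us ! i) y)) *r (us ! i) y)" for y s
 have Pf: "P y s : fibre E y" if "y : W" "s : fibre E y" for y s unfolding P_def using that fb by (intro fibre_diff fibre_comb) auto
 have Po: "form E y (P y s) ((us ! j) y) = 0" if "y : W" "s : fibre E y" "j < ?k" for y s j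
 proof -
  have "form E y (P y s) ((us ! j) y) = form E y s ((us ! j) y) -
    (SUM i<?k. \<epsilon> i * form E y s ((us ! i) y) * form E y ((us ! i) y) ((us ! j) y))"
  proof -
   have "(SUM i<?k. (\<epsilon> i * form E y s ((us ! i) y)) *r (us ! i) y) : fibre E y" by (rule fibre_comb) (use that fb in auto)
   moreover have "form E y (SUM i<?k. (\<epsilon> i * form E y s ((us ! i) y)) *r (us ! i) y) ((us ! j) y) =
     (SUM i<?k. \<epsilon> i * form E y s ((us ! i) y) * form E y ((us ! i) y) ((us ! j) y))" by (rule form_comb) (use that fb in auto)
   ultimately show ?thesis unfolding P_def using that fb by (subst form_diff) auto
  qed
  also have "(SUM i<?k. \<epsilon> i * form E y s ((us ! i) y) * form E y ((us ! i) y) ((us ! j) y)) =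
    (SUM i<?k. if i = j then \<epsilon> j * \<epsilon> j * form E y s ((us ! j) y) else 0)" by (rule sum.cong) (use that e(2) in auto)
  also have "... = form E y s ((us ! j) y)" using that(3) by (simp add: e(1))
  finally show ?thesis by simp
 qed
 have fx: "frame_at E es x" by (rule triv(2)[OF V])
 have "\<not> fibre E x <= span (set (map (%u. u x) us))"
 proof
  assume s: "fibre E x <= span (set (map (%u. u x) us))"
  have "set (map (%e. e x) es) <= fibre E x" using fx real_vector.span_superset unfolding frame_at_def by metis
  hence "card (set (map (%e. e x) es)) <= card (set (map (%u. u x) us))"
   using s fx real_vector.independent_span_bound[of "set (map (%u. u x) us)" "set (map (%e. e x) es)"]
   unfolding frame_at_def by blast
  moreover have "card (set (map (%e. e x) es)) = length es" using fx distinct_card unfolding frame_at_def by fastforce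
  moreover have "card (set (map (%u. u x) us)) <= ?k" using card_length[of "map (%u. u x) us"] by simp
  ultimately show False using l by simp
 qed
 then obtain b where b: "b : fibre E x" "b ~: span (set (map (%u. u x) us))" by blast
 define w0 where "w0 = P x b"
 have w0: "w0 : fibre E x" "w0 ~= 0"
 proof -
  show "w0 : fibre E x" unfolding w0_def by (rule Pf[OF x b(1)])
  have "(SUM i<?k. (\<epsilon> i * form E x b ((us ! i) x)) *r (us ! i) x) : span (set (map (%u. u x) us))"
   by (intro real_vector.span_sum real_vector.span_scale real_vector.span_base) auto
  thus "w0 ~= 0" using b(2) unfolding w0_def P_def by auto
 qed
 obtain z where z: "z : fibre E x" "form E x w0 z ~= 0" using form_nondeg[OF w0(1)] w0(2) by blast
 define z0 where "z0 = P x z"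
 have z0: "z0 : fibre E x" unfolding z0_def by (rule Pf[OF x z(1)])
 have "form E x w0 z0 = form E x w0 z - (SUM i<?k. \<epsilon> i * form E x z ((us ! i) x) * form E x w0 ((us ! i) x))"
 proof -
  have "(SUM i<?k. (\<epsilon> i * form E x z ((us ! i) x)) *r (us ! i) x) : fibre E x" by (rule fibre_comb) (use x fb in auto)
  moreover have "form E x w0 (SUM i<?k. (\<epsilon> i * form E x z ((us ! i) x)) *r (us ! i) x) =
    (SUM i<?k. \<epsilon> i * form E x z ((us ! i) x) * form E x w0 ((us ! i) x))" by (rule form_comb_right) (use x fb w0(1) in auto)
  ultimately show ?thesis unfolding z0_def P_def using w0(1) z(1) by (subst form_diff_right) auto
 qed
 hence wz: "form E x w0 z0 ~= 0" using Po[OF x b(1)] z(2) by (simp add: w0_def)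
 have ow: "form E x w0 ((us ! j) x) = 0" "form E x z0 ((us ! j) x) = 0" if "j < ?k" for j
  using Po[OF x b(1) that] Po[OF x z(1) that] by (simp_all add: w0_def z0_def)
 \<comment> \<open>Polarisation: if \<open>w0\<close> and \<open>z0\<close> are both null, the
   square of their sum is twice their pairing, which is nonzero.\<close>
 obtain w where w: "w : fibre E x" "form E x w w ~= 0" "!!j. j < ?k ==> form E x w ((us ! j) x) = 0"
 proof (cases "form E x w0 w0 = 0 & form E x z0 z0 = 0")
  case True
  have "form E x (w0 + z0) (w0 + z0) = 2 * form E x w0 z0"
   using True w0(1) z0 form_sym[OF w0(1) z0] by (simp add: form_add form_add_right fibre_add)
  thus thesis using that[of "w0 + z0"] wz ow w0(1) z0 fb x by (simp add: form_add fibre_add)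
 next
  case False
  thus thesis using that[of w0] that[of z0] ow w0(1) z0 by blast
 qed
 \<comment> \<open>\<open>w\<close> is continued with constant coefficients in the frame
   \<open>es\<close>; \<open>P\<close> restores orthogonality at every point.\<close>
 define s where "s y = (SUM a<length es. fco es a (%_. w) x *r (es ! a) y)" for y
 have sx: "s x = w" using frame_sum[OF fx, of "%_. w"] w(1) by (simp add: s_def)
 note Vo = triv(1)[OF V(1)]
 have ss: "sms E V s" unfolding s_def by (intro section_sum section_scale smooth_fun_const Vo triv_section[OF V(1)]) auto
 let ?WV = "W Int V"
 have WVo: "open ?WV" using Wo Vo by auto
 have ps: "sms E ?WV (%y. P y (s y))"
 proof -
  have "sms E ?WV (%y. s y - (SUM i<?k. (\<epsilon> i * pairing E s (us ! i) y) *r (us ! i) y))"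
   using us by (intro section_diff section_sum section_scale smooth_fun_mult smooth_fun_const WVo pairing_smooth
     section_subset[OF ss]) (auto intro: section_subset)
  thus ?thesis by (simp add: P_def pairing_def)
 qed
 define q where "q y = form E y (P y (s y)) (P y (s y))" for y
 have qs: "smf E ?WV q" using pairing_smooth[OF WVo ps ps] by (simp add: q_def[abs_def] pairing_def)
 have Px: "P x (s x) = w"
 proof -
  have "(SUM i<?k. (\<epsilon> i * form E x w ((us ! i) x)) *r (us ! i) x) = 0" by (rule sum.neutral) (simp add: w(3))
  thus ?thesis by (simp add: P_def sx)
 qed
 \<comment> \<open>The square of the projected section may be negative. Its sign at \<open>x\<close>
   makes \<open>d * q\<close> positive nearby, so that the real power -1/2 is available and
   normalises the square to \<open>d\<close>.\<close>
 define d where "d = sgn (q x)"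
 have qx: "q x ~= 0" by (simp add: q_def Px w(2))
 have dd: "d * d = 1" using qx by (auto simp: d_def sgn_if)
 have dq: "d * q x > 0" using qx by (simp add: d_def sgn_if)
 define W' where "W' = {y : ?WV. d * q y > 0}"
 have dqs: "smf E ?WV (%y. d * q y)" by (intro smooth_fun_mult smooth_fun_const WVo qs)
 have "open (?WV Int (%y. d * q y) -` {0<..})" using smooth_fun_continuous[OF WVo dqs] WVo by (rule continuous_open_preimage) simp
 hence W'o: "open W'" by (simp add: W'_def vimage_def Int_def)
 define u where "u y = ((d * q y) powr (- 1 / 2)) *r P y (s y)" for y
 have us': "sms E W' u" unfolding u_def
 proof (rule section_scale[OF W'o _ section_subset[OF ps]])
  show "smf E W' (%y. (d * q y) powr (- 1 / 2))"
   by (rule smooth_fun_compose[OF W'o smooth_fun_subset[OF dqs] open_greaterThan smooth_on_powr]) (auto simp: W'_def)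
 qed (auto simp: W'_def)
 have sf: "s y : fibre E y" if "y : V" for y using ss that by (rule section_fibre)
 have uu: "form E y (u y) (u y) = d" if "y : W'" for y
 proof -
  have y: "y : W" "y : V" "d * q y > 0" using that by (auto simp: W'_def)
  have "form E y (u y) (u y) = (d * q y) powr (- 1 / 2) * ((d * q y) powr (- 1 / 2) * q y)"
   unfolding u_def using Pf[OF y(1) sf[OF y(2)]] by (simp add: form_scale form_scale_right fibre_scale q_def)
  also have "... = (d * q y) powr (- 1) * q y" by (simp add: powr_add[symmetric] mult.assoc[symmetric])
  also have "... = q y / (d * q y)" using y(3) by (simp add: powr_minus divide_inverse)
  also have "... = 1 / d" using y(3) by auto
  also have "1 / d = d * d / d" unfolding dd ..
  also have "... = d"
  proof -
   have "d ~= 0" using dd by auto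
   thus ?thesis by simp
  qed
  finally show ?thesis .
 qed
 have uo: "form E y (u y) ((us ! j) y) = 0" if "y : W'" "j < ?k" for y j
 proof -
  have y: "y : W" "y : V" using that by (auto simp: W'_def)
  show ?thesis unfolding u_def using Pf[OF y(1) sf[OF y(2)]] fb[OF that(2) y(1)] Po[OF y(1) sf[OF y(2)] that(2)] by (simp add: form_scale)
 qed
 have uf: "u y : fibre E y" if "y : W'" for y using us' that by (rule section_fibre)
 have "onb W' (us @ [u])" unfolding onb_def
 proof (intro conjI exI[of _ "\<epsilon>(?k := d)"])
  show "ALL v:set (us @ [u]). sms E W' v" using us' us section_subset[of W _ W'] by (auto simp: W'_def in_set_conv_nth)
  show "ALL i<length (us @ [u]). ALL j<length (us @ [u]). ALL y:W'.
   form E y (((us @ [u]) ! i) y) (((us @ [u]) ! j) y) = (if i = j then (\<epsilon>(?k := d)) i else 0)"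
  proof (intro allI impI ballI)
   fix i j y assume i: "i < length (us @ [u])" and j: "j < length (us @ [u])" and y: "y : W'"
   have yW: "y : W" using y by (simp add: W'_def)
   have ou: "form E y ((us ! l) y) (u y) = 0" if "l < ?k" for l using form_sym[OF uf[OF y] fb[OF that yW]] uo[OF y that] by simp
   consider "i < ?k" "j < ?k" | "i = ?k" "j < ?k" | "i < ?k" "j = ?k" | "i = ?k" "j = ?k" using i j by fastforce
   thus "form E y (((us @ [u]) ! i) y) (((us @ [u]) ! j) y) = (if i = j then (\<epsilon>(?k := d)) i else 0)"
    by cases (use e(2)[OF yW] uu[OF y] uo[OF y] ou in \<open>auto simp: nth_append\<close>)
  qed
 qed (use W'o e(1) dd in auto)
 moreover have "x : W'" using x V dq by (simp add: W'_def)
 ultimately show thesis using that[of W' u] by (auto simp: W'_def)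
qed

lemma onb_exists:
 assumes "open U" "x : U"
 obtains W us where "x : W" "W <= U" "onb W us" "!!y. y : W ==> frame_at E us y"
proof -
 obtain V es where V: "(V, es) : trivs E" "x : V" by (rule triv_exists)
 note Vo = triv(1)[OF V(1)]
 have "EX W us. x : W & W <= U Int V & onb W us & length us = k" if "k <= length es" for k using that
 proof (induction k)
  case 0
  have "onb (U Int V) []" unfolding onb_def using assms Vo by (auto intro!: exI[of _ "%_. 1"])
  thus ?case using assms V by (intro exI[of _ "U Int V"] exI[of _ "[]"]) auto
 next
  case (Suc k)
  then obtain W us where W: "x : W" "W <= U Int V" "onb W us" "length us = k" by auto
  obtain W' u where "x : W'" "W' <= W Int V" "onb W' (us @ [u])" by (rule onb_extend[OF W(3,1) V]) (use W(4) Suc.prems in auto)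
  thus ?case using W by (intro exI[of _ W'] exI[of _ "us @ [u]"]) auto
 qed
 from this[OF order_refl] obtain W us where W: "x : W" "W <= U Int V" "onb W us" "length us = length es" by blast
 have "frame_at E us y" if "y : W" for y using onb_frame[OF W(3) that triv(2)[OF V(1)] W(4)] that W(2) by auto
 thus thesis using that W by blast
qed

subsection \<open>Charts of the N-manifold\<close>

text \<open>Inverse and transition maps over \<open>W\<close> are restrictions of those over
  \<open>V\<close>, and a maximal atlas contains every compatible chart. This supplies charts of the
  N-manifold inside any given open set.\<close>

lemma atlas_restrict:
 assumes c: "(V, ph) : atlas E" and W: "open W" "W <= V" shows "(W, ph) : atlas E"
proof -
 have inv: "inv_into W ph (ph x) = x" "inv_into V ph (ph x) = x" if "x : W" for x
  using inv_into_f_f[OF inj_on_subset[OF chart_inj[OF c] W(2)] that] chart_inv[OF c] that W(2) by auto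
 have op: "openin (top_of_set (span (axes E))) (ph ` W)"
 proof -
  have "openin (top_of_set (ph ` V)) (ph ` W)"
  proof (rule homeomorphism_imp_open_map)
   show "homeomorphism V (ph ` V) ph (inv_into V ph)" using chart[OF c] unfolding is_chart_def by blast
   show "openin (top_of_set V) W" using W open_subset by blast
  qed
  thus ?thesis using chart_openin[OF c] openin_trans by blast
 qed
 have "homeomorphism W (ph ` W) ph (inv_into W ph)"
 proof -
  have "continuous_on (ph ` W) (inv_into V ph)" using continuous_on_subset[OF chart_continuous(2)[OF c]] W(2) by blast
  hence "continuous_on (ph ` W) (inv_into W ph)" by (rule continuous_on_eq) (auto simp: inv)
  moreover have "continuous_on W ph" using continuous_on_subset[OF chart_continuous(1)[OF c] W(2)] .
  ultimately show ?thesis unfolding homeomorphism_def by (auto simp: inv image_iff)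
 qed
 hence ch: "is_chart E W ph" unfolding is_chart_def using W op by auto
 have comp: "compatible_charts E (W, ph) d" if d: "d : atlas E" for d
 proof -
  obtain V' ph' where dd: "d = (V', ph')" by (cases d)
  have d': "(V', ph') : atlas E" using d dd by simp
  let ?S = "{y. proj_axes E y : ph ` (V' Int W)}" and ?S' = "{y. proj_axes E y : ph' ` (W Int V')}"
  have WV: "W Int V' Int V = V' Int W" using W(2) by auto
  have So: "open ?S" using chart_dom_open[OF c open_Int[OF W(1) chart_open[OF d']]] WV by simp
  have "smooth_on ?S (%y. ph' (inv_into V ph (proj_axes E y)))" using charts_compatible[OF d' c] unfolding smooth_in_chart_def
   by (rule smooth_on_subset) (use W(2) in auto)
  hence "smooth_on ?S (%y. ph' (inv_into W ph (proj_axes E y)))" by (rule smooth_on_cong[OF So, rotated]) (auto simp: inv)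
  moreover have "smooth_on ?S' (%y. ph (inv_into V' ph' (proj_axes E y)))"
   using charts_compatible[OF c d'] unfolding smooth_in_chart_def by (rule smooth_on_subset) (use W(2) in auto)
  ultimately show ?thesis by (simp add: compatible_charts_def smooth_in_chart_def dd)
 qed
 show ?thesis using mfd ch comp unfolding smooth_manifold_def by blast
qed

lemma nchartD:
 assumes "(V, ph, es) : ncharts E"
 shows "(V, ph) : atlas E" "open V" "a < length es ==> sms E V (es ! a)" "x : V ==> frame_at E es x"
  "a < length es ==> b < length es ==> x : V ==> y : V ==>
   pairing E (es ! a) (es ! b) x = pairing E (es ! a) (es ! b) y"
  "a < length es ==> x : V ==> (es ! a) x : fibre E x"
proof -
 have 1: "(V, ph) : atlas E" "ALL e:set es. sms E V e" "ALL x:V. frame_at E es x"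
  "ALL a<length es. ALL b<length es. EX c. ALL x:V. pairing E (es ! a) (es ! b) x = c"
  using assms unfolding ncharts_def by auto
 show "(V, ph) : atlas E" "open V" using 1(1) chart_open by auto
 show "a < length es ==> sms E V (es ! a)" "x : V ==> frame_at E es x" using 1 by auto
 show "a < length es ==> b < length es ==> x : V ==> y : V ==>
   pairing E (es ! a) (es ! b) x = pairing E (es ! a) (es ! b) y" using 1(4) by metis
 show "a < length es ==> x : V ==> (es ! a) x : fibre E x" using 1(3) frame_fibre by blast
qed

lemma nchart_exists:
 assumes "open U" "x : U"
 obtains V ph es where "(V, ph, es) : ncharts E" "onb V es" "x : V" "V <= U"
proof -
 obtain V0 ph where c: "(V0, ph) : atlas E" "x : V0" by (rule chart_exists)
 obtain W us where W: "x : W" "W <= U Int V0" "onb W us" "!!y. y : W ==> frame_at E us y"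
  by (rule onb_exists[of "U Int V0" x]) (use assms c chart_open[OF c(1)] in auto)
 have Wo: "open W" using W(3) by (simp add: onb_def)
 have "(W, ph) : atlas E" by (rule atlas_restrict[OF c(1) Wo]) (use W in auto)
 moreover have "EX c. ALL x:W. pairing E (us ! a) (us ! b) x = c" if "a < length us" "b < length us" for a b
  using W(3) that unfolding onb_def pairing_def by metis
 moreover have "ALL e:set us. sms E W e" using W(3) unfolding onb_def by blast
 ultimately have "(W, ph, us) : ncharts E" unfolding ncharts_def using W by auto
 thus thesis using that W by auto
qed

text \<open>The coefficients in a frame with constant $g_{ab}$ are constant linear combinations of
 the pairings with the frame.\<close>

lemma nchart_dual:
 assumes k: "(V, ph, es) : ncharts E"
 obtains h :: "nat => nat => real" where "!!x s a. x : V ==> s x : fibre E x ==> a < length es ==>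
  fco es a s x = (SUM b<length es. h a b * form E x ((es ! b) x) (s x))"
proof (cases "V = {}")
 case True
 thus thesis using that by auto
next
 case False
 then obtain x0 where x0: "x0 : V" by blast
 note D = nchartD[OF k]
 let ?n = "length es"
 obtain W us where W: "x0 : W" "W <= V" "onb W us" "!!y. y : W ==> frame_at E us y"
  by (rule onb_exists[OF D(2) x0]) blast
 note fu = W(4)[OF W(1)] and fe = D(4)[OF x0]
 obtain \<epsilon> :: "nat => real" where e: "!!i. \<epsilon> i * \<epsilon> i = 1" "!!i j. i < length us ==> j < length us ==>
   form E x0 ((us ! i) x0) ((us ! j) x0) = (if i = j then \<epsilon> i else 0)" using W(1,3) unfolding onb_def by blast
 let ?c = "%a v. fco es a (%_. v) x0"
 \<comment> \<open>\<open>z a\<close> represents the functional that takes the a-th coefficient at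
   \<open>x0\<close>. Its coordinates \<open>h a b\<close> form the inverse of the matrix g_ab;
   since g_ab is constant they serve at every other point of \<open>V\<close>.\<close>
 define z where "z a = (SUM i<length us. (\<epsilon> i * ?c a ((us ! i) x0)) *r (us ! i) x0)" for a
 have zf: "z a : fibre E x0" for a unfolding z_def using frame_fibre[OF fu] by (intro fibre_comb) auto
 define h where "h a b = ?c b (z a)" for a b
 let ?g = "%b c. form E x0 ((es ! b) x0) ((es ! c) x0)"
 have zc: "form E x0 (z a) v = ?c a v" if v: "v : fibre E x0" and a: "a < ?n" for a v
 proof -
  let ?u = "%i. fco us i (%_. v) x0"
  have v': "v = (SUM j<length us. ?u j *r (us ! j) x0)" using frame_sum[OF fu, of "%_. v"] v by simp
  have zj: "form E x0 (z a) ((us ! j) x0) = ?c a ((us ! j) x0)" if j: "j < length us" for j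
  proof -
   have "form E x0 (z a) ((us ! j) x0) = (SUM i<length us. \<epsilon> i * ?c a ((us ! i) x0) * form E x0 ((us ! i) x0) ((us ! j) x0))"
    unfolding z_def using frame_fibre[OF fu] j by (subst form_comb) auto
   also have "... = (SUM i<length us. if i = j then \<epsilon> j * \<epsilon> j * ?c a ((us ! j) x0) else 0)"
    by (rule sum.cong) (use e(2) j in auto)
   finally show ?thesis using j by (simp add: e(1))
  qed
  have "form E x0 (z a) v = (SUM j<length us. ?u j * ?c a ((us ! j) x0))"
   by (subst v') (subst form_comb_right; use zf frame_fibre[OF fu] zj in simp)
  also have "... = ?c a v"
  proof (rule frame_unique[OF fe _ a, symmetric])
   have "v = (SUM j<length us. ?u j *r (SUM a<?n. ?c a ((us ! j) x0) *r (es ! a) x0))"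
    using v' frame_sum[OF fe, of "%_. (us ! j) x0" for j] frame_fibre[OF fu] by simp
   also have "... = (SUM a<?n. SUM j<length us. (?u j * ?c a ((us ! j) x0)) *r (es ! a) x0)"
    by (simp add: scaleR_sum_right) (rule sum.swap)
   finally show "v = (SUM a<?n. (SUM j<length us. ?u j * ?c a ((us ! j) x0)) *r (es ! a) x0)" by (simp add: scaleR_sum_left)
  qed
  finally show ?thesis .
 qed
 have hg: "(SUM b<?n. h a b * ?g b c) = (if a = c then 1 else 0)" if a: "a < ?n" and c: "c < ?n" for a c
 proof -
  have "(SUM b<?n. h a b * ?g b c) = form E x0 (SUM b<?n. h a b *r (es ! b) x0) ((es ! c) x0)"
   using frame_fibre[OF fe] c by (subst form_comb) auto
  also have "(SUM b<?n. h a b *r (es ! b) x0) = z a" using frame_sum[OF fe, of "%_. z a"] zf by (simp add: h_def)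
  also have "form E x0 (z a) ((es ! c) x0) = ?c a ((es ! c) x0)" by (rule zc[OF frame_fibre[OF fe c] a])
  also have "... = (if a = c then 1 else 0)"
   by (rule frame_unique[OF fe _ a]) (use c in \<open>simp add: if_distrib[of "%t. t *r _"] cong: if_cong\<close>)
  finally show ?thesis .
 qed
 show thesis
 proof (rule that[of h])
  fix x s a assume x: "x : V" and s: "s x : fibre E x" and a: "a < ?n"
  note fx = D(4)[OF x]
  have g: "form E x ((es ! b) x) ((es ! c) x) = ?g b c" if "b < ?n" "c < ?n" for b c using D(5)[OF that x x0] by (simp add: pairing_def)
  have "form E x ((es ! b) x) (s x) = (SUM c<?n. fco es c s x * ?g b c)" if b: "b < ?n" for b
   by (subst frame_sum[where s = s, OF fx s, symmetric])
    (subst form_comb_right; use frame_fibre[OF fx] b in \<open>simp add: g\<close>)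
  hence "(SUM b<?n. h a b * form E x ((es ! b) x) (s x)) = (SUM b<?n. SUM c<?n. fco es c s x * (h a b * ?g b c))"
   by (simp add: sum_distrib_left mult_ac)
  also have "... = (SUM c<?n. fco es c s x * (SUM b<?n. h a b * ?g b c))" by (subst sum.swap) (simp add: sum_distrib_left)
  also have "... = (SUM c<?n. if a = c then fco es a s x else 0)" by (rule sum.cong) (use hg a in auto)
  finally show "fco es a s x = (SUM b<?n. h a b * form E x ((es ! b) x) (s x))" using a by simp
 qed
qed

text \<open>Smooth sections are defined by their coefficients in the frames of \<open>trivs\<close>,
  and the frame of an N-chart need not be one of them. Its coefficients are constant combinations of
  pairings, which are smooth.\<close>

lemma nchart_coeff_smooth:
 assumes k: "(V, ph, es) : ncharts E" and U: "open U" and s: "sms E U s" and a: "a < length es"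
 shows "smf E (U Int V) (fco es a s)"
proof -
 note D = nchartD[OF k]
 obtain h where h: "!!x s a. x : V ==> s x : fibre E x ==> a < length es ==>
  fco es a s x = (SUM b<length es. h a b * form E x ((es ! b) x) (s x))" by (rule nchart_dual[OF k]) blast
 have o: "open (U Int V)" using U D(2) by auto
 have "smf E (U Int V) (%x. SUM b<length es. h a b * pairing E (es ! b) s x)"
  using D(3) s by (intro smooth_fun_sum smooth_fun_mult smooth_fun_const o pairing_smooth) (auto intro: section_subset)
 thus ?thesis by (rule smooth_fun_cong[OF o, rotated]) (use h a s section_fibre in \<open>auto simp: pairing_def\<close>)
qed

end

section \<open>The gauge Lie algebroid as a sheaf\<close>

lemma cut_eq_iff: "cut U f = f \<longleftrightarrow> (ALL x. x ~: U --> f x = 0)" by (auto simp: cut_def fun_eq_iff)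

lemma cut_in: "x : U ==> cut U f x = f x" and cut_out: "x ~: U ==> cut U f x = 0" by (simp_all add: cut_def)

lemma cut_cut: "V <= U ==> cut V (cut U f) = cut V f" by (auto simp: cut_def fun_eq_iff)

lemma near_cut: "open U ==> x : U ==> \<forall>\<^sub>F y in nhds x. cut U f y = f y"
 by (rule eventually_mono[OF eventually_nhds_in_open]) (auto simp: cut_in)

context pe_mfd
begin

abbreviation "CC U == carrier (Cinf E U)"
abbreviation "SS U == secs E U"
abbreviation "GG U == gaug E U"

lemma C_iff: "f : CC U \<longleftrightarrow> smf E U f & (ALL x. x ~: U --> f x = 0)"
 by (auto simp: Cinf_def cut_eq_iff)

lemma S_iff: "s : SS U \<longleftrightarrow> sms E U s & (ALL x. x ~: U --> s x = 0)"
 by (auto simp: sections_def cut_eq_iff)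

lemma G_iff: "D : GG U \<longleftrightarrow> is_cdo E U (fst D) (snd D)" by (auto simp: gauge_def)

lemma C_simps: "add (Cinf E U) f g = (%x. f x + g x)" "mult (Cinf E U) f g = (%x. f x * g x)"
 "zero (Cinf E U) = (%x. 0)" "one (Cinf E U) = cut U (%x. 1)" by (simp_all add: Cinf_def)

lemma S_simps: "add (sections E U) s t = (%x. s x + t x)" "smult (sections E U) f s = (%x. f x *r s x)"
 "zero (sections E U) = (%x. 0)" by (simp_all add: sections_def)

lemma G_simps: "add (gauge E U) D D' = (%X x. fst D X x + fst D' X x, %f x. snd D f x + snd D' f x)"
 "smult (gauge E U) h D = (%X x. h x *r fst D X x, %f x. h x * snd D f x)"
 "zero (gauge E U) = (%X x. 0, %f x. 0)" by (simp_all add: gauge_def case_prod_beta)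

lemma C_add: "open U ==> f : CC U ==> g : CC U ==> (%x. f x + g x) : CC U"
 and C_mult: "open U ==> f : CC U ==> g : CC U ==> (%x. f x * g x) : CC U"
 and C_minus: "open U ==> f : CC U ==> (%x. - f x) : CC U"
 and C_scale: "open U ==> f : CC U ==> (%x. c * f x) : CC U"
 and C_zero: "open U ==> (%x. 0) : CC U"
 by (auto simp: C_iff intro: smooth_fun_add smooth_fun_mult smooth_fun_minus smooth_fun_const)

lemma C_cut: "open U ==> smf E U f ==> cut U f : CC U"
 by (auto simp: C_iff cut_out cut_in intro: smooth_fun_cong[of U f])

lemma C_cut_sub: "open V ==> V <= U ==> f : CC U ==> cut V f : CC V"
 by (rule C_cut) (auto simp: C_iff intro: smooth_fun_subset)

lemma C_const: "open U ==> cut U (%x. c) : CC U" by (rule C_cut) (auto intro: smooth_fun_const)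

lemma C_cring: "open U ==> cring (Cinf E U)"
proof -
 assume U: "open U"
 have one: "cut U (%x. 1) x * f x = f x" if "f : CC U" for f x using that by (cases "x : U") (auto simp: cut_def C_iff)
 show ?thesis
 proof (rule cringI)
  show "abelian_group (Cinf E U)"
  proof (rule abelian_groupI)
   fix f assume "f : CC U"
   thus "EX g:CC U. g \<oplus>\<^bsub>Cinf E U\<^esub> f = \<zero>\<^bsub>Cinf E U\<^esub>"
    using C_minus[OF U] by (intro bexI[of _ "%x. - f x"]) (auto simp: C_simps)
  qed (simp_all add: C_simps C_add[OF U] C_zero[OF U] add_ac)
  show "Group.comm_monoid (Cinf E U)"
   by (rule comm_monoidI) (simp_all add: C_simps C_mult[OF U] C_const[OF U] one one[unfolded mult.commute[of "cut U (%x. 1) _"]] mult_ac)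
 qed (simp add: C_simps distrib_right)
qed

lemma cut_ring_hom: "open V ==> V <= U ==> cut V : ring_hom (Cinf E U) (Cinf E V)"
 by (rule ring_hom_memI) (auto simp: C_cut_sub C_simps cut_cut, auto simp: cut_def fun_eq_iff)

lemma S_add: "open U ==> s : SS U ==> t : SS U ==> (%x. s x + t x) : SS U"
 by (auto simp: S_iff intro: section_add)

lemma S_smult: "open U ==> f : CC U ==> s : SS U ==> (%x. f x *r s x) : SS U"
 by (auto simp: S_iff C_iff intro: section_scale)

lemma S_scale: "open U ==> s : SS U ==> (%x. c *r s x) : SS U"
 by (auto simp: S_iff intro!: section_scale smooth_fun_const)

lemma S_zero: "open U ==> (%x. 0) : SS U" by (auto simp: S_iff intro: section_zero)

lemma S_cut: "open U ==> sms E U f ==> cut U f : SS U"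
 by (auto simp: S_iff cut_out cut_in intro: section_cong[of U f])

lemma S_cut_sub: "open V ==> V <= U ==> f : SS U ==> cut V f : SS V"
 by (rule S_cut) (auto simp: S_iff intro: section_subset)

lemma S_fibre: "s : SS U ==> s x : fibre E x" using section_fibre fibre_zero by (cases "x : U") (auto simp: S_iff)

lemma C_pairing: "open U ==> s : SS U ==> t : SS U ==> cut U (pairing E s t) : CC U"
 by (rule C_cut) (auto simp: S_iff intro: pairing_smooth)

subsection \<open>Extension of local sections\<close>

lemma bump_mult:
 assumes V: "open V" "x : V"
 obtains \<beta> C where "smf E UNIV \<beta>" "\<forall>\<^sub>F y in nhds x. \<beta> y = 1" "closed C" "C <= V" "!!y. y ~: C ==> \<beta> y = 0"
proof -
 obtain \<beta> N C where b: "smf E UNIV \<beta>" "open N" "x : N" "N <= V" "!!y. y : N ==> \<beta> y = 1"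
  "closed C" "C <= V" "!!y. y ~: C ==> \<beta> y = 0" by (rule bump_function[OF V]) blast
 have "\<forall>\<^sub>F y in nhds x. \<beta> y = 1" by (rule eventually_mono[OF eventually_nhds_in_open[OF b(2,3)]]) (rule b(5))
 thus thesis using that b by blast
qed

text \<open>An operator over \<open>U\<close> accepts only arguments defined on all of
  \<open>U\<close>. A bump function replaces a local argument by one over \<open>U\<close> with the
  same germ at \<open>x\<close>; \<open>extend_section\<close> does the same for sections.\<close>

lemma extend_fun:
 assumes V: "open V" "x : V" and U: "open U" and f: "smf E V f"
 obtains g where "g : CC U" "x : U ==> \<forall>\<^sub>F y in nhds x. g y = f y"
proof -
 obtain \<beta> C where b: "smf E UNIV \<beta>" "\<forall>\<^sub>F y in nhds x. \<beta> y = 1" "closed C" "C <= V" "!!y. y ~: C ==> \<beta> y = 0"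
  by (rule bump_mult[OF V]) blast
 let ?g = "cut V (%y. \<beta> y * f y)"
 have "smf E UNIV ?g"
 proof (rule smooth_fun_local[OF open_UNIV])
  fix y :: 'm
  show "EX W. open W & y : W & smf E (W Int UNIV) ?g"
  proof (cases "y : V")
   case True
   have "smf E V ?g" by (rule smooth_fun_cong[OF V(1) _ smooth_fun_mult[OF V(1) smooth_fun_subset[OF b(1)] f]]) (auto simp: cut_in)
   thus ?thesis using True V by auto
  next
   case False
   have o: "open (- C)" using b(3) by (simp add: open_Compl)
   have "smf E (- C) ?g" by (rule smooth_fun_cong[OF o _ smooth_fun_const[OF o, of 0]]) (simp add: b(5) cut_def)
   thus ?thesis using False b(4) o by (intro exI[of _ "- C"]) auto
  qed
 qed
 hence "cut U ?g : CC U" by (intro C_cut[OF U]) (auto intro: smooth_fun_subset)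
 moreover have "\<forall>\<^sub>F y in nhds x. cut U ?g y = f y" if "x : U"
  using near_cut[OF U that, of ?g] near_cut[OF V, of "%y. \<beta> y * f y"] b(2) by eventually_elim simp
 ultimately show thesis using that by blast
qed

lemma extend_section:
 assumes V: "open V" "x : V" and U: "open U" and f: "sms E V f"
 obtains g where "g : SS U" "x : U ==> \<forall>\<^sub>F y in nhds x. g y = f y"
proof -
 obtain \<beta> C where b: "smf E UNIV \<beta>" "\<forall>\<^sub>F y in nhds x. \<beta> y = 1" "closed C" "C <= V" "!!y. y ~: C ==> \<beta> y = 0"
  by (rule bump_mult[OF V]) blast
 let ?g = "cut V (%y. \<beta> y *r f y)"
 have "sms E UNIV ?g"
 proof (rule section_local[OF open_UNIV])
  fix y :: 'm
  show "EX W. open W & y : W & sms E (W Int UNIV) ?g"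
  proof (cases "y : V")
   case True
   have "sms E V ?g" by (rule section_cong[OF V(1) _ section_scale[OF V(1) smooth_fun_subset[OF b(1)] f]]) (auto simp: cut_in)
   thus ?thesis using True V by auto
  next
   case False
   have o: "open (- C)" using b(3) by (simp add: open_Compl)
   have "sms E (- C) ?g" by (rule section_cong[OF o _ section_zero[OF o]]) (simp add: b(5) cut_def)
   thus ?thesis using False b(4) o by (intro exI[of _ "- C"]) auto
  qed
 qed
 hence "cut U ?g : SS U" by (intro S_cut[OF U]) (auto intro: section_subset)
 moreover have "\<forall>\<^sub>F y in nhds x. cut U ?g y = f y" if "x : U"
  using near_cut[OF U that, of ?g] near_cut[OF V, of "%y. \<beta> y *r f y"] b(2) by eventually_elim simp
 ultimately show thesis using that by blast
qed

subsection \<open>Vector fields\<close>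

lemma pderiv_near:
 assumes c: "(V, ph) : atlas E" and x: "x : V" and b: "b : axes E" and e: "near x f g"
 shows "pdc V ph b f x = pdc V ph b g x"
proof -
 obtain W where "open W" "x : W" "!!y. y : W ==> f y = g y" using e unfolding eventually_nhds by blast
 thus ?thesis using pderiv_cong[OF c _ _ x b, of W f g] by blast
qed

lemma vf_iff: "v : vector_fields E U \<longleftrightarrow> (ALL f. f ~: CC U --> v f = (%x. 0)) & (ALL f:CC U. v f : CC U)
 & (ALL V ph. (V, ph) : atlas E --> (EX w. (ALL b:axes E. smf E (U Int V) (w b)) &
    (ALL f:CC U. ALL x:U Int V. v f x = (SUM b:axes E. w b x * pdc V ph b f x))))"
 unfolding vector_fields_def by auto

lemma vf_formula:
 assumes v: "v : vector_fields E U" and c: "(V, ph) : atlas E"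
 obtains w where "!!b. b : axes E ==> smf E (U Int V) (w b)"
  "!!f x. f : CC U ==> x : U ==> x : V ==> v f x = (SUM b:axes E. w b x * pdc V ph b f x)"
 using v c unfolding vf_iff by blast

lemma vf_closed: "v : vector_fields E U ==> f : CC U ==> v f : CC U" unfolding vf_iff by blast

lemma vf_near:
 assumes v: "v : vector_fields E U" and x: "x : U" and f: "f : CC U" "g : CC U" and e: "near x f g" shows "v f x = v g x"
proof -
 obtain V ph where c: "(V, ph) : atlas E" "x : V" by (rule chart_exists)
 obtain w where w: "!!f x. f : CC U ==> x : U ==> x : V ==> v f x = (SUM b:axes E. w b x * pdc V ph b f x)"
  by (rule vf_formula[OF v c(1)]) blast
 show ?thesis unfolding w[OF f(1) x c(2)] w[OF f(2) x c(2)] by (rule sum.cong) (simp_all add: pderiv_near[OF c _ e])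
qed

lemma vf_const:
 assumes U: "open U" and v: "v : vector_fields E U" shows "v (cut U (%x. c)) = (%x. 0)"
proof
 fix x
 show "v (cut U (%x. c)) x = 0"
 proof (cases "x : U")
  case True
  obtain V ph where ch: "(V, ph) : atlas E" "x : V" by (rule chart_exists)
  obtain w where w: "!!f x. f : CC U ==> x : U ==> x : V ==> v f x = (SUM b:axes E. w b x * pdc V ph b f x)"
   by (rule vf_formula[OF v ch(1)]) blast
  have "pdc V ph b (cut U (%x. c)) x = 0" if "b : axes E" for b
   using pderiv_near[OF ch that near_cut[OF U True, of "%x. c"]] by (simp add: pderiv_const)
  thus ?thesis unfolding w[OF C_const[OF U] True ch(2)] by (intro sum.neutral) auto
 next
  case False
  thus ?thesis using vf_closed[OF v C_const[OF U]] by (simp add: C_iff)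
 qed
qed

subsection \<open>Covariant differential operators\<close>

lemma cdoD:
 assumes "is_cdo E U L v" shows "X ~: SS U ==> L X = (%x. 0)" "X : SS U ==> L X : SS U"
  "X : SS U ==> Y : SS U ==> L (%x. X x + Y x) = (%x. L X x + L Y x)"
  "X : SS U ==> L (%x. c *r X x) = (%x. c *r L X x)" "v : vector_fields E U"
  "f : CC U ==> X : SS U ==> L (%x. f x *r X x) = (%x. f x *r L X x + v f x *r X x)"
  "X : SS U ==> Y : SS U ==> v (cut U (pairing E X Y)) = cut U (%x. pairing E (L X) Y x + pairing E X (L Y) x)"
 using assms unfolding is_cdo_def by blast+

text \<open>The difference \<open>Z\<close> of the two sections vanishes near \<open>x\<close>, so Z
  = (1 - \<beta>) Z for a bump \<beta> supported there. The Leibniz rule then expresses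
  \<open>L Z x\<close> by 1 - \<beta>(x) = 0 and Z(x) = 0.\<close>

lemma cdo_near:
 assumes U: "open U" and L: "is_cdo E U L v" and x: "x : U" and X: "X : SS U" "Y : SS U" and e: "near x X Y" shows "L X x = L Y x"
proof -
 note D = cdoD[OF L]
 let ?Z = "%y. X y + (- 1) *r Y y"
 have nY: "(%y. (- 1) *r Y y) : SS U" by (rule S_scale[OF U X(2)])
 have Z: "?Z : SS U" by (rule S_add[OF U X(1) nY])
 obtain N where N: "open N" "x : N" "!!y. y : N ==> X y = Y y" using e unfolding eventually_nhds by blast
 obtain \<beta> C where b: "smf E UNIV \<beta>" "\<forall>\<^sub>F y in nhds x. \<beta> y = 1" "closed C" "C <= N" "!!y. y ~: C ==> \<beta> y = 0"
  by (rule bump_mult[OF N(1,2)]) blast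
 have "smf E U (%y. 1 - \<beta> y)" by (intro smooth_fun_diff smooth_fun_const U smooth_fun_subset[OF b(1)]) auto
 hence f: "cut U (%y. 1 - \<beta> y) : CC U" by (rule C_cut[OF U])
 have bx: "\<beta> x = 1" using eventually_nhds_x_imp_x[OF b(2)] .
 have "?Z = (%y. cut U (%y. 1 - \<beta> y) y *r ?Z y)"
 proof
  fix y
  show "?Z y = cut U (%y. 1 - \<beta> y) y *r ?Z y"
  proof (cases "y : U")
   case True
   thus ?thesis using N(3)[of y] b(4) b(5)[of y] by (cases "y : C") (auto simp: cut_in)
  next
   case False
   hence "?Z y = 0" using Z by (simp add: S_iff)
   thus ?thesis by simp
  qed
 qed
 hence "L ?Z x = L (%y. cut U (%y. 1 - \<beta> y) y *r ?Z y) x" by simp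
 also have "... = cut U (%y. 1 - \<beta> y) x *r L ?Z x + v (cut U (%y. 1 - \<beta> y)) x *r ?Z x"
  using D(6)[OF f Z] by (rule fun_cong)
 also have "... = 0" using x bx N(2,3) by (simp add: cut_in)
 finally have "L X x + (- 1) *r L Y x = 0" using D(3)[OF X(1) nY] D(4)[OF X(2), of "- 1"] by simp
 thus ?thesis by simp
qed

text \<open>Both sides of each identity vanish off \<open>U\<close>, so they need checking on
  \<open>U\<close> alone. Linearity over the reals is the Leibniz rule for a constant function,
  which the vector field kills.\<close>

lemma cdoI:
 assumes U: "open U" and L: "!!X. X ~: SS U ==> L X = (%x. 0)" "!!X. X : SS U ==> L X : SS U"
  and v: "v : vector_fields E U"
  and add: "!!X Y x. X : SS U ==> Y : SS U ==> x : U ==> L (%x. X x + Y x) x = L X x + L Y x"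
  and leib: "!!f X x. f : CC U ==> X : SS U ==> x : U ==> L (%x. f x *r X x) x = f x *r L X x + v f x *r X x"
  and met: "!!X Y x. X : SS U ==> Y : SS U ==> x : U ==>
   v (cut U (pairing E X Y)) x = form E x (L X x) (Y x) + form E x (X x) (L Y x)" shows "is_cdo E U L v"
proof -
 have S0: "X x = 0" if "X : SS U" "x ~: U" for X x using that by (simp add: S_iff)
 have l: "L (%x. f x *r X x) = (%x. f x *r L X x + v f x *r X x)" if f: "f : CC U" and X: "X : SS U" for f X
 proof
  fix x show "L (%x. f x *r X x) x = f x *r L X x + v f x *r X x"
   using leib[OF f X] S0[OF L(2)[OF S_smult[OF U f X]]] S0[OF L(2)[OF X]] S0[OF X] by (cases "x : U") auto
 qed
 have a: "L (%x. X x + Y x) = (%x. L X x + L Y x)" if X: "X : SS U" and Y: "Y : SS U" for X Y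
 proof
  fix x show "L (%x. X x + Y x) x = L X x + L Y x"
   using add[OF X Y] S0[OF L(2)[OF S_add[OF U X Y]]] S0[OF L(2)[OF X]] S0[OF L(2)[OF Y]] by (cases "x : U") auto
 qed
 have c: "L (%x. c *r X x) = (%x. c *r L X x)" if X: "X : SS U" for c X
 proof -
  have e: "(%x. cut U (%x. c) x *r X x) = (%x. c *r X x)" using S0[OF X] by (auto simp: fun_eq_iff cut_def)
  show ?thesis using l[OF C_const[OF U] X, of c] S0[OF L(2)[OF X]] unfolding e vf_const[OF U v] by (fastforce simp: fun_eq_iff cut_def)
 qed
 have m: "v (cut U (pairing E X Y)) = cut U (%x. pairing E (L X) Y x + pairing E X (L Y) x)" if X: "X : SS U" and Y: "Y : SS U" for X Y
 proof
  fix x show "v (cut U (pairing E X Y)) x = cut U (%x. pairing E (L X) Y x + pairing E X (L Y) x) x"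
   using met[OF X Y] vf_closed[OF v C_pairing[OF U X Y]] by (cases "x : U") (auto simp: cut_def pairing_def C_iff)
 qed
 show ?thesis unfolding is_cdo_def using L v a c l m by blast
qed

lemma cdo_add:
 assumes U: "open U" and L: "is_cdo E U L v" and L': "is_cdo E U L' v'"
 shows "is_cdo E U (%X x. L X x + L' X x) (%f x. v f x + v' f x)"
proof (rule cdoI[OF U])
 note D = cdoD[OF L] and D' = cdoD[OF L']
 show "(%f x. v f x + v' f x) : vector_fields E U" unfolding vf_iff
 proof (intro conjI allI impI ballI, goal_cases)
  case (1 f) thus ?case using D(5) D'(5) unfolding vf_iff by simp
 next
  case (2 f) thus ?case using vf_closed[OF D(5)] vf_closed[OF D'(5)] C_add[OF U] by blast
 next
  case (3 V ph)
  obtain w where w: "!!b. b : axes E ==> smf E (U Int V) (w b)"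
   "!!f x. f : CC U ==> x : U ==> x : V ==> v f x = (SUM b:axes E. w b x * pdc V ph b f x)"
   by (rule vf_formula[OF D(5) 3]) blast
  obtain w' where w': "!!b. b : axes E ==> smf E (U Int V) (w' b)"
   "!!f x. f : CC U ==> x : U ==> x : V ==> v' f x = (SUM b:axes E. w' b x * pdc V ph b f x)"
   by (rule vf_formula[OF D'(5) 3]) blast
  have "open (U Int V)" using U chart_open[OF 3] by auto
  thus ?case using w w' by (intro exI[of _ "%b x. w b x + w' b x"]) (auto simp: distrib_right sum.distrib intro: smooth_fun_add)
 qed
 show "v (cut U (pairing E X Y)) x + v' (cut U (pairing E X Y)) x =
  form E x (L X x + L' X x) (Y x) + form E x (X x) (L Y x + L' Y x)" if X: "X : SS U" and Y: "Y : SS U" and "x : U" for X Y x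
  unfolding D(7)[OF X Y] D'(7)[OF X Y] using that(3)
   S_fibre[OF X] S_fibre[OF Y] S_fibre[OF D(2)[OF X]] S_fibre[OF D'(2)[OF X]] S_fibre[OF D(2)[OF Y]] S_fibre[OF D'(2)[OF Y]]
  by (simp add: cut_def pairing_def form_add form_add_right)
qed (use cdoD[OF L] cdoD[OF L'] S_add[OF U] in \<open>auto simp: scaleR_add_right scaleR_add_left add_ac\<close>)

lemma cdo_smult:
 assumes U: "open U" and L: "is_cdo E U L v" and h: "h : CC U" shows "is_cdo E U (%X x. h x *r L X x) (%f x. h x * v f x)"
proof (rule cdoI[OF U])
 note D = cdoD[OF L]
 show "(%f x. h x * v f x) : vector_fields E U" unfolding vf_iff
 proof (intro conjI allI impI ballI, goal_cases)
  case (1 f) thus ?case using D(5) unfolding vf_iff by simp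
 next
  case (2 f) thus ?case using vf_closed[OF D(5)] C_mult[OF U h] by blast
 next
  case (3 V ph)
  obtain w where w: "!!b. b : axes E ==> smf E (U Int V) (w b)"
   "!!f x. f : CC U ==> x : U ==> x : V ==> v f x = (SUM b:axes E. w b x * pdc V ph b f x)"
   by (rule vf_formula[OF D(5) 3]) blast
  have o: "open (U Int V)" using U chart_open[OF 3] by auto
  have "smf E (U Int V) h" using h by (auto simp: C_iff intro: smooth_fun_subset)
  thus ?case using w o by (intro exI[of _ "%b x. h x * w b x"]) (auto simp: mult.assoc sum_distrib_left intro: smooth_fun_mult)
 qed
 show "h x * v (cut U (pairing E X Y)) x = form E x (h x *r L X x) (Y x) + form E x (X x) (h x *r L Y x)"
  if X: "X : SS U" and Y: "Y : SS U" and "x : U" for X Y x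
  unfolding D(7)[OF X Y] using that(3) S_fibre[OF X] S_fibre[OF Y] S_fibre[OF D(2)[OF X]] S_fibre[OF D(2)[OF Y]]
  by (simp add: cut_def pairing_def form_scale form_scale_right distrib_left)
qed (use cdoD[OF L] S_smult[OF U h] in \<open>auto simp: scaleR_add_right mult_ac\<close>)

lemma wedge_apply: "X : SS U ==> fst (wedge_cdo E U e1 e2) X = cut U (%x. form E x (e2 x) (X x) *r e1 x - form E x (e1 x) (X x) *r e2 x)"
 by (simp add: wedge_cdo_def pairing_def)

lemma wedge_gauge:
 assumes U: "open U" and e: "e1 : SS U" "e2 : SS U" shows "wedge_cdo E U e1 e2 : GG U" unfolding G_iff
proof (rule cdoI[OF U])
 note w = wedge_apply[where ?e1.0 = e1 and ?e2.0 = e2 and U = U]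
 have s0: "snd (wedge_cdo E U e1 e2) = (%f x. 0)" by (simp add: wedge_cdo_def)
 note f = S_fibre[OF e(1)] S_fibre[OF e(2)]
 show "fst (wedge_cdo E U e1 e2) X = (%x. 0)" if "X ~: SS U" for X using that by (simp add: wedge_cdo_def)
 show "snd (wedge_cdo E U e1 e2) : vector_fields E U"
  unfolding s0 vf_iff using U chart_open by (auto simp: C_zero intro!: exI[of _ "%b x. 0"] smooth_fun_const)
 fix X x assume X: "X : SS U"
 have "sms E U (%x. pairing E e2 X x *r e1 x - pairing E e1 X x *r e2 x)"
  using e X by (intro section_diff section_scale U pairing_smooth) (auto simp: S_iff)
 thus "fst (wedge_cdo E U e1 e2) X : SS U" unfolding w[OF X] using S_cut[OF U] by (simp add: pairing_def)
 assume x: "x : U"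
 show "fst (wedge_cdo E U e1 e2) (%x. g x *r X x) x = g x *r fst (wedge_cdo E U e1 e2) X x + snd (wedge_cdo E U e1 e2) g x *r X x"
  if g: "g : CC U" for g unfolding w[OF X] w[OF S_smult[OF U g X]] s0 using f S_fibre[OF X] x
  by (simp add: cut_def form_scale_right scaleR_diff_right)
 fix Y assume Y: "Y : SS U"
 show "fst (wedge_cdo E U e1 e2) (%x. X x + Y x) x = fst (wedge_cdo E U e1 e2) X x + fst (wedge_cdo E U e1 e2) Y x"
  unfolding w[OF X] w[OF Y] w[OF S_add[OF U X Y]] using f S_fibre[OF X] S_fibre[OF Y] x by (simp add: cut_def form_add_right scaleR_add_left)
 have "form E x (X x) (e1 x) = form E x (e1 x) (X x)" "form E x (X x) (e2 x) = form E x (e2 x) (X x)" using form_sym f S_fibre[OF X] by blast+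
 thus "snd (wedge_cdo E U e1 e2) (cut U (pairing E X Y)) x =
  form E x (fst (wedge_cdo E U e1 e2) X x) (Y x) + form E x (X x) (fst (wedge_cdo E U e1 e2) Y x)"
  unfolding w[OF X] w[OF Y] s0 using f S_fibre[OF X] S_fibre[OF Y] x
  by (simp add: cut_def form_diff form_diff_right fibre_scale form_scale form_scale_right)
qed

lemma gauge_zero: "open U ==> \<zero>\<^bsub>gauge E U\<^esub> : GG U"
proof -
 assume U: "open U"
 have "wedge_cdo E U (%x. 0) (%x. 0) = \<zero>\<^bsub>gauge E U\<^esub>" by (auto simp: wedge_cdo_def G_simps fun_eq_iff cut_def)
 thus ?thesis using wedge_gauge[OF U S_zero[OF U] S_zero[OF U]] by simp
qed

lemma gauge_add: "open U ==> D : GG U ==> D' : GG U ==> D \<oplus>\<^bsub>gauge E U\<^esub> D' : GG U"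
 unfolding G_iff G_simps fst_conv snd_conv by (rule cdo_add)

lemma gauge_smult: "open U ==> h : CC U ==> D : GG U ==> h \<odot>\<^bsub>gauge E U\<^esub> D : GG U"
 unfolding G_iff G_simps fst_conv snd_conv by (rule cdo_smult)

lemma gauge_eqI:
 assumes D: "D : GG U" "D' : GG U" and 1: "!!X x. X : SS U ==> x : U ==> fst D X x = fst D' X x"
  and 2: "!!f x. f : CC U ==> x : U ==> snd D f x = snd D' f x" shows "D = D'"
proof (rule prod_eqI)
 note c = cdoD[OF D(1)[unfolded G_iff]] and c' = cdoD[OF D(2)[unfolded G_iff]]
 show "fst D = fst D'"
 proof
  fix X
  show "fst D X = fst D' X"
  proof (cases "X : SS U")
   case True
   have "fst D X x = fst D' X x" for x using 1[OF True] c(2)[OF True] c'(2)[OF True] by (cases "x : U") (auto simp: S_iff)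
   thus ?thesis by auto
  qed (simp add: c(1) c'(1))
 qed
 show "snd D = snd D'"
 proof
  fix f
  show "snd D f = snd D' f"
  proof (cases "f : CC U")
   case True
   have "snd D f x = snd D' f x" for x using 2[OF True] vf_closed[OF c(5) True] vf_closed[OF c'(5) True] by (cases "x : U") (auto simp: C_iff)
   thus ?thesis by auto
  next
   case False
   thus ?thesis using c(5) c'(5) unfolding vf_iff by simp
  qed
 qed
qed

lemma gauge_group: "open U ==> abelian_group (gauge E U)"
proof (rule abelian_groupI)
 assume U: "open U"
 fix D assume D: "D : GG U"
 have "cut U (%x. - 1) \<odot>\<^bsub>gauge E U\<^esub> D : GG U" by (rule gauge_smult[OF U C_const[OF U] D])
 moreover have "(cut U (%x. - 1) \<odot>\<^bsub>gauge E U\<^esub> D) \<oplus>\<^bsub>gauge E U\<^esub> D = \<zero>\<^bsub>gauge E U\<^esub>"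
  by (rule gauge_eqI[OF gauge_add[OF U calculation D] gauge_zero[OF U]]) (simp_all add: G_simps cut_in)
 ultimately show "EX D':GG U. D' \<oplus>\<^bsub>gauge E U\<^esub> D = \<zero>\<^bsub>gauge E U\<^esub>" by blast
qed (simp_all add: gauge_add gauge_zero, simp_all add: G_simps add_ac)

subsection \<open>Local action\<close>

text \<open>The action on a section known only near \<open>x\<close>, such as a frame vector. By
  \<open>cdo_near\<close> every extension gives the same value. The chosen extension does not depend
  on \<open>D\<close>, so linearity in \<open>D\<close> holds by unfolding.\<close>

definition opL :: "'m set => ('m, 'v) cdo => ('m => 'v) => 'm => 'v" where
 "opL U D s x = fst D (SOME X. X : SS U & (\<forall>\<^sub>F y in nhds x. X y = s y)) x"

definition opv :: "'m set => ('m, 'v) cdo => ('m => real) => 'm => real" where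
 "opv U D f x = snd D (SOME g. g : CC U & (\<forall>\<^sub>F y in nhds x. g y = f y)) x"

lemma opL_add: "opL U (D \<oplus>\<^bsub>gauge E U\<^esub> D') s x = opL U D s x + opL U D' s x"
 and opv_add: "opv U (D \<oplus>\<^bsub>gauge E U\<^esub> D') f x = opv U D f x + opv U D' f x"
 and opL_smult: "opL U (h \<odot>\<^bsub>gauge E U\<^esub> D) s x = h x *r opL U D s x"
 and opv_smult: "opv U (h \<odot>\<^bsub>gauge E U\<^esub> D) f x = h x * opv U D f x" by (simp_all only: opL_def opv_def G_simps fst_conv snd_conv)

lemma opL_eq:
 assumes U: "open U" and D: "D : GG U" and x: "x : U" and X: "X : SS U" "near x X s" shows "opL U D s x = fst D X x"
proof -
 let ?Y = "SOME X. X : SS U & (\<forall>\<^sub>F y in nhds x. X y = s y)"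
 have Y: "?Y : SS U & (\<forall>\<^sub>F y in nhds x. ?Y y = s y)"
  by (rule someI[where P = "%X. X : SS U & (\<forall>\<^sub>F y in nhds x. X y = s y)", OF conjI[OF X]])
 have "\<forall>\<^sub>F y in nhds x. ?Y y = X y" using conjunct2[OF Y] X(2) by eventually_elim simp
 thus ?thesis unfolding opL_def by (rule cdo_near[OF U D[unfolded G_iff] x conjunct1[OF Y] X(1)])
qed

lemma opv_eq:
 assumes D: "D : GG U" and x: "x : U" and X: "f : CC U" "near x f s" shows "opv U D s x = snd D f x"
proof -
 let ?Y = "SOME g. g : CC U & (\<forall>\<^sub>F y in nhds x. g y = s y)"
 have Y: "?Y : CC U & (\<forall>\<^sub>F y in nhds x. ?Y y = s y)"
  by (rule someI[where P = "%g. g : CC U & (\<forall>\<^sub>F y in nhds x. g y = s y)", OF conjI[OF X]])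
 have "\<forall>\<^sub>F y in nhds x. ?Y y = f y" using conjunct2[OF Y] X(2) by eventually_elim simp
 thus ?thesis unfolding opv_def by (rule vf_near[OF cdoD(5)[OF D[unfolded G_iff]] x conjunct1[OF Y] X(1)])
qed

lemma ext_sec:
 assumes U: "open U" "x : U" and W: "open W" "x : W" "sms E W s"
 obtains X where "X : SS U" "near x X s" using extend_section[OF W(1,2) U(1) W(3)] U(2) by metis

lemma ext_fun:
 assumes U: "open U" "x : U" and W: "open W" "x : W" "smf E W s"
 obtains X where "X : CC U" "near x X s" using extend_fun[OF W(1,2) U(1) W(3)] U(2) by metis

context
 fixes U W :: "'m set" and D :: "('m, 'v) cdo"
 assumes U: "open U" and D: "D : GG U" and W: "open W"
begin

text \<open>An extension with the germ of \<open>s\<close> at \<open>x\<close> agrees with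
  \<open>s\<close> on a whole neighbourhood, where \<open>opL\<close> is therefore the value of the
  operator on a single section.\<close>

lemma opL_smooth:
 assumes s: "sms E W s" shows "sms E (U Int W) (opL U D s)"
proof (rule section_local)
 show "open (U Int W)" using U W by auto
 fix x assume x: "x : U Int W"
 obtain X where X: "X : SS U" "near x X s" by (rule ext_sec[OF U _ W _ s]) (use x in auto)
 obtain N where N: "open N" "x : N" "!!y. y : N ==> X y = s y" using X(2) unfolding eventually_nhds by blast
 have e: "fst D X y = opL U D s y" if "y : N Int (U Int W)" for y
 proof -
  have "\<forall>\<^sub>F z in nhds y. X z = s z" using N that unfolding eventually_nhds by blast
  thus ?thesis using opL_eq[OF U D _ X(1)] that by auto
 qed
 have "sms E (N Int (U Int W)) (fst D X)"
  by (rule section_subset[of U]) (use cdoD(2)[OF D[unfolded G_iff] X(1)] in \<open>auto simp: S_iff\<close>)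
 hence "sms E (N Int (U Int W)) (opL U D s)" by (rule section_cong[rotated 2]) (use N U W e in auto)
 thus "EX N. open N & x : N & sms E (N Int (U Int W)) (opL U D s)" using N by blast
qed

lemma opv_smooth:
 assumes s: "smf E W s" shows "smf E (U Int W) (opv U D s)"
proof (rule smooth_fun_local)
 show "open (U Int W)" using U W by auto
 fix x assume x: "x : U Int W"
 obtain X where X: "X : CC U" "near x X s" by (rule ext_fun[OF U _ W _ s]) (use x in auto)
 obtain N where N: "open N" "x : N" "!!y. y : N ==> X y = s y" using X(2) unfolding eventually_nhds by blast
 have e: "snd D X y = opv U D s y" if "y : N Int (U Int W)" for y
 proof -
  have "\<forall>\<^sub>F z in nhds y. X z = s z" using N that unfolding eventually_nhds by blast
  thus ?thesis using opv_eq[OF D _ X(1)] that by auto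
 qed
 have "smf E (N Int (U Int W)) (snd D X)"
  by (rule smooth_fun_subset[of U]) (use vf_closed[OF cdoD(5)[OF D[unfolded G_iff]] X(1)] in \<open>auto simp: C_iff\<close>)
 hence "smf E (N Int (U Int W)) (opv U D s)" by (rule smooth_fun_cong[rotated 2]) (use N U W e in auto)
 thus "EX N. open N & x : N & smf E (N Int (U Int W)) (opv U D s)" using N by blast
qed

lemma opL_fibre: "sms E W s ==> x : U ==> x : W ==> opL U D s x : fibre E x"
 by (rule section_fibre[OF opL_smooth]) auto

context
 fixes x assumes x: "x : U" "x : W"
begin

lemma opL_plus:
 assumes s: "sms E W s" and t: "sms E W t" shows "opL U D (%y. s y + t y) x = opL U D s x + opL U D t x"
proof -
 obtain X where X: "X : SS U" "near x X s" by (rule ext_sec[OF U x(1) W x(2) s])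
 obtain Y where Y: "Y : SS U" "near x Y t" by (rule ext_sec[OF U x(1) W x(2) t])
 have "\<forall>\<^sub>F y in nhds x. X y + Y y = s y + t y" using X(2) Y(2) by eventually_elim simp
 note opL_eq[OF U D x(1) S_add[OF U X(1) Y(1)] this]
 thus ?thesis using cdoD(3)[OF D[unfolded G_iff] X(1) Y(1)] opL_eq[OF U D x(1) X] opL_eq[OF U D x(1) Y] by simp
qed

lemma opL_leibniz:
 assumes f: "smf E W f" and t: "sms E W t"
 shows "opL U D (%y. f y *r t y) x = f x *r opL U D t x + opv U D f x *r t x"
proof -
 obtain X where X: "X : CC U" "near x X f" by (rule ext_fun[OF U x(1) W x(2) f])
 obtain Y where Y: "Y : SS U" "near x Y t" by (rule ext_sec[OF U x(1) W x(2) t])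
 have "\<forall>\<^sub>F y in nhds x. X y *r Y y = f y *r t y" using X(2) Y(2) by eventually_elim simp
 note opL_eq[OF U D x(1) S_smult[OF U X(1) Y(1)] this]
 thus ?thesis using cdoD(6)[OF D[unfolded G_iff] X(1) Y(1)] opv_eq[OF D x(1) X] opL_eq[OF U D x(1) Y]
  eventually_nhds_x_imp_x[OF X(2)] eventually_nhds_x_imp_x[OF Y(2)] by simp
qed

lemma opL_zero: "opL U D (%y. 0) x = 0" using opL_plus[OF section_zero[OF W] section_zero[OF W]] by simp

lemma opL_comb:
 assumes "finite I" "!!i. i : I ==> smf E W (c i)" "!!i. i : I ==> sms E W (s i)"
 shows "opL U D (%y. SUM i:I. c i y *r s i y) x = (SUM i:I. c i x *r opL U D (s i) x + opv U D (c i) x *r s i x)"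
 using assms
proof (induction I rule: finite_induct)
 case (insert i I)
 have "sms E W (%y. SUM i:I. c i y *r s i y)"
  by (rule section_sum[OF W], rule section_scale[OF W]) (use insert.prems in auto)
 moreover have "sms E W (%y. c i y *r s i y)" by (rule section_scale[OF W]) (use insert.prems in auto)
 ultimately have "opL U D (%y. c i y *r s i y + (SUM i:I. c i y *r s i y)) x
   = opL U D (%y. c i y *r s i y) x + opL U D (%y. SUM i:I. c i y *r s i y) x" by (intro opL_plus)
 thus ?case using insert opL_leibniz[of "c i" "s i"] by simp
qed (simp add: opL_zero)

text \<open>The components of the vector field are its values on the coordinate functions, whose
  partial derivatives are 0 or 1.\<close>

lemma opv_chart:
 assumes f: "smf E W f" and c: "(V, ph) : atlas E" "x : V"
 shows "opv U D f x = (SUM b:axes E. opv U D (%y. ph y \<bullet> b) x * pdc V ph b f x)"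
proof -
 have V: "open V" by (rule chart_open[OF c(1)])
 obtain w where w: "!!b. b : axes E ==> smf E (U Int V) (w b)"
  "!!f x. f : CC U ==> x : U ==> x : V ==> snd D f x = (SUM b:axes E. w b x * pdc V ph b f x)"
  by (rule vf_formula[OF cdoD(5)[OF D[unfolded G_iff]] c(1)]) blast
 have *: "opv U D g x = (SUM b:axes E. w b x * pdc V ph b g x)" if g: "open W'" "x : W'" "smf E W' g" for g W'
 proof -
  obtain X where X: "X : CC U" "near x X g" by (rule ext_fun[OF U x(1) g])
  have "pdc V ph b X x = pdc V ph b g x" if "b : axes E" for b by (rule pderiv_near[OF c that X(2)])
  thus ?thesis using w(2)[OF X(1) x(1) c(2)] opv_eq[OF D x(1) X] by simp
 qed
 have "opv U D (%y. ph y \<bullet> b) x = w b x" if b: "b : axes E" for b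
 proof -
  have "opv U D (%y. ph y \<bullet> b) x = (SUM b':axes E. w b' x * (if b' = b then 1 else 0))"
   unfolding *[OF V c(2) smooth_fun_coordinate[OF c(1)]] by (rule sum.cong) (simp_all add: pderiv_coordinate[OF c _ b])
  also have "... = w b x" using finite_axes b by (simp add: if_distrib[of "%t. _ * t"] sum.delta cong: if_cong)
  finally show ?thesis .
 qed
 thus ?thesis using *[OF W x(2) f] by simp
qed

lemma opv_pairing:
 assumes s: "sms E W s" and t: "sms E W t"
 shows "opv U D (pairing E s t) x = form E x (opL U D s x) (t x) + form E x (s x) (opL U D t x)"
proof -
 obtain X where X: "X : SS U" "near x X s" by (rule ext_sec[OF U x(1) W x(2) s])
 obtain Y where Y: "Y : SS U" "near x Y t" by (rule ext_sec[OF U x(1) W x(2) t])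
 have "\<forall>\<^sub>F y in nhds x. cut U (pairing E X Y) y = pairing E s t y"
  using X(2) Y(2) near_cut[OF U x(1), of "pairing E X Y"] by eventually_elim (simp add: pairing_def)
 note opv_eq[OF D x(1) C_pairing[OF U X(1) Y(1)] this]
 thus ?thesis using cdoD(7)[OF D[unfolded G_iff] X(1) Y(1)] opL_eq[OF U D x(1) X] opL_eq[OF U D x(1) Y]
  eventually_nhds_x_imp_x[OF X(2)] eventually_nhds_x_imp_x[OF Y(2)] x(1) by (simp add: cut_in pairing_def)
qed

end
end

lemma opL_cong: "\<forall>\<^sub>F y in nhds x. s y = t y ==> opL U D s x = opL U D t x"
proof -
 assume e: "near x s t"
 have "(\<forall>\<^sub>F y in nhds x. X y = s y) \<longleftrightarrow> (\<forall>\<^sub>F y in nhds x. X y = t y)" for X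
  by (rule eventually_cong[OF e]) simp
 thus ?thesis by (simp add: opL_def)
qed

lemma opv_cong: "\<forall>\<^sub>F y in nhds x. s y = t y ==> opv U D s x = opv U D t x"
proof -
 assume e: "near x s t"
 have "(\<forall>\<^sub>F y in nhds x. X y = s y) \<longleftrightarrow> (\<forall>\<^sub>F y in nhds x. X y = t y)" for X
  by (rule eventually_cong[OF e]) simp
 thus ?thesis by (simp add: opv_def)
qed

lemma wedge_opL:
 assumes U: "open U" "x : U" and e: "e1 : SS U" "e2 : SS U" and W: "open W" "x : W" "sms E W s"
 shows "opL U (wedge_cdo E U e1 e2) s x = form E x (e2 x) (s x) *r e1 x - form E x (e1 x) (s x) *r e2 x"
  and "opv U (wedge_cdo E U e1 e2) f x = 0"
proof -
 obtain X where X: "X : SS U" "near x X s" by (rule ext_sec[OF U W])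
 show "opL U (wedge_cdo E U e1 e2) s x = form E x (e2 x) (s x) *r e1 x - form E x (e1 x) (s x) *r e2 x"
  using opL_eq[OF U(1) wedge_gauge[OF U(1) e] U(2) X] wedge_apply[OF X(1)] U(2) eventually_nhds_x_imp_x[OF X(2)] by (simp add: cut_in)
 show "opv U (wedge_cdo E U e1 e2) f x = 0" by (simp add: opv_def wedge_cdo_def)
qed

subsection \<open>Restriction of operators\<close>

text \<open>\<open>gauge_restr\<close> is a definite description; this is the explicit operator that
  it denotes.\<close>

definition res :: "'m set => 'm set => ('m, 'v) cdo => ('m, 'v) cdo" where
 "res U V D = (%X. if X : SS V then cut V (opL U D X) else (%x. 0), %f. if f : CC V then cut V (opv U D f) else (%x. 0))"

context
 fixes U V :: "'m set" and D :: "('m, 'v) cdo"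
 assumes U: "open U" and V: "open V" "V <= U" and D: "D : GG U"
begin

lemma res_gauge: "res U V D : GG V" unfolding G_iff
proof (rule cdoI[OF V(1)])
 have UV: "U Int V = V" using V by auto
 have Xs: "sms E V X" if "X : SS V" for X using that by (simp add: S_iff)
 have fs: "smf E V f" if "f : CC V" for f using that by (simp add: C_iff)
 have r: "fst (res U V D) X x = opL U D X x" if "X : SS V" "x : V" for X x using that by (simp add: res_def cut_in)
 have rv: "snd (res U V D) f x = opv U D f x" if "f : CC V" "x : V" for f x using that by (simp add: res_def cut_in)
 show "fst (res U V D) X = (%x. 0)" if "X ~: SS V" for X using that by (simp add: res_def)
 show "fst (res U V D) X : SS V" if "X : SS V" for X
  using S_cut[OF V(1) opL_smooth[OF U D V(1) Xs[OF that], unfolded UV]] that by (simp add: res_def)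
 show "snd (res U V D) : vector_fields E V" unfolding vf_iff
 proof (intro conjI allI impI ballI, goal_cases)
  case (1 f) thus ?case by (simp add: res_def)
 next
  case (2 f) thus ?case using C_cut[OF V(1) opv_smooth[OF U D V(1) fs[OF 2], unfolded UV]] by (simp add: res_def)
 next
  case (3 V' ph)
  have "smf E (V Int V') (opv U D (%y. ph y \<bullet> b))" for b
   by (rule smooth_fun_subset[OF opv_smooth[OF U D chart_open[OF 3] smooth_fun_coordinate[OF 3]]]) (use V in auto)
  moreover have "snd (res U V D) f x = (SUM b:axes E. opv U D (%y. ph y \<bullet> b) x * pdc V' ph b f x)"
   if f: "f : CC V" and x: "x : V Int V'" for f x using rv[OF f, of x] opv_chart[OF U D V(1) _ _ fs[OF f] 3, of x] x V by auto
  ultimately show ?case by (intro exI[of _ "%b. opv U D (%y. ph y \<bullet> b)"] conjI ballI)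
 qed
 fix X Y x assume X: "X : SS V" and Y: "Y : SS V" and x: "x : V"
 have xU: "x : U" using x V by auto
 show "fst (res U V D) (%x. X x + Y x) x = fst (res U V D) X x + fst (res U V D) Y x"
  unfolding r[OF X x] r[OF Y x] r[OF S_add[OF V(1) X Y] x] by (rule opL_plus[OF U D V(1) xU x Xs[OF X] Xs[OF Y]])
 show "fst (res U V D) (%x. f x *r X x) x = f x *r fst (res U V D) X x + snd (res U V D) f x *r X x" if f: "f : CC V" for f
  unfolding r[OF X x] rv[OF f x] r[OF S_smult[OF V(1) f X] x] by (rule opL_leibniz[OF U D V(1) xU x fs[OF f] Xs[OF X]])
 show "snd (res U V D) (cut V (pairing E X Y)) x = form E x (fst (res U V D) X x) (Y x) + form E x (X x) (fst (res U V D) Y x)"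
  unfolding r[OF X x] r[OF Y x] rv[OF C_pairing[OF V(1) X Y] x] opv_cong[OF near_cut[OF V(1) x]]
  by (rule opv_pairing[OF U D V(1) xU x Xs[OF X] Xs[OF Y]])
qed

lemma gauge_restr_eq: "gauge_restr E U V D = res U V D" and gauge_restr_closed: "gauge_restr E U V D : GG V"
proof -
 let ?P = "%D'. D' : GG V & (ALL X : SS U. fst D' (cut V X) = cut V (fst D X)) & (ALL f : CC U. snd D' (cut V f) = cut V (snd D f))"
 have P: "?P (res U V D)"
 proof (intro conjI ballI res_gauge)
  have n: "near x X (cut V X)" if "x : V" for x and X :: "'m => 'b::zero" using near_cut[OF V(1) that, of X] by eventually_elim simp
  show "fst (res U V D) (cut V X) = cut V (fst D X)" if X: "X : SS U" for X
   using S_cut_sub[OF V X] V opL_eq[OF U D _ X n] by (auto simp: res_def cut_def fun_eq_iff)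
  show "snd (res U V D) (cut V X) = cut V (snd D X)" if X: "X : CC U" for X
   using C_cut_sub[OF V X] V opv_eq[OF D _ X n] by (auto simp: res_def cut_def fun_eq_iff)
 qed
 \<comment> \<open>A section over \<open>V\<close> need not extend to \<open>U\<close>, but near
   each point it agrees with the cut of a section over \<open>U\<close>, and operators are
   local.\<close>
 have uniq: "D' = res U V D" if D': "?P D'" for D'
 proof (rule gauge_eqI[OF _ res_gauge])
  show G': "D' : GG V" using D' by blast
  note L' = G'[unfolded G_iff]
  show "fst D' X x = fst (res U V D) X x" if X: "X : SS V" and x: "x : V" for X x
  proof -
   have xU: "x : U" using x V by auto
   obtain X' where X': "X' : SS U" "near x X' X" by (rule ext_sec[OF U xU V(1) x]) (use X in \<open>simp add: S_iff\<close>, blast)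
   have "near x X (cut V X')" using X'(2) near_cut[OF V(1) x, of X'] by eventually_elim simp
   hence "fst D' X x = fst D' (cut V X') x" by (rule cdo_near[OF V(1) L' x X S_cut_sub[OF V X'(1)]])
   thus ?thesis using D' X'(1) x opL_eq[OF U D xU X'] X by (simp add: cut_in res_def)
  qed
  show "snd D' f x = snd (res U V D) f x" if X: "f : CC V" and x: "x : V" for f x
  proof -
   have xU: "x : U" using x V by auto
   obtain X' where X': "X' : CC U" "near x X' f" by (rule ext_fun[OF U xU V(1) x]) (use X in \<open>simp add: C_iff\<close>, blast)
   have "near x f (cut V X')" using X'(2) near_cut[OF V(1) x, of X'] by eventually_elim simp
   hence "snd D' f x = snd D' (cut V X') x" by (rule vf_near[OF cdoD(5)[OF L'] x X C_cut_sub[OF V X'(1)]])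
   thus ?thesis using D' X'(1) x opv_eq[OF D xU X'] X by (simp add: cut_in res_def)
  qed
 qed
 show e: "gauge_restr E U V D = res U V D" unfolding gauge_restr_def using P uniq by (rule the_equality)
 show "gauge_restr E U V D : GG V" unfolding e by (rule res_gauge)
qed

lemma gauge_restr_apply:
 "X : SS V ==> x : V ==> fst (gauge_restr E U V D) X x = opL U D X x"
 "f : CC V ==> x : V ==> snd (gauge_restr E U V D) f x = opv U D f x"
 by (simp_all add: gauge_restr_eq res_def cut_in)

lemma opL_restr:
 assumes x: "x : V" "x : W" and W: "open W" "sms E W s" shows "opL V (gauge_restr E U V D) s x = opL U D s x"
proof -
 obtain Y where Y: "Y : SS V" "near x Y s" by (rule ext_sec[OF V(1) x(1) W(1) x(2) W(2)])
 show ?thesis using opL_eq[OF V(1) gauge_restr_closed x(1) Y] gauge_restr_apply(1)[OF Y(1) x(1)] opL_cong[OF Y(2)] by simp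
qed

lemma opv_restr:
 assumes x: "x : V" "x : W" and W: "open W" "smf E W s" shows "opv V (gauge_restr E U V D) s x = opv U D s x"
proof -
 obtain Y where Y: "Y : CC V" "near x Y s" by (rule ext_fun[OF V(1) x(1) W(1) x(2) W(2)])
 show ?thesis using opv_eq[OF gauge_restr_closed x(1) Y] gauge_restr_apply(2)[OF Y(1) x(1)] opv_cong[OF Y(2)] by simp
qed

end

context
 fixes U V :: "'m set"
 assumes U: "open U" and V: "open V" "V <= U"
begin

lemma gauge_restr_add:
 assumes D: "D : GG U" "D' : GG U"
 shows "gauge_restr E U V (D \<oplus>\<^bsub>gauge E U\<^esub> D') = gauge_restr E U V D \<oplus>\<^bsub>gauge E V\<^esub> gauge_restr E U V D'"
proof -
 note a = gauge_restr_apply[OF U V gauge_add[OF U D]] gauge_restr_apply[OF U V D(1)] gauge_restr_apply[OF U V D(2)]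
 show ?thesis
  by (rule gauge_eqI[OF gauge_restr_closed[OF U V gauge_add[OF U D]] gauge_add[OF V(1) gauge_restr_closed[OF U V D(1)] gauge_restr_closed[OF U V D(2)]]])
   (simp_all add: a opL_add opv_add, simp_all add: G_simps a)
qed

lemma gauge_restr_smult:
 assumes h: "h : CC U" and D: "D : GG U"
 shows "gauge_restr E U V (h \<odot>\<^bsub>gauge E U\<^esub> D) = cut V h \<odot>\<^bsub>gauge E V\<^esub> gauge_restr E U V D"
proof -
 note a = gauge_restr_apply[OF U V gauge_smult[OF U h D]] gauge_restr_apply[OF U V D]
 show ?thesis
  by (rule gauge_eqI[OF gauge_restr_closed[OF U V gauge_smult[OF U h D]] gauge_smult[OF V(1) C_cut_sub[OF V h] gauge_restr_closed[OF U V D]]])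
   (simp_all add: a opL_smult opv_smult, simp_all add: G_simps a cut_in)
qed

lemma gauge_restr_wedge:
 assumes e: "e1 : SS U" "e2 : SS U" shows "gauge_restr E U V (wedge_cdo E U e1 e2) = wedge_cdo E V (cut V e1) (cut V e2)"
proof (rule gauge_eqI[OF gauge_restr_closed[OF U V wedge_gauge[OF U e]] wedge_gauge[OF V(1) S_cut_sub[OF V e(1)] S_cut_sub[OF V e(2)]]])
 have xU: "x : U" if "x : V" for x using that V by auto
 show "fst (gauge_restr E U V (wedge_cdo E U e1 e2)) X x = fst (wedge_cdo E V (cut V e1) (cut V e2)) X x" if X: "X : SS V" and x: "x : V" for X x
  unfolding gauge_restr_apply(1)[OF U V wedge_gauge[OF U e] X x] wedge_apply[OF X] cut_in[OF x]
  by (rule wedge_opL(1)[OF U xU[OF x] e V(1) x]) (use X in \<open>simp add: S_iff\<close>)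
 show "snd (gauge_restr E U V (wedge_cdo E U e1 e2)) f x = snd (wedge_cdo E V (cut V e1) (cut V e2)) f x" if f: "f : CC V" and x: "x : V" for f x
  unfolding gauge_restr_apply(2)[OF U V wedge_gauge[OF U e] f x] by (simp add: opv_def wedge_cdo_def)
qed

end

end

section \<open>Restriction maps between the algebras over open sets\<close>

context pe_mfd
begin

lemma EA: "open U ==> EA E U"
proof -
 assume U: "open U"
 interpret C: cring "Cinf E U" by (rule C_cring[OF U])
 show ?thesis
 proof (rule EA.intro)
  show "gen_module (Cinf E U) (sections E U)" by unfold_locales (simp_all add: S_simps S_add[OF U] S_smult[OF U])
  show "gen_module (Cinf E U) (gauge E U)" by unfold_locales (rule gauge_add[OF U] gauge_smult[OF U]; assumption)+
  show "abelian_group (gauge E U)" by (rule gauge_group[OF U])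
  show "wedge_cdo E U e1 e2 : GG U" if "e1 : SS U" "e2 : SS U" for e1 e2 by (rule wedge_gauge[OF U that])
 qed
qed

lemma restr_hom:
 assumes U: "open U" and V: "open V" "V <= U" shows "alg_hom (cut V) (Cinf E U) (EA_alg E U) (EA_alg E V) (EA_restr E U V)"
  and "X : SS U ==> EA_restr E U V (EA_E E U X) = EA_E E V (cut V X)"
  and "D : GG U ==> EA_restr E U V (EA_A E U D) = EA_A E V (gauge_restr E U V D)"
proof -
 have k: "lin_map (cut V) (Cinf E U) (sections E U) (sections E V) (cut V)"
  unfolding lin_map_def S_simps using S_cut_sub[OF V] by (auto simp: cut_def fun_eq_iff)
 have l: "lin_map (cut V) (Cinf E U) (gauge E U) (gauge E V) (gauge_restr E U V)"
  unfolding lin_map_def by (intro conjI ballI gauge_restr_closed[OF U V] gauge_restr_add[OF U V] gauge_restr_smult[OF U V])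
 note * = EA_restr_hom[OF EA[OF U] EA[OF V(1)] cut_ring_hom[OF V] k l gauge_restr_wedge[OF U V]]
 show "alg_hom (cut V) (Cinf E U) (EA_alg E U) (EA_alg E V) (EA_restr E U V)" by (rule *(1))
 show "X : SS U ==> EA_restr E U V (EA_E E U X) = EA_E E V (cut V X)" by (rule *(2))
 show "D : GG U ==> EA_restr E U V (EA_A E U D) = EA_A E V (gauge_restr E U V D)" by (rule *(3))
qed

end

section \<open>Linear and quadratic forms in the odd variables\<close>

definition lf :: "nat => (nat => real) => 'a spoly" where
 "lf n c = (SUM a<n. pscl (c a) (xi a))"

definition qf :: "nat => (nat => nat => real) => 'a spoly" where
 "qf n c = (SUM a<n. SUM b<n. pscl (c a b) (pmul (xi a) (xi b)))"

lemma lf_add: "lf n (%a. c a + d a) = lf n c + lf n d" and lf_scale: "lf n (%a. r * c a) = pscl r (lf n c)"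
 by (simp_all add: lf_def spoly_scale_add_left sum.distrib spoly_scale_sum spoly_scale_scale)

lemma lf_cong: "(!!a. a < n ==> c a = d a) ==> lf n c = lf n d" by (simp add: lf_def)

lemma lf_sum: "lf n (%a. SUM i:I. c i a) = (SUM i:I. lf n (c i))" unfolding lf_def spoly_sum_scale by (rule sum.swap)

lemma qf_add: "qf n (%a b. c a b + d a b) = qf n c + qf n d" and qf_scale: "qf n (%a b. r * c a b) = pscl r (qf n c)"
 by (simp_all add: qf_def spoly_scale_add_left sum.distrib spoly_scale_sum spoly_scale_scale)

lemma qf_cong: "(!!a b. a < n ==> b < n ==> c a b = d a b) ==> qf n c = qf n d" by (simp add: qf_def)

lemma qf_minus: "qf n (%a b. - c a b) = - qf n c" by (simp add: qf_def spoly_scale_minus sum_negf)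

lemma qf_diff: "qf n (%a b. c a b - d a b) = qf n c - qf n d" using qf_add[of n c "%a b. - d a b"] by (simp add: qf_minus)

lemma qf_sum: "qf n (%a b. SUM i:I. c i a b) = (SUM i:I. qf n (c i))"
proof -
 have "qf n (%a b. SUM i:I. c i a b) = (SUM a<n. SUM i:I. SUM b<n. pscl (c i a b) (pmul (xi a) (xi b)))"
  unfolding qf_def spoly_sum_scale by (rule sum.cong[OF refl], rule sum.swap)
 also have "... = (SUM i:I. qf n (c i))" unfolding qf_def by (rule sum.swap)
 finally show ?thesis .
qed

text \<open>Since the xi^a anticommute, \<open>qf\<close> sees only the antisymmetric part of its
  matrix. The sign of the momenta and the factor 1/2 in \<open>symb_A0\<close> both rest on
  this.\<close>

lemma qf_swap: "qf n (%a b. c b a) = - qf n c"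
proof -
 have "qf n (%a b. c b a) = (SUM b<n. SUM a<n. pscl (c b a) (pmul (xi a) (xi b)))" unfolding qf_def by (rule sum.swap)
 also have "... = (SUM b<n. SUM a<n. - pscl (c b a) (pmul (xi b) (xi a)))"
  by (intro sum.cong refl) (subst xi_anticommute, simp add: spoly_scale_minus)
 finally show ?thesis by (simp add: qf_def sum_negf)
qed

lemma lf_mult: "pmul (lf n u) (lf n w) = qf n (%a b. u a * w b)"
proof -
 have "pmul (lf n u) (lf n w) = (SUM a<n. SUM b<n. pmul (pscl (u a) (xi a)) (pscl (w b) (xi b)))"
  unfolding lf_def spoly_mult_sum(1) unfolding spoly_mult_sum(2) ..
 thus ?thesis by (simp add: qf_def spoly_mult_scale spoly_scale_scale mult.commute)
qed

lemma lf_anti: "pmul (lf n u) (lf n w) = - pmul (lf n w) (lf n u)"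
proof -
 have "qf n (%a b. u a * w b) = qf n (%a b. w b * u a)" by (rule qf_cong) simp
 also have "... = - qf n (%a b. w a * u b)" by (rule qf_swap)
 finally show ?thesis unfolding lf_mult .
qed

lemma spoly_half: "(F :: 'a spoly) = - F ==> F = 0"
 by (metis add.right_inverse field_sum_of_halves spoly_scale_add_left spoly_scale_minus(2) spoly_scale_one)

lemma lf_square: "pmul (lf n u) (lf n u) = 0" by (rule spoly_half[OF lf_anti])

lemma qf_central: "pmul (qf n c) F = pmul F (qf n c)"
proof -
 have "pmul (pmul (xi a) (xi b)) F = pmul F (pmul (xi a) (xi b))" for a b
 proof (rule spoly_mult_even)
  fix k assume "k : supp (pmul (xi a) (xi b))"
  thus "even (card (fset (fst k)))" by (rule keys_spoly_mult) (auto simp: keys_xi)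
 qed
 thus ?thesis by (simp add: qf_def spoly_mult_sum spoly_mult_scale)
qed

section \<open>Supports and weights\<close>

definition mons :: "nat => 'a set => (nat fset \<times> 'a multiset) set" where
 "mons n B = {(A, m). fset A <= {..<n} & set_mset m <= B}"

abbreviation wt :: "nat => (nat fset \<times> 'a multiset) set" where
 "wt d == {k. weight k = d}"

abbreviation wtle :: "nat => (nat fset \<times> 'a multiset) set" where
 "wtle d == {k. weight k <= d}"

text \<open>A bound on the weight bounds the number of factors of either kind. Local weight bounds
  thus give finite index sets that do not vary with the point.\<close>

lemma finite_mons: "finite B ==> finite (mons n B Int wtle d)"
proof (rule finite_subset)
 assume B: "finite B"
 show "mons n B Int wtle d <= (fset_of_list ` {xs. set xs <= {..<n} & length xs <= d}) \<times> (mset ` {xs. set xs <= B & length xs <= d})"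
 proof
  fix k assume k: "k : mons n B Int wtle d"
  obtain A m where [simp]: "k = (A, m)" by (cases k)
  obtain ys where ys: "m = mset ys" by (metis ex_mset)
  have "A = fset_of_list (sorted_list_of_set (fset A))" by (simp add: fset_inject[symmetric] fset_of_list.rep_eq)
  hence "A : fset_of_list ` {xs. set xs <= {..<n} & length xs <= d}"
   by (rule image_eqI) (use k in \<open>auto simp: mons_def weight_def\<close>)
  moreover have "m : mset ` {xs. set xs <= B & length xs <= d}"
   by (rule image_eqI[where x = ys], rule ys) (use k ys in \<open>auto simp: mons_def weight_def\<close>)
  ultimately show "k : (fset_of_list ` {xs. set xs <= {..<n} & length xs <= d}) \<times> (mset ` {xs. set xs <= B & length xs <= d})"
   by simp
 qed
 show "finite ((fset_of_list ` {xs. set xs <= {..<n} & length xs <= d}) \<times> (mset ` {xs. set xs <= B & length xs <= d}))"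
  using finite_lists_length_le[OF B] finite_lists_length_le[of "{..<n}"] by blast
qed

lemma keys_add_sub: "supp F <= K ==> supp G <= K ==> supp (F + G :: 'a spoly) <= K"
 using Poly_Mapping.keys_add[of F G] by blast

lemma keys_scale_sub: "supp F <= K ==> supp (pscl c F) <= K"
 using keys_spoly_scale by blast

lemma keys_minus_sub: "supp F <= K ==> supp (- F :: 'a spoly) <= K" by simp

lemma keys_sum_sub: "(!!i. i : I ==> supp (F i) <= K) ==> supp (SUM i:I. F i :: 'a spoly) <= K"
 by (induction I rule: infinite_finite_induct) (simp_all add: keys_add_sub)

lemma keys_mult_mons:
 assumes "supp F <= mons n B" "supp G <= mons n B"
 shows "supp (pmul F G) <= mons n B"
proof
 fix k assume "k : supp (pmul F G)"
 thus "k : mons n B" by (rule keys_spoly_mult) (use assms in \<open>fastforce simp: mons_def\<close>)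
qed

lemma keys_mult_wt:
 assumes "supp F <= wt d" "supp G <= wt e"
 shows "supp (pmul F G) <= wt (d + e)"
proof
 fix k assume "k : supp (pmul F G)"
 then obtain A m B n where "(A, m) : supp F" "(B, n) : supp G"
  "fset A Int fset B = {}" "k = (A |\<union>| B, m + n)" by (rule keys_spoly_mult)
 thus "k : wt (d + e)" using assms weight_Un[of A B m n] by auto
qed

lemma keys_mult_wtle:
 assumes "supp F <= wtle d" "supp G <= wtle e"
 shows "supp (pmul F G) <= wtle (d + e)"
proof
 fix k assume "k : supp (pmul F G)"
 then obtain A m B n where k: "(A, m) : supp F" "(B, n) : supp G"
  "fset A Int fset B = {}" "k = (A |\<union>| B, m + n)" by (rule keys_spoly_mult)
 hence "weight (A, m) <= d" "weight (B, n) <= e" using assms by auto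
 thus "k : wtle (d + e)" using weight_Un[OF k(3), of m n] k(4) by simp
qed

lemma keys_xi_sub: "a < n ==> supp (xi a) <= mons n B" "supp (xi a) <= wt 1"
 by (auto simp: keys_xi mons_def weight_def)

lemma keys_mom_sub: "i : B ==> supp (mom i) <= mons n B" "supp (mom i) <= wt 2"
 by (auto simp: keys_mom mons_def weight_def)

lemma keys_one_sub: "supp spoly_one <= mons n B" "supp spoly_one <= wt 0"
 by (auto simp: spoly_one_def mons_def weight_def)

lemma keys_lf: "supp (lf n c) <= mons n B" "supp (lf n c) <= wt 1"
 unfolding lf_def by (intro keys_sum_sub keys_scale_sub keys_xi_sub; simp)+

lemma keys_qf: "supp (qf n c) <= mons n B" "supp (qf n c) <= wt 2"
proof -
 show "supp (qf n c) <= mons n B" unfolding qf_def by (intro keys_sum_sub keys_scale_sub keys_mult_mons keys_xi_sub) auto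
 have "supp (pmul (xi a) (xi b)) <= wt 2" for a b
  using keys_mult_wt[OF keys_xi_sub(2)[of a] keys_xi_sub(2)[of b]] by (simp only: one_add_one)
 thus "supp (qf n c) <= wt 2" unfolding qf_def by (intro keys_sum_sub keys_scale_sub)
qed

lemma lookup_mult_superset:
 assumes "finite K" "supp F <= K" "finite L" "supp G <= L"
 shows "coef (pmul F G) j = (SUM k:K. SUM l:L.
  (if (fst k |\<union>| fst l, snd k + snd l) = j then odd_sign (fst k) (fst l) else 0)
   * (coef F k * coef G l))" unfolding spoly_mult_superset[OF assms] sterm_def
 by (auto simp: lookup_sum lookup_single when_def intro!: sum.cong)

section \<open>Polynomial functions\<close>

context pe_mfd
begin

text \<open>The conditions of \<open>nfuns\<close> within a single chart, separated from the gluing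
  so that closure under the operations can be proved chart by chart.\<close>

definition nice :: "'m set => ('m, 'a, 'v) nchart => ('m => 'a spoly) => bool" where
 "nice U ch G \<longleftrightarrow> (ALL x:U Int fst ch. supp (G x) <= mons (length (snd (snd ch))) (axes E))
  & (ALL k. smf E (U Int fst ch) (%x. coef (G x) k))
  & (ALL x:U Int fst ch. EX N d. open N & x : N & (ALL y:N Int (U Int fst ch). supp (G y) <= wtle d))"

lemma nice_smooth: "nice U ch G ==> smf E (U Int fst ch) (%x. coef (G x) k)"
 unfolding nice_def by blast

lemma nfuns_iff: "F : nfuns E U \<longleftrightarrow>
  (ALL ch x. \<not> (ch : ncharts E & x : U Int fst ch) --> F ch x = 0) & (ALL ch:ncharts E. nice U ch (F ch))
 & (ALL ch:ncharts E. ALL ch':ncharts E. ALL x:U Int fst ch Int fst ch'. F ch' x =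
    spoly_subst (trans_xi (snd (snd ch)) (snd (snd ch')) x) (trans_mom E ch ch' x) (F ch x))"
proof -
 have wl: "(ALL y:N Int U Int V. ALL k:supp (G y). weight k <= d) \<longleftrightarrow>
   (ALL y:N Int (U Int V). supp (G y) <= wtle d)" for N V d and G :: "'m => 'a spoly" by auto
 show ?thesis unfolding nfuns_def nice_def mem_Collect_eq wl split_beta mons_def prod.collapse by (simp only: conj_assoc)
qed

context
 fixes U :: "'m set" and ch :: "('m, 'a, 'v) nchart"
 assumes U: "open U" and k: "ch : ncharts E"
begin

lemma UV: "open (U Int fst ch)"
proof -
 obtain V ph es where "ch = (V, ph, es)" by (cases ch)
 thus ?thesis using nchartD(2)[of V ph es] k U by auto
qed

lemma nice_add:
 assumes F: "nice U ch F" and G: "nice U ch G" shows "nice U ch (%x. F x + G x)" unfolding nice_def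
proof (intro conjI allI ballI)
 show "supp (F x + G x) <= mons (length (snd (snd ch))) (axes E)" if "x : U Int fst ch" for x
  by (rule keys_add_sub) (use F G that in \<open>auto simp: nice_def\<close>)
 show "smf E (U Int fst ch) (%x. coef (F x + G x) k)" for k
  unfolding lookup_add by (rule smooth_fun_add[OF UV nice_smooth[OF F] nice_smooth[OF G]])
 fix x assume x: "x : U Int fst ch"
 obtain N d where N: "open N" "x : N" "ALL y:N Int (U Int fst ch). supp (F y) <= wtle d"
  using F x unfolding nice_def by blast
 obtain N' d' where N': "open N'" "x : N'" "ALL y:N' Int (U Int fst ch). supp (G y) <= wtle d'"
  using G x unfolding nice_def by blast
 have "supp (F y + G y) <= wtle (max d d')" if "y : (N Int N') Int (U Int fst ch)" for y
  by (rule keys_add_sub) (use N(3) N'(3) that in force)+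
 thus "EX N d. open N & x : N & (ALL y:N Int (U Int fst ch). supp (F y + G y) <= wtle d)"
  using N N' open_Int[of N N'] by blast
qed

lemma nice_mult:
 assumes F: "nice U ch F" and G: "nice U ch G" shows "nice U ch (%x. pmul (F x) (G x))" unfolding nice_def
proof (intro conjI allI ballI)
 let ?K = "mons (length (snd (snd ch))) (axes E)"
 have kF: "supp (F x) <= ?K" and kG: "supp (G x) <= ?K" if "x : U Int fst ch" for x
  using F G that unfolding nice_def by blast+
 show "supp (pmul (F x) (G x)) <= ?K" if "x : U Int fst ch" for x
  by (rule keys_mult_mons[OF kF[OF that] kG[OF that]])
 have loc: "EX N d d'. open N & x : N & (ALL y:N Int (U Int fst ch). supp (F y) <= wtle d & supp (G y) <= wtle d')"
  if x: "x : U Int fst ch" for x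
 proof -
  obtain N d where N: "open N" "x : N" "ALL y:N Int (U Int fst ch). supp (F y) <= wtle d"
   using F x unfolding nice_def by blast
  obtain N' d' where N': "open N'" "x : N'" "ALL y:N' Int (U Int fst ch). supp (G y) <= wtle d'"
   using G x unfolding nice_def by blast
  show ?thesis by (intro exI[of _ "N Int N'"] exI[of _ d] exI[of _ d']) (use N N' in auto)
 qed
 show "EX N d. open N & x : N & (ALL y:N Int (U Int fst ch). supp (pmul (F y) (G y)) <= wtle d)"
  if x: "x : U Int fst ch" for x using loc[OF x] keys_mult_wtle by metis
 show "smf E (U Int fst ch) (%x. coef (pmul (F x) (G x)) j)" for j
 proof (rule smooth_fun_local[OF UV])
  fix x assume "x : U Int fst ch"
  from loc[OF this] obtain N d d' where N: "open N" "x : N"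
   "!!y. y : N Int (U Int fst ch) ==> supp (F y) <= wtle d"
   "!!y. y : N Int (U Int fst ch) ==> supp (G y) <= wtle d'" by blast
  have o: "open (N Int (U Int fst ch))" using N UV by blast
  have sF: "smf E (N Int (U Int fst ch)) (%x. coef (F x) i)"
   and sG: "smf E (N Int (U Int fst ch)) (%x. coef (G x) i)" for i
   by (rule smooth_fun_subset[OF nice_smooth[OF F]] smooth_fun_subset[OF nice_smooth[OF G]], blast)+
  \<comment> \<open>The supports of the factors vary with the point. The local weight bounds confine
    them to fixed finite sets, over which the coefficient of the product is a finite sum of smooth
    functions.\<close>
  have s: "smf E (N Int (U Int fst ch)) (%x. SUM k:?K Int wtle d. SUM l:?K Int wtle d'.
    (if (fst k |\<union>| fst l, snd k + snd l) = j then odd_sign (fst k) (fst l) else 0)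
     * (coef (F x) k * coef (G x) l))"
   by (intro smooth_fun_sum[OF o] smooth_fun_mult[OF o] smooth_fun_const[OF o] sF sG)
  have "smf E (N Int (U Int fst ch)) (%x. coef (pmul (F x) (G x)) j)"
  proof (rule smooth_fun_cong[OF o _ s])
   fix y assume y: "y : N Int (U Int fst ch)"
   show "(SUM k:?K Int wtle d. SUM l:?K Int wtle d'.
    (if (fst k |\<union>| fst l, snd k + snd l) = j then odd_sign (fst k) (fst l) else 0)
     * (coef (F y) k * coef (G y) l)) = coef (pmul (F y) (G y)) j"
    by (rule lookup_mult_superset[symmetric]) (use finite_mons[OF finite_axes] kF[of y] kG[of y] N(3,4)[OF y] y in auto)
  qed
  thus "EX W. open W & x : W & smf E (W Int (U Int fst ch)) (%x. coef (pmul (F x) (G x)) j)"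
   using N by blast
 qed
qed

lemma nice_scale:
 assumes f: "smf E (U Int fst ch) f" and G: "nice U ch G" shows "nice U ch (%x. pscl (f x) (G x))"
 unfolding nice_def
proof (intro conjI allI ballI)
 show "supp (pscl (f x) (G x)) <= mons (length (snd (snd ch))) (axes E)" if "x : U Int fst ch" for x
  by (rule keys_scale_sub) (use G that in \<open>auto simp: nice_def\<close>)
 show "smf E (U Int fst ch) (%x. coef (pscl (f x) (G x)) k)" for k
  unfolding lookup_spoly_scale by (rule smooth_fun_mult[OF UV f nice_smooth[OF G]])
 fix x assume x: "x : U Int fst ch"
 obtain N d where N: "open N" "x : N" "ALL y:N Int (U Int fst ch). supp (G y) <= wtle d"
  using G x unfolding nice_def by blast
 hence "ALL y:N Int (U Int fst ch). supp (pscl (f y) (G y)) <= wtle d"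
  using keys_scale_sub by blast
 thus "EX N d. open N & x : N & (ALL y:N Int (U Int fst ch). supp (pscl (f y) (G y)) <= wtle d)"
  using N by blast
qed

lemma nice_const:
 assumes F: "supp F <= mons (length (snd (snd ch))) (axes E)" shows "nice U ch (%x. F)" unfolding nice_def
proof (intro conjI allI ballI)
 show "smf E (U Int fst ch) (%x. coef F k)" for k by (rule smooth_fun_const[OF UV])
 have "supp F <= wtle (Max (weight ` supp F))" by auto
 thus "EX N d. open N & x : N & (ALL y:N Int (U Int fst ch). supp F <= wtle d)" for x
  by (intro exI[of _ UNIV] exI[of _ "Max (weight ` supp F)"]) auto
qed (use F in auto)

lemma nice_sum: "(!!i. i : I ==> nice U ch (F i)) ==> nice U ch (%x. SUM i:I. F i x)"
proof (induction I rule: infinite_finite_induct)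
 case (insert i I)
 thus ?case using nice_add[of "F i" "%x. SUM i:I. F i x"] by simp
qed (simp_all add: nice_const)

lemma nice_cong:
 assumes "nice U ch F" "!!x. x : U Int fst ch ==> F x = G x" shows "nice U ch G" unfolding nice_def
proof (intro conjI allI ballI)
 show "supp (G x) <= mons (length (snd (snd ch))) (axes E)" if "x : U Int fst ch" for x
  using assms that unfolding nice_def by metis
 show "smf E (U Int fst ch) (%x. coef (G x) k)" for k
  by (rule smooth_fun_cong[OF UV _ nice_smooth[OF assms(1)]]) (simp add: assms(2))
 fix x assume x: "x : U Int fst ch"
 obtain N d where N: "open N" "x : N" "ALL y:N Int (U Int fst ch). supp (F y) <= wtle d"
  using assms(1) x unfolding nice_def by blast
 hence "ALL y:N Int (U Int fst ch). supp (G y) <= wtle d" using assms(2) by simp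
 thus "EX N d. open N & x : N & (ALL y:N Int (U Int fst ch). supp (G y) <= wtle d)"
  using N by blast
qed

end

lemma trans_xi_lf: "trans_xi es es' x a = lf (length es') (%a'. fco es a (es' ! a') x)" by (simp add: trans_xi_def lf_def)

lemma trans_mom_qf: "trans_mom E (V, ph, es) (V', ph', es') x i =
  (SUM i':axes E. pscl (pdc V ph i (%y. ph' y \<bullet> i') x) (mom i'))
 + qf (length es') (%a' b'. SUM a<length es. SUM b<length es. 1 / 2 * pdc V ph i (fco es a (es' ! a')) x
   * pairing E (es ! a) (es ! b) x * fco es b (es' ! b') x)" by (simp add: trans_mom_def qf_def spoly_sum_scale)

text \<open>The image of p_i is linear in the momenta plus quadratic in the odd variables, hence
  even and central; the images of the xi^a are linear and odd.\<close>

lemma trans_hom: "spoly_hom (trans_xi (snd (snd ch)) (snd (snd ch')) x) (trans_mom E ch ch' x)"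
proof
 show "pmul (trans_xi (snd (snd ch)) (snd (snd ch')) x a) (trans_xi (snd (snd ch)) (snd (snd ch')) x b) =
   - pmul (trans_xi (snd (snd ch)) (snd (snd ch')) x b) (trans_xi (snd (snd ch)) (snd (snd ch')) x a)" for a b
  unfolding trans_xi_lf by (rule lf_anti)
 obtain V ph es V' ph' es' where k: "ch = (V, ph, es)" "ch' = (V', ph', es')" by (metis prod_cases3)
 show "pmul (trans_mom E ch ch' x i) F = pmul F (trans_mom E ch ch' x i)" for i F unfolding k trans_mom_qf
  by (simp add: spoly_mult_add qf_central spoly_mult_sum spoly_mult_scale mom_central)
qed

lemma nfuns_add:
 assumes U: "open U" and F: "F : nfuns E U" and G: "G : nfuns E U" shows "(%ch x. F ch x + G ch x) : nfuns E U"
 unfolding nfuns_iff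
proof (intro conjI ballI)
 show "nice U ch (%x. F ch x + G ch x)" if "ch : ncharts E" for ch
  by (rule nice_add[OF U that]) (use F G that in \<open>simp_all add: nfuns_iff\<close>)
 show "F ch' x + G ch' x = spoly_subst (trans_xi (snd (snd ch)) (snd (snd ch')) x) (trans_mom E ch ch' x) (F ch x + G ch x)"
  if "ch : ncharts E" "ch' : ncharts E" "x : U Int fst ch Int fst ch'" for ch ch' x
  unfolding spoly_hom.subst_add[OF trans_hom] using F G that unfolding nfuns_iff by metis
qed (use F G in \<open>simp add: nfuns_iff\<close>)

lemma nfuns_mult:
 assumes U: "open U" and F: "F : nfuns E U" and G: "G : nfuns E U"
 shows "(%ch x. pmul (F ch x) (G ch x)) : nfuns E U" unfolding nfuns_iff
proof (intro conjI ballI)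
 show "nice U ch (%x. pmul (F ch x) (G ch x))" if "ch : ncharts E" for ch
  by (rule nice_mult[OF U that]) (use F G that in \<open>simp_all add: nfuns_iff\<close>)
 show "pmul (F ch' x) (G ch' x) = spoly_subst (trans_xi (snd (snd ch)) (snd (snd ch')) x) (trans_mom E ch ch' x) (pmul (F ch x) (G ch x))"
  if "ch : ncharts E" "ch' : ncharts E" "x : U Int fst ch Int fst ch'" for ch ch' x
  unfolding spoly_hom.subst_mult[OF trans_hom] using F G that unfolding nfuns_iff by metis
qed (use F G in \<open>simp add: nfuns_iff spoly_mult_zero\<close>)

lemma nfuns_scale:
 assumes U: "open U" and f: "f : CC U" and F: "F : nfuns E U" shows "(%ch x. pscl (f x) (F ch x)) : nfuns E U"
 unfolding nfuns_iff
proof (intro conjI ballI)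
 show "nice U ch (%x. pscl (f x) (F ch x))" if "ch : ncharts E" for ch
  by (rule nice_scale[OF U that]) (use F f that in \<open>auto simp: nfuns_iff C_iff intro: smooth_fun_subset\<close>)
 show "pscl (f x) (F ch' x) = spoly_subst (trans_xi (snd (snd ch)) (snd (snd ch')) x) (trans_mom E ch ch' x) (pscl (f x) (F ch x))"
  if "ch : ncharts E" "ch' : ncharts E" "x : U Int fst ch Int fst ch'" for ch ch' x
  unfolding spoly_hom.subst_scale[OF trans_hom] using F that unfolding nfuns_iff by metis
qed (use F in \<open>simp add: nfuns_iff spoly_scale_zero\<close>)

lemma nfuns_one:
 assumes U: "open U"
 shows "(%ch x. if ch : ncharts E & x : U Int fst ch then spoly_one else 0) : nfuns E U"
 unfolding nfuns_iff
proof (intro conjI ballI)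
 fix ch assume k: "ch : ncharts E"
 show "nice U ch (%x. if ch : ncharts E & x : U Int fst ch then spoly_one else 0)"
  by (rule nice_cong[OF U k nice_const[OF U k keys_one_sub(1)]]) (use k in simp)
qed (simp_all add: spoly_hom.subst_one[OF trans_hom])

end

section \<open>The homomorphism to polynomial functions\<close>

context pe_mfd
begin

text \<open>The fibrewise linear function on E[1] that corresponds to \<open>X\<close> under the
  identification of E with its dual.\<close>

definition symb_E :: "'m set => ('m => 'v) => ('m, 'a, 'v) nchart => 'm => 'a spoly" where
 "symb_E U X = (%(V, ph, es) x. if (V, ph, es) : ncharts E & x : U Int V
  then lf (length es) (%a. form E x ((es ! a) x) (X x)) else 0)"

text \<open>The matrix of the operator in the frame, with its first index lowered by the
  form.\<close>

definition conn :: "'m set => ('m, 'v) cdo => ('m => 'v) list => 'm => nat => nat => real" where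
 "conn U D es x a b = form E x ((es ! a) x) (opL U D (es ! b) x)"

definition symb_A0 :: "'m set => ('m, 'v) cdo => ('m, 'a, 'v) nchart => 'm => 'a spoly" where
 "symb_A0 U D = (%(V, ph, es) x. qf (length es) (%a b. 1 / 2 * conn U D es x a b)
  - (SUM i:axes E. pscl (opv U D (%y. ph y \<bullet> i) x) (mom i)))"

definition symb_A :: "'m set => ('m, 'v) cdo => ('m, 'a, 'v) nchart => 'm => 'a spoly" where
 "symb_A U D = (%ch x. if ch : ncharts E & x : U Int fst ch then symb_A0 U D ch x else 0)"

lemma symb_E_in: "(V, ph, es) : ncharts E ==> x : U ==> x : V ==>
  symb_E U X (V, ph, es) x = lf (length es) (%a. form E x ((es ! a) x) (X x))" by (simp add: symb_E_def)

lemma symb_A_in: "(V, ph, es) : ncharts E ==> x : U ==> x : V ==>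
  symb_A U D (V, ph, es) x = qf (length es) (%a b. 1 / 2 * conn U D es x a b)
  - (SUM i:axes E. pscl (opv U D (%y. ph y \<bullet> i) x) (mom i))" by (simp add: symb_A_def symb_A0_def)

context
 fixes V ph es and U :: "'m set" and x :: 'm
 assumes k: "(V, ph, es) : ncharts E" and U: "open U" and x: "x : U" "x : V"
begin

lemma opL_frame_fibre: "D : GG U ==> a < length es ==> opL U D (es ! a) x : fibre E x"
 by (rule opL_fibre[OF U _ nchartD(2)[OF k] nchartD(3)[OF k] x])

lemma conn_add: "D : GG U ==> D' : GG U ==> a < length es ==> b < length es ==>
  conn U (D \<oplus>\<^bsub>gauge E U\<^esub> D') es x a b = conn U D es x a b + conn U D' es x a b"
 unfolding conn_def opL_add by (rule form_add_right) (auto intro: opL_frame_fibre nchartD(6)[OF k] x)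

lemma conn_smult: "D : GG U ==> a < length es ==> b < length es ==>
  conn U (h \<odot>\<^bsub>gauge E U\<^esub> D) es x a b = h x * conn U D es x a b"
 unfolding conn_def opL_smult by (rule form_scale_right) (auto intro: opL_frame_fibre nchartD(6)[OF k] x)

lemma symb_E_lin: "lin_map (%h. h x) (Cinf E U) (sections E U) spoly_alg (%X. symb_E U X (V, ph, es) x)"
 unfolding lin_map_def symb_E_in[OF k x]
proof (intro conjI ballI)
 fix X assume X: "X : SS U"
 show "lf (length es) (%a. form E x ((es ! a) x) ((X \<oplus>\<^bsub>sections E U\<^esub> Y) x)) =
   lf (length es) (%a. form E x ((es ! a) x) (X x)) \<oplus>\<^bsub>spoly_alg\<^esub> lf (length es) (%a. form E x ((es ! a) x) (Y x))"
  if Y: "Y : SS U" for Y using S_fibre[OF X] S_fibre[OF Y] nchartD(6)[OF k _ x(2)]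
  by (simp add: S_simps spoly_alg_def lf_add[symmetric]) (rule lf_cong, simp add: form_add_right)
 show "lf (length es) (%a. form E x ((es ! a) x) ((h \<odot>\<^bsub>sections E U\<^esub> X) x)) =
   h x \<odot>\<^bsub>spoly_alg\<^esub> lf (length es) (%a. form E x ((es ! a) x) (X x))" for h using S_fibre[OF X] nchartD(6)[OF k _ x(2)]
  by (simp add: S_simps spoly_alg_def lf_scale[symmetric]) (rule lf_cong, simp add: form_scale_right)
qed (simp add: spoly_alg_def)

lemma symb_A_lin: "lin_map (%h. h x) (Cinf E U) (gauge E U) spoly_alg (%D. symb_A U D (V, ph, es) x)"
 unfolding lin_map_def symb_A_in[OF k x]
proof (intro conjI ballI)
 fix D assume D: "D : GG U"
 let ?n = "length es"
 let ?q = "%D. qf ?n (%a b. 1 / 2 * conn U D es x a b)"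
 let ?p = "%D. SUM i:axes E. pscl (opv U D (%y. ph y \<bullet> i) x) (mom i)"
 show "?q (D \<oplus>\<^bsub>gauge E U\<^esub> D') - ?p (D \<oplus>\<^bsub>gauge E U\<^esub> D') = (?q D - ?p D) \<oplus>\<^bsub>spoly_alg\<^esub> (?q D' - ?p D')"
  if D': "D' : GG U" for D'
 proof -
  have "?q (D \<oplus>\<^bsub>gauge E U\<^esub> D') = ?q D + ?q D'"
   unfolding qf_add[symmetric] by (rule qf_cong) (simp only: conn_add[OF D D'] distrib_left)
  moreover have "?p (D \<oplus>\<^bsub>gauge E U\<^esub> D') = ?p D + ?p D'" by (simp only: opv_add spoly_scale_add_left sum.distrib)
  ultimately show ?thesis by (simp add: spoly_alg_def)
 qed
 show "?q (h \<odot>\<^bsub>gauge E U\<^esub> D) - ?p (h \<odot>\<^bsub>gauge E U\<^esub> D) = h x \<odot>\<^bsub>spoly_alg\<^esub> (?q D - ?p D)" for h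
 proof -
  have "?q (h \<odot>\<^bsub>gauge E U\<^esub> D) = pscl (h x) (?q D)"
   unfolding qf_scale[symmetric] by (rule qf_cong) (simp add: conn_smult[OF D])
  moreover have "?p (h \<odot>\<^bsub>gauge E U\<^esub> D) = pscl (h x) (?p D)" by (simp only: opv_smult spoly_scale_sum spoly_scale_scale)
  ultimately show ?thesis using spoly_scale_add[of "h x" "?q D" "- ?p D"] by (simp add: spoly_alg_def spoly_scale_minus)
 qed
qed (simp add: spoly_alg_def)

lemma symb_A_central: "pmul (symb_A U D (V, ph, es) x) F = pmul F (symb_A U D (V, ph, es) x)"
proof -
 have "pmul (A - B) F = pmul A F - pmul B F" "pmul F (A - B) = pmul F A - pmul F B" for A B
  using spoly_mult_add[of A "- B" F] spoly_mult_add(2)[of F A "- B"] by (simp_all add: spoly_mult_minus)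
 thus ?thesis unfolding symb_A_in[OF k x] by (simp add: qf_central spoly_mult_sum spoly_mult_scale mom_central)
qed

text \<open>The matrix of the wedge is \<open>?c a b - ?c b a\<close>, which \<open>qf\<close>
  counts as twice \<open>?c\<close>; the factor 1/2 in the symbol makes the result equal to the
  product of the two linear forms.\<close>

lemma symb_wedge:
 assumes e: "e1 : SS U" "e2 : SS U"
 shows "pmul (symb_E U e1 (V, ph, es) x) (symb_E U e2 (V, ph, es) x) = symb_A U (wedge_cdo E U e1 e2) (V, ph, es) x"
proof -
 let ?c = "%a b. form E x ((es ! a) x) (e1 x) * form E x ((es ! b) x) (e2 x)"
 note f = S_fibre[OF e(1), of x] S_fibre[OF e(2), of x] nchartD(6)[OF k _ x(2)]
 have c: "conn U (wedge_cdo E U e1 e2) es x a b = ?c a b - ?c b a" if ab: "a < length es" "b < length es" for a b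
 proof -
  have "opL U (wedge_cdo E U e1 e2) (es ! b) x = form E x (e2 x) ((es ! b) x) *r e1 x - form E x (e1 x) ((es ! b) x) *r e2 x"
   by (rule wedge_opL(1)[OF U x(1) e nchartD(2)[OF k] x(2) nchartD(3)[OF k ab(2)]])
  thus ?thesis using f ab by (simp add: conn_def form_diff_right form_scale_right fibre_scale form_sym[of "(es ! b) x"])
 qed
 have "symb_A U (wedge_cdo E U e1 e2) (V, ph, es) x = qf (length es) (%a b. 1 / 2 * conn U (wedge_cdo E U e1 e2) es x a b)"
  unfolding symb_A_in[OF k x] by (simp add: wedge_opL(2)[OF U x(1) e open_UNIV _ section_zero[OF open_UNIV]] spoly_scale_zero)
 also have "... = qf (length es) (%a b. 1 / 2 * ?c a b - (1 / 2 * ?c b a))" by (rule qf_cong) (simp add: c right_diff_distrib)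
 also have "... = pscl (1 / 2) (qf (length es) ?c) - pscl (1 / 2) (qf (length es) (%a b. ?c b a))"
  by (simp only: qf_diff qf_scale)
 also have "... = qf (length es) ?c"
  unfolding qf_swap[of _ ?c] spoly_scale_minus(2) diff_minus_eq_add spoly_scale_add_left[symmetric] by (simp add: spoly_scale_one)
 finally show ?thesis unfolding symb_E_in[OF k x] lf_mult by simp
qed

text \<open>The scalars act through their values at \<open>x\<close>, so \<open>EA_lift\<close>
  applies along the evaluation homomorphism with target an algebra over the reals. No smoothness
  enters at this stage.\<close>

lemma theta_exists:
 obtains T where "alg_hom (%h. h x) (Cinf E U) (EA_alg E U) spoly_alg T"
  "!!X. X : SS U ==> T (EA_E E U X) = symb_E U X (V, ph, es) x"
  "!!D. D : GG U ==> T (EA_A E U D) = symb_A U D (V, ph, es) x"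
proof -
 have h: "(%h. h x) : ring_hom (Cinf E U) real_ring" by (rule ring_hom_memI) (simp_all add: real_ring_def C_simps cut_in x)
 have sq: "symb_E U X (V, ph, es) x \<otimes>\<^bsub>spoly_alg\<^esub> symb_E U X (V, ph, es) x = \<zero>\<^bsub>spoly_alg\<^esub>" for X
  by (simp add: spoly_alg_def symb_E_in[OF k x] lf_square)
 have c: "F \<otimes>\<^bsub>spoly_alg\<^esub> symb_A U D (V, ph, es) x = symb_A U D (V, ph, es) x \<otimes>\<^bsub>spoly_alg\<^esub> F" for D F
  by (simp add: spoly_alg_def symb_A_central)
 have w: "symb_E U e1 (V, ph, es) x \<otimes>\<^bsub>spoly_alg\<^esub> symb_E U e2 (V, ph, es) x = symb_A U (wedge_cdo E U e1 e2) (V, ph, es) x"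
  if "e1 : SS U" "e2 : SS U" for e1 e2 using symb_wedge[OF that] by (simp add: spoly_alg_def)
 show ?thesis by (rule EA.EA_lift[OF EA[OF U] spoly_assoc_alg h symb_E_lin symb_A_lin sq c c w]; (assumption | rule that; assumption))
qed

end

lemma symb_E_nfuns:
 assumes U: "open U" and X: "X : SS U" shows "symb_E U X : nfuns E U" unfolding nfuns_iff
proof (intro conjI allI ballI impI)
 fix ch :: "('m, 'a, 'v) nchart" and x
 obtain V ph es where k: "ch = (V, ph, es)" by (cases ch)
 show "\<not> (ch : ncharts E & x : U Int fst ch) ==> symb_E U X ch x = 0" by (auto simp: symb_E_def k)
next
 fix ch assume k0: "ch : ncharts E"
 obtain V ph es where k: "ch = (V, ph, es)" by (cases ch)
 note k1 = k0[unfolded k]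
 have UV: "open (U Int V)" using U nchartD(2)[OF k1] by blast
 have XU: "sms E U X" using X by (simp add: S_iff)
 show "nice U ch (symb_E U X ch)"
 proof (rule nice_cong[OF U k0])
  show "nice U ch (%x. SUM a<length es. pscl (pairing E (es ! a) X x) (xi a))"
  proof (rule nice_sum[OF U k0], rule nice_scale[OF U k0])
   fix a assume a: "a : {..<length es}"
   show "smf E (U Int fst ch) (pairing E (es ! a) X)"
    unfolding k fst_conv by (rule pairing_smooth[OF UV section_subset[OF nchartD(3)[OF k1]] section_subset[OF XU]]) (use a in auto)
   show "nice U ch (%x. xi a)" by (rule nice_const[OF U k0]) (use a in \<open>simp add: k keys_xi mons_def\<close>)
  qed
 qed (simp add: k symb_E_in[OF k1] lf_def pairing_def)
next
 fix ch ch' x assume k0: "ch : ncharts E" "ch' : ncharts E" and x: "x : U Int fst ch Int fst ch'"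
 obtain V ph es where k: "ch = (V, ph, es)" by (cases ch)
 obtain V' ph' es' where k': "ch' = (V', ph', es')" by (cases ch')
 note k1 = k0(1)[unfolded k] and k1' = k0(2)[unfolded k']
 have xs: "x : U" "x : V" "x : V'" using x by (auto simp: k k')
 interpret spoly_hom "trans_xi es es' x" "trans_mom E ch ch' x" using trans_hom[of ch ch' x] by (simp add: k k')
 let ?T = "%a a'. fco es a (es' ! a') x"
 let ?c = "%a. form E x ((es ! a) x) (X x)"
 have "spoly_subst (trans_xi es es' x) (trans_mom E ch ch' x) (symb_E U X ch x)
   = (SUM a<length es. pscl (?c a) (lf (length es') (?T a)))"
  unfolding k symb_E_in[OF k1 xs(1,2)] unfolding k[symmetric] lf_def[of "length es"] by (simp only: subst_sum subst_scale subst_xi trans_xi_lf)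
 also have "... = lf (length es') (%a'. SUM a<length es. ?c a * ?T a a')" by (simp only: lf_scale[symmetric] lf_sum[symmetric])
 also have "... = lf (length es') (%a'. form E x ((es' ! a') x) (X x))"
 proof (rule lf_cong)
  fix a' assume a': "a' < length es'"
  have "form E x ((es' ! a') x) (X x) = form E x (SUM a<length es. ?T a a' *r (es ! a) x) (X x)"
   using frame_sum[where s = "es' ! a'", OF nchartD(4)[OF k1 xs(2)] nchartD(6)[OF k1' a' xs(3)]] by simp
  also have "... = (SUM a<length es. ?T a a' * ?c a)" by (rule form_comb) (use nchartD(6)[OF k1 _ xs(2)] S_fibre[OF X] in auto)
  finally show "(SUM a<length es. ?c a * ?T a a') = form E x ((es' ! a') x) (X x)" by (simp add: mult.commute)
 qed
 also have "... = symb_E U X ch' x" unfolding k' by (rule symb_E_in[OF k1' xs(1,3), symmetric])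
 finally show "symb_E U X ch' x = spoly_subst (trans_xi (snd (snd ch)) (snd (snd ch')) x) (trans_mom E ch ch' x) (symb_E U X ch x)"
  by (simp add: k k')
qed

text \<open>Expanding the new frame in the old one and applying the Leibniz rule differentiates the
  coefficients of the second argument only; this is the inhomogeneous term that the momenta have to
  absorb.\<close>

lemma conn_transition:
 assumes U: "open U" and D: "D : GG U" and k: "(V, ph, es) : ncharts E" and k': "(V', ph', es') : ncharts E"
  and x: "x : U" "x : V" "x : V'" and ab: "a' < length es'" "b' < length es'"
 shows "conn U D es' x a' b' = (SUM a<length es. SUM b<length es.
   fco es a (es' ! a') x * fco es b (es' ! b') x * conn U D es x a b
  + fco es a (es' ! a') x * opv U D (fco es b (es' ! b')) x * pairing E (es ! a) (es ! b) x)"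
proof -
 let ?T = "%a a'. fco es a (es' ! a')"
 have W: "open (V Int V')" "x : V Int V'" using nchartD(2)[OF k] nchartD(2)[OF k'] x by auto
 have "\<forall>\<^sub>F y in nhds x. y : V Int V'" by (rule eventually_nhds_in_open[OF W])
 hence "\<forall>\<^sub>F y in nhds x. (es' ! b') y = (SUM b<length es. ?T b b' y *r (es ! b) y)"
 proof eventually_elim
  case (elim y)
  thus ?case using frame_sum[where s = "es' ! b'", OF nchartD(4)[OF k, of y] nchartD(6)[OF k' ab(2), of y]] by simp
 qed
 hence "opL U D (es' ! b') x = opL U D (%y. SUM b<length es. ?T b b' y *r (es ! b) y) x" by (rule opL_cong)
 also have "... = (SUM b<length es. ?T b b' x *r opL U D (es ! b) x + opv U D (?T b b') x *r (es ! b) x)"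
 proof (rule opL_comb[OF U D W(1) x(1) W(2)])
  fix b assume "b : {..<length es}"
  thus "smf E (V Int V') (?T b b')" "sms E (V Int V') (es ! b)"
   using nchart_coeff_smooth[OF k nchartD(2)[OF k'] nchartD(3)[OF k' ab(2)], of b] section_subset[OF nchartD(3)[OF k], of b]
   by (auto simp: Int_commute)
 qed simp
 finally have L: "opL U D (es' ! b') x = (SUM b<length es. ?T b b' x *r opL U D (es ! b) x + opv U D (?T b b') x *r (es ! b) x)" .
 note fe = nchartD(6)[OF k _ x(2)] and fL = opL_frame_fibre[OF k U x(1,2) D]
 have fs: "(SUM b<length es. ?T b b' x *r opL U D (es ! b) x + opv U D (?T b b') x *r (es ! b) x) : fibre E x"
  by (rule fibre_sum) (auto intro!: fibre_add fibre_scale fe fL)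
 have "conn U D es' x a' b' = form E x (SUM a<length es. ?T a a' x *r (es ! a) x)
   (SUM b<length es. ?T b b' x *r opL U D (es ! b) x + opv U D (?T b b') x *r (es ! b) x)"
  unfolding conn_def L using frame_sum[where s = "es' ! a'", OF nchartD(4)[OF k x(2)] nchartD(6)[OF k' ab(1) x(3)]] by simp
 also have "... = (SUM a<length es. ?T a a' x * form E x ((es ! a) x)
   (SUM b<length es. ?T b b' x *r opL U D (es ! b) x + opv U D (?T b b') x *r (es ! b) x))"
  by (rule form_comb[OF _ fs]) (auto intro: fe)
 also have "... = (SUM a<length es. ?T a a' x * (SUM b<length es. ?T b b' x * conn U D es x a b + opv U D (?T b b') x * pairing E (es ! a) (es ! b) x))"
 proof (intro sum.cong refl arg_cong[of _ _ "(*) _"])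
  fix a assume a: "a : {..<length es}"
  have "form E x ((es ! a) x) (SUM b<length es. 1 *r (?T b b' x *r opL U D (es ! b) x + opv U D (?T b b') x *r (es ! b) x))
    = (SUM b<length es. 1 * form E x ((es ! a) x) (?T b b' x *r opL U D (es ! b) x + opv U D (?T b b') x *r (es ! b) x))"
   by (rule form_comb_right) (use a in \<open>auto intro!: fibre_add fibre_scale fe fL\<close>)
  also have "... = (SUM b<length es. ?T b b' x * conn U D es x a b + opv U D (?T b b') x * pairing E (es ! a) (es ! b) x)"
  proof (rule sum.cong[OF refl])
   fix b assume "b : {..<length es}"
   hence "(es ! a) x : fibre E x" "(es ! b) x : fibre E x" "opL U D (es ! b) x : fibre E x" using a fe fL by auto
   thus "1 * form E x ((es ! a) x) (?T b b' x *r opL U D (es ! b) x + opv U D (?T b b') x *r (es ! b) x)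
     = ?T b b' x * conn U D es x a b + opv U D (?T b b') x * pairing E (es ! a) (es ! b) x"
    by (simp add: form_add_right form_scale_right fibre_scale conn_def pairing_def)
  qed
  finally show "form E x ((es ! a) x) (SUM b<length es. ?T b b' x *r opL U D (es ! b) x + opv U D (?T b b') x *r (es ! b) x)
    = (SUM b<length es. ?T b b' x * conn U D es x a b + opv U D (?T b b') x * pairing E (es ! a) (es ! b) x)" by simp
 qed
 finally show ?thesis by (simp add: sum_distrib_left distrib_left mult.assoc)
qed

text \<open>Gluing is a cancellation: the Leibniz term in the new matrix of \<open>D\<close> equals,
  after exchanging two anticommuting variables, the quadratic term in the gluing formula for the
  momenta.\<close>

lemma symb_A_nfuns:
 assumes U: "open U" and D: "D : GG U" shows "symb_A U D : nfuns E U" unfolding nfuns_iff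
proof (intro conjI allI ballI impI)
 show "symb_A U D ch x = 0" if "\<not> (ch : ncharts E & x : U Int fst ch)" for ch x using that by (simp only: symb_A_def if_False)
next
 fix ch assume k0: "ch : ncharts E"
 obtain V ph es where k: "ch = (V, ph, es)" by (cases ch)
 note k1 = k0[unfolded k]
 have UV: "open (U Int V)" using U nchartD(2)[OF k1] by blast
 show "nice U ch (symb_A U D ch)"
 proof (rule nice_cong[OF U k0])
  show "nice U ch (%x. (SUM a<length es. SUM b<length es. pscl (1 / 2 * pairing E (es ! a) (opL U D (es ! b)) x) (pmul (xi a) (xi b)))
    + (SUM i:axes E. pscl (- 1 * opv U D (%y. ph y \<bullet> i) x) (mom i)))"
  proof (intro nice_add[OF U k0] nice_sum[OF U k0] nice_scale[OF U k0])
   fix a b assume ab: "a : {..<length es}" "b : {..<length es}"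
   have "smf E (U Int V) (pairing E (es ! a) (opL U D (es ! b)))"
    by (rule pairing_smooth[OF UV section_subset[OF nchartD(3)[OF k1]] opL_smooth[OF U D nchartD(2)[OF k1] nchartD(3)[OF k1]]]) (use ab in auto)
   thus "smf E (U Int fst ch) (%x. 1 / 2 * pairing E (es ! a) (opL U D (es ! b)) x)"
    unfolding k fst_conv by (rule smooth_fun_mult[OF UV smooth_fun_const[OF UV]])
   show "nice U ch (%x. pmul (xi a) (xi b))"
    unfolding k using ab nice_const[OF U k1 keys_mult_mons[OF keys_xi_sub(1) keys_xi_sub(1)]] by simp
  next
   fix i assume i: "i : axes E"
   have "smf E (U Int V) (opv U D (%y. ph y \<bullet> i))"
    by (rule opv_smooth[OF U D nchartD(2)[OF k1] smooth_fun_coordinate[OF nchartD(1)[OF k1]]])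
   thus "smf E (U Int fst ch) (%x. - 1 * opv U D (%y. ph y \<bullet> i) x)"
    unfolding k fst_conv by (rule smooth_fun_mult[OF UV smooth_fun_const[OF UV]])
   show "nice U ch (%x. mom i)" by (rule nice_const[OF U k0]) (rule keys_mom_sub(1)[OF i])
  qed
 qed (simp add: k symb_A_in[OF k1] qf_def pairing_def conn_def spoly_scale_minus sum_negf)
next
 fix ch ch' x assume k0: "ch : ncharts E" "ch' : ncharts E" and x: "x : U Int fst ch Int fst ch'"
 obtain V ph es where k: "ch = (V, ph, es)" by (cases ch)
 obtain V' ph' es' where k': "ch' = (V', ph', es')" by (cases ch')
 note k1 = k0(1)[unfolded k] and k1' = k0(2)[unfolded k']
 have xs: "x : U" "x : V" "x : V'" using x by (auto simp: k k')
 let ?n = "length es" and ?n' = "length es'"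
 interpret spoly_hom "trans_xi es es' x" "trans_mom E ch ch' x" using trans_hom[of ch ch' x] by (simp add: k k')
 let ?S = "spoly_subst (trans_xi es es' x) (trans_mom E ch ch' x)"
 let ?T = "%a a'. fco es a (es' ! a')"
 let ?v = "opv U D"
 let ?g = "%a b. pairing E (es ! a) (es ! b) x"
 let ?G = "%a b. conn U D es x a b"
 have diff: "?S (A - B) = ?S A - ?S B" for A B using subst_add[of "A - B" B] by (simp add: algebra_simps)
 have smT: "smf E (V Int V') (?T a a')" if "a < ?n" "a' < ?n'" for a a'
  using nchart_coeff_smooth[OF k1 nchartD(2)[OF k1'] nchartD(3)[OF k1' that(2)] that(1)] by (simp add: Int_commute)
 have W: "open (V Int V')" "x : V Int V'" using nchartD(2)[OF k1] nchartD(2)[OF k1'] xs by auto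
 have q: "?S (qf ?n (%a b. 1 / 2 * ?G a b)) = qf ?n' (%a' b'. SUM a<?n. SUM b<?n. 1 / 2 * ?G a b * (?T a a' x * ?T b b' x))"
 proof -
  have "?S (qf ?n (%a b. 1 / 2 * ?G a b)) = (SUM a<?n. SUM b<?n. pscl (1 / 2 * ?G a b) (pmul (lf ?n' (%a'. ?T a a' x)) (lf ?n' (%b'. ?T b b' x))))"
   unfolding qf_def by (simp only: subst_sum subst_scale subst_mult subst_xi trans_xi_lf)
  thus ?thesis by (simp only: lf_mult qf_scale[symmetric] qf_sum[symmetric])
 qed
 have "?S (SUM i:axes E. pscl (?v (%y. ph y \<bullet> i) x) (mom i)) =
   (SUM i:axes E. pscl (?v (%y. ph y \<bullet> i) x) (trans_mom E ch ch' x i))"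
  by (simp only: subst_sum subst_scale subst_mom)
 also have "... = (SUM i:axes E. SUM i':axes E. pscl (?v (%y. ph y \<bullet> i) x * pdc V ph i (%y. ph' y \<bullet> i') x) (mom i'))
  + qf ?n' (%a' b'. SUM i:axes E. ?v (%y. ph y \<bullet> i) x * (SUM a<?n. SUM b<?n. 1 / 2 * pdc V ph i (?T a a') x * ?g a b * ?T b b' x))"
  unfolding k k' trans_mom_qf by (simp only: spoly_scale_add sum.distrib spoly_scale_sum spoly_scale_scale qf_scale qf_sum)
 also have "(SUM i:axes E. SUM i':axes E. pscl (?v (%y. ph y \<bullet> i) x * pdc V ph i (%y. ph' y \<bullet> i') x) (mom i'))
   = (SUM i':axes E. pscl (?v (%y. ph' y \<bullet> i') x) (mom i'))"
 proof -
  have "?v (%y. ph' y \<bullet> i') x = (SUM i:axes E. ?v (%y. ph y \<bullet> i) x * pdc V ph i (%y. ph' y \<bullet> i') x)" for i'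
   by (rule opv_chart[OF U D nchartD(2)[OF k1'] xs(1,3) smooth_fun_coordinate[OF nchartD(1)[OF k1']] nchartD(1)[OF k1] xs(2)])
  thus ?thesis by (subst sum.swap) (simp only: spoly_sum_scale)
 qed
 \<comment> \<open>By \<open>opv_chart\<close> the derivative of the transition matrix along
   \<open>D\<close> is the sum over coordinate directions; this removes the chart derivatives of the
   gluing formula.\<close>
 also have "qf ?n' (%a' b'. SUM i:axes E. ?v (%y. ph y \<bullet> i) x * (SUM a<?n. SUM b<?n. 1 / 2 * pdc V ph i (?T a a') x * ?g a b * ?T b b' x))
   = qf ?n' (%a' b'. SUM a<?n. SUM b<?n. 1 / 2 * ?v (?T a a') x * ?g a b * ?T b b' x)"
 proof (rule qf_cong)
  fix a' b' assume ab: "a' < ?n'" "b' < ?n'"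
  have v: "?v (?T a a') x = (SUM i:axes E. ?v (%y. ph y \<bullet> i) x * pdc V ph i (?T a a') x)" if "a < ?n" for a
   by (rule opv_chart[OF U D W(1) xs(1) W(2) smT[OF that ab(1)] nchartD(1)[OF k1] xs(2)])
  have "(SUM i:axes E. ?v (%y. ph y \<bullet> i) x * (SUM a<?n. SUM b<?n. 1 / 2 * pdc V ph i (?T a a') x * ?g a b * ?T b b' x))
   = (SUM i:axes E. SUM a<?n. SUM b<?n. 1 / 2 * (?v (%y. ph y \<bullet> i) x * pdc V ph i (?T a a') x) * ?g a b * ?T b b' x)"
   by (simp add: sum_distrib_left mult_ac)
  also have "... = (SUM a<?n. SUM i:axes E. SUM b<?n. 1 / 2 * (?v (%y. ph y \<bullet> i) x * pdc V ph i (?T a a') x) * ?g a b * ?T b b' x)"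
   by (rule sum.swap)
  also have "... = (SUM a<?n. SUM b<?n. SUM i:axes E. 1 / 2 * (?v (%y. ph y \<bullet> i) x * pdc V ph i (?T a a') x) * ?g a b * ?T b b' x)"
   by (rule sum.cong[OF refl], rule sum.swap)
  also have "... = (SUM a<?n. SUM b<?n. 1 / 2 * ?v (?T a a') x * ?g a b * ?T b b' x)"
   by (intro sum.cong refl) (simp only: v lessThan_iff sum_distrib_left sum_distrib_right)
  finally show "(SUM i:axes E. ?v (%y. ph y \<bullet> i) x * (SUM a<?n. SUM b<?n. 1 / 2 * pdc V ph i (?T a a') x * ?g a b * ?T b b' x))
   = (SUM a<?n. SUM b<?n. 1 / 2 * ?v (?T a a') x * ?g a b * ?T b b' x)" .
 qed
 finally have p: "?S (SUM i:axes E. pscl (?v (%y. ph y \<bullet> i) x) (mom i)) = (SUM i':axes E. pscl (?v (%y. ph' y \<bullet> i') x) (mom i'))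
   + qf ?n' (%a' b'. SUM a<?n. SUM b<?n. 1 / 2 * ?v (?T a a') x * ?g a b * ?T b b' x)" .
 let ?R = "%a' b'. SUM a<?n. SUM b<?n. 1 / 2 * ?v (?T a a') x * ?g a b * ?T b b' x"
 \<comment> \<open>The Leibniz term differentiates the factor with index b', the gluing term the one
   with index a'. It is therefore \<open>?R\<close> with its arguments exchanged, which
   \<open>qf_swap\<close> turns into minus \<open>?R\<close>.\<close>
 have "qf ?n' (%a' b'. 1 / 2 * conn U D es' x a' b') = qf ?n' (%a' b'. (SUM a<?n. SUM b<?n. 1 / 2 * ?G a b * (?T a a' x * ?T b b' x)) + ?R b' a')"
 proof (rule qf_cong)
  fix a' b' assume ab: "a' < ?n'" "b' < ?n'"
  have sw: "?R b' a' = (SUM a<?n. SUM b<?n. 1 / 2 * (?T a a' x * ?v (?T b b') x * ?g a b))"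
  proof -
   have "?R b' a' = (SUM b<?n. SUM a<?n. 1 / 2 * ?v (?T a b') x * ?g a b * ?T b a' x)" by (rule sum.swap)
   also have "... = (SUM a<?n. SUM b<?n. 1 / 2 * (?T a a' x * ?v (?T b b') x * ?g a b))"
   proof (intro sum.cong refl)
    fix a b assume "a : {..<?n}" "b : {..<?n}"
    hence "?g b a = ?g a b" unfolding pairing_def by (intro form_sym nchartD(6)[OF k1 _ xs(2)]) auto
    thus "1 / 2 * ?v (?T b b') x * ?g b a * ?T a a' x = 1 / 2 * (?T a a' x * ?v (?T b b') x * ?g a b)" by simp
   qed
   finally show ?thesis .
  qed
  show "1 / 2 * conn U D es' x a' b' = (SUM a<?n. SUM b<?n. 1 / 2 * ?G a b * (?T a a' x * ?T b b' x)) + ?R b' a'"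
   unfolding sw conn_transition[OF U D k1 k1' xs ab] sum.distrib[symmetric] sum_distrib_left by (intro sum.cong refl) (simp add: algebra_simps)
 qed
 also have "... = qf ?n' (%a' b'. SUM a<?n. SUM b<?n. 1 / 2 * ?G a b * (?T a a' x * ?T b b' x)) - qf ?n' ?R"
  by (simp only: qf_add qf_swap[of _ ?R] add_uminus_conv_diff)
 finally have G': "qf ?n' (%a' b'. 1 / 2 * conn U D es' x a' b') =
  qf ?n' (%a' b'. SUM a<?n. SUM b<?n. 1 / 2 * ?G a b * (?T a a' x * ?T b b' x)) - qf ?n' ?R" .
 have "?S (symb_A U D ch x) = symb_A U D ch' x"
  unfolding k k' symb_A_in[OF k1 xs(1,2)] symb_A_in[OF k1' xs(1,3)] unfolding k[symmetric] k'[symmetric] diff q p G'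
  by (simp only: diff_diff_eq add.commute)
 thus "symb_A U D ch' x = spoly_subst (trans_xi (snd (snd ch)) (snd (snd ch')) x) (trans_mom E ch ch' x) (symb_A U D ch x)"
  by (simp add: k k')
qed

end

section \<open>The homomorphism \<open>theta\<close> over an open set, its degree and its
  naturality\<close>

context pe_mfd
begin

text \<open>On the carrier such a homomorphism is determined by its values on generators, so the
  choice affects only arguments outside it.\<close>

definition theta_at :: "'m set => ('m, 'a, 'v) nchart => 'm => ('m, 'v) EA_tensor set => 'a spoly" where
 "theta_at U ch x = (SOME T. alg_hom (%h. h x) (Cinf E U) (EA_alg E U) spoly_alg T
  & (ALL X:SS U. T (EA_E E U X) = symb_E U X ch x) & (ALL D:GG U. T (EA_A E U D) = symb_A U D ch x))"

definition theta :: "'m set => ('m, 'v) EA_tensor set => ('m, 'a, 'v) nchart => 'm => 'a spoly" where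
 "theta U s = (%ch x. if ch : ncharts E & x : U Int fst ch then theta_at U ch x s else 0)"

abbreviation "AA U == carrier (EA_alg E U)"

lemma eval_hom: "x : U ==> (%h. h x) : ring_hom (Cinf E U) real_ring"
 by (rule ring_hom_memI) (simp_all add: real_ring_def C_simps cut_in)

lemma theta_out: "\<not> (ch : ncharts E & x : U Int fst ch) ==> theta U s ch x = 0"
 by (simp only: theta_def if_False)

context
 fixes U :: "'m set"
 assumes U: "open U"
begin

lemmas AA_assoc = EA.EA_assoc[OF EA[OF U]]

lemma theta_at:
 assumes k: "ch : ncharts E" and x: "x : U" "x : fst ch"
 shows "alg_hom (%h. h x) (Cinf E U) (EA_alg E U) spoly_alg (%s. theta U s ch x)"
  and "X : SS U ==> theta U (EA_E E U X) ch x = symb_E U X ch x"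
  and "D : GG U ==> theta U (EA_A E U D) ch x = symb_A U D ch x"
proof -
 obtain V ph es where k': "ch = (V, ph, es)" by (cases ch)
 have xV: "x : V" using x(2) k' by simp
 obtain T where T: "alg_hom (%h. h x) (Cinf E U) (EA_alg E U) spoly_alg T"
  "!!X. X : SS U ==> T (EA_E E U X) = symb_E U X (V, ph, es) x"
  "!!D. D : GG U ==> T (EA_A E U D) = symb_A U D (V, ph, es) x" by (rule theta_exists[OF k[unfolded k'] U x(1) xV]) blast
 let ?P = "%T. alg_hom (%h. h x) (Cinf E U) (EA_alg E U) spoly_alg T
  & (ALL X:SS U. T (EA_E E U X) = symb_E U X ch x) & (ALL D:GG U. T (EA_A E U D) = symb_A U D ch x)"
 have "?P T" unfolding k' using T by blast
 hence P: "?P (theta_at U ch x)" unfolding theta_at_def by (rule someI[of ?P])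
 have e: "theta U s ch x = theta_at U ch x s" for s using k x by (simp add: theta_def)
 show "alg_hom (%h. h x) (Cinf E U) (EA_alg E U) spoly_alg (%s. theta U s ch x)" using conjunct1[OF P] by (simp only: e)
 show "X : SS U ==> theta U (EA_E E U X) ch x = symb_E U X ch x" using P unfolding e by blast
 show "D : GG U ==> theta U (EA_A E U D) ch x = symb_A U D ch x" using P unfolding e by blast
qed

lemma theta_gens: shows "X : SS U ==> theta U (EA_E E U X) = symb_E U X"
  and "D : GG U ==> theta U (EA_A E U D) = symb_A U D"
proof -
 show "theta U (EA_E E U X) = symb_E U X" if X: "X : SS U"
 proof (intro ext)
  fix ch x
  show "theta U (EA_E E U X) ch x = symb_E U X ch x"
  proof (cases "ch : ncharts E & x : U Int fst ch")
   case True thus ?thesis using theta_at(2)[of ch x X] X by blast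
  next
   case False
   thus ?thesis using symb_E_nfuns[OF U X] unfolding theta_out[OF False] nfuns_iff by metis
  qed
 qed
 show "theta U (EA_A E U D) = symb_A U D" if X: "D : GG U"
 proof (intro ext)
  fix ch x
  show "theta U (EA_A E U D) ch x = symb_A U D ch x"
  proof (cases "ch : ncharts E & x : U Int fst ch")
   case True thus ?thesis using theta_at(3)[of ch x D] X by blast
  next
   case False
   thus ?thesis using symb_A_nfuns[OF U X] unfolding theta_out[OF False] nfuns_iff by metis
  qed
 qed
qed

lemma theta_ops:
 shows "s : AA U ==> t : AA U ==> theta U (s \<oplus>\<^bsub>EA_alg E U\<^esub> t) = (%ch x. theta U s ch x + theta U t ch x)"
  and "s : AA U ==> t : AA U ==> theta U (s \<otimes>\<^bsub>EA_alg E U\<^esub> t) = (%ch x. pmul (theta U s ch x) (theta U t ch x))"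
  and "f : CC U ==> s : AA U ==> theta U (f \<odot>\<^bsub>EA_alg E U\<^esub> s) = (%ch x. pscl (f x) (theta U s ch x))"
  and "theta U \<one>\<^bsub>EA_alg E U\<^esub> = (%ch x. if ch : ncharts E & x : U Int fst ch then spoly_one else 0)"
  and "theta U \<zero>\<^bsub>EA_alg E U\<^esub> = (%ch x. 0)"
proof -
 note D = alg_homD[OF theta_at(1) AA_assoc spoly_assoc_alg eval_hom]
 have s: "add spoly_alg = (+)" "mult spoly_alg = pmul" "smult spoly_alg = pscl" "\<one>\<^bsub>spoly_alg\<^esub> = spoly_one" "\<zero>\<^bsub>spoly_alg\<^esub> = 0"
  by (simp_all add: spoly_alg_def)
 note D = D[unfolded s]
 { assume st: "s : AA U" "t : AA U"
  show "theta U (s \<oplus>\<^bsub>EA_alg E U\<^esub> t) = (%ch x. theta U s ch x + theta U t ch x)"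
  proof (intro ext)
   fix ch x
   show "theta U (s \<oplus>\<^bsub>EA_alg E U\<^esub> t) ch x = theta U s ch x + theta U t ch x"
   proof (cases "ch : ncharts E & x : U Int fst ch")
    case True thus ?thesis using D(2)[of ch x s t] st by blast
   next
    case False show ?thesis unfolding theta_out[OF False] by simp
   qed
  qed
  show "theta U (s \<otimes>\<^bsub>EA_alg E U\<^esub> t) = (%ch x. pmul (theta U s ch x) (theta U t ch x))"
  proof (intro ext)
   fix ch x
   show "theta U (s \<otimes>\<^bsub>EA_alg E U\<^esub> t) ch x = pmul (theta U s ch x) (theta U t ch x)"
   proof (cases "ch : ncharts E & x : U Int fst ch")
    case True thus ?thesis using D(3)[of ch x s t] st by blast
   next
    case False show ?thesis unfolding theta_out[OF False] by (simp add: spoly_mult_zero)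
   qed
  qed }
 { assume st: "f : CC U" "s : AA U"
  show "theta U (f \<odot>\<^bsub>EA_alg E U\<^esub> s) = (%ch x. pscl (f x) (theta U s ch x))"
  proof (intro ext)
   fix ch x
   show "theta U (f \<odot>\<^bsub>EA_alg E U\<^esub> s) ch x = pscl (f x) (theta U s ch x)"
   proof (cases "ch : ncharts E & x : U Int fst ch")
    case True thus ?thesis using D(5)[of ch x f s] st by blast
   next
    case False show ?thesis unfolding theta_out[OF False] by (simp add: spoly_scale_zero)
   qed
  qed }
 show "theta U \<one>\<^bsub>EA_alg E U\<^esub> = (%ch x. if ch : ncharts E & x : U Int fst ch then spoly_one else 0)"
 proof (intro ext)
  fix ch x
  show "theta U \<one>\<^bsub>EA_alg E U\<^esub> ch x = (if ch : ncharts E & x : U Int fst ch then spoly_one else 0)"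
  proof (cases "ch : ncharts E & x : U Int fst ch")
   case True thus ?thesis using D(6)[of ch x] by simp
  next
   case False show ?thesis unfolding theta_out[OF False] by (rule if_not_P[OF False, symmetric])
  qed
 qed
 show "theta U \<zero>\<^bsub>EA_alg E U\<^esub> = (%ch x. 0)"
 proof (intro ext)
  fix ch x
  show "theta U \<zero>\<^bsub>EA_alg E U\<^esub> ch x = 0"
  proof (cases "ch : ncharts E & x : U Int fst ch")
   case True thus ?thesis using D(7)[of ch x] by blast
  next
   case False show ?thesis unfolding theta_out[OF False] by simp
  qed
 qed
qed

lemma AA_one: "\<one>\<^bsub>EA_alg E U\<^esub> : AA U" and AA_zero: "\<zero>\<^bsub>EA_alg E U\<^esub> : AA U"
 and AA_add: "s : AA U ==> t : AA U ==> s \<oplus>\<^bsub>EA_alg E U\<^esub> t : AA U"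
 and AA_mult: "s : AA U ==> t : AA U ==> s \<otimes>\<^bsub>EA_alg E U\<^esub> t : AA U"
 and AA_smult: "f : CC U ==> s : AA U ==> f \<odot>\<^bsub>EA_alg E U\<^esub> s : AA U"
proof -
 interpret A: ring "EA_alg E U" by (rule assoc_algD(2)[OF AA_assoc])
 show "\<one>\<^bsub>EA_alg E U\<^esub> : AA U" "\<zero>\<^bsub>EA_alg E U\<^esub> : AA U" by simp_all
 show "s : AA U ==> t : AA U ==> s \<oplus>\<^bsub>EA_alg E U\<^esub> t : AA U"
  "s : AA U ==> t : AA U ==> s \<otimes>\<^bsub>EA_alg E U\<^esub> t : AA U" by simp_all
 show "f : CC U ==> s : AA U ==> f \<odot>\<^bsub>EA_alg E U\<^esub> s : AA U" by (rule assoc_algD(3)[OF AA_assoc])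
qed

lemma theta_minus:
 assumes s: "s : AA U" shows "theta U (\<ominus>\<^bsub>EA_alg E U\<^esub> s) = (%ch x. - theta U s ch x)"
proof -
 interpret A: ring "EA_alg E U" by (rule assoc_algD(2)[OF AA_assoc])
 have "theta U (\<ominus>\<^bsub>EA_alg E U\<^esub> s \<oplus>\<^bsub>EA_alg E U\<^esub> s) = theta U \<zero>\<^bsub>EA_alg E U\<^esub>" using s by (simp add: A.l_neg)
 hence "(%ch x. theta U (\<ominus>\<^bsub>EA_alg E U\<^esub> s) ch x + theta U s ch x) = (%ch x. 0)"
  using theta_ops(1)[OF A.a_inv_closed[OF s] s] theta_ops(5) by simp
 thus ?thesis by (simp add: fun_eq_iff eq_neg_iff_add_eq_0)
qed

lemma AA_gens: shows "X : SS U ==> EA_E E U X : AA U" and "D : GG U ==> EA_A E U D : AA U"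
 by (rule EA.EA_E_closed[OF EA[OF U]], assumption) (rule EA.EA_A_closed[OF EA[OF U]])

lemma AA_induct [consumes 1, case_names one add smult E A]:
 assumes s: "s : AA U" and one: "P \<one>\<^bsub>EA_alg E U\<^esub>"
  and add: "!!s t. s : AA U ==> t : AA U ==> P s ==> P t ==> P (s \<oplus>\<^bsub>EA_alg E U\<^esub> t)"
  and smult: "!!f s. f : CC U ==> s : AA U ==> P s ==> P (f \<odot>\<^bsub>EA_alg E U\<^esub> s)"
  and E: "!!X s. X : SS U ==> s : AA U ==> P s ==> P (EA_E E U X \<otimes>\<^bsub>EA_alg E U\<^esub> s)"
  and A: "!!D s. D : GG U ==> s : AA U ==> P s ==> P (EA_A E U D \<otimes>\<^bsub>EA_alg E U\<^esub> s)"
 shows "P s"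
proof -
 note cl = alg_span_closed[OF AA_assoc EA.EA_gen_closed[OF EA[OF U]]]
 show ?thesis using EA.EA_generated[OF EA[OF U] s]
 proof (induction rule: alg_span.induct)
  case one show ?case by (rule \<open>P \<one>\<^bsub>EA_alg E U\<^esub>\<close>)
 next
  case (add a b) show ?case by (rule assms(3)[OF cl[OF add.hyps(1)] cl[OF add.hyps(2)] add.IH])
 next
  case (smult r a) show ?case by (rule assms(4)[OF smult.hyps(1) cl[OF smult.hyps(2)] smult.IH])
 next
  case (mult g a)
  thus ?case using assms(5,6) cl[OF mult.hyps(2)] by blast
 qed
qed

lemma theta_nfuns: "s : AA U ==> theta U s : nfuns E U"
proof (induction s rule: AA_induct)
 case one show ?case unfolding theta_ops(4) by (rule nfuns_one[OF U])
next
 case (add s t) show ?case unfolding theta_ops(1)[OF add(1,2)] by (rule nfuns_add[OF U add(3,4)])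
next
 case (smult f s) show ?case unfolding theta_ops(3)[OF smult(1,2)] by (rule nfuns_scale[OF U smult(1,3)])
next
 case (E X s)
 show ?case unfolding theta_ops(2)[OF AA_gens(1)[OF E(1)] E(2)] theta_gens(1)[OF E(1)] by (rule nfuns_mult[OF U symb_E_nfuns[OF U E(1)] E(3)])
next
 case (A D s)
 show ?case unfolding theta_ops(2)[OF AA_gens(2)[OF A(1)] A(2)] theta_gens(2)[OF A(1)] by (rule nfuns_mult[OF U symb_A_nfuns[OF U A(1)] A(3)])
qed

lemma symb_weight:
 shows "supp (symb_E U X ch x) <= wt 1" and "supp (symb_A U D ch x) <= wt 2"
proof -
 obtain V ph es where k: "ch = (V, ph, es)" by (cases ch)
 show "supp (symb_E U X ch x) <= wt 1" unfolding k symb_E_def using keys_lf(2) by auto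
 have "supp (symb_A0 U D (V, ph, es) x) <= wt 2" unfolding symb_A0_def prod.case diff_conv_add_uminus
  by (intro keys_add_sub keys_qf(2) keys_minus_sub keys_sum_sub keys_scale_sub keys_mom_sub(2))
 thus "supp (symb_A U D ch x) <= wt 2" unfolding k symb_A_def by simp
qed

text \<open>Sections and operators have symbols of weight 1 and 2, scalars do not change the
  support, and weights add under \<open>spoly_mult\<close>. Membership is carried along since
  \<open>theta\<close> respects the operations only on the carrier.\<close>

lemma theta_homog:
 assumes "s : EA_homog E U n" shows "s : AA U & (ALL ch x. supp (theta U s ch x) <= wt n)"
proof -
 let ?A = "EA_alg E U"
 let ?P = "%n s. s : AA U & (ALL ch x. supp (theta U s ch x) <= wt n)"
 interpret A: ring ?A by (rule assoc_algD(2)[OF AA_assoc])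
 have mult: "?P (m + n) (s \<otimes>\<^bsub>?A\<^esub> t)" if s: "?P m s" and t: "?P n t" for m n s t
 proof (intro conjI allI)
  show "s \<otimes>\<^bsub>?A\<^esub> t : AA U" using s t by (blast intro: AA_mult)
  show "supp (theta U (s \<otimes>\<^bsub>?A\<^esub> t) ch x) <= wt (m + n)" for ch x
   unfolding theta_ops(2)[OF conjunct1[OF s] conjunct1[OF t]] by (rule keys_mult_wt) (use s t in blast)+
 qed
 have one: "?P 0 \<one>\<^bsub>?A\<^esub>" using AA_one unfolding theta_ops(4) by (simp add: keys_one_sub)
 have fE: "?P (length es) (foldr (%X. (\<otimes>\<^bsub>?A\<^esub>) (EA_E E U X)) es \<one>\<^bsub>?A\<^esub>)" if "set es <= SS U" for es
  using that
 proof (induction es)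
  case (Cons X es)
  have "?P 1 (EA_E E U X)" using Cons.prems theta_gens(1)[of X] AA_gens(1)[of X] symb_weight(1) by simp
  from mult[OF this Cons.IH] Cons.prems show ?case by simp
 qed (simp add: one)
 have fA: "?P (2 * length es) (foldr (%X. (\<otimes>\<^bsub>?A\<^esub>) (EA_A E U X)) es \<one>\<^bsub>?A\<^esub>)" if "set es <= GG U" for es
  using that
 proof (induction es)
  case (Cons X es)
  have X: "X : GG U" using Cons.prems by (simp only: list.set insert_subset)
  have "?P 2 (EA_A E U X)" using theta_gens(2)[OF X] AA_gens(2)[OF X] symb_weight(2) by simp
  from mult[OF this Cons.IH] Cons.prems show ?case by simp
 qed (simp add: one)
 have g: "?P n (f \<odot>\<^bsub>?A\<^esub> EA_monom E U es Ds)" if f: "f : CC U" and es: "es : lists (SS U)" "Ds : lists (GG U)" "length es + 2 * length Ds = n" for f es Ds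
 proof -
  have "?P (length es + 2 * length Ds) (EA_monom E U es Ds)"
   unfolding EA.EA_monom_eq[OF EA[OF U] es(1,2)] by (rule mult[OF fE fA]) (use es in auto)
  thus ?thesis using f es(3) AA_smult[OF f] theta_ops(3)[OF f] by (simp add: keys_scale_sub)
 qed
 show ?thesis using assms unfolding EA_homog_def
 proof (induction rule: generate.induct)
  case one show ?case using AA_zero theta_ops(5) by simp
 next
  case (incl h) thus ?case using g by blast
 next
  case (inv h)
  hence "?P n h" using g by blast
  thus ?case using theta_minus[of h] A.a_inv_closed[of h] unfolding a_inv_def by simp
 next
  case (eng h1 h2)
  thus ?case using theta_ops(1)[of h1 h2] AA_add[of h1 h2] by (simp add: keys_add_sub)
 qed
qed

end

text \<open>Both sides are homomorphisms on \<open>EA_alg E U\<close> along evaluation at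
  \<open>x\<close>. It is enough to compare them on generators, whose symbols at \<open>x\<close>
  depend only on germs at \<open>x\<close>.\<close>

lemma theta_restr:
 assumes U: "open U" and V: "open V" "V <= U" and s: "s : AA U" and x: "x : V"
 shows "theta V (EA_restr E U V s) ch x = theta U s ch x"
proof (cases "ch : ncharts E & x : fst ch")
 case True
 hence k: "ch : ncharts E" "x : fst ch" by auto
 have xU: "x : U" using x V by auto
 obtain W ph es where k': "ch = (W, ph, es)" by (cases ch)
 note k1 = k(1)[unfolded k'] and xW = k(2)[unfolded k' fst_conv]
 have e: "(%h. h x) \<circ> cut V = (%h. h x)" using x by (simp add: fun_eq_iff cut_in)
 have T: "alg_hom (%h. h x) (Cinf E U) (EA_alg E U) spoly_alg ((%s. theta V s ch x) \<circ> EA_restr E U V)"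
  using alg_hom_comp[OF restr_hom(1)[OF U V] theta_at(1)[OF V(1) k(1) x k(2)] AA_assoc[OF U] AA_assoc[OF V(1)] spoly_assoc_alg
   cut_ring_hom[OF V] eval_hom[OF x]] unfolding e .
 have "((%s. theta V s ch x) \<circ> EA_restr E U V) s = (%s. theta U s ch x) s"
 proof (rule alg_hom_unique[OF T theta_at(1)[OF U k(1) xU k(2)] AA_assoc[OF U] spoly_assoc_alg eval_hom[OF xU]
    EA.EA_gen_closed[OF EA[OF U]] EA.EA_generated[OF EA[OF U] s]])
  fix g assume "g : EA_E E U ` SS U Un EA_A E U ` GG U"
  then consider X where "X : SS U" "g = EA_E E U X" | D where "D : GG U" "g = EA_A E U D" by blast
  thus "((%s. theta V s ch x) \<circ> EA_restr E U V) g = theta U g ch x"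
  proof cases
   case 1
   hence "((%s. theta V s ch x) \<circ> EA_restr E U V) g = symb_E V (cut V X) ch x"
    by (simp only: o_apply restr_hom(2)[OF U V] theta_gens(1)[OF V(1) S_cut_sub[OF V]])
   also have "... = symb_E U X ch x" unfolding k' symb_E_in[OF k1 x xW] symb_E_in[OF k1 xU xW] by (simp add: cut_in x)
   finally show ?thesis using theta_gens(1)[OF U 1(1)] 1(2) by simp
  next
   case 2
   note D = 2(1)
   have "((%s. theta V s ch x) \<circ> EA_restr E U V) g = symb_A V (gauge_restr E U V D) ch x"
    by (simp only: o_apply 2(2) restr_hom(3)[OF U V D] theta_gens(2)[OF V(1) gauge_restr_closed[OF U V D]])
   also have "... = symb_A U D ch x"
   proof -
    have "conn V (gauge_restr E U V D) es x a b = conn U D es x a b" if "b < length es" for a b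
     unfolding conn_def opL_restr[OF U V D x xW nchartD(2)[OF k1] nchartD(3)[OF k1 that]] ..
    hence "qf (length es) (%a b. 1 / 2 * conn V (gauge_restr E U V D) es x a b) = qf (length es) (%a b. 1 / 2 * conn U D es x a b)"
     by (intro qf_cong) simp
    moreover have "opv V (gauge_restr E U V D) (%y. ph y \<bullet> i) x = opv U D (%y. ph y \<bullet> i) x" for i
     by (rule opv_restr[OF U V D x xW nchartD(2)[OF k1] smooth_fun_coordinate[OF nchartD(1)[OF k1]]])
    ultimately show ?thesis unfolding k' symb_A_in[OF k1 x xW] symb_A_in[OF k1 xU xW] by simp
   qed
   finally show ?thesis using theta_gens(2)[OF U D] 2(2) by simp
  qed
 qed
 thus ?thesis by simp
next
 case False
 have "theta V (EA_restr E U V s) ch x = 0" by (rule theta_out) (use False in blast)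
 moreover have "theta U s ch x = 0" by (rule theta_out) (use False in blast)
 ultimately show ?thesis by simp
qed

lemma restr_closed:
 assumes U: "open U" and V: "open V" "V <= U" and s: "s : AA U" shows "EA_restr E U V s : AA V"
 by (rule alg_homD(1)[OF restr_hom(1)[OF U V] AA_assoc[OF U] AA_assoc[OF V(1)] cut_ring_hom[OF V] s])

end

section \<open>Linear spans in algebras\<close>

text \<open>Linear combinations over the base ring, as opposed to \<open>alg_span\<close>, which
  also contains products: the existence of normal forms is a statement about
  \<open>lspan\<close>.\<close>

inductive_set lspan :: "('r, 'y) ring_scheme => ('r, 'x) module => 'x set => 'x set" for R A G where
 zero: "\<zero>\<^bsub>A\<^esub> : lspan R A G"
| step: "r : carrier R ==> g : G ==> a : lspan R A G ==> r \<odot>\<^bsub>A\<^esub> g \<oplus>\<^bsub>A\<^esub> a : lspan R A G"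

context
 fixes R :: "('r, 'y) ring_scheme" and A :: "('r, 'x) module" (structure)
 assumes A: "assoc_alg R A"
begin

interpretation R: cring R by (rule assoc_algD(1)[OF A])
interpretation A: ring A by (rule assoc_algD(2)[OF A])

lemma lspan_closed: "G <= carrier A ==> a : lspan R A G ==> a : carrier A"
proof -
 assume G: "G <= carrier A" and a: "a : lspan R A G"
 show ?thesis using a by induction (use G assoc_algD(3)[OF A] in auto)
qed

lemma lspan_add:
 assumes G: "G <= carrier A" and a: "a : lspan R A G" and b: "b : lspan R A G" shows "a \<oplus> b : lspan R A G" using a
proof induction
 case zero thus ?case using b lspan_closed[OF G b] by simp
next
 case (step r g a)
 have c: "r \<odot> g : carrier A" "a : carrier A" "b : carrier A" using step G lspan_closed[OF G] b assoc_algD(3)[OF A step(1)] by auto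
 show ?case unfolding A.a_assoc[OF c] by (rule lspan.step[OF step(1,2,4)])
qed

lemma lspan_incl:
 assumes G: "G <= carrier A" and g: "g : G" shows "g : lspan R A G"
 using lspan.step[OF R.one_closed g lspan.zero[of A R G]] G g assoc_algD(10)[OF A, of g] by auto

lemma lspan_smult:
 assumes G: "G <= carrier A" and r: "r : carrier R" and a: "a : lspan R A G" shows "r \<odot> a : lspan R A G" using a
proof induction
 case zero thus ?case using lspan.zero[of A R G] assoc_algD(12)[OF A r] by simp
next
 case (step s g a)
 have c: "g : carrier A" "a : carrier A" using step G lspan_closed[OF G] by auto
 have "r \<odot> (s \<odot> g \<oplus> a) = (r \<otimes>\<^bsub>R\<^esub> s) \<odot> g \<oplus> r \<odot> a"
  using assoc_algD(7)[OF A r assoc_algD(3)[OF A step(1) c(1)] c(2)] assoc_algD(9)[OF A r step(1) c(1)] by simp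
 thus ?case using lspan.step[OF R.m_closed[OF r step(1)] step(2,4)] by simp
qed

lemma lspan_minus:
 assumes G: "G <= carrier A" and a: "a : lspan R A G" shows "\<ominus> a : lspan R A G"
proof -
 have c: "a : carrier A" by (rule lspan_closed[OF G a])
 have m: "\<ominus>\<^bsub>R\<^esub> \<one>\<^bsub>R\<^esub> : carrier R" by simp
 have "(\<ominus>\<^bsub>R\<^esub> \<one>\<^bsub>R\<^esub>) \<odot> a \<oplus> a = \<zero>"
  using assoc_algD(8)[OF A m R.one_closed c] assoc_algD(10,11)[OF A c] by (simp add: R.l_neg)
 hence "\<ominus> a = (\<ominus>\<^bsub>R\<^esub> \<one>\<^bsub>R\<^esub>) \<odot> a" by (rule A.minus_equality[OF _ c assoc_algD(3)[OF A m c]])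
 thus ?thesis using lspan_smult[OF G m a] by simp
qed

lemma lspan_trans:
 assumes G: "G <= carrier A" and H: "H <= carrier A" and GH: "!!g. g : G ==> g : lspan R A H" and a: "a : lspan R A G"
 shows "a : lspan R A H" using a by induction (blast intro: lspan.zero lspan_add[OF H] lspan_smult[OF H] GH)+

text \<open>By bilinearity only products of spanning elements have to be rewritten; the reduction to
  ordered monomials rests on this.\<close>

lemma lspan_mult:
 assumes G: "G <= carrier A" and H: "H <= carrier A" and K: "K <= carrier A"
  and gh: "!!g h. g : G ==> h : H ==> g \<otimes> h : lspan R A K"
  and a: "a : lspan R A G" and b: "b : lspan R A H" shows "a \<otimes> b : lspan R A K" using a
proof induction
 case zero thus ?case using lspan_closed[OF H b] lspan.zero[of A R K] by simp
next
 case (step r g a)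
 have c: "g : carrier A" "a : carrier A" "b : carrier A" using step G H lspan_closed[OF G] lspan_closed[OF H b] by auto
 note g = step(2)
 have gb: "g \<otimes> b : lspan R A K" using b
 proof induction
  case zero thus ?case using c lspan.zero[of A R K] by simp
 next
  case (step s h b)
  note step' = step
  have d: "h : carrier A" "b : carrier A" using step' H lspan_closed[OF H] by auto
  have "g \<otimes> (s \<odot> h \<oplus> b) = s \<odot> (g \<otimes> h) \<oplus> g \<otimes> b"
   using A.r_distr[OF assoc_algD(3)[OF A step'(1) d(1)] d(2) c(1)] assoc_algD(6)[OF A step'(1) c(1) d(1)] by simp
  thus ?case using lspan_add[OF K lspan_smult[OF K step'(1) gh[OF g step'(2)]] step'(4)] by simp
 qed
 have "(r \<odot> g \<oplus> a) \<otimes> b = r \<odot> (g \<otimes> b) \<oplus> a \<otimes> b"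
  using A.l_distr[OF assoc_algD(3)[OF A step(1) c(1)] c(2,3)] assoc_algD(5)[OF A step(1) c(1,3)] by simp
 thus ?case using lspan_add[OF K lspan_smult[OF K step(1) gb] step(4)] by simp
qed

text \<open>Coefficients of repeated indices are merged, so that each index occurs once and its
  coefficient can later be read off.\<close>

lemma lspan_finsum:
 assumes g: "!!k. k : I ==> g k : carrier A" and a: "a : lspan R A (g ` I)"
 obtains K f where "finite K" "K <= I" "!!k. k : K ==> f k : carrier R" "a = (\<Oplus>k\<in>K. f k \<odot> g k)"
proof -
 have "EX K f. finite K & K <= I & (ALL k:K. f k : carrier R) & a = (\<Oplus>k\<in>K. f k \<odot> g k)"
  using a
 proof induction
  case zero thus ?case by (intro exI[of _ "{}"]) simp
 next
  case (step r b a)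
  then obtain j where j: "j : I" "b = g j" by blast
  obtain K f where K: "finite K" "K <= I" "ALL k:K. f k : carrier R" "a = (\<Oplus>k\<in>K. f k \<odot> g k)" using step(4) by blast
  have cl: "f k \<odot> g k : carrier A" if "k : K" for k using K that g assoc_algD(3)[OF A] by blast
  have cj: "g j : carrier A" "r \<odot> g j : carrier A" using g[OF j(1)] assoc_algD(3)[OF A step(1)] by auto
  let ?f = "%k. if k = j then (if j : K then r \<oplus>\<^bsub>R\<^esub> f j else r) else f k"
  let ?K = "K - {j}"
  have cl': "(%k. f k \<odot> g k) : ?K \<rightarrow> carrier A" using cl by auto
  let ?S = "\<Oplus>k\<in>?K. f k \<odot> g k"
  have S: "?S : carrier A" by (rule A.finsum_closed[OF cl'])
  have "(\<Oplus>k\<in>insert j ?K. ?f k \<odot> g k) = ?f j \<odot> g j \<oplus> (\<Oplus>k\<in>?K. ?f k \<odot> g k)"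
   by (rule A.finsum_insert) (use K cl step(1) cj assoc_algD(3)[OF A _ cj(1)] in auto)
  also have "(\<Oplus>k\<in>?K. ?f k \<odot> g k) = ?S" by (rule A.finsum_cong'[OF refl cl']) simp
  also have "?f j \<odot> g j \<oplus> ?S = r \<odot> g j \<oplus> a"
  proof (cases "j : K")
   case True
   have "a = (\<Oplus>k\<in>insert j ?K. f k \<odot> g k)" using K(4) True by (simp add: insert_absorb)
   also have "... = f j \<odot> g j \<oplus> ?S" by (rule A.finsum_insert) (use K cl True in auto)
   finally show ?thesis using True assoc_algD(8)[OF A step(1) _ cj(1), of "f j"] K(3) cj cl S by (simp add: A.a_assoc)
  qed (use K(4) in simp)
  finally have e: "(\<Oplus>k\<in>insert j ?K. ?f k \<odot> g k) = r \<odot> b \<oplus> a" using j by simp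
  show ?case by (rule exI[of _ "insert j ?K"], rule exI[of _ ?f]) (use K j step(1) e in auto)
 qed
 thus ?thesis using that by blast
qed

end

section \<open>Orthonormal charts\<close>

lemma lf_delta: "a < n ==> lf n (%b. if b = a then 1 else 0) = xi a"
 unfolding lf_def by (simp add: if_distrib[of "%c. pscl c _"] spoly_scale_zero spoly_scale_one cong: if_cong)

lemma qf_zero: "qf n (%a b. 0) = 0" by (simp add: qf_def spoly_scale_zero)

text \<open>The open set \<open>N\<close> may be smaller than the chart domain \<open>V\<close>:
  surjectivity requires shrinking to a set where the weights are bounded, while chart and frame stay
  the same.\<close>

locale on_chart = pe_mfd E for E :: "('m::{t2_space, second_countable_topology}, 'a::euclidean_space, 'v::real_vector, 'z) pe_bundle_scheme" +
 fixes V :: "'m set" and ph :: "'m => 'a" and es :: "('m => 'v) list" and \<epsilon> :: "nat => real" and N :: "'m set"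
 assumes k: "(V, ph, es) : ncharts E" and eps: "\<epsilon> a * \<epsilon> a = 1"
  and orth: "a < length es ==> b < length es ==> y : V ==> form E y ((es ! a) y) ((es ! b) y) = (if a = b then \<epsilon> a else 0)"
  and N: "open N" "N <= V"
begin

abbreviation "n == length es"

lemmas kc = nchartD(1)[OF k]

lemma NV: "x : N ==> x : V" using N by auto

lemma e_fibre: "a < n ==> x : N ==> (es ! a) x : fibre E x" by (rule nchartD(6)[OF k _ NV])

lemma e_section: "a < n ==> sms E N (es ! a)" by (rule section_subset[OF nchartD(3)[OF k] N(2)])

definition "xc X a = pairing E (es ! a) X"

lemma expand:
 assumes x: "x : N" and X: "X x : fibre E x" shows "X x = (SUM a<n. (\<epsilon> a * xc X a x) *r (es ! a) x)"
proof -
 note fs = frame_sum[where s = X, OF nchartD(4)[OF k NV[OF x]] X]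
 have "fco es a X x = \<epsilon> a * xc X a x" if a: "a < n" for a
 proof -
  have "form E x ((es ! a) x) (X x) = form E x ((es ! a) x) (SUM b<n. fco es b X x *r (es ! b) x)" unfolding fs ..
  also have "... = (SUM b<n. fco es b X x * form E x ((es ! a) x) ((es ! b) x))" by (rule form_comb_right) (use e_fibre a x in auto)
  also have "... = (SUM b<n. if b = a then fco es b X x * \<epsilon> a else 0)" by (rule sum.cong) (use orth a NV[OF x] in auto)
  also have "... = fco es a X x * \<epsilon> a" using a by simp
  finally show ?thesis using eps[of a] by (simp add: xc_def pairing_def mult.left_commute)
 qed
 thus ?thesis using fs by simp
qed

lemma form_expand:
 assumes x: "x : N" and X: "X x : fibre E x" and Y: "Y x : fibre E x"
 shows "form E x (X x) (Y x) = (SUM a<n. \<epsilon> a * (xc X a x * xc Y a x))"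
proof -
 have "form E x (X x) (Y x) = form E x (SUM a<n. (\<epsilon> a * xc X a x) *r (es ! a) x) (Y x)" using expand[where X = X, OF x X] by simp
 also have "... = (SUM a<n. (\<epsilon> a * xc X a x) * form E x ((es ! a) x) (Y x))" by (rule form_comb) (use e_fibre x Y in auto)
 finally show ?thesis by (simp add: xc_def pairing_def mult.assoc)
qed

lemma xc_smooth: "sms E N X ==> a < n ==> smf E N (xc X a)"
 unfolding xc_def by (rule pairing_smooth[OF N(1) e_section])

definition "pd = pdc V ph"

lemma pd_smooth: "i : axes E ==> smf E N f ==> smf E N (pd i f)"
 using smooth_fun_pderiv[OF kc N(1), of f i] N(2) by (simp add: pd_def Int_absorb2)

text \<open>The dual frame; because \<open>\<epsilon> a\<close> is its own inverse, the symbol of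
  \<open>ue a\<close> is exactly xi^a.\<close>

definition ue :: "nat => 'm => 'v" where "ue a = cut N (%x. \<epsilon> a *r (es ! a) x)"

text \<open>Minus the flat lift of a coordinate field: it differentiates the coefficients in the
  frame. The sign cancels the one in \<open>symb_A0\<close>, so that the symbol is p_i.\<close>

definition pa :: "'a => ('m, 'v) cdo" where
 "pa i = (%X. if X : SS N then cut N (%x. SUM a<n. (- (\<epsilon> a * pd i (xc X a) x)) *r (es ! a) x) else (%x. 0),
     %f. if f : CC N then cut N (%x. - pd i f x) else (%x. 0))"

lemma pa_apply: "X : SS N ==> x : N ==> fst (pa i) X x = (SUM a<n. (- (\<epsilon> a * pd i (xc X a) x)) *r (es ! a) x)"
 "f : CC N ==> x : N ==> snd (pa i) f x = - pd i f x"
 "x ~: N ==> fst (pa i) X x = 0" "x ~: N ==> snd (pa i) f x = 0" by (simp_all add: pa_def cut_in cut_out)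

lemma ue_section: "a < n ==> ue a : SS N"
 unfolding ue_def by (rule S_cut[OF N(1) section_scale[OF N(1) smooth_fun_const[OF N(1)] e_section]])

text \<open>\<open>vector_fields\<close> asks for an expression in every chart of the atlas, not
  only in the given one; the chain rule provides it.\<close>

lemma pa_vf:
 assumes i: "i : axes E" shows "snd (pa i) : vector_fields E N" unfolding vf_iff
proof (intro conjI allI impI ballI)
 show "snd (pa i) f = (%x. 0)" if "f ~: CC N" for f using that by (simp add: pa_def)
 show "snd (pa i) f : CC N" if f: "f : CC N" for f
  using f C_cut[OF N(1) smooth_fun_minus[OF N(1) pd_smooth[OF i]], of f] by (simp add: pa_def C_iff)
 fix V' ph' assume c: "(V', ph') : atlas E"
 let ?w = "%b x. - pd i (%y. ph' y \<bullet> b) x"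
 have o: "open (N Int V')" using N chart_open[OF c] by auto
 have "smf E (N Int V') (?w b)" for b
 proof (rule smooth_fun_minus[OF o])
  have "smf E (V' Int V) (pd i (%y. ph' y \<bullet> b))"
   unfolding pd_def by (rule smooth_fun_pderiv[OF kc chart_open[OF c] smooth_fun_coordinate[OF c] i])
  thus "smf E (N Int V') (pd i (%y. ph' y \<bullet> b))" by (rule smooth_fun_subset) (use N in auto)
 qed
 moreover have "snd (pa i) f x = (SUM b:axes E. ?w b x * pdc V' ph' b f x)" if f: "f : CC N" and x: "x : N Int V'" for f x
 proof -
  have fs: "smf E N f" using f by (simp add: C_iff)
  have "pd i f x = (SUM b:axes E. pd i (%y. ph' y \<bullet> b) x * pdc V' ph' b f x)"
   unfolding pd_def by (rule pderiv_chain[OF kc c N(1) fs]) (use x i NV in auto)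
  thus ?thesis using pa_apply(2)[OF f, of x i] x by (simp add: sum_negf)
 qed
 ultimately show "EX w. (ALL b:axes E. smf E (N Int V') (w b)) &
   (ALL f:CC N. ALL x:N Int V'. snd (pa i) f x = (SUM b:axes E. w b x * pdc V' ph' b f x))"
  by (intro exI[of _ ?w] conjI ballI)
qed

lemma pd_cong: "i : axes E ==> x : N ==> (!!y. y : N ==> f y = g y) ==> pd i f x = pd i g x"
 unfolding pd_def by (rule pderiv_cong[OF kc N(1)]) (use NV in auto)

lemma pd_mult: "i : axes E ==> x : N ==> smf E N f ==> smf E N g ==>
  pd i (%y. f y * g y) x = pd i f x * g x + f x * pd i g x" unfolding pd_def by (rule pderiv_mult[OF kc N(1)]) (use NV in auto)

text \<open>The form is a sum of products of coefficients with constant signs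
  \<open>\<epsilon>\<close>, so compatibility with it is the product rule.\<close>

lemma pa_gauge:
 assumes i: "i : axes E" shows "pa i : GG N" unfolding G_iff
proof (rule cdoI[OF N(1)])
 show "fst (pa i) X = (%x. 0)" if "X ~: SS N" for X using that by (simp add: pa_def)
 show "fst (pa i) X : SS N" if X: "X : SS N" for X
 proof -
  have Xs: "sms E N X" using X by (simp add: S_iff)
  have "sms E N (%x. SUM a<n. (- (\<epsilon> a * pd i (xc X a) x)) *r (es ! a) x)"
   by (intro section_sum[OF N(1)] section_scale[OF N(1)] smooth_fun_minus[OF N(1)] smooth_fun_mult[OF N(1)]
    smooth_fun_const[OF N(1)] pd_smooth[OF i] xc_smooth[OF Xs] e_section) auto
  thus ?thesis using S_cut[OF N(1)] X by (simp add: pa_def)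
 qed
 show "snd (pa i) : vector_fields E N" by (rule pa_vf[OF i])
 show "fst (pa i) (%x. X x + Y x) x = fst (pa i) X x + fst (pa i) Y x" if X: "X : SS N" and Y: "Y : SS N" and x: "x : N" for X Y x
 proof -
   have "pd i (xc (%x. X x + Y x) a) x = pd i (xc X a) x + pd i (xc Y a) x" if a: "a < n" for a
   proof -
    have "pd i (xc (%x. X x + Y x) a) x = pd i (%y. xc X a y + xc Y a y) x"
     by (rule pd_cong[OF i x]) (simp add: xc_def pairing_def form_add_right e_fibre[OF a] S_fibre[OF X] S_fibre[OF Y])
    also have "... = pd i (xc X a) x + pd i (xc Y a) x"
     unfolding pd_def by (rule pderiv_add[OF kc N(1) x NV[OF x] i]) (use X Y a xc_smooth in \<open>auto simp: S_iff\<close>)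
    finally show ?thesis .
   qed
   thus ?thesis unfolding pa_apply(1)[OF S_add[OF N(1) X Y] x] pa_apply(1)[OF X x] pa_apply(1)[OF Y x] sum.distrib[symmetric]
    by (intro sum.cong refl) (simp add: distrib_left scaleR_left_distrib[symmetric] scaleR_left_diff_distrib)
 qed
 show "fst (pa i) (%x. f x *r X x) x = f x *r fst (pa i) X x + snd (pa i) f x *r X x" if f: "f : CC N" and X: "X : SS N" and x: "x : N" for f X x
 proof -
   have fs: "smf E N f" "sms E N X" using f X by (simp_all add: C_iff S_iff)
   have d: "pd i (xc (%x. f x *r X x) a) x = pd i f x * xc X a x + f x * pd i (xc X a) x" if a: "a < n" for a
   proof -
    have "pd i (xc (%x. f x *r X x) a) x = pd i (%y. f y * xc X a y) x"
     by (rule pd_cong[OF i x]) (simp add: xc_def pairing_def form_scale_right e_fibre[OF a] S_fibre[OF X])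
    also have "... = pd i f x * xc X a x + f x * pd i (xc X a) x" by (rule pd_mult[OF i x fs(1) xc_smooth[OF fs(2) a]])
    finally show ?thesis .
   qed
   have "snd (pa i) f x *r X x = (SUM a<n. (- pd i f x * (\<epsilon> a * xc X a x)) *r (es ! a) x)"
    unfolding pa_apply(2)[OF f x] by (subst expand[where X = X, OF x S_fibre[OF X]]) (simp add: scaleR_sum_right)
   thus ?thesis unfolding pa_apply(1)[OF S_smult[OF N(1) f X] x] pa_apply(1)[OF X x] scaleR_sum_right
    by (simp add: sum.distrib[symmetric] d scaleR_left_distrib[symmetric] algebra_simps)
 qed
 show "snd (pa i) (cut N (pairing E X Y)) x = form E x (fst (pa i) X x) (Y x) + form E x (X x) (fst (pa i) Y x)"
  if X: "X : SS N" and Y: "Y : SS N" and x: "x : N" for X Y x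
 proof -
   have s: "smf E N (xc X a)" "smf E N (xc Y a)" if "a < n" for a using X Y that xc_smooth by (auto simp: S_iff)
   have "pd i (cut N (pairing E X Y)) x = pd i (%y. SUM a<n. \<epsilon> a * (xc X a y * xc Y a y)) x"
    by (rule pd_cong[OF i x]) (simp add: cut_in pairing_def form_expand[where X = X and Y = Y, OF _ S_fibre[OF X] S_fibre[OF Y]])
   also have "... = (SUM a<n. pd i (%y. \<epsilon> a * (xc X a y * xc Y a y)) x)"
    unfolding pd_def by (rule pderiv_sum[OF kc N(1) x NV[OF x] i])
     (use s smooth_fun_mult[OF N(1)] smooth_fun_const[OF N(1)] in auto)
   also have "... = (SUM a<n. \<epsilon> a * (pd i (xc X a) x * xc Y a x) + \<epsilon> a * (xc X a x * pd i (xc Y a) x))"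
   proof (rule sum.cong[OF refl])
    fix a assume a: "a : {..<n}"
    have "pd i (%y. \<epsilon> a * (xc X a y * xc Y a y)) x = pd i (%y. \<epsilon> a) x * (xc X a x * xc Y a x) + \<epsilon> a * pd i (%y. xc X a y * xc Y a y) x"
     by (rule pd_mult[OF i x smooth_fun_const[OF N(1)] smooth_fun_mult[OF N(1)]]) (use a s in auto)
    also have "pd i (%y. xc X a y * xc Y a y) x = pd i (xc X a) x * xc Y a x + xc X a x * pd i (xc Y a) x"
     by (rule pd_mult[OF i x]) (use a s in auto)
    also have "pd i (%y. \<epsilon> a) x = 0" unfolding pd_def by (rule pderiv_const)
    finally show "pd i (%y. \<epsilon> a * (xc X a y * xc Y a y)) x = \<epsilon> a * (pd i (xc X a) x * xc Y a x) + \<epsilon> a * (xc X a x * pd i (xc Y a) x)"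
     by (simp add: distrib_left)
   qed
   finally have 1: "pd i (cut N (pairing E X Y)) x = ..." .
   have 2: "pairing E (fst (pa i) X) Y x = (SUM a<n. - (\<epsilon> a * (pd i (xc X a) x * xc Y a x)))"
   proof -
    have "pairing E (fst (pa i) X) Y x = (SUM a<n. (- (\<epsilon> a * pd i (xc X a) x)) * form E x ((es ! a) x) (Y x))"
     unfolding pairing_def pa_apply(1)[OF X x] by (rule form_comb) (use e_fibre x S_fibre[OF Y] in auto)
    thus ?thesis by (simp add: xc_def pairing_def mult.assoc)
   qed
   have 3: "pairing E X (fst (pa i) Y) x = (SUM a<n. - (\<epsilon> a * (xc X a x * pd i (xc Y a) x)))"
   proof -
    have "pairing E X (fst (pa i) Y) x = (SUM a<n. (- (\<epsilon> a * pd i (xc Y a) x)) * form E x (X x) ((es ! a) x))"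
     unfolding pairing_def pa_apply(1)[OF Y x] by (rule form_comb_right) (use e_fibre x S_fibre[OF X] in auto)
    also have "... = (SUM a<n. - (\<epsilon> a * (xc X a x * pd i (xc Y a) x)))"
     by (rule sum.cong) (simp_all add: xc_def pairing_def form_sym[OF S_fibre[OF X] e_fibre[OF _ x]])
    finally show ?thesis .
   qed
   show ?thesis unfolding pa_apply(2)[OF C_pairing[OF N(1) X Y] x] 1 2[unfolded pairing_def] 3[unfolded pairing_def]
    by (simp add: sum.distrib sum_negf)
 qed
qed

lemma symb_ue:
 assumes a: "a < n" and x: "x : N" shows "symb_E N (ue a) (V, ph, es) x = xi a"
proof -
 have "form E x ((es ! b) x) (ue a x) = (if b = a then 1 else 0)" if b: "b < n" for b
  using orth[OF b a NV[OF x]] eps[of a] e_fibre[OF _ x] a b by (simp add: ue_def cut_in[OF x] form_scale_right)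
 thus ?thesis unfolding symb_E_in[OF k x NV[OF x]] lf_delta[OF a, symmetric] by (rule lf_cong)
qed

text \<open>The frame vectors have constant components, so the operator kills them and its matrix
  vanishes. Only the momentum part of the symbol is left.\<close>

lemma symb_pa:
 assumes i: "i : axes E" and x: "x : N" shows "symb_A N (pa i) (V, ph, es) x = mom i"
proof -
 note G = pa_gauge[OF i]
 have "opL N (pa i) (es ! b) x = 0" if b: "b < n" for b
 proof -
  obtain X where X: "X : SS N" "\<forall>\<^sub>F y in nhds x. X y = (es ! b) y" by (rule ext_sec[OF N(1) x N(1) x e_section[OF b]])
  have "pd i (xc X a) x = 0" if a: "a < n" for a
  proof -
   have "\<forall>\<^sub>F y in nhds x. xc X a y = (if a = b then \<epsilon> a else 0)"
    using X(2) eventually_nhds_in_open[OF N(1) x] by eventually_elim (use orth[OF a b] NV in \<open>simp add: xc_def pairing_def\<close>)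
   from pderiv_near[OF kc NV[OF x] i this] show ?thesis by (simp add: pd_def pderiv_const)
  qed
  thus ?thesis unfolding opL_eq[OF N(1) G x X] pa_apply(1)[OF X(1) x] by simp
 qed
 hence 1: "qf n (%a b. 1 / 2 * conn N (pa i) es x a b) = 0"
  unfolding qf_zero[of n, symmetric] by (intro qf_cong) (simp add: conn_def form_zero e_fibre[OF _ x])
 have "opv N (pa i) (%y. ph y \<bullet> j) x = (if j = i then - 1 else 0)" if j: "j : axes E" for j
 proof -
  obtain f where f: "f : CC N" "\<forall>\<^sub>F y in nhds x. f y = ph y \<bullet> j"
   by (rule ext_fun[OF N(1) x nchartD(2)[OF k] NV[OF x] smooth_fun_coordinate[OF kc]])
  show ?thesis unfolding opv_eq[OF G x f] pa_apply(2)[OF f(1) x] pd_def pderiv_near[OF kc NV[OF x] i f(2)] pderiv_coordinate[OF kc NV[OF x] i j]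
   by simp
 qed
 hence "(SUM j:axes E. pscl (opv N (pa i) (%y. ph y \<bullet> j) x) (mom j)) = (SUM j:axes E. if j = i then - mom j else 0)"
  by (intro sum.cong) (simp_all add: spoly_scale_zero spoly_scale_minus spoly_scale_one)
 also have "... = - mom i" using i finite_axes by simp
 finally show ?thesis unfolding symb_A_in[OF k x NV[OF x]] 1 by simp
qed

section \<open>Spanning the sections by the frame, and the operators by flat lifts and
  wedges\<close>

definition gcomb :: "'i set => ('i => 'm => real) => ('i => ('m, 'v) cdo) => ('m, 'v) cdo" where
 "gcomb I c D = (%X x. SUM i:I. c i x *r fst (D i) X x, %f x. SUM i:I. c i x * snd (D i) f x)"

lemma lin_zero:
 assumes "lin_map id (Cinf E N) M (EA_alg E N) j" "\<zero>\<^bsub>M\<^esub> : carrier M" "\<zero>\<^bsub>M\<^esub> \<oplus>\<^bsub>M\<^esub> \<zero>\<^bsub>M\<^esub> = \<zero>\<^bsub>M\<^esub>"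
 shows "j \<zero>\<^bsub>M\<^esub> = \<zero>\<^bsub>EA_alg E N\<^esub>"
proof -
 interpret A: ring "EA_alg E N" by (rule assoc_algD(2)[OF AA_assoc[OF N(1)]])
 have j: "j \<zero>\<^bsub>M\<^esub> : AA N" "j \<zero>\<^bsub>M\<^esub> \<oplus>\<^bsub>EA_alg E N\<^esub> j \<zero>\<^bsub>M\<^esub> = j \<zero>\<^bsub>M\<^esub>"
  using assms unfolding lin_map_def by (blast, metis)
 thus ?thesis by (metis A.add.r_cancel_one')
qed

lemma gcomb:
 assumes I: "finite I" and c: "!!i. i : I ==> c i : CC N" and D: "!!i. i : I ==> D i : GG N"
 shows "gcomb I c D : GG N & EA_A E N (gcomb I c D) : lspan (Cinf E N) (EA_alg E N) (EA_A E N ` D ` I)"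
proof -
 let ?A = "EA_alg E N"
 let ?G = "EA_A E N ` D ` I"
 note lin = EA.EA_A_lin[OF EA[OF N(1)]]
 have G: "?G <= AA N" using AA_gens(2)[OF N(1)] D by blast
 have "J <= I ==> gcomb J c D : GG N & EA_A E N (gcomb J c D) : lspan (Cinf E N) ?A ?G" for J
 proof (induction J rule: infinite_finite_induct)
  case (infinite J) thus ?case using I finite_subset by blast
 next
  case empty
  have z: "gcomb {} c D = \<zero>\<^bsub>gauge E N\<^esub>" by (simp add: gcomb_def G_simps)
  have "EA_A E N \<zero>\<^bsub>gauge E N\<^esub> = \<zero>\<^bsub>?A\<^esub>" by (rule lin_zero[OF lin gauge_zero[OF N(1)]]) (simp add: G_simps)
  thus ?case unfolding z using gauge_zero[OF N(1)] lspan.zero[of ?A "Cinf E N" ?G] by simp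
 next
  case (insert i J)
  have s: "gcomb (insert i J) c D = (c i \<odot>\<^bsub>gauge E N\<^esub> D i) \<oplus>\<^bsub>gauge E N\<^esub> gcomb J c D"
   using insert(1,2) by (simp add: gcomb_def G_simps)
  have ci: "c i : CC N" and Di: "D i : GG N" and J: "gcomb J c D : GG N" using c D insert by blast+
  have cD: "c i \<odot>\<^bsub>gauge E N\<^esub> D i : GG N" by (rule gauge_smult[OF N(1) ci Di])
  have "EA_A E N (gcomb (insert i J) c D) = c i \<odot>\<^bsub>?A\<^esub> EA_A E N (D i) \<oplus>\<^bsub>?A\<^esub> EA_A E N (gcomb J c D)"
   unfolding s using lin ci Di J cD unfolding lin_map_def by simp
  moreover have "... : lspan (Cinf E N) ?A ?G" by (rule lspan.step[OF ci]) (use insert in blast)+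
  ultimately show ?case using gauge_add[OF N(1) cD J] s by simp
 qed
 thus ?thesis by blast
qed

lemma EA_E_span:
 assumes X: "X : SS N" shows "EA_E E N X : lspan (Cinf E N) (EA_alg E N) (EA_E E N ` ue ` {..<n})"
proof -
 let ?A = "EA_alg E N"
 let ?G = "EA_E E N ` ue ` {..<n}"
 let ?c = "%a. cut N (xc X a)"
 note lin = EA.EA_E_lin[OF EA[OF N(1)]]
 have c: "?c a : CC N" if "a < n" for a using C_cut[OF N(1) xc_smooth[OF _ that]] X by (simp add: S_iff)
 have comb: "J <= {..<n} ==> (%x. SUM a:J. ?c a x *r ue a x) : SS N & EA_E E N (%x. SUM a:J. ?c a x *r ue a x) : lspan (Cinf E N) ?A ?G" for J
 proof (induction J rule: infinite_finite_induct)
  case (infinite J) thus ?case using finite_subset by blast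
 next
  case empty
  have "EA_E E N \<zero>\<^bsub>sections E N\<^esub> = \<zero>\<^bsub>?A\<^esub>"
   by (rule lin_zero[OF lin]) (simp_all add: S_simps S_zero[OF N(1)])
  thus ?case using S_zero[OF N(1)] lspan.zero[of ?A "Cinf E N" ?G] by (simp add: S_simps)
 next
  case (insert i J)
  let ?s = "%x. SUM a:J. ?c a x *r ue a x"
  have s: "(%x. SUM a:insert i J. ?c a x *r ue a x) = (?c i \<odot>\<^bsub>sections E N\<^esub> ue i) \<oplus>\<^bsub>sections E N\<^esub> ?s"
   using insert(1,2) by (simp add: S_simps)
  have ci: "?c i : CC N" and Di: "ue i : SS N" and J: "?s : SS N" using c ue_section insert by auto
  have cD: "?c i \<odot>\<^bsub>sections E N\<^esub> ue i : SS N" unfolding S_simps by (rule S_smult[OF N(1) ci Di])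
  have "EA_E E N ((?c i \<odot>\<^bsub>sections E N\<^esub> ue i) \<oplus>\<^bsub>sections E N\<^esub> ?s) = ?c i \<odot>\<^bsub>?A\<^esub> EA_E E N (ue i) \<oplus>\<^bsub>?A\<^esub> EA_E E N ?s"
   using lin ci Di J cD unfolding lin_map_def by simp
  moreover have "... : lspan (Cinf E N) ?A ?G" by (rule lspan.step[OF ci]) (use insert in blast)+
  moreover have "(?c i \<odot>\<^bsub>sections E N\<^esub> ue i) \<oplus>\<^bsub>sections E N\<^esub> ?s : SS N"
   using S_add[OF N(1) cD J] by (simp only: S_simps)
  ultimately show ?case unfolding s by simp
 qed
 have e: "(%x. SUM a<n. ?c a x *r ue a x) = X"
 proof
  fix x show "(SUM a<n. ?c a x *r ue a x) = X x"
  proof (cases "x : N")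
   case True thus ?thesis using expand[where X = X, OF True S_fibre[OF X]] by (simp add: cut_in ue_def mult.commute)
  qed (use X in \<open>simp add: cut_out S_iff\<close>)
 qed
 from comb[OF order_refl] show ?thesis unfolding e by (rule conjunct2)
qed

text \<open>The Atiyah sequence splits over the chart. \<open>P\<close> is the flat operator with
  the same vector field as \<open>D\<close>; the remainder is linear over functions and
  antisymmetric, hence a combination of wedges of frame vectors.\<close>

lemma EA_A_decomp:
 assumes D: "D : GG N"
 obtains P Q where "P : GG N" "Q : GG N" "D = P \<oplus>\<^bsub>gauge E N\<^esub> Q"
  "EA_A E N P : lspan (Cinf E N) (EA_alg E N) (EA_A E N ` pa ` axes E)"
  "EA_A E N Q : lspan (Cinf E N) (EA_alg E N) (EA_A E N ` (%(a, b). wedge_cdo E N (ue a) (ue b)) ` ({..<n} \<times> {..<n}))"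
proof -
 \<comment> \<open>\<open>pa i\<close> differentiates with a minus sign, hence the sign in
   \<open>?cp\<close>. The 1/2 in \<open>?cq\<close> compensates that each pair of frame vectors
   occurs in both orders.\<close>
 let ?cp = "%i. cut N (%x. - opv N D (%y. ph y \<bullet> i) x)"
 let ?cq = "%(a, b). cut N (%x. 1 / 2 * pairing E (es ! a) (opL N D (es ! b)) x)"
 let ?w = "%(a, b). wedge_cdo E N (ue a) (ue b)"
 let ?P = "gcomb (axes E) ?cp pa" and ?Q = "gcomb ({..<n} \<times> {..<n}) ?cq ?w"
 have opLs: "sms E N (opL N D (es ! b))" if "b < n" for b using opL_smooth[OF N(1) D N(1) e_section[OF that]] by simp
 have P: "?P : GG N & EA_A E N ?P : lspan (Cinf E N) (EA_alg E N) (EA_A E N ` pa ` axes E)"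
 proof (rule gcomb[OF finite_axes])
  fix i assume i: "i : axes E"
  have "smf E N (opv N D (%y. ph y \<bullet> i))"
   using opv_smooth[OF N(1) D nchartD(2)[OF k] smooth_fun_coordinate[OF kc]] N(2) by (simp add: Int_absorb2)
  thus "?cp i : CC N" by (rule C_cut[OF N(1) smooth_fun_minus[OF N(1)]])
 qed (rule pa_gauge)
 have Q: "?Q : GG N & EA_A E N ?Q : lspan (Cinf E N) (EA_alg E N) (EA_A E N ` ?w ` ({..<n} \<times> {..<n}))"
 proof (rule gcomb)
  fix p assume "p : {..<n} \<times> {..<n}"
  then obtain a b where p: "p = (a, b)" "a < n" "b < n" by auto
  have "smf E N (pairing E (es ! a) (opL N D (es ! b)))" by (rule pairing_smooth[OF N(1) e_section[OF p(2)] opLs[OF p(3)]])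
  thus "?cq p : CC N" unfolding p(1) prod.case by (intro C_cut[OF N(1)] smooth_fun_mult[OF N(1)] smooth_fun_const[OF N(1)])
  show "?w p : GG N" unfolding p(1) prod.case by (rule wedge_gauge[OF N(1) ue_section ue_section]) (use p in auto)
 qed simp
 have "D = ?P \<oplus>\<^bsub>gauge E N\<^esub> ?Q"
 proof (rule gauge_eqI[OF D gauge_add[OF N(1) conjunct1[OF P] conjunct1[OF Q]]])
  fix f x assume f: "f : CC N" and x: "x : N"
  have fs: "smf E N f" using f by (simp add: C_iff)
  have "snd D f x = opv N D f x" by (rule opv_eq[OF D x f, symmetric]) simp
  also have "... = (SUM i:axes E. opv N D (%y. ph y \<bullet> i) x * pd i f x)"
   unfolding pd_def by (rule opv_chart[OF N(1) D N(1) x x fs kc NV[OF x]])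
  finally show "snd D f x = snd (?P \<oplus>\<^bsub>gauge E N\<^esub> ?Q) f x"
   by (simp add: G_simps gcomb_def cut_in[OF x] pa_apply(2)[OF f x] wedge_cdo_def split_beta)
 next
  fix X x assume X: "X : SS N" and x: "x : N"
  have Xs: "sms E N X" using X by (simp add: S_iff)
  let ?c = "%a y. \<epsilon> a * xc X a y"
  let ?g = "%a b. pairing E (es ! a) (opL N D (es ! b)) x"
  have cs: "smf E N (?c a)" if "a < n" for a by (rule smooth_fun_mult[OF N(1) smooth_fun_const[OF N(1)] xc_smooth[OF Xs that]])
  have "fst D X x = opL N D X x" by (rule opL_eq[OF N(1) D x X, symmetric]) simp
  also have "... = opL N D (%y. SUM a<n. ?c a y *r (es ! a) y) x"
  proof (rule opL_cong)
   show "\<forall>\<^sub>F y in nhds x. X y = (SUM a<n. ?c a y *r (es ! a) y)"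
    using eventually_nhds_in_open[OF N(1) x] by eventually_elim (rule expand[where X = X, OF _ S_fibre[OF X]])
  qed
  also have "... = (SUM a<n. ?c a x *r opL N D (es ! a) x + opv N D (?c a) x *r (es ! a) x)"
   by (rule opL_comb[OF N(1) D N(1) x x]) (use cs e_section in auto)
  finally have DX: "fst D X x = (SUM b<n. ?c b x *r opL N D (es ! b) x) + (SUM a<n. opv N D (?c a) x *r (es ! a) x)"
   by (simp only: sum.distrib)
  have PX: "fst ?P X x = (SUM a<n. opv N D (?c a) x *r (es ! a) x)"
  proof -
   have "fst ?P X x = (SUM i:axes E. SUM a<n. (opv N D (%y. ph y \<bullet> i) x * pd i (?c a) x) *r (es ! a) x)"
   proof -
    have "pd i (?c a) x = \<epsilon> a * pd i (xc X a) x" if "i : axes E" "a < n" for i a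
     using pd_mult[OF that(1) x smooth_fun_const[OF N(1)] xc_smooth[OF Xs that(2)], of "\<epsilon> a"] pderiv_const[of V ph i "\<epsilon> a" x]
     by (simp add: pd_def)
    thus ?thesis by (simp add: gcomb_def cut_in[OF x] pa_apply(1)[OF X x] scaleR_sum_right sum_negf)
   qed
   also have "... = (SUM a<n. (SUM i:axes E. opv N D (%y. ph y \<bullet> i) x * pd i (?c a) x) *r (es ! a) x)"
    by (subst sum.swap) (simp only: scaleR_sum_left)
   also have "... = (SUM a<n. opv N D (?c a) x *r (es ! a) x)"
   proof (rule sum.cong[OF refl])
    fix a assume "a : {..<n}"
    hence "opv N D (?c a) x = (SUM i:axes E. opv N D (%y. ph y \<bullet> i) x * pd i (?c a) x)"
     unfolding pd_def using opv_chart[OF N(1) D N(1) x x cs kc NV[OF x], of a] by simp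
    thus "(SUM i:axes E. opv N D (%y. ph y \<bullet> i) x * pd i (?c a) x) *r (es ! a) x = opv N D (?c a) x *r (es ! a) x"
     by (simp only:)
   qed
   finally show ?thesis .
  qed
  \<comment> \<open>The Gram matrix is constant, so the vector field of \<open>D\<close> kills it,
    and compatibility with the form becomes antisymmetry of the matrix.\<close>
  have anti: "?g a b = - ?g b a" if ab: "a < n" "b < n" for a b
  proof -
   have "opv N D (pairing E (es ! a) (es ! b)) x = 0"
   proof -
    have "\<forall>\<^sub>F y in nhds x. cut N (%x. if a = b then \<epsilon> a else 0) y = pairing E (es ! a) (es ! b) y"
     using eventually_nhds_in_open[OF N(1) x] by eventually_elim (simp add: cut_in pairing_def orth[OF ab NV])
    from opv_eq[OF D x C_const[OF N(1)] this] show ?thesis using vf_const[OF N(1) cdoD(5)[OF D[unfolded G_iff]]] by simp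
   qed
   moreover have "opv N D (pairing E (es ! a) (es ! b)) x = form E x (opL N D (es ! a) x) ((es ! b) x) + form E x ((es ! a) x) (opL N D (es ! b) x)"
    by (rule opv_pairing[OF N(1) D N(1) x x e_section[OF ab(1)] e_section[OF ab(2)]])
   moreover have "form E x (opL N D (es ! a) x) ((es ! b) x) = ?g b a"
    unfolding pairing_def by (rule form_sym[OF section_fibre[OF opLs[OF ab(1)] x] e_fibre[OF ab(2) x]])
   ultimately show ?thesis by (simp add: pairing_def)
  qed
  have QX: "fst ?Q X x = (SUM b<n. ?c b x *r opL N D (es ! b) x)"
  proof -
   have w: "fst (wedge_cdo E N (ue a) (ue b)) X x = ?c b x *r ue a x - ?c a x *r ue b x" if ab: "a < n" "b < n" for a b
    unfolding wedge_apply[OF X] cut_in[OF x] using e_fibre[OF ab(1) x] e_fibre[OF ab(2) x] S_fibre[OF X, of x]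
    by (simp add: ue_def cut_in[OF x] form_scale xc_def pairing_def)
   have "fst ?Q X x = (SUM a<n. SUM b<n. (1 / 2 * ?g a b) *r (?c b x *r ue a x - ?c a x *r ue b x))"
   proof -
    have "fst ?Q X x = (\<Sum>(a, b)\<in>{..<n} \<times> {..<n}. (1 / 2 * ?g a b) *r fst (wedge_cdo E N (ue a) (ue b)) X x)"
     by (simp add: gcomb_def split_beta cut_in[OF x])
    also have "... = (SUM a<n. SUM b<n. (1 / 2 * ?g a b) *r fst (wedge_cdo E N (ue a) (ue b)) X x)"
     by (rule sum.cartesian_product[symmetric])
    finally show ?thesis by (simp add: w)
   qed
   also have "... = (SUM a<n. SUM b<n. (1 / 2 * ?g a b * ?c b x) *r ue a x) - (SUM a<n. SUM b<n. (1 / 2 * ?g a b * ?c a x) *r ue b x)"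
    by (simp only: scaleR_right_diff_distrib sum_subtractf scaleR_scaleR)
   also have "(SUM a<n. SUM b<n. (1 / 2 * ?g a b * ?c a x) *r ue b x) = (SUM a<n. SUM b<n. (- (1 / 2 * ?g a b * ?c b x)) *r ue a x)"
   proof (subst sum.swap, intro sum.cong refl)
    fix a b assume "a : {..<n}" "b : {..<n}"
    hence "?g b a = - ?g a b" using anti by blast
    thus "(1 / 2 * ?g b a * ?c b x) *r ue a x = (- (1 / 2 * ?g a b * ?c b x)) *r ue a x" by (simp only:) simp
   qed
   also have "(SUM a<n. SUM b<n. (1 / 2 * ?g a b * ?c b x) *r ue a x) - ... = (SUM a<n. SUM b<n. (?g a b * ?c b x) *r ue a x)"
    unfolding sum_subtractf[symmetric] by (intro sum.cong refl) (simp add: scaleR_left_distrib[symmetric])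
   also have "... = (SUM b<n. ?c b x *r (SUM a<n. ?g a b *r ue a x))"
    by (subst sum.swap) (simp add: scaleR_sum_right mult.commute)
   also have "... = (SUM b<n. ?c b x *r opL N D (es ! b) x)"
   proof (intro sum.cong refl arg_cong2[of _ _ _ _ scaleR])
    fix b assume "b : {..<n}"
    hence "opL N D (es ! b) x : fibre E x" using section_fibre[OF opLs x] by simp
    from expand[where X = "opL N D (es ! b)", OF x this] show "(SUM a<n. ?g a b *r ue a x) = opL N D (es ! b) x"
     by (simp add: ue_def cut_in[OF x] xc_def mult.commute)
   qed
   finally show ?thesis .
  qed
  have "fst (?P \<oplus>\<^bsub>gauge E N\<^esub> ?Q) X x = fst ?P X x + fst ?Q X x" by (simp only: G_simps fst_conv)
  thus "fst D X x = fst (?P \<oplus>\<^bsub>gauge E N\<^esub> ?Q) X x" unfolding DX PX QX by (simp only: add.commute)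
 qed
 thus ?thesis using that[of ?P ?Q] P Q by blast
qed

end

section \<open>Ordered monomials as a basis, and bijectivity of \<open>theta\<close> over a small
  open set\<close>

context on_chart
begin

abbreviation "A == EA_alg E N"
abbreviation EA_mult (infixl "\<cdot>" 70) where "a \<cdot> b == a \<otimes>\<^bsub>A\<^esub> b"
abbreviation "sp == lspan (Cinf E N) A"

interpretation A: ring A by (rule assoc_algD(2)[OF AA_assoc[OF N(1)]])

lemmas asA = AA_assoc[OF N(1)]
lemmas sp_incl = lspan_incl[OF asA] and sp_add = lspan_add[OF asA] and sp_smult = lspan_smult[OF asA]
 and sp_minus = lspan_minus[OF asA] and sp_trans = lspan_trans[OF asA] and sp_mult = lspan_mult[OF asA] and sp_closed = lspan_closed[OF asA]

definition "ze a = EA_E E N (ue a)"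
definition "za i = EA_A E N (pa i)"

lemma ze_closed: "a < n ==> ze a : AA N" unfolding ze_def by (rule AA_gens(1)[OF N(1) ue_section])

lemma za_closed: "i : axes E ==> za i : AA N" unfolding za_def by (rule AA_gens(2)[OF N(1) pa_gauge])

lemma za_ze: "i : axes E ==> a < n ==> za i \<cdot> ze a = ze a \<cdot> za i"
 unfolding za_def ze_def by (rule EA.EA_A_central(1)[OF EA[OF N(1)] pa_gauge ue_section])

lemma za_za: "i : axes E ==> j : axes E ==> za i \<cdot> za j = za j \<cdot> za i"
 unfolding za_def by (rule EA.EA_A_central(2)[OF EA[OF N(1)] pa_gauge pa_gauge])

lemma ze_square: "a < n ==> ze a \<cdot> ze a = \<zero>\<^bsub>A\<^esub>"
 unfolding ze_def by (rule EA.EA_E_square[OF EA[OF N(1)] ue_section])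

text \<open>Polarisation: the square of the sum of two sections vanishes as well.\<close>

lemma ze_anti:
 assumes a: "a < n" "b < n" shows "ze a \<cdot> ze b = \<ominus>\<^bsub>A\<^esub> (ze b \<cdot> ze a)"
proof -
 note c = ze_closed[OF a(1)] ze_closed[OF a(2)]
 have s: "ue a \<oplus>\<^bsub>sections E N\<^esub> ue b : SS N"
  unfolding S_simps by (rule S_add[OF N(1) ue_section[OF a(1)] ue_section[OF a(2)]])
 have "EA_E E N (ue a \<oplus>\<^bsub>sections E N\<^esub> ue b) = ze a \<oplus>\<^bsub>A\<^esub> ze b"
  using EA.EA_E_lin[OF EA[OF N(1)]] ue_section[OF a(1)] ue_section[OF a(2)] unfolding lin_map_def ze_def by blast
 hence "(ze a \<oplus>\<^bsub>A\<^esub> ze b) \<cdot> (ze a \<oplus>\<^bsub>A\<^esub> ze b) = \<zero>\<^bsub>A\<^esub>"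
  using EA.EA_E_square[OF EA[OF N(1)] s] by simp
 hence "ze b \<cdot> ze a \<oplus>\<^bsub>A\<^esub> ze a \<cdot> ze b = \<zero>\<^bsub>A\<^esub>"
  using c by (simp add: A.l_distr A.r_distr ze_square a)
 hence "ze a \<cdot> ze b \<oplus>\<^bsub>A\<^esub> ze b \<cdot> ze a = \<zero>\<^bsub>A\<^esub>"
  using c by (simp add: A.a_comm[of "ze a \<cdot> ze b"])
 thus ?thesis using c by (metis A.m_closed A.minus_equality)
qed

text \<open>The tail \<open>T\<close> keeps the even part of a monomial fixed while the odd factors
  in front of it are reordered.\<close>

definition "ew as T = foldr (%a. (\<cdot>) (ze a)) as T"
definition "aw is = foldr (%i. (\<cdot>) (za i)) is \<one>\<^bsub>A\<^esub>"

lemma ew_simps: "ew [] T = T" "ew (a # as) T = ze a \<cdot> ew as T" by (simp_all add: ew_def)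

lemma aw_simps: "aw [] = \<one>\<^bsub>A\<^esub>" "aw (i # is) = za i \<cdot> aw is" by (simp_all add: aw_def)

lemma ew_closed: "set as <= {..<n} ==> T : AA N ==> ew as T : AA N"
 by (induction as) (auto simp: ew_simps ze_closed)

lemma aw_closed: "set is <= axes E ==> aw is : AA N" by (induction "is") (auto simp: aw_simps za_closed)

lemma aw_move: "set ys <= axes E ==> i : axes E ==> set zs <= axes E ==> aw (ys @ i # zs) = za i \<cdot> aw (ys @ zs)"
proof (induction ys)
 case (Cons y ys)
 have c: "za y : AA N" "za i : AA N" "aw (ys @ zs) : AA N" using Cons.prems by (auto intro!: za_closed aw_closed)
 show ?case using Cons za_za[of y i] c by (simp add: aw_simps A.m_assoc[symmetric])
qed (simp add: aw_simps)

text \<open>The generators \<open>za i\<close> commute, so a product depends only on the multiset of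
  its indices. This makes the choice of a list in \<open>lst\<close> harmless.\<close>

lemma aw_perm: "mset is = mset js ==> set is <= axes E ==> aw is = aw js"
proof (induction "is" arbitrary: js)
 case (Cons i "is")
 have sj: "set js <= axes E" using Cons.prems by (metis set_mset_mset)
 have "i : set js" using Cons.prems(1) by (metis list.set_intros(1) set_mset_mset)
 then obtain ys zs where js: "js = ys @ i # zs" by (meson split_list)
 have "aw is = aw (ys @ zs)" using Cons js by simp
 moreover have "aw js = za i \<cdot> aw (ys @ zs)" unfolding js by (rule aw_move) (use sj js in auto)
 ultimately show ?case by (simp add: aw_simps)
qed simp

lemma za_ew:
 assumes i: "i : axes E" and T: "T : AA N" shows "set as <= {..<n} ==> za i \<cdot> ew as T = ew as (za i \<cdot> T)"
proof (induction as)
 case (Cons a as)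
 have c: "za i : AA N" "ze a : AA N" "ew as T : AA N" using Cons.prems i T by (auto intro!: za_closed ze_closed ew_closed)
 have "za i \<cdot> (ze a \<cdot> ew as T) = ze a \<cdot> (za i \<cdot> ew as T)"
  using za_ze[OF i, of a] c Cons.prems by (simp add: A.m_assoc[symmetric])
 thus ?case using Cons by (simp add: ew_simps)
qed (simp add: ew_simps)

text \<open>Insertion into a sorted word: the new letter is in place, annihilates its equal, or
  passes the first letter with a sign. Signs and zeros are the reason for a conclusion about a
  span.\<close>

lemma ew_insert:
 assumes T: "T : AA N" and c: "c < n" shows "sorted_wrt (<) l ==> set l <= {..<n} ==>
  ze c \<cdot> ew l T : sp {ew l' T | l'. sorted_wrt (<) l' & set l' <= insert c (set l)}"
proof (induction l)
 case Nil
 let ?G = "{ew l' T | l'. sorted_wrt (<) l' & set l' <= insert c (set [])}"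
 have "ew [c] T : ?G" by (intro CollectI exI[of _ "[c]"]) simp
 moreover have "?G <= AA N" using c by (auto intro!: ew_closed[OF _ T])
 ultimately have "ew [c] T : sp ?G" by (intro sp_incl)
 thus ?case by (simp only: ew_simps)
next
 case (Cons b l)
 let ?G = "{ew l' T | l'. sorted_wrt (<) l' & set l' <= insert c (set (b # l))}"
 let ?H = "{ew l' T | l'. sorted_wrt (<) l' & set l' <= insert c (set l)}"
 have G: "?G <= AA N" using c Cons.prems by (auto intro!: ew_closed[OF _ T])
 have H: "?H <= AA N" using c Cons.prems by (auto intro!: ew_closed[OF _ T])
 have cl: "ze c : AA N" "ze b : AA N" "ew l T : AA N" using c Cons.prems T by (auto intro!: ze_closed ew_closed)
 consider "c < b" | "c = b" | "b < c" by linarith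
 thus ?case
 proof cases
  case 1
  have "sorted_wrt (<) (c # b # l)" using Cons.prems(1) 1 by auto
  hence "ew (c # b # l) T : ?G" by (intro CollectI exI[of _ "c # b # l"]) simp
  thus ?thesis using sp_incl[OF G] by (simp add: ew_simps)
 next
  case 2
  have "ze c \<cdot> ew (b # l) T = (ze c \<cdot> ze c) \<cdot> ew l T" using cl 2 by (simp add: ew_simps A.m_assoc)
  thus ?thesis using ze_square[OF c] cl lspan.zero[of A "Cinf E N" ?G] by simp
 next
  case 3
  have "ze c \<cdot> ew (b # l) T = (ze c \<cdot> ze b) \<cdot> ew l T" using cl by (simp add: ew_simps A.m_assoc)
  also have "... = \<ominus>\<^bsub>A\<^esub> (ze b \<cdot> (ze c \<cdot> ew l T))"
   using ze_anti[of c b] c Cons.prems cl by (simp add: A.l_minus A.m_assoc)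
  finally have e: "ze c \<cdot> ew (b # l) T = ..." .
  have IH: "ze c \<cdot> ew l T : sp ?H" using Cons by simp
  have "ze b \<cdot> (ze c \<cdot> ew l T) : sp ?G"
  proof (rule sp_mult[of "{ze b}" ?H ?G])
   show "{ze b} <= AA N" using cl by simp
   show "ze b : sp {ze b}" by (rule sp_incl) (use cl in auto)
   fix g h assume g: "g : {ze b}" and "h : ?H"
   then obtain l' where l': "h = ew l' T" "sorted_wrt (<) l'" "set l' <= insert c (set l)" by blast
   have "sorted_wrt (<) (b # l')" using l' 3 Cons.prems(1) by auto
   hence "ew (b # l') T : ?G" using l'(3) by (intro CollectI exI[of _ "b # l'"]) auto
   thus "g \<cdot> h : sp ?G" using sp_incl[OF G] g l'(1) by (simp add: ew_simps)
  qed (use G H IH in auto)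
  thus ?thesis unfolding e by (rule sp_minus[OF G])
 qed
qed

lemma ew_sort:
 assumes T: "T : AA N"
 shows "set as <= {..<n} ==> ew as T : sp {ew l T | l. sorted_wrt (<) l & set l <= {..<n}}"
proof (induction as)
 let ?G = "{ew l T | l. sorted_wrt (<) l & set l <= {..<n}}"
 have G: "?G <= AA N" by (auto intro!: ew_closed[OF _ T])
 {
  case Nil
  have "ew [] T : ?G" by (intro CollectI exI[of _ "[]"]) simp
  thus ?case by (rule sp_incl[OF G])
 next
  case (Cons a as)
  have a: "a < n" using Cons.prems by simp
  have "ze a \<cdot> ew as T : sp ?G"
  proof (rule sp_mult[of "{ze a}" ?G ?G])
   show "ze a : sp {ze a}" by (rule sp_incl) (use ze_closed[OF a] in auto)
   fix g h assume g: "g : {ze a}" and "h : ?G"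
   then obtain l where l: "h = ew l T" "sorted_wrt (<) l" "set l <= {..<n}" by blast
   have "ze a \<cdot> ew l T : sp ?G"
   proof (rule sp_trans[OF _ G _ ew_insert[OF T a l(2,3)]])
    have sub: "{ew l' T |l'. sorted_wrt (<) l' & set l' <= insert a (set l)} <= ?G"
    proof
     fix t assume "t : {ew l' T |l'. sorted_wrt (<) l' & set l' <= insert a (set l)}"
     then obtain l' where l': "t = ew l' T" "sorted_wrt (<) l'" "set l' <= insert a (set l)" by blast
     moreover have "set l' <= {..<n}" using l'(3) l(3) a by auto
     ultimately show "t : ?G" by blast
    qed
    thus "{ew l' T |l'. sorted_wrt (<) l' & set l' <= insert a (set l)} <= AA N" using G by (rule subset_trans)
    show "g : sp ?G" if "g : {ew l' T |l'. sorted_wrt (<) l' & set l' <= insert a (set l)}" for g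
     by (rule sp_incl[OF G subsetD[OF sub that]])
   qed
   thus "g \<cdot> h : sp ?G" using g l(1) by simp
  qed (use G ze_closed[OF a] Cons in auto)
  thus ?case by (simp add: ew_simps)
 }
qed

definition "lst m = (SOME is. mset is = m)"

lemma mset_lst: "mset (lst m) = m" unfolding lst_def by (rule someI_ex) (rule ex_mset)

text \<open>The lift of the basis monomial with exponent \<open>k\<close>: odd generators in
  increasing order, followed by the even ones.\<close>

definition "nm k = ew (sorted_list_of_set (fset (fst k))) (aw (lst (snd k)))"

abbreviation "ks == mons n (axes E)"

lemma ks_lists:
 assumes "k : ks" shows "set (sorted_list_of_set (fset (fst k))) <= {..<n}" "set (lst (snd k)) <= axes E"
proof -
 obtain B m where k: "k = (B, m)" by (cases k)
 show "set (sorted_list_of_set (fset (fst k))) <= {..<n}" using assms k by (simp add: mons_def)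
 have "set (lst m) = set_mset m" by (metis mset_lst set_mset_mset)
 thus "set (lst (snd k)) <= axes E" using assms k by (simp add: mons_def)
qed

lemma nm_closed: "k : ks ==> nm k : AA N" unfolding nm_def by (intro ew_closed aw_closed ks_lists)

lemma word_span:
 assumes a: "set as <= {..<n}" and i: "set is <= axes E" shows "ew as (aw is) : sp (nm ` ks)"
proof -
 let ?G = "{ew l (aw is) | l. sorted_wrt (<) l & set l <= {..<n}}"
 have "?G <= nm ` ks"
 proof
  fix t assume "t : ?G"
  then obtain l where l: "t = ew l (aw is)" "sorted_wrt (<) l" "set l <= {..<n}" by blast
  have "sorted_list_of_set (fset (fset_of_list l)) = l"
   using l(2) by (simp add: fset_of_list.rep_eq strict_sorted_iff sorted_list_of_set.idem_if_sorted_distinct)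
  moreover have "aw (lst (mset is)) = aw is" using aw_perm[of "is" "lst (mset is)"] i by (simp add: mset_lst)
  ultimately have "t = nm (fset_of_list l, mset is)" by (simp add: nm_def l(1))
  moreover have "(fset_of_list l, mset is) : ks" using l(3) i by (simp add: mons_def fset_of_list.rep_eq)
  ultimately show "t : nm ` ks" by (rule image_eqI)
 qed
 moreover have "nm ` ks <= AA N" using nm_closed by auto
 ultimately show ?thesis
  using sp_trans[OF _ \<open>nm ` ks <= AA N\<close> _ ew_sort[OF aw_closed[OF i] a]] sp_incl[OF \<open>nm ` ks <= AA N\<close>]
  by (meson subset_iff)
qed

text \<open>The span is stable under left multiplication by every generator. For an operator the
  flat part is a combination of the \<open>za i\<close>, and the wedge part of products
  \<open>ze a \<cdot> ze b\<close>, by the relations generating the ideal.\<close>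

lemma nm_span:
 assumes s: "s : AA N" shows "s : sp (nm ` ks)"
proof -
 let ?S = "nm ` ks"
 have S: "?S <= AA N" using nm_closed by auto
 have ze_nm: "ze a \<cdot> h : sp ?S" if a: "a < n" and h: "h : ?S" for a h
 proof -
  obtain k where k: "k : ks" "h = nm k" using h by blast
  have "ze a \<cdot> h = ew (a # sorted_list_of_set (fset (fst k))) (aw (lst (snd k)))" by (simp add: k(2) nm_def ew_simps)
  thus ?thesis using word_span[of "a # sorted_list_of_set (fset (fst k))" "lst (snd k)"] a ks_lists[OF k(1)] by simp
 qed
 have za_nm: "za i \<cdot> h : sp ?S" if i: "i : axes E" and h: "h : ?S" for i h
 proof -
  obtain k where k: "k : ks" "h = nm k" using h by blast
  have "za i \<cdot> h = ew (sorted_list_of_set (fset (fst k))) (aw (i # lst (snd k)))"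
   unfolding k(2) nm_def aw_simps by (rule za_ew[OF i aw_closed]) (rule ks_lists[OF k(1)])+
  thus ?thesis using word_span[of "sorted_list_of_set (fset (fst k))" "i # lst (snd k)"] i ks_lists[OF k(1)] by simp
 qed
 have zes: "ze ` {..<n} <= AA N" using ze_closed by auto
 have zas: "za ` axes E <= AA N" using za_closed by auto
 have ze_sp: "ze a \<cdot> s : sp ?S" if "a < n" "s : sp ?S" for a s
  by (rule sp_mult[OF zes S S _ sp_incl[OF zes] that(2)]) (use that ze_nm in auto)
 show ?thesis using s
 proof (induction s rule: AA_induct[OF N(1), consumes 1, case_names one add smult E A])
  case one
  show ?case using word_span[of "[]" "[]"] by (simp add: ew_simps aw_simps)
 next
  case (add s t) thus ?case by (intro sp_add[OF S])
 next
  case (smult f s) thus ?case by (intro sp_smult[OF S])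
 next
  case (E X s)
  have X: "EA_E E N X : sp (ze ` {..<n})" using EA_E_span[OF E(1)] by (simp add: ze_def image_image)
  show ?case by (rule sp_mult[OF zes S S _ X E(3)]) (use ze_nm in auto)
 next
  case (A D s)
  obtain P Q where PQ: "P : GG N" "Q : GG N" "D = P \<oplus>\<^bsub>gauge E N\<^esub> Q"
   "EA_A E N P : sp (EA_A E N ` pa ` axes E)"
   "EA_A E N Q : sp (EA_A E N ` (%(a, b). wedge_cdo E N (ue a) (ue b)) ` ({..<n} \<times> {..<n}))" by (rule EA_A_decomp[OF A(1)])
  have cl: "EA_A E N P : AA N" "EA_A E N Q : AA N" using AA_gens(2)[OF N(1)] PQ by auto
  have "EA_A E N P : sp (za ` axes E)" using PQ(4) by (simp add: za_def image_image)
  hence 1: "EA_A E N P \<cdot> s : sp ?S" by (rule sp_mult[OF zas S S _ _ A(3), rotated]) (use za_nm in auto)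
  let ?W = "(%(a, b). ze a \<cdot> ze b) ` ({..<n} \<times> {..<n})"
  have "EA_A E N ` (%(a, b). wedge_cdo E N (ue a) (ue b)) ` ({..<n} \<times> {..<n}) = ?W"
   unfolding image_image by (rule image_cong) (auto simp: ze_def EA.EA_wedge[OF EA[OF N(1)]] ue_section)
  hence Q: "EA_A E N Q : sp ?W" using PQ(5) by simp
  have W: "?W <= AA N" using ze_closed by auto
  have 2: "EA_A E N Q \<cdot> s : sp ?S"
  proof (rule sp_mult[OF W S S _ Q A(3)])
   fix g h assume "g : ?W" and h: "h : ?S"
   then obtain a b where ab: "a < n" "b < n" "g = ze a \<cdot> ze b" by auto
   have "ze a \<cdot> (ze b \<cdot> h) : sp ?S" by (rule ze_sp[OF ab(1) ze_nm[OF ab(2) h]])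
   thus "g \<cdot> h : sp ?S" using ab h S ze_closed by (simp add: A.m_assoc subset_iff)
  qed
  have "EA_A E N D \<cdot> s = EA_A E N P \<cdot> s \<oplus>\<^bsub>A\<^esub> EA_A E N Q \<cdot> s"
  proof -
   have "EA_A E N D = EA_A E N P \<oplus>\<^bsub>A\<^esub> EA_A E N Q"
    using EA.EA_A_lin[OF EA[OF N(1)]] PQ(1,2) unfolding lin_map_def PQ(3) by blast
   thus ?thesis using A.l_distr[OF cl A(2)] by simp
  qed
  thus ?case using sp_add[OF S 1 2] by simp
 qed
qed

lemma theta_ew:
 assumes T: "T : AA N" and x: "x : N" shows "set as <= {..<n} ==> theta N (ew as T) (V, ph, es) x =
  pmul (foldr (%a. pmul (xi a)) as spoly_one) (theta N T (V, ph, es) x)"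
proof (induction as)
 case (Cons a as)
 have a: "a < n" "ew as T : AA N" using Cons.prems ew_closed[OF _ T] by auto
 have "theta N (ze a) (V, ph, es) x = xi a" unfolding ze_def theta_gens(1)[OF N(1) ue_section[OF a(1)]] by (rule symb_ue[OF a(1) x])
 thus ?case using Cons theta_ops(2)[OF N(1) ze_closed[OF a(1)] a(2)] by (simp add: ew_simps spoly_mult_assoc)
qed (simp add: ew_simps spoly_mult_one)

lemma theta_aw:
 assumes x: "x : N"
 shows "set is <= axes E ==> theta N (aw is) (V, ph, es) x = foldr (%i. pmul (mom i)) is spoly_one"
proof (induction "is")
 case Nil show ?case using k x NV[OF x] by (simp add: aw_simps theta_ops(4)[OF N(1)])
next
 case (Cons i "is")
 have i: "i : axes E" "aw is : AA N" using Cons.prems aw_closed by auto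
 have "theta N (za i) (V, ph, es) x = mom i" unfolding za_def theta_gens(2)[OF N(1) pa_gauge[OF i(1)]] by (rule symb_pa[OF i(1) x])
 thus ?case using Cons theta_ops(2)[OF N(1) za_closed[OF i(1)] i(2)] by (simp add: aw_simps)
qed

text \<open>Sorted odd factors and commuting even ones produce no sign, so the coefficient is 1.
  Independence of the normal monomials is thereby reduced to that of the monomials in
  polynomials.\<close>

lemma theta_nm:
 assumes j: "j : ks" and x: "x : N" shows "theta N (nm j) (V, ph, es) x = sgl j 1"
proof -
 obtain B m where jm: "j = (B, m)" by (cases j)
 have "fset_of_list (sorted_list_of_set (fset B)) = B" by (simp add: fset_inject[symmetric] fset_of_list.rep_eq)
 thus ?thesis unfolding nm_def theta_ew[OF aw_closed[OF ks_lists(2)[OF j]] x ks_lists(1)[OF j]] theta_aw[OF x ks_lists(2)[OF j]]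
  by (simp add: foldr_xi foldr_mom mset_lst jm spoly_mult_single odd_sign_eq set_sign_empty)
qed

lemma theta_finsum:
 assumes K: "finite K" "K <= ks" and f: "!!j. j : K ==> f j : CC N" and x: "x : N"
 shows "theta N (\<Oplus>\<^bsub>A\<^esub>j\<in>K. f j \<odot>\<^bsub>A\<^esub> nm j) (V, ph, es) x = (SUM j:K. sgl j (f j x))"
 using K f
proof (induction K rule: finite_induct)
 case empty show ?case by (simp add: theta_ops(5)[OF N(1)])
next
 case (insert j K)
 have c: "f i \<odot>\<^bsub>A\<^esub> nm i : AA N" if "i : insert j K" for i
  by (rule AA_smult[OF N(1) insert.prems(2)[OF that] nm_closed]) (use insert.prems(1) that in blast)
 hence s: "(\<Oplus>\<^bsub>A\<^esub>j\<in>K. f j \<odot>\<^bsub>A\<^esub> nm j) : AA N" by (intro A.finsum_closed) auto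
 have "(\<Oplus>\<^bsub>A\<^esub>j\<in>insert j K. f j \<odot>\<^bsub>A\<^esub> nm j) = f j \<odot>\<^bsub>A\<^esub> nm j \<oplus>\<^bsub>A\<^esub> (\<Oplus>\<^bsub>A\<^esub>j\<in>K. f j \<odot>\<^bsub>A\<^esub> nm j)"
  by (rule A.finsum_insert) (use insert c in auto)
 moreover have "theta N (f j \<odot>\<^bsub>A\<^esub> nm j) (V, ph, es) x = sgl j (f j x)"
  using theta_ops(3)[OF N(1), of "f j" "nm j"] insert.prems nm_closed theta_nm[OF _ x, of j] by (simp add: spoly_scale_single)
 ultimately show ?case using theta_ops(1)[OF N(1) c s, of j] insert by simp
qed

text \<open>Distinct normal monomials have distinct basis monomials as symbols at every point, so
  the coefficient functions vanish wherever the symbol does.\<close>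

lemma theta_kernel:
 assumes s: "s : AA N" and z: "!!x. x : N ==> theta N s (V, ph, es) x = 0" shows "s = \<zero>\<^bsub>A\<^esub>"
proof -
 obtain K f where K: "finite K" "K <= ks" "!!j. j : K ==> f j : CC N" "s = (\<Oplus>\<^bsub>A\<^esub>j\<in>K. f j \<odot>\<^bsub>A\<^esub> nm j)"
  by (rule lspan_finsum[OF asA nm_closed nm_span[OF s]]) blast+
 have f0: "f j = \<zero>\<^bsub>Cinf E N\<^esub>" if j: "j : K" for j
 proof
  fix x
  show "f j x = \<zero>\<^bsub>Cinf E N\<^esub> x"
  proof (cases "x : N")
   case True
   have "(SUM j:K. sgl j (f j x)) = 0" using theta_finsum[OF K(1-3) True] z[OF True] K(4) by simp
   hence "coef (SUM j:K. sgl j (f j x)) j = 0" by simp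
   thus ?thesis using K(1) j by (simp add: lookup_sum lookup_single when_def C_simps)
  qed (use K(3)[OF j] in \<open>simp add: C_iff C_simps\<close>)
 qed
 have "f j \<odot>\<^bsub>A\<^esub> nm j = \<zero>\<^bsub>A\<^esub>" if "j : K" for j
  unfolding f0[OF that] by (rule assoc_algD(11)[OF asA nm_closed]) (use that K in auto)
 hence "s = (\<Oplus>\<^bsub>A\<^esub>j\<in>K. \<zero>\<^bsub>A\<^esub>)" unfolding K(4) by (intro A.finsum_cong') auto
 thus ?thesis by simp
qed

lemma theta_inj:
 assumes s: "s : AA N" "t : AA N" and e: "!!x. x : N ==> theta N s (V, ph, es) x = theta N t (V, ph, es) x"
 shows "s = t"
proof -
 have m: "\<ominus>\<^bsub>A\<^esub> t : AA N" using s by simp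
 have "s \<oplus>\<^bsub>A\<^esub> \<ominus>\<^bsub>A\<^esub> t = \<zero>\<^bsub>A\<^esub>"
  by (rule theta_kernel) (use s m e in \<open>simp_all add: theta_ops(1)[OF N(1) s(1) m] theta_minus[OF N(1) s(2)]\<close>)
 thus ?thesis using s m by (metis A.minus_equality A.minus_minus)
qed

text \<open>Identifies the normal monomials with those that define the grading, so that the degree
  of a preimage is visible from its index set.\<close>

lemma nm_monom:
 assumes j: "j : ks" shows "nm j = EA_monom E N (map ue (sorted_list_of_set (fset (fst j)))) (map pa (lst (snd j)))"
proof -
 note l = ks_lists[OF j]
 have m: "ew as T = ew as \<one>\<^bsub>A\<^esub> \<cdot> T" if "set as <= {..<n}" "T : AA N" for as T using that
 proof (induction as)
  case (Cons a as)
  thus ?case using ew_closed[of as "\<one>\<^bsub>A\<^esub>"] ze_closed[of a] by (simp add: ew_simps A.m_assoc)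
 qed (simp add: ew_simps)
 have 1: "map ue (sorted_list_of_set (fset (fst j))) : lists (SS N)"
  using l(1) by (auto simp: in_lists_conv_set simp del: set_sorted_list_of_set intro!: ue_section)
 have 2: "map pa (lst (snd j)) : lists (GG N)"
 proof -
  have "set (map pa (lst (snd j))) <= GG N" using l(2) pa_gauge by (simp only: set_map) blast
  thus ?thesis by blast
 qed
 show ?thesis unfolding EA.EA_monom_eq[OF EA[OF N(1)] 1 2] nm_def m[OF l(1) aw_closed[OF l(2)]]
  by (simp add: ew_def aw_def foldr_map comp_def ze_def za_def)
qed

text \<open>The coefficients of \<open>F\<close> in the given chart, cut to \<open>N\<close>, are
  the scalars of the preimage. The index set \<open>K\<close> is finite so that their combination
  lies in the algebra over \<open>N\<close>.\<close>

lemma theta_surj: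
 assumes F: "F : nfuns E U" and U: "open U" and NU: "N <= U" and K: "K <= ks" "finite K"
  and keys: "!!x. x : N ==> supp (F (V, ph, es) x) <= K"
 obtains t where "t : AA N" "!!ch x. x : N ==> theta N t ch x = F ch x"
  "!!d. K <= wt d ==> t : EA_homog E N d"
proof -
 let ?f = "%j. cut N (%x. coef (F (V, ph, es) x) j)"
 let ?t = "\<Oplus>\<^bsub>A\<^esub>j\<in>K. ?f j \<odot>\<^bsub>A\<^esub> nm j"
 have Fk: "nice U (V, ph, es) (F (V, ph, es))" using F k unfolding nfuns_iff by blast
 have f: "?f j : CC N" for j by (rule C_cut[OF N(1) smooth_fun_subset[OF nice_smooth[OF Fk]]]) (use N NU in auto)
 have c: "?f j \<odot>\<^bsub>A\<^esub> nm j : AA N" if "j : K" for j by (rule AA_smult[OF N(1) f nm_closed]) (use K that in auto)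
 have t: "?t : AA N" by (rule A.finsum_closed) (use c in auto)
 have e0: "theta N ?t (V, ph, es) x = F (V, ph, es) x" if x: "x : N" for x
  using theta_finsum[OF K(2,1) f x] spoly_sum_keys[OF K(2) keys[OF x]] by (simp add: cut_in[OF x])
 \<comment> \<open>In any other chart both sides arise from their values in the given one by the
   same substitution.\<close>
 have e: "theta N ?t ch x = F ch x" if x: "x : N" for ch x
 proof (cases "ch : ncharts E & x : fst ch")
  case True
  have 1: "x : N Int fst (V, ph, es) Int fst ch" "x : U Int fst (V, ph, es) Int fst ch" using x True NV[OF x] NU by auto
  have "theta N ?t ch x = spoly_subst (trans_xi (snd (snd (V, ph, es))) (snd (snd ch)) x) (trans_mom E (V, ph, es) ch x) (theta N ?t (V, ph, es) x)"
   using theta_nfuns[OF N(1) t] True k 1(1) unfolding nfuns_iff by blast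
  also have "... = F ch x" unfolding e0[OF x] using F True k 1(2) unfolding nfuns_iff by metis
  finally show ?thesis .
 next
  case False
  have "F ch x = 0" using F False unfolding nfuns_iff by blast
  moreover have "theta N ?t ch x = 0" by (rule theta_out) (use False in blast)
  ultimately show ?thesis by simp
 qed
 have h: "?t : EA_homog E N d" if d: "K <= wt d" for d
 proof -
  let ?G = "{f \<odot>\<^bsub>A\<^esub> EA_monom E N es Ds | f es Ds. f : CC N
    & es : lists (SS N) & Ds : lists (GG N) & length es + 2 * length Ds = d}"
  have g: "?f j \<odot>\<^bsub>A\<^esub> nm j : ?G" if j: "j : K" for j
  proof -
   let ?es = "map ue (sorted_list_of_set (fset (fst j)))" and ?Ds = "map pa (lst (snd j))"
   have jk: "j : ks" using j K by blast
   note l = ks_lists[OF jk]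
   have "?es : lists (SS N)" using l(1) by (auto simp: in_lists_conv_set simp del: set_sorted_list_of_set intro!: ue_section)
   moreover have "?Ds : lists (GG N)"
   proof -
    have "set ?Ds <= GG N" using l(2) pa_gauge by (simp only: set_map) blast
    thus ?thesis by blast
   qed
   moreover have "length ?es + 2 * length ?Ds = d"
   proof -
    have "length (lst (snd j)) = size (snd j)" by (metis mset_lst size_mset)
    thus ?thesis using d j by (auto simp: weight_def)
   qed
   ultimately show ?thesis unfolding nm_monom[OF jk] using f by blast
  qed
  have "J <= K ==> (\<Oplus>\<^bsub>A\<^esub>j\<in>J. ?f j \<odot>\<^bsub>A\<^esub> nm j) : generate (add_monoid A) ?G" for J
  proof (induction J rule: infinite_finite_induct)
   case (infinite J) thus ?case using K finite_subset by blast
  next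
   case empty show ?case using generate.one[of "add_monoid A" ?G] by simp
  next
   case (insert j J)
   have "(\<Oplus>\<^bsub>A\<^esub>j\<in>insert j J. ?f j \<odot>\<^bsub>A\<^esub> nm j) = ?f j \<odot>\<^bsub>A\<^esub> nm j \<oplus>\<^bsub>A\<^esub> (\<Oplus>\<^bsub>A\<^esub>j\<in>J. ?f j \<odot>\<^bsub>A\<^esub> nm j)"
    by (rule A.finsum_insert) (use insert c in auto)
   moreover have "?f j \<odot>\<^bsub>A\<^esub> nm j : generate (add_monoid A) ?G" by (rule generate.incl[OF g]) (use insert in auto)
   ultimately show ?case using generate.eng[of _ "add_monoid A" ?G] insert by simp
  qed
  thus ?thesis unfolding EA_homog_def by blast
 qed
 show ?thesis by (rule that[OF t e h])
qed

end

section \<open>The isomorphism of sheaves\<close>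

context pe_mfd
begin

lemma on_chart_exists:
 assumes "open U" "x : U"
 obtains V ph es \<epsilon> where "x : V" "V <= U" "on_chart E V ph es \<epsilon> V"
proof -
 obtain V ph es where k: "(V, ph, es) : ncharts E" "onb V es" "x : V" "V <= U" by (rule nchart_exists[OF assms])
 obtain \<epsilon> :: "nat => real" where e: "ALL i. \<epsilon> i * \<epsilon> i = 1"
  "ALL i<length es. ALL j<length es. ALL y:V. form E y ((es ! i) y) ((es ! j) y) = (if i = j then \<epsilon> i else 0)"
  using k(2) unfolding onb_def by blast
 have "on_chart E V ph es \<epsilon> V" by unfold_locales (use k(1) e nchartD(2)[OF k(1)] in auto)
 thus ?thesis using that k by blast
qed

text \<open>Injectivity is available only over orthonormal charts, so the two sections are compared
  after restriction to one around \<open>x\<close>; by naturality their images still agree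
  there.\<close>

lemma local_inj:
 assumes V: "open V" "s : AA V" and W: "open W" "t : AA W" and N: "open N" "x : N" "N <= V Int W"
  and e: "!!ch y. y : N ==> theta V s ch y = theta W t ch y"
 obtains N' where "open N'" "x : N'" "N' <= V Int W" "EA_restr E V N' s = EA_restr E W N' t"
proof -
 obtain N' ph es \<epsilon> where N': "x : N'" "N' <= N" "on_chart E N' ph es \<epsilon> N'" by (rule on_chart_exists[OF N(1,2)])
 interpret c: on_chart E N' ph es \<epsilon> N' by (rule N'(3))
 have sub: "N' <= V" "N' <= W" using N'(2) N(3) by auto
 have "EA_restr E V N' s = EA_restr E W N' t"
 proof (rule c.theta_inj[OF restr_closed[OF V(1) c.N(1) sub(1) V(2)] restr_closed[OF W(1) c.N(1) sub(2) W(2)]])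
  fix y assume y: "y : N'"
  show "theta N' (EA_restr E V N' s) (N', ph, es) y = theta N' (EA_restr E W N' t) (N', ph, es) y"
   unfolding theta_restr[OF V(1) c.N(1) sub(1) V(2) y] theta_restr[OF W(1) c.N(1) sub(2) W(2) y] by (rule e) (use y N'(2) in auto)
 qed
 thus ?thesis using that[of N'] c.N(1) N'(1) sub by blast
qed

text \<open>The last clause asks a single \<open>t\<close> to be homogeneous in every degree in
  which \<open>F\<close> is; there is more than one such degree exactly when \<open>F\<close> is
  zero.\<close>

lemma local_surj:
 assumes U: "open U" "x : U" and F: "F : nfuns E U"
 obtains N t where "open N" "x : N" "N <= U" "t : AA N" "!!ch y. y : N ==> theta N t ch y = F ch y"
  "!!d. ALL ch y. supp (F ch y) <= wt d ==> t : EA_homog E N d"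
proof -
 obtain V ph es \<epsilon> where V: "x : V" "V <= U" "on_chart E V ph es \<epsilon> V" by (rule on_chart_exists[OF U])
 interpret c: on_chart E V ph es \<epsilon> V by (rule V(3))
 have nc: "nice U (V, ph, es) (F (V, ph, es))" using F c.k unfolding nfuns_iff by blast
 have keys: "supp (F (V, ph, es) y) <= mons (length es) (axes E)" if "y : V" for y
  using nc that V(2) unfolding nice_def by auto
 have "x : U Int V" using V(1) U(2) by blast
 hence "EX M d. open M & x : M & (ALL y:M Int (U Int V). supp (F (V, ph, es) y) <= wtle d)"
  using nc unfolding nice_def fst_conv by blast
 then obtain M d where M: "open M" "x : M" "!!y. y : M Int (U Int V) ==> supp (F (V, ph, es) y) <= wtle d"
  by blast
 let ?N = "M Int V"
 interpret c': on_chart E V ph es \<epsilon> ?N by unfold_locales (use c.k c.eps c.orth c.N(1) M(1) in auto)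
 have NU: "?N <= U" and xN: "x : ?N" using V M by auto
 show ?thesis
 proof (cases "EX d. ALL ch y. supp (F ch y) <= wt d")
  case True
  then obtain e where e: "!!ch y. supp (F ch y) <= wt e" by blast
  let ?K = "mons (length es) (axes E) Int wt e"
  have fin: "finite ?K" by (rule finite_subset[OF _ finite_mons[OF finite_axes, of "length es" e]]) auto
  obtain t where t: "t : AA ?N" "!!ch y. y : ?N ==> theta ?N t ch y = F ch y" "!!d. ?K <= wt d ==> t : EA_homog E ?N d"
   by (rule c'.theta_surj[OF F U(1) NU _ fin]) (use keys e in blast)+
  have h: "t : EA_homog E ?N d" if d: "ALL ch y. supp (F ch y) <= wt d" for d
  proof (cases "d = e")
   case True thus ?thesis by (intro t(3)) auto
  next
   case False
   \<comment> \<open>Two different weights force \<open>F\<close> to vanish. By injectivity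
     \<open>t\<close> then equals the preimage with empty index set, which has every degree.\<close>
   have "wt d Int wt e = ({} :: (nat fset \<times> 'a multiset) set)" using False by auto
   hence "supp (F ch y) = {}" for ch y using d e[of ch y] by blast
   then obtain t' where t': "t' : AA ?N" "!!ch y. y : ?N ==> theta ?N t' ch y = F ch y" "!!d. {} <= wt d ==> t' : EA_homog E ?N d"
    using c'.theta_surj[OF F U(1) NU, of "{}"] by (metis empty_subsetI finite.emptyI order_refl)
   have "t = t'" by (rule c'.theta_inj[OF t(1) t'(1)]) (simp add: t(2) t'(2))
   thus ?thesis using t'(3) by simp
  qed
  show ?thesis by (rule that[OF c'.N(1) xN NU t(1,2) h])
 next
  case False
  let ?K = "mons (length es) (axes E) Int wtle d"
  obtain t where t: "t : AA ?N" "!!ch y. y : ?N ==> theta ?N t ch y = F ch y"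
  proof (rule c'.theta_surj[OF F U(1) NU _ finite_mons[OF finite_axes]])
   show "?K <= mons (length es) (axes E)" by blast
   show "supp (F (V, ph, es) y) <= ?K" if "y : ?N" for y using keys[of y] M(3)[of y] that V(2) by blast
  qed blast
  show ?thesis by (rule that[OF c'.N(1) xN NU t]) (use False in blast)+
 qed
qed

section \<open>From polynomial functions to families of germs\<close>

abbreviation "P == EA_presheaf E"

lemma P_simps: "alg P = EA_alg E" "homog P = EA_homog E" "restr P = EA_restr E" by (simp_all add: EA_presheaf_def)

text \<open>A germ is the set of its representatives, so the germ attached to \<open>F\<close> at
  \<open>x\<close> is the set of pairs whose image under \<open>theta\<close> agrees with
  \<open>F\<close> near \<open>x\<close>. This inverts the map of sheaves induced by
  \<open>theta\<close> without choosing preimages.\<close>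

definition Phi :: "'m set => (('m, 'a, 'v) nchart => 'm => 'a spoly) => 'm => ('m set \<times> ('m, 'v) EA_tensor set) set" where
 "Phi U F x = (if x : U then {(W, t). open W & x : W & t : AA W
  & (EX N. open N & x : N & N <= W Int U & (ALL ch. ALL y:N. theta W t ch y = F ch y))} else {})"

lemma PhiI: "open W ==> t : AA W ==> open N ==> x : N ==> N <= W ==> N <= U ==> (!!ch y. y : N ==> theta W t ch y = F ch y) ==>
  (W, t) : Phi U F x" unfolding Phi_def by auto

lemma PhiE:
 assumes "(W, t) : Phi U F x"
 obtains N where "x : U" "open W" "x : W" "t : AA W" "open N" "x : N" "N <= W" "N <= U"
  "!!ch y. y : N ==> theta W t ch y = F ch y" using assms unfolding Phi_def by (auto split: if_splits)

lemma Phi_mono: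
 assumes N: "open N" "x : N" "N <= U'" "!!ch y. y : N ==> F ch y = F' ch y"
 shows "Phi U F x <= Phi U' F' x"
proof (rule subrelI)
 fix W t assume "(W, t) : Phi U F x"
 then obtain M where M: "x : U" "open W" "x : W" "t : AA W" "open M" "x : M" "M <= W" "M <= U"
  "!!ch y. y : M ==> theta W t ch y = F ch y" by (rule PhiE) blast
 show "(W, t) : Phi U' F' x" by (rule PhiI[of W t "M Int N"]) (use M N in auto)
qed

lemma Phi_local:
 assumes N: "open N" "x : N" "N <= U" "N <= U'" "!!ch y. y : N ==> F ch y = F' ch y"
 shows "Phi U F x = Phi U' F' x" by (rule subset_antisym; rule Phi_mono[OF N(1,2)]) (use N in auto)

text \<open>One inclusion is naturality of \<open>theta\<close> under restriction, the other its
  local injectivity.\<close>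

lemma germ_Phi:
 assumes V: "open V" and s: "s : AA V" and x: "x : V" shows "germ P x V s = Phi V (theta V s) x"
proof (rule Set.set_eqI)
 fix p :: "'m set \<times> ('m, 'v) EA_tensor set"
 obtain W t where p: "p = (W, t)" by (cases p)
 show "p : germ P x V s \<longleftrightarrow> p : Phi V (theta V s) x"
 proof
  assume "p : germ P x V s"
  then obtain N where N: "open W" "x : W" "t : AA W" "open N" "x : N" "N <= V Int W" "EA_restr E V N s = EA_restr E W N t"
   unfolding p germ_def P_simps by blast
  have sub: "N <= V" "N <= W" using N(6) by auto
  show "p : Phi V (theta V s) x" unfolding p
  proof (rule PhiI[OF N(1,3,4,5) sub(2,1)])
   fix ch y assume y: "y : N"
   show "theta W t ch y = theta V s ch y"
    using theta_restr[OF V N(4) sub(1) s y, of ch] theta_restr[OF N(1) N(4) sub(2) N(3) y, of ch] N(7) by simp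
  qed
 next
  assume "p : Phi V (theta V s) x"
  then obtain M where M: "open W" "x : W" "t : AA W" "open M" "x : M" "M <= W" "M <= V"
   "!!ch y. y : M ==> theta W t ch y = theta V s ch y" unfolding p by (rule PhiE) blast
  obtain N where "open N" "x : N" "N <= V Int W" "EA_restr E V N s = EA_restr E W N t"
   by (rule local_inj[OF V s M(1,3,4,5)]) (use M in auto)
  thus "p : germ P x V s" unfolding p germ_def P_simps using M by blast
 qed
qed

lemma Phi_sections:
 assumes U: "open U" and F: "F : nfuns E U" shows "Phi U F : germ_sections P AA U"
  and "(!!ch y. supp (F ch y) <= wt d) ==> Phi U F : germ_sections P (%V. EA_homog E V d) U"
proof -
 have "EX V. open V & x : V & V <= U & (EX s. s : AA V & ((ALL ch y. supp (F ch y) <= wt d) --> s : EA_homog E V d)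
   & (ALL y:V. Phi U F y = germ P y V s))" if x: "x : U" for x d
 proof -
  obtain N t where N: "open N" "x : N" "N <= U" "t : AA N" "!!ch y. y : N ==> theta N t ch y = F ch y"
   "!!d. ALL ch y. supp (F ch y) <= wt d ==> t : EA_homog E N d" by (rule local_surj[OF U x F]) blast
  have e: "Phi U F y = germ P y N t" if y: "y : N" for y unfolding germ_Phi[OF N(1,4) y] by (rule Phi_local[OF N(1) y]) (use N in auto)
  show ?thesis by (rule exI[of _ N], intro conjI N(1-4) N(6) exI[of _ t] impI ballI e)
 qed
 note loc = this
 have out: "x ~: U ==> Phi U F x = {}" for x by (simp add: Phi_def)
 show "Phi U F : germ_sections P AA U" unfolding germ_sections_def
 proof (intro CollectI conjI allI impI ballI out)
  fix x assume x: "x : U"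
  \<comment> \<open>\<open>undefined\<close> stands for an arbitrary degree; the claim here concerns
    the whole algebra.\<close>
  from loc[OF x, of undefined] obtain V s where V: "open V" "x : V" "V <= U" "s : AA V" "ALL y:V. Phi U F y = germ P y V s"
   by (elim exE conjE)
  show "EX V. open V & x : V & V <= U & (EX s:AA V. ALL y:V. Phi U F y = germ P y V s)"
   by (rule exI[of _ V], intro conjI V(1-3) bexI[of _ s], rule V(5), rule V(4))
 qed
 show "Phi U F : germ_sections P (%V. EA_homog E V d) U" if k: "!!ch y. supp (F ch y) <= wt d"
  unfolding germ_sections_def
 proof (intro CollectI conjI allI impI ballI out)
  fix x assume x: "x : U"
  from loc[OF x, of d] obtain V s where V: "open V" "x : V" "V <= U"
   "(ALL ch y. supp (F ch y) <= wt d) --> s : EA_homog E V d" "ALL y:V. Phi U F y = germ P y V s"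
   by (elim exE conjE)
  have s: "s : EA_homog E V d" by (rule mp[OF V(4)], intro allI, rule k)
  show "EX V. open V & x : V & V <= U & (EX s:EA_homog E V d. ALL y:V. Phi U F y = germ P y V s)"
   by (rule exI[of _ V], intro conjI V(1-3) bexI[of _ s], rule V(5), rule s)
 qed
qed

text \<open>Polynomial functions form a sheaf: each condition in \<open>nfuns\<close> concerns a
  point or a neighbourhood of a point. In particular the weight bound is only required
  locally.\<close>

lemma nfuns_local:
 assumes U: "open U" and out: "!!ch x. x ~: U ==> F ch x = 0"
  and loc: "!!x. x : U ==> EX W G. open W & x : W & W <= U & G : nfuns E W & (ALL ch. ALL y:W. F ch y = G ch y)"
 shows "F : nfuns E U" unfolding nfuns_iff
proof (intro conjI allI ballI impI)
 fix ch :: "('m, 'a, 'v) nchart" and x assume n: "\<not> (ch : ncharts E & x : U Int fst ch)"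
 show "F ch x = 0"
 proof (cases "x : U")
  case True
  from loc[OF True] obtain W G where "x : W" "W <= U" "G : nfuns E W" "F ch x = G ch x" by blast
  moreover have "\<not> (ch : ncharts E & x : W Int fst ch)" using n True by blast
  ultimately show ?thesis unfolding nfuns_iff by metis
 qed (rule out)
next
 fix ch assume k: "ch : ncharts E"
 have UV: "open (U Int fst ch)" by (rule UV[OF U k])
 have nloc: "EX W G. open W & x : W & W <= U & nice W ch G & (ALL y:W. F ch y = G y)" if "x : U" for x
 proof -
  from loc[OF that] obtain W G where "open W" "x : W" "W <= U" "G : nfuns E W" "ALL ch. ALL y:W. F ch y = G ch y" by blast
  moreover from this k have "nice W ch (G ch)" unfolding nfuns_iff by blast
  ultimately show ?thesis by blast
 qed
 show "nice U ch (F ch)" unfolding nice_def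
 proof (intro conjI allI ballI)
  fix x assume x: "x : U Int fst ch"
  hence "x : U" by blast
  from nloc[OF this] obtain W G where W: "open W" "x : W" "W <= U" "nice W ch G" "ALL y:W. F ch y = G y" by blast
  show "supp (F ch x) <= mons (length (snd (snd ch))) (axes E)" using W x unfolding nice_def by auto
  obtain M d where M: "open M" "x : M" "ALL y:M Int (W Int fst ch). supp (G y) <= wtle d"
   using W(2,4) x unfolding nice_def by blast
  have "ALL y:(M Int W) Int (U Int fst ch). supp (F ch y) <= wtle d" using M(3) W(5) by simp
  thus "EX N d. open N & x : N & (ALL y:N Int (U Int fst ch). supp (F ch y) <= wtle d)"
   using M W open_Int[OF M(1) W(1)] by blast
 next
  fix j
  show "smf E (U Int fst ch) (%x. coef (F ch x) j)"
  proof (rule smooth_fun_local[OF UV])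
   fix x assume x: "x : U Int fst ch"
   hence "x : U" by blast
  from nloc[OF this] obtain W G where W: "open W" "x : W" "W <= U" "nice W ch G" "ALL y:W. F ch y = G y" by blast
   have e: "W Int (U Int fst ch) = W Int fst ch" using W(3) by blast
   have "smf E (W Int (U Int fst ch)) (%x. coef (F ch x) j)"
    unfolding e by (rule smooth_fun_cong[OF _ _ nice_smooth[OF W(4), of j]]) (use W k pe_mfd.UV[OF pe_mfd_axioms W(1) k] in auto)
   thus "EX W. open W & x : W & smf E (W Int (U Int fst ch)) (%x. coef (F ch x) j)"
    using W by blast
  qed
 qed
next
 fix ch ch' x assume k: "ch : ncharts E" "ch' : ncharts E" and x: "x : U Int fst ch Int fst ch'"
 hence "x : U" by blast
 from loc[OF this] obtain W G where W: "open W" "x : W" "W <= U" "G : nfuns E W" "ALL ch. ALL y:W. F ch y = G ch y" by blast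
 have "G ch' x = spoly_subst (trans_xi (snd (snd ch)) (snd (snd ch')) x) (trans_mom E ch ch' x) (G ch x)"
  using W(2,4) k x unfolding nfuns_iff by blast
 moreover have "F ch x = G ch x" "F ch' x = G ch' x" using W(2,5) by blast+
 ultimately show "F ch' x = spoly_subst (trans_xi (snd (snd ch)) (snd (snd ch')) x) (trans_mom E ch ch' x) (F ch x)"
  by (simp only:)
qed

text \<open>The value of \<open>F\<close> at a point is that of a chosen local representative of the
  family. The parameter \<open>C\<close> lets the same argument serve for the whole algebra and for
  each homogeneous part.\<close>

lemma sections_Phi:
 assumes U: "open U" and \<sigma>: "\<sigma> : germ_sections P C U" and C: "!!V. open V ==> C V <= AA V"
 obtains F where "F : nfuns E U" "Phi U F = \<sigma>"
  "!!d ch y. ALL V. open V --> C V <= EA_homog E V d ==> supp (F ch y) <= wt d"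
proof -
 have ex: "ALL x:U. EX p. open (fst p) & x : fst p & fst p <= U & snd p : C (fst p) & (ALL y:fst p. \<sigma> y = germ P y (fst p) (snd p))"
 proof
  fix x assume "x : U"
  then obtain V s where "open V" "x : V" "V <= U" "s : C V" "ALL y:V. \<sigma> y = germ P y V s"
   using \<sigma> unfolding germ_sections_def by blast
  thus "EX p. open (fst p) & x : fst p & fst p <= U & snd p : C (fst p) & (ALL y:fst p. \<sigma> y = germ P y (fst p) (snd p))"
   by (intro exI[of _ "(V, s)"]) simp
 qed
 obtain p where p: "!!x. x : U ==> open (fst (p x)) & x : fst (p x) & fst (p x) <= U & snd (p x) : C (fst (p x))
   & (ALL y:fst (p x). \<sigma> y = germ P y (fst (p x)) (snd (p x)))" using bchoice[OF ex] by blast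
 define F where "F = (%ch x. if x : U then theta (fst (p x)) (snd (p x)) ch x else 0)"
 have s: "snd (p x) : AA (fst (p x))" if "x : U" for x using p[OF that] C by blast
 \<comment> \<open>At \<open>y\<close> the function \<open>F\<close> uses the representative chosen
   for \<open>y\<close>. It and the one chosen for \<open>x\<close> have the same germ at
   \<open>y\<close>, and representatives of one germ have equal images under \<open>theta\<close>
   there.\<close>
 have Fe: "F ch y = theta (fst (p x)) (snd (p x)) ch y" if x: "x : U" and y: "y : fst (p x)" for x y ch
 proof -
  have yU: "y : U" using p[OF x] y by blast
  have "\<sigma> y = Phi (fst (p x)) (theta (fst (p x)) (snd (p x))) y" using p[OF x] y germ_Phi[of "fst (p x)" "snd (p x)" y] s[OF x] by simp
  moreover have "\<sigma> y = Phi (fst (p y)) (theta (fst (p y)) (snd (p y))) y"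
   using p[OF yU] germ_Phi[of "fst (p y)" "snd (p y)" y] s[OF yU] by simp
  moreover have "(fst (p y), snd (p y)) : Phi (fst (p y)) (theta (fst (p y)) (snd (p y))) y"
   by (rule PhiI[of _ _ "fst (p y)"]) (use p[OF yU] s[OF yU] in auto)
  ultimately have "(fst (p y), snd (p y)) : Phi (fst (p x)) (theta (fst (p x)) (snd (p x))) y" by simp
  hence "theta (fst (p y)) (snd (p y)) ch y = theta (fst (p x)) (snd (p x)) ch y" by (rule PhiE) blast
  thus ?thesis unfolding F_def using yU by simp
 qed
 have F: "F : nfuns E U"
 proof (rule nfuns_local[OF U])
  show "F ch x = 0" if "x ~: U" for ch x using that by (simp add: F_def)
  show "EX W G. open W & x : W & W <= U & G : nfuns E W & (ALL ch. ALL y:W. F ch y = G ch y)" if x: "x : U" for x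
   using p[OF x] theta_nfuns[OF _ s[OF x]] Fe[OF x] by blast
 qed
 have e: "Phi U F = \<sigma>"
 proof
  fix x show "Phi U F x = \<sigma> x"
  proof (cases "x : U")
   case True
   have "Phi U F x = Phi (fst (p x)) (theta (fst (p x)) (snd (p x))) x" by (rule Phi_local[of "fst (p x)"]) (use p[OF True] Fe[OF True] in auto)
   also have "... = \<sigma> x" using p[OF True] germ_Phi[of "fst (p x)" "snd (p x)" x] s[OF True] by simp
   finally show ?thesis .
  next
   case False thus ?thesis using \<sigma> by (simp add: Phi_def germ_sections_def)
  qed
 qed
 show ?thesis
 proof (rule that[OF F e])
  fix d ch y assume h: "ALL V. open V --> C V <= EA_homog E V d"
  show "supp (F ch y) <= wt d"
  proof (cases "y : U")
   case True
   have "snd (p y) : EA_homog E (fst (p y)) d" using p[OF True] h by blast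
   hence "supp (theta (fst (p y)) (snd (p y)) ch y) <= wt d"
    using theta_homog[of "fst (p y)" "snd (p y)" d] p[OF True] by blast
   thus ?thesis using True by (simp only: F_def if_True)
  qed (simp add: F_def)
 qed
qed

text \<open>A local preimage of \<open>F\<close> represents the germ of \<open>F\<close>, hence that
  of \<open>G\<close>, and so has the values of both at the point.\<close>

lemma Phi_inj:
 assumes U: "open U" and F: "F : nfuns E U" and G: "G : nfuns E U" and e: "Phi U F = Phi U G" shows "F = G"
proof (intro ext)
 fix ch x
 show "F ch x = G ch x"
 proof (cases "x : U")
  case True
  obtain N t where N: "open N" "x : N" "N <= U" "t : AA N" "!!ch y. y : N ==> theta N t ch y = F ch y" by (rule local_surj[OF U True F]) blast
  have "(N, t) : Phi U F x" by (rule PhiI[of _ _ N]) (use N in auto)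
  hence "(N, t) : Phi U G x" unfolding e .
  hence "theta N t ch x = G ch x" by (rule PhiE) blast
  thus ?thesis using N by simp
 next
  case False
  hence "F ch x = 0" "G ch x = 0" using F G unfolding nfuns_iff by blast+
  thus ?thesis by simp
 qed
qed

text \<open>Addition and multiplication are treated at once, as an operation \<open>f\<close> on
  sections that \<open>theta\<close> turns into the operation \<open>h\<close> on values.\<close>

lemma Phi_op:
 assumes U: "open U" and F: "F : nfuns E U" and G: "G : nfuns E U"
  and f: "!!V s t. open V ==> s : AA V ==> t : AA V ==> f V s t : AA V"
  and h: "!!V s t. open V ==> s : AA V ==> t : AA V ==> theta V (f V s t) = (%ch x. h (theta V s ch x) (theta V t ch x))"
 shows "Phi U (%ch x. h (F ch x) (G ch x)) = (%x. germ_op P f x (Phi U F x) (Phi U G x))"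
proof
 fix x
 let ?H = "%ch x. h (F ch x) (G ch x)"
 show "Phi U ?H x = germ_op P f x (Phi U F x) (Phi U G x)"
 proof (cases "x : U")
  case x: True
  \<comment> \<open>The union in \<open>germ_op\<close> runs over all pairs of representatives. Each
    pair contributes the same set, and local surjectivity supplies at least one pair.\<close>
  have *: "germ P x (V Int W) (f (V Int W) (restr P V (V Int W) s) (restr P W (V Int W) t)) = Phi U ?H x"
   if s: "(V, s) : Phi U F x" and t: "(W, t) : Phi U G x" for V s W t
  proof -
   obtain M where M: "open V" "x : V" "s : AA V" "open M" "x : M" "M <= V" "M <= U" "!!ch y. y : M ==> theta V s ch y = F ch y"
    using s by (rule PhiE) blast
   obtain N where N: "open W" "x : W" "t : AA W" "open N" "x : N" "N <= W" "N <= U" "!!ch y. y : N ==> theta W t ch y = G ch y"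
    using t by (rule PhiE) blast
   have o: "open (V Int W)" using M N by blast
   have st: "EA_restr E V (V Int W) s : AA (V Int W)" "EA_restr E W (V Int W) t : AA (V Int W)"
    by (rule restr_closed[OF M(1) o _ M(3)] restr_closed[OF N(1) o _ N(3)], blast)+
   show ?thesis unfolding P_simps germ_Phi[OF o f[OF o st] IntI[OF M(2) N(2)]]
   proof (rule Phi_local[of "M Int N"])
    fix ch y assume y: "y : M Int N"
    hence yVW: "y : V Int W" using M N by blast
    show "theta (V Int W) (f (V Int W) (EA_restr E V (V Int W) s) (EA_restr E W (V Int W) t)) ch y = ?H ch y"
     unfolding h[OF o st] theta_restr[OF M(1) o Int_lower1 M(3) yVW] theta_restr[OF N(1) o Int_lower2 N(3) yVW] using M(8) N(8) y by simp
   qed (use M N in auto)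
  qed
  obtain V s where "open V" "x : V" "V <= U" "s : AA V" "!!ch y. y : V ==> theta V s ch y = F ch y" by (rule local_surj[OF U x F]) blast
  hence s: "(V, s) : Phi U F x" by (intro PhiI[of _ _ V]) auto
  obtain W t where "open W" "x : W" "W <= U" "t : AA W" "!!ch y. y : W ==> theta W t ch y = G ch y" by (rule local_surj[OF U x G]) blast
  hence t: "(W, t) : Phi U G x" by (intro PhiI[of _ _ W]) auto
  show ?thesis
  proof (rule Set.set_eqI)
   fix q
   show "q : Phi U ?H x \<longleftrightarrow> q : germ_op P f x (Phi U F x) (Phi U G x)"
   proof
    assume "q : Phi U ?H x"
    thus "q : germ_op P f x (Phi U F x) (Phi U G x)" using s t *[OF s t] unfolding germ_op_def by blast
   next
    assume "q : germ_op P f x (Phi U F x) (Phi U G x)"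
    then obtain V s W t where "(V, s) : Phi U F x" "(W, t) : Phi U G x"
     "q : germ P x (V Int W) (f (V Int W) (restr P V (V Int W) s) (restr P W (V Int W) t))" unfolding germ_op_def by blast
    thus "q : Phi U ?H x" using *[of V s W t] by simp
   qed
  qed
 next
  case False thus ?thesis by (simp add: Phi_def germ_op_def)
 qed
qed

lemma Phi_smult:
 assumes U: "open U" and g: "g : CC U" and F: "F : nfuns E U"
 shows "Phi U (%ch x. pscl (g x) (F ch x)) = (%x. \<Union>(V, s) \<in> Phi U F x.
  germ P x (U Int V) (cut (U Int V) g \<odot>\<^bsub>alg P (U Int V)\<^esub> restr P V (U Int V) s))"
proof
 fix x
 let ?H = "%ch x. pscl (g x) (F ch x)"
 let ?R = "%(V, s). germ P x (U Int V) (cut (U Int V) g \<odot>\<^bsub>alg P (U Int V)\<^esub> restr P V (U Int V) s)"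
 show "Phi U ?H x = (\<Union>p \<in> Phi U F x. ?R p)"
 proof (cases "x : U")
  case x: True
  \<comment> \<open>As for \<open>germ_op\<close>, every representative contributes the same germ,
    so the union equals that germ once a representative exists.\<close>
  have *: "?R p = Phi U ?H x" if p: "p : Phi U F x" for p
  proof -
   obtain V s where p': "p = (V, s)" by (cases p)
   obtain M where M: "open V" "x : V" "s : AA V" "open M" "x : M" "M <= V" "M <= U" "!!ch y. y : M ==> theta V s ch y = F ch y"
    using p unfolding p' by (rule PhiE) blast
   have o: "open (U Int V)" using M U by blast
   have s: "EA_restr E V (U Int V) s : AA (U Int V)" by (rule restr_closed[OF M(1) o _ M(3)]) blast
   have c: "cut (U Int V) g : CC (U Int V)" by (rule C_cut_sub[OF o _ g]) blast
   show ?thesis unfolding p' prod.case P_simps germ_Phi[OF o AA_smult[OF o c s] IntI[OF x M(2)]]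
   proof (rule Phi_local[of M])
    fix ch y assume y: "y : M"
    hence yUV: "y : U Int V" using M by blast
    show "theta (U Int V) (cut (U Int V) g \<odot>\<^bsub>EA_alg E (U Int V)\<^esub> EA_restr E V (U Int V) s) ch y = ?H ch y"
     unfolding theta_ops(3)[OF o c s] theta_restr[OF M(1) o Int_lower2 M(3) yUV] cut_in[OF yUV] using M(8) y by simp
   qed (use M in auto)
  qed
  obtain V s where "open V" "x : V" "V <= U" "s : AA V" "!!ch y. y : V ==> theta V s ch y = F ch y" by (rule local_surj[OF U x F]) blast
  hence s: "(V, s) : Phi U F x" by (intro PhiI[of _ _ V]) auto
  have "(\<Union>p \<in> Phi U F x. ?R p) = (\<Union>p \<in> Phi U F x. Phi U ?H x)" by (rule SUP_cong[OF refl *])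
  also have "... = Phi U ?H x" using s by blast
  finally show ?thesis by (rule sym)
 next
  case False thus ?thesis by (simp add: Phi_def)
 qed
qed

theorem sheaf_iso: "isomorphic_galg_sheaves E (polynomial_functions E) (EA_sheaf E)" unfolding isomorphic_galg_sheaves_def
proof (intro exI[of _ Phi] allI impI)
 fix U :: "'m set" assume U: "open U"
 let ?P = "polynomial_functions E" and ?Q = "EA_sheaf E"
 have Pc: "carrier (alg ?P V) = nfuns E V" "mult (alg ?P V) F G = (%ch x. pmul (F ch x) (G ch x))"
  "\<one>\<^bsub>alg ?P V\<^esub> = (%ch x. if ch : ncharts E & x : V Int fst ch then spoly_one else 0)"
  "add (alg ?P V) F G = (%ch x. F ch x + G ch x)" "smult (alg ?P V) f F = (%ch x. pscl (f x) (F ch x))"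
  "homog ?P V n = {F : nfuns E V. ALL ch x. ALL k : supp (F ch x). weight k = n}"
  "restr ?P V W F = (%ch. cut W (F ch))" for V W F G f n by (simp_all add: polynomial_functions_def)
 have Qc: "carrier (alg ?Q V) = germ_sections P AA V"
  "mult (alg ?Q V) \<sigma> \<tau> = (%x. germ_op P (%V. mult (EA_alg E V)) x (\<sigma> x) (\<tau> x))"
  "\<one>\<^bsub>alg ?Q V\<^esub> = (%x. if x : V then germ P x V \<one>\<^bsub>EA_alg E V\<^esub> else {})"
  "add (alg ?Q V) \<sigma> \<tau> = (%x. germ_op P (%V. add (EA_alg E V)) x (\<sigma> x) (\<tau> x))"
  "smult (alg ?Q V) f \<sigma> = (%x. \<Union>(W, s) \<in> \<sigma> x.
    germ P x (V Int W) (cut (V Int W) f \<odot>\<^bsub>alg P (V Int W)\<^esub> restr P W (V Int W) s))"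
  "homog ?Q V n = germ_sections P (%W. EA_homog E W n) V"
  "restr ?Q V W \<sigma> = (%x. if x : W then \<sigma> x else {})" for V W \<sigma> \<tau> f n
  unfolding EA_sheaf_def sheafify_def P_simps by simp_all
 have hom_sub: "EA_homog E V n <= AA V" if "open V" for V n using theta_homog[OF that] by blast
 show "bij_betw (Phi U) (carrier (alg ?P U)) (carrier (alg ?Q U)) &
   (ALL n. Phi U ` homog ?P U n = homog ?Q U n) &
   Phi U \<one>\<^bsub>alg ?P U\<^esub> = \<one>\<^bsub>alg ?Q U\<^esub> &
   (ALL s:carrier (alg ?P U). ALL t:carrier (alg ?P U).
     Phi U (s \<oplus>\<^bsub>alg ?P U\<^esub> t) = Phi U s \<oplus>\<^bsub>alg ?Q U\<^esub> Phi U t &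
     Phi U (s \<otimes>\<^bsub>alg ?P U\<^esub> t) = Phi U s \<otimes>\<^bsub>alg ?Q U\<^esub> Phi U t) &
   (ALL f:CC U. ALL s:carrier (alg ?P U). Phi U (f \<odot>\<^bsub>alg ?P U\<^esub> s) = f \<odot>\<^bsub>alg ?Q U\<^esub> Phi U s) &
   (ALL V. open V & V <= U --> (ALL s:carrier (alg ?P U). Phi V (restr ?P U V s) = restr ?Q U V (Phi U s)))"
  unfolding Pc Qc
 proof (intro conjI allI ballI impI)
  show "bij_betw (Phi U) (nfuns E U) (germ_sections P AA U)"
  proof (rule bij_betw_imageI)
   show "inj_on (Phi U) (nfuns E U)" by (rule inj_onI) (rule Phi_inj[OF U])
   show "Phi U ` nfuns E U = germ_sections P AA U"
   proof
    show "Phi U ` nfuns E U <= germ_sections P AA U" using Phi_sections(1)[OF U] by blast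
    show "germ_sections P AA U <= Phi U ` nfuns E U"
    proof
     fix \<sigma> assume "\<sigma> : germ_sections P AA U"
     then obtain F where "F : nfuns E U" "Phi U F = \<sigma>" by (rule sections_Phi[OF U]) blast+
     thus "\<sigma> : Phi U ` nfuns E U" by blast
    qed
   qed
  qed
 next
  fix n
  have w: "(ALL ch x. ALL k : supp (F ch x). weight k = n) \<longleftrightarrow> (ALL ch x. supp (F ch x) <= wt n)"
   for F :: "('m, 'a, 'v) nchart => 'm => 'a spoly" by blast
  show "Phi U ` {F : nfuns E U. ALL ch x. ALL k : supp (F ch x). weight k = n} = germ_sections P (%W. EA_homog E W n) U"
   unfolding w
  proof
   show "Phi U ` {F : nfuns E U. ALL ch x. supp (F ch x) <= wt n} <= germ_sections P (%W. EA_homog E W n) U"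
    using Phi_sections(2)[OF U] by blast
   show "germ_sections P (%W. EA_homog E W n) U <= Phi U ` {F : nfuns E U. ALL ch x. supp (F ch x) <= wt n}"
   proof
    fix \<sigma> assume s: "\<sigma> : germ_sections P (%W. EA_homog E W n) U"
    obtain F where F: "F : nfuns E U" "Phi U F = \<sigma>"
     "!!d ch y. ALL V. open V --> EA_homog E V n <= EA_homog E V d ==> supp (F ch y) <= wt d"
     by (rule sections_Phi[OF U s hom_sub]) blast+
    have "supp (F ch y) <= wt n" for ch y by (rule F(3)) blast
    thus "\<sigma> : Phi U ` {F : nfuns E U. ALL ch x. supp (F ch x) <= wt n}"
     unfolding F(2)[symmetric] using F(1) by blast
   qed
  qed
 next
  show "Phi U (%ch x. if ch : ncharts E & x : U Int fst ch then spoly_one else 0) = (%x. if x : U then germ P x U \<one>\<^bsub>EA_alg E U\<^esub> else {})"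
   unfolding theta_ops(4)[OF U, symmetric]
  proof
   fix x show "Phi U (theta U \<one>\<^bsub>EA_alg E U\<^esub>) x = (if x : U then germ P x U \<one>\<^bsub>EA_alg E U\<^esub> else {})"
    using germ_Phi[OF U AA_one[OF U], of x] by (simp add: Phi_def)
  qed
 next
  fix F G assume F: "F : nfuns E U" and G: "G : nfuns E U"
  show "Phi U (%ch x. F ch x + G ch x) = (%x. germ_op P (%V. add (EA_alg E V)) x (Phi U F x) (Phi U G x))"
   by (rule Phi_op[where f = "%V. add (EA_alg E V)" and h = "(+)", OF U F G AA_add theta_ops(1)])
  show "Phi U (%ch x. pmul (F ch x) (G ch x)) = (%x. germ_op P (%V. mult (EA_alg E V)) x (Phi U F x) (Phi U G x))"
   by (rule Phi_op[where f = "%V. mult (EA_alg E V)" and h = pmul, OF U F G AA_mult theta_ops(2)])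
 next
  fix f F assume "f : CC U" "F : nfuns E U"
  thus "Phi U (%ch x. pscl (f x) (F ch x)) = (%x. \<Union>(V, s) \<in> Phi U F x.
   germ P x (U Int V) (cut (U Int V) f \<odot>\<^bsub>alg P (U Int V)\<^esub> restr P V (U Int V) s))" by (rule Phi_smult[OF U])
 next
  fix V F assume V: "open V & V <= U" and F: "F : nfuns E U"
  show "Phi V (%ch. cut V (F ch)) = (%x. if x : V then Phi U F x else {})"
  proof
   fix x show "Phi V (%ch. cut V (F ch)) x = (if x : V then Phi U F x else {})"
   proof (cases "x : V")
    case True
    have "Phi V (%ch. cut V (F ch)) x = Phi U F x" by (rule Phi_local[of V]) (use V True in \<open>auto simp: cut_in\<close>)
    thus ?thesis using True by simp
   qed (simp add: Phi_def)
  qed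
 qed
qed

end

theorem mainTheorem7:
  fixes E :: "('m::{t2_space, second_countable_topology}, 'a::euclidean_space, 'v::real_vector) pe_bundle"
  assumes "pseudo_euclidean_bundle E"
  shows "isomorphic_galg_sheaves E (polynomial_functions E) (EA_sheaf E)"
proof -
 interpret pe_mfd E
 proof
  show "smooth_manifold E" using assms unfolding pseudo_euclidean_bundle_def vector_bundle_def by blast
 qed (rule assms)
 show ?thesis by (rule sheaf_iso)
qed

end
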